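(* Let $(X,d,\mu)$ be a metric measure space and let $L$ be a self-adjoint, non-negative operator on $L^2(X,\mu)$ which satisfies the finite propagation speed property for the corresponding wave equation. Suppose that for some exponents $\sigma>0$ and $\kappa\ge 0$ there is a constant $C$ such that $$\|V_t^{1/2}(I+t^2L)^{-\sigma}\|_{2\to\infty}\le C(1+t^2)^{\kappa}\quad\text{for all } t>0.$$ Then: (i) There exists a constant $C>0$ such that $$\|e^{i\xi tL}e^{-tL}\|_{1\to1}\le C(1+\xi^2)^{\sigma+\kappa+1/4}(1+t)^{\kappa}$$ for all $t>0$ and $\xi\in\mathbb{R}$. (ii) Let $s>2\sigma+2\kappa+1$. For every bounded Borel function $F$ with $\operatorname{supp}F\subset[-1,1]$ and $F\in H^s(\mathbb{R})$, the operator $F(L)$ is bounded on $L^p(X)$ for all $1\le p\le\infty$, and there exists a constant $C=C(s)>0$ such that $$\|F(tL)\|_{p\to p}\le C(1+t)^{\kappa}\|F\|_{H^s}$$ for all $t>0$.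
   Context: $B(x,r)$ is the ball with center $x$ and radius $r$; $V_r(x)=V(x,r)=\mu(B(x,r))$. A function $W:X\to\mathbb{R}$ is identified with the operator of multiplication by $W$, so $V_t^{1/2}T$ denotes the operator $f\mapsto V_t^{1/2}(x)\,(Tf)(x)$. $\|T\|_{p\to q}$ is the operator norm from $L^p(X,\mu)$ to $L^q(X,\mu)$ (of the extension of $T$, when $T$ is initially defined on $L^2$). For bounded Borel $F$, $F(L)=\int_0^\infty F(\lambda)\,dE_L(\lambda)$ is defined by the spectral theorem on $L^2(X,\mu)$; boundedness on $L^p$ means that $F(L)$ extends to a bounded operator on $L^p$. $H^s(\mathbb{R})$ is the $L^2$-based Sobolev space of order $s$. The finite propagation speed property means: $\langle\cos(r\sqrt L)f_1,f_2\rangle=0$ for all $r>0$ and all $f_i\in L^2(B_i,\mu)$, $i=1,2$, whenever $B_1,B_2$ are open balls in $X$ with $d(B_1,B_2)>r$. No doubling condition is assumed on $X$.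
   Formalization: In (ii) F is also assumed continuous (the continuous representative in H^s); for arbitrary Borel F the bound fails, e.g. X a point, L=0, F the indicator of {0}. Balls have finite measure and the complement of the support of μ is null. *)

theory Defs
  imports "HOL-Probability.Essential_Supremum"
begin

section \<open>Metric measure spaces\<close>

text \<open>
  The space X is the whole type. Finiteness of the measure of balls makes \<open>V\<^sub>r\<close> a real function.
  The last condition says that the complement of the support of \<open>\<mu>\<close> is a null set. It holds if
  all balls have positive measure, and also if X is separable; it only excludes measures that
  charge a non-separable, locally null set.
\<close>
definition metric_measure_space :: "'a::metric_space measure \<Rightarrow> bool" where
  "metric_measure_space \<mu> \<longleftrightarrow>
     sets \<mu> = sets borel \<and>
     (\<forall>x r. 0 < r \<longrightarrow> emeasure \<mu> (ball x r) < \<infinity>) \<and>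
     (AE x in \<mu>. \<forall>r>0. 0 < emeasure \<mu> (ball x r))"

definition vol :: "'a::metric_space measure \<Rightarrow> real \<Rightarrow> 'a \<Rightarrow> real" where
  "vol \<mu> r x = measure \<mu> (ball x r)"

section \<open>Lebesgue spaces and operators between them\<close>

text \<open>
  Elements of \<open>L\<^sup>p\<close> are functions, not classes; all operator identities are therefore stated
  almost everywhere.
\<close>
definition Lp :: "'a measure \<Rightarrow> ennreal \<Rightarrow> ('a \<Rightarrow> complex) set" where
  "Lp \<mu> p = {f \<in> borel_measurable \<mu>.
     if p = \<infinity> then esssup \<mu> (\<lambda>x. ennreal (norm (f x))) < \<infinity>
     else (\<integral>\<^sup>+x. ennreal (norm (f x) powr enn2real p) \<partial>\<mu>) < \<infinity>}"

definition Lp_norm :: "'a measure \<Rightarrow> ennreal \<Rightarrow> ('a \<Rightarrow> complex) \<Rightarrow> real" where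
  "Lp_norm \<mu> p f =
     (if p = \<infinity> then enn2real (esssup \<mu> (\<lambda>x. ennreal (norm (f x))))
      else enn2real (\<integral>\<^sup>+x. ennreal (norm (f x) powr enn2real p) \<partial>\<mu>) powr (1 / enn2real p))"

definition L2_inner :: "'a measure \<Rightarrow> ('a \<Rightarrow> complex) \<Rightarrow> ('a \<Rightarrow> complex) \<Rightarrow> complex" where
  "L2_inner \<mu> f g = (LINT x|\<mu>. f x * cnj (g x))"

definition linear_op ::
  "'a measure \<Rightarrow> ('a \<Rightarrow> complex) set \<Rightarrow> ('a \<Rightarrow> complex) set
    \<Rightarrow> (('a \<Rightarrow> complex) \<Rightarrow> ('a \<Rightarrow> complex)) \<Rightarrow> bool" where
  "linear_op \<mu> A B T \<longleftrightarrow>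
     (\<forall>f\<in>A. T f \<in> B) \<and>
     (\<forall>f\<in>A. \<forall>g\<in>A. (AE x in \<mu>. f x = g x) \<longrightarrow> (AE x in \<mu>. T f x = T g x)) \<and>
     (\<forall>f\<in>A. \<forall>g\<in>A. AE x in \<mu>. T (\<lambda>y. f y + g y) x = T f x + T g x) \<and>
     (\<forall>f\<in>A. \<forall>c. AE x in \<mu>. T (\<lambda>y. c * f y) x = c * T f x)"

text \<open>
  The norm \<open>\<parallel>T\<parallel>\<close> from \<open>L\<^sup>p\<close> to \<open>L\<^sup>q\<close> of the extension to \<open>L\<^sup>p\<close> of an operator given on \<open>L\<^sup>2\<close>;
  it is \<open>\<infinity>\<close> if there is no bounded extension. For \<open>p < \<infinity>\<close> the bounded extension is unique by
  density of \<open>L\<^sup>2 \<inter> L\<^sup>p\<close>. For \<open>p = \<infinity>\<close> the infimum over all extensions is the norm of the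
  weak-* continuous one, whenever that exists, because both equal the norm of \<open>T\<close> on
  \<open>L\<^sup>2 \<inter> L\<^sup>\<infinity>\<close>.
\<close>
definition op_norm ::
  "'a measure \<Rightarrow> ennreal \<Rightarrow> ennreal \<Rightarrow> (('a \<Rightarrow> complex) \<Rightarrow> ('a \<Rightarrow> complex)) \<Rightarrow> ennreal" where
  "op_norm \<mu> p q T = Inf {ennreal C | C. 0 \<le> C \<and>
     (\<exists>S. linear_op \<mu> (Lp \<mu> p) (Lp \<mu> q) S \<and>
          (\<forall>f\<in>Lp \<mu> 2 \<inter> Lp \<mu> p. AE x in \<mu>. S f x = T f x) \<and>
          (\<forall>f\<in>Lp \<mu> p. Lp_norm \<mu> q (S f) \<le> C * Lp_norm \<mu> p f))}"

section \<open>Self-adjoint operators and their functional calculus\<close>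

text \<open>An unbounded operator on \<open>L\<^sup>2\<close> is given by its domain \<open>D\<close> and a map \<open>L\<close> on \<open>D\<close>.\<close>

definition densely_defined_op ::
  "'a measure \<Rightarrow> ('a \<Rightarrow> complex) set \<Rightarrow> (('a \<Rightarrow> complex) \<Rightarrow> ('a \<Rightarrow> complex)) \<Rightarrow> bool" where
  "densely_defined_op \<mu> D L \<longleftrightarrow>
     D \<subseteq> Lp \<mu> 2 \<and>
     (\<forall>f\<in>D. \<forall>g\<in>D. (\<lambda>x. f x + g x) \<in> D) \<and> (\<forall>f\<in>D. \<forall>c. (\<lambda>x. c * f x) \<in> D) \<and>
     (\<forall>f\<in>Lp \<mu> 2. \<forall>\<epsilon>>0. \<exists>g\<in>D. Lp_norm \<mu> 2 (\<lambda>x. f x - g x) < \<epsilon>) \<and>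
     linear_op \<mu> D (Lp \<mu> 2) L"

definition adjoint_domain ::
  "'a measure \<Rightarrow> ('a \<Rightarrow> complex) set \<Rightarrow> (('a \<Rightarrow> complex) \<Rightarrow> ('a \<Rightarrow> complex))
    \<Rightarrow> ('a \<Rightarrow> complex) set" where
  "adjoint_domain \<mu> D L =
     {g \<in> Lp \<mu> 2. \<exists>h\<in>Lp \<mu> 2. \<forall>f\<in>D. L2_inner \<mu> (L f) g = L2_inner \<mu> f h}"

definition self_adjoint_op ::
  "'a measure \<Rightarrow> ('a \<Rightarrow> complex) set \<Rightarrow> (('a \<Rightarrow> complex) \<Rightarrow> ('a \<Rightarrow> complex)) \<Rightarrow> bool" where
  "self_adjoint_op \<mu> D L \<longleftrightarrow>
     densely_defined_op \<mu> D L \<and>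
     adjoint_domain \<mu> D L = D \<and>
     (\<forall>f\<in>D. \<forall>g\<in>D. L2_inner \<mu> (L f) g = L2_inner \<mu> f (L g))"

definition nonneg_op ::
  "'a measure \<Rightarrow> ('a \<Rightarrow> complex) set \<Rightarrow> (('a \<Rightarrow> complex) \<Rightarrow> ('a \<Rightarrow> complex)) \<Rightarrow> bool" where
  "nonneg_op \<mu> D L \<longleftrightarrow> (\<forall>f\<in>D. 0 \<le> Re (L2_inner \<mu> (L f) f))"

definition projection_valued_measure ::
  "'a measure \<Rightarrow> (real set \<Rightarrow> ('a \<Rightarrow> complex) \<Rightarrow> ('a \<Rightarrow> complex)) \<Rightarrow> bool" where
  "projection_valued_measure \<mu> E \<longleftrightarrow>
     (\<forall>A\<in>sets borel. linear_op \<mu> (Lp \<mu> 2) (Lp \<mu> 2) (E A)) \<and>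
     (\<forall>A\<in>sets borel. \<forall>f\<in>Lp \<mu> 2. \<forall>g\<in>Lp \<mu> 2. L2_inner \<mu> (E A f) g = L2_inner \<mu> f (E A g)) \<and>
     (\<forall>A\<in>sets borel. \<forall>B\<in>sets borel. \<forall>f\<in>Lp \<mu> 2. AE x in \<mu>. E A (E B f) x = E (A \<inter> B) f x) \<and>
     (\<forall>f\<in>Lp \<mu> 2. AE x in \<mu>. E UNIV f x = f x) \<and>
     (\<forall>A :: nat \<Rightarrow> real set. range A \<subseteq> sets borel \<longrightarrow> disjoint_family A \<longrightarrow>
        (\<forall>f\<in>Lp \<mu> 2. \<forall>g\<in>Lp \<mu> 2.
           (\<lambda>i. L2_inner \<mu> (E (A i) f) g) sums L2_inner \<mu> (E (\<Union>i. A i) f) g))"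

text \<open>The scalar measure \<open>A \<mapsto> \<langle>E(A) f, f\<rangle>\<close>.\<close>
definition scalar_measure ::
  "'a measure \<Rightarrow> (real set \<Rightarrow> ('a \<Rightarrow> complex) \<Rightarrow> ('a \<Rightarrow> complex)) \<Rightarrow> ('a \<Rightarrow> complex)
    \<Rightarrow> real measure" where
  "scalar_measure \<mu> E f =
     measure_of UNIV (sets borel) (\<lambda>A. ennreal (Re (L2_inner \<mu> (E A f) f)))"

text \<open>
  \<open>L = \<integral> \<lambda> dE(\<lambda>)\<close>. As for every operator on a complex Hilbert space, the quadratic form
  \<open>\<langle>L f, f\<rangle>\<close> on the domain determines \<open>\<langle>L f, g\<rangle>\<close> by polarisation.
\<close>
definition spectral_resolution ::
  "'a measure \<Rightarrow> ('a \<Rightarrow> complex) set \<Rightarrow> (('a \<Rightarrow> complex) \<Rightarrow> ('a \<Rightarrow> complex))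
    \<Rightarrow> (real set \<Rightarrow> ('a \<Rightarrow> complex) \<Rightarrow> ('a \<Rightarrow> complex)) \<Rightarrow> bool" where
  "spectral_resolution \<mu> D L E \<longleftrightarrow>
     projection_valued_measure \<mu> E \<and>
     D = {f \<in> Lp \<mu> 2. (\<integral>\<^sup>+u. ennreal (u\<^sup>2) \<partial>scalar_measure \<mu> E f) < \<infinity>} \<and>
     (\<forall>f\<in>D. L2_inner \<mu> (L f) f = complex_of_real (LINT u|scalar_measure \<mu> E f. u))"

text \<open>
  \<open>E\<^sub>L\<close>. By the spectral theorem a self-adjoint operator has a spectral resolution, unique up to
  null sets, so for such operators the second branch (a totalisation by zero) is never taken.
\<close>
definition spectral_measure ::
  "'a measure \<Rightarrow> ('a \<Rightarrow> complex) set \<Rightarrow> (('a \<Rightarrow> complex) \<Rightarrow> ('a \<Rightarrow> complex))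
    \<Rightarrow> (real set \<Rightarrow> ('a \<Rightarrow> complex) \<Rightarrow> ('a \<Rightarrow> complex))" where
  "spectral_measure \<mu> D L =
     (if \<exists>E. spectral_resolution \<mu> D L E then SOME E. spectral_resolution \<mu> D L E
      else (\<lambda>A f x. 0))"

text \<open>
  \<open>F(L) = \<integral>\<^sub>0\<^sup>\<infinity> F(\<lambda>) dE\<^sub>L(\<lambda>)\<close> for bounded Borel \<open>F\<close> (on the half line): the bounded operator on
  \<open>L\<^sup>2\<close> with \<open>\<langle>F(L) f, f\<rangle> = \<integral>\<^sub>0\<^sup>\<infinity> F(\<lambda>) d\<langle>E\<^sub>L(\<lambda>) f, f\<rangle>\<close>; it is unique up to null sets by
  polarisation.
\<close>
definition func_calc ::
  "'a measure \<Rightarrow> ('a \<Rightarrow> complex) set \<Rightarrow> (('a \<Rightarrow> complex) \<Rightarrow> ('a \<Rightarrow> complex))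
    \<Rightarrow> (real \<Rightarrow> complex) \<Rightarrow> (('a \<Rightarrow> complex) \<Rightarrow> ('a \<Rightarrow> complex))" where
  "func_calc \<mu> D L F = (SOME T.
     linear_op \<mu> (Lp \<mu> 2) (Lp \<mu> 2) T \<and>
     (\<exists>C. \<forall>f\<in>Lp \<mu> 2. Lp_norm \<mu> 2 (T f) \<le> C * Lp_norm \<mu> 2 f) \<and>
     (\<forall>f\<in>Lp \<mu> 2. L2_inner \<mu> (T f) f =
        (LINT u:{0..}|scalar_measure \<mu> (spectral_measure \<mu> D L) f. F u)))"

definition finite_propagation_speed ::
  "'a::metric_space measure \<Rightarrow> ('a \<Rightarrow> complex) set \<Rightarrow> (('a \<Rightarrow> complex) \<Rightarrow> ('a \<Rightarrow> complex))
    \<Rightarrow> bool" where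
  "finite_propagation_speed \<mu> D L \<longleftrightarrow>
     (\<forall>r>0. \<forall>x1 r1 x2 r2. setdist (ball x1 r1) (ball x2 r2) > r \<longrightarrow>
        (\<forall>f1\<in>Lp \<mu> 2. \<forall>f2\<in>Lp \<mu> 2.
           (\<forall>x. x \<notin> ball x1 r1 \<longrightarrow> f1 x = 0) \<longrightarrow> (\<forall>x. x \<notin> ball x2 r2 \<longrightarrow> f2 x = 0) \<longrightarrow>
           L2_inner \<mu> (func_calc \<mu> D L (\<lambda>u. complex_of_real (cos (r * sqrt u))) f1) f2 = 0))"

section \<open>Sobolev spaces on the line\<close>

text \<open>
  Fourier--Plancherel transform of \<open>F \<in> L\<^sup>2(\<real>)\<close>: the \<open>L\<^sup>2\<close> limit of the Fourier integrals
  of \<open>F\<close> truncated to \<open>[-n, n]\<close>, with the unitary normalisation.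
\<close>
definition is_plancherel_transform :: "(real \<Rightarrow> complex) \<Rightarrow> (real \<Rightarrow> complex) \<Rightarrow> bool" where
  "is_plancherel_transform F G \<longleftrightarrow>
     F \<in> Lp lborel 2 \<and> G \<in> Lp lborel 2 \<and>
     (\<lambda>n::nat. \<integral>\<^sup>+\<xi>. ennreal ((norm (G \<xi> -
          complex_of_real (1 / sqrt (2 * pi)) *
            (LINT x:{- real n..real n}|lborel. F x * exp (- (\<i> * of_real (x * \<xi>))))))\<^sup>2) \<partial>lborel)
       \<longlonglongrightarrow> 0"

definition plancherel_transform :: "(real \<Rightarrow> complex) \<Rightarrow> (real \<Rightarrow> complex)" where
  "plancherel_transform F = (SOME G. is_plancherel_transform F G)"

text \<open>
  Only \<open>s \<ge> 0\<close> is meaningful here. Membership does not see null sets: for \<open>s > 1/2\<close> the usual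
  identification of \<open>F \<in> H\<^sup>s(\<real>)\<close> with its continuous representative, which matters for \<open>F(L)\<close>
  because \<open>E\<^sub>L\<close> may charge points, has to be expressed by continuity of \<open>F\<close>.
\<close>

definition sobolev_space :: "real \<Rightarrow> (real \<Rightarrow> complex) set" where
  "sobolev_space s = {F \<in> Lp lborel 2.
     (\<integral>\<^sup>+\<xi>. ennreal ((1 + \<xi>\<^sup>2) powr s * (norm (plancherel_transform F \<xi>))\<^sup>2) \<partial>lborel) < \<infinity>}"

definition sobolev_norm :: "real \<Rightarrow> (real \<Rightarrow> complex) \<Rightarrow> real" where
  "sobolev_norm s F =
     sqrt (LINT \<xi>|lborel. (1 + \<xi>\<^sup>2) powr s * (norm (plancherel_transform F \<xi>))\<^sup>2)"

end

theory Submission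
  imports Defs "HOL-Probability.Probability"
begin

text \<open>
  Put \<open>b = 2 \<sigma> + 1/2\<close> and let \<open>\<psi>(y) = \<Sum>k. (- y / 4)\<^sup>k / (k! \<Gamma>(b + k))\<close>, a Bessel-type function.
  Since \<open>\<psi>(x\<^sup>2)\<close> is a superposition of \<open>cos (s x)\<close> with \<open>0 < s < 1\<close>, the operator \<open>\<psi>(v L)\<close> propagates
  at most by \<open>\<surd>v\<close>, and since \<open>\<psi>(x\<^sup>2) = O(x powr - 2 \<sigma>)\<close> it factors through \<open>(I + 4 v L) powr - \<sigma>\<close>. The
  hypothesis at \<open>t = 2 \<surd>v\<close> therefore bounds \<open>\<psi>(v L)\<close> on \<open>L\<^sup>1\<close> and on \<open>L\<^sup>\<infinity>\<close> by a multiple of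
  \<open>(1 + v) powr \<kappa>\<close>. For \<open>Re p > 0\<close>,
    \<open>exp (- u / (4 p)) = p powr b * \<integral> exp (- p v) v powr (b - 1) \<psi>(v u) dv\<close>  over \<open>v > 0\<close>;
  with \<open>1 / (4 p) = t (1 - \<i> \<xi>)\<close> this gives (i). Part (ii) follows by Fourier inversion, writing
  \<open>F(u)\<close> as a superposition of the functions \<open>exp (\<i> \<xi> u) exp (- u)\<close>.

  Bounds on \<open>L\<^sup>p\<close> are carried by the forms \<open>\<langle>F(L) f, g\<rangle>\<close>, which are linear in \<open>F\<close>. A form bound against
  \<open>L\<^sup>1 \<times> L\<^sup>\<infinity>\<close> and \<open>L\<^sup>\<infinity> \<times> L\<^sup>1\<close> yields an operator on \<open>L\<^sup>1 + L\<^sup>\<infinity>\<close>, and truncation at height \<open>s\<close> gives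
  \<open>\<integral> (|S f| - M s)\<^sub>+ \<le> M \<integral> (|f| - s)\<^sub>+\<close>; integrating against \<open>s powr (p - 2) ds\<close> is the \<open>L\<^sup>p\<close> bound.
  No spectral theorem enters: the calculus does not use \<open>E(\<real>) = I\<close>, hence it also covers
  the totalisation of the spectral measure by zero.
\<close>

section \<open>The Hilbert space of square integrable functions\<close>

text \<open>The value of b comes from the decay of Bessel functions:
  \<open>psi b (x\<^sup>2)\<close> decays like x powr (1/2 - b), so b = 2 \<sigma> + 1/2 is the
  least b that absorbs the resolvent of power \<sigma>. The 1/4 in the exponent is b / 2 - \<sigma>,
  the price of the complex direction of p. An operator that sees distances up to \<surd>v alone
  avoids them: what it sees from x lies in the ball of radius 2 \<surd>v about x, whose volume is
  the one in the hypothesis, and the volumes cancel. The factor 2 leaves room for a cover by small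
  balls, because finite propagation speaks about pairs of balls, whereas the part of a function far
  from x is not contained in one ball. In (ii) the damping exp (- u) must be undone by a function
  with integrable weighted Fourier transform; exp u itself has none, so it is altered outside the
  support of the multiplier. Cauchy-Schwarz on the frequency line then costs 1/2 in the exponent: s
  > 2 (\<sigma> + \<kappa> + 1/4) + 1/2.\<close>

lemma L2_iff: "f \<in> Lp \<mu> 2 \<longleftrightarrow> f \<in> borel_measurable \<mu> \<and> integrable \<mu> (\<lambda>x. (norm (f x))\<^sup>2)"
  by (auto simp: Lp_def integrable_iff_bounded)

lemma L1_iff: "f \<in> Lp \<mu> 1 \<longleftrightarrow> integrable \<mu> f"
  by (auto simp: Lp_def integrable_iff_bounded)

lemma Linf_iff: "f \<in> Lp \<mu> \<infinity> \<longleftrightarrow> f \<in> borel_measurable \<mu> \<and> (\<exists>B\<ge>0. AE x in \<mu>. norm (f x) \<le> B)"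
proof -
  have "esssup \<mu> (\<lambda>x. ennreal (norm (f x))) < \<infinity> \<longleftrightarrow> (\<exists>B\<ge>0. AE x in \<mu>. norm (f x) \<le> B)"
    if [measurable]: "f \<in> borel_measurable \<mu>"
  proof
    assume "esssup \<mu> (\<lambda>x. ennreal (norm (f x))) < \<infinity>"
    then obtain B where B: "B \<ge> 0" "esssup \<mu> (\<lambda>x. ennreal (norm (f x))) = ennreal B"
      by (cases "esssup \<mu> (\<lambda>x. ennreal (norm (f x)))") auto
    have "AE x in \<mu>. ennreal (norm (f x)) \<le> ennreal B"
      using esssup_AE[of "\<lambda>x. ennreal (norm (f x))" \<mu>] B by simp
    then show "\<exists>B\<ge>0. AE x in \<mu>. norm (f x) \<le> B"
      using B by (auto intro!: exI[of _ B])
  next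
    assume "\<exists>B\<ge>0. AE x in \<mu>. norm (f x) \<le> B"
    then obtain B where B: "B \<ge> 0" "AE x in \<mu>. norm (f x) \<le> B" by auto
    have "esssup \<mu> (\<lambda>x. ennreal (norm (f x))) \<le> ennreal B"
      using B by (intro esssup_I) (auto elim!: eventually_mono intro!: ennreal_leI)
    then show "esssup \<mu> (\<lambda>x. ennreal (norm (f x))) < \<infinity>"
      by (metis ennreal_less_top infinity_ennreal_def le_less_trans)
  qed
  then show ?thesis by (auto simp: Lp_def)
qed

lemma Lp_norm_2: "f \<in> Lp \<mu> 2 \<Longrightarrow> Lp_norm \<mu> 2 f = sqrt (LINT x|\<mu>. (norm (f x))\<^sup>2)"
  by (simp add: Lp_norm_def L2_iff nn_integral_eq_integral powr_half_sqrt)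

lemma Lp_norm_1: "f \<in> Lp \<mu> 1 \<Longrightarrow> Lp_norm \<mu> 1 f = (LINT x|\<mu>. norm (f x))"
  by (simp add: Lp_norm_def L1_iff nn_integral_eq_integral)

lemma Lp_norm_nonneg: "0 \<le> Lp_norm \<mu> p f"
  by (simp add: Lp_norm_def)

lemma Linf_bound: assumes "f \<in> Lp \<mu> \<infinity>" shows "AE x in \<mu>. norm (f x) \<le> Lp_norm \<mu> \<infinity> f"
proof -
  have fin: "esssup \<mu> (\<lambda>x. ennreal (norm (f x))) < top" using assms by (simp add: Lp_def)
  have "AE x in \<mu>. ennreal (norm (f x)) \<le> esssup \<mu> (\<lambda>x. ennreal (norm (f x)))"
    by (rule esssup_AE)
  then show ?thesis
  proof (rule eventually_mono)
    fix x assume "ennreal (norm (f x)) \<le> esssup \<mu> (\<lambda>x. ennreal (norm (f x)))"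
    from enn2real_mono[OF this fin] show "norm (f x) \<le> Lp_norm \<mu> \<infinity> f" by (simp add: Lp_norm_def)
  qed
qed

lemma Lp_norm_infinity_le:
  assumes "f \<in> borel_measurable \<mu>" "0 \<le> B" "AE x in \<mu>. norm (f x) \<le> B"
  shows "Lp_norm \<mu> \<infinity> f \<le> B"
proof -
  have "esssup \<mu> (\<lambda>x. ennreal (norm (f x))) \<le> ennreal B"
    using assms by (intro esssup_I) (auto elim!: eventually_mono intro!: ennreal_leI)
  then show ?thesis using assms(2) by (simp add: Lp_norm_def enn2real_leI)
qed

lemma L2_measurable: "f \<in> Lp \<mu> 2 \<Longrightarrow> f \<in> borel_measurable \<mu>" by (simp add: L2_iff)

lemma norm_add_power2_le: "(norm (a + b))\<^sup>2 \<le> 2 * (norm a)\<^sup>2 + 2 * (norm (b::'b::real_normed_vector))\<^sup>2"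
proof -
  have "(norm (a + b))\<^sup>2 \<le> (norm a + norm b)\<^sup>2" by (intro power_mono norm_triangle_ineq) auto
  also have "\<dots> \<le> 2 * (norm a)\<^sup>2 + 2 * (norm b)\<^sup>2"
    using sum_squares_bound[of "norm a" "norm b"] by (simp add: power2_sum)
  finally show ?thesis .
qed

lemma L2_add: assumes "f \<in> Lp \<mu> 2" "g \<in> Lp \<mu> 2" shows "(\<lambda>x. f x + g x) \<in> Lp \<mu> 2"
proof -
  have [measurable]: "f \<in> borel_measurable \<mu>" "g \<in> borel_measurable \<mu>" using assms by (auto simp: L2_iff)
  have "integrable \<mu> (\<lambda>x. (norm (f x + g x))\<^sup>2)"
    by (rule Bochner_Integration.integrable_bound[where f="\<lambda>x. 2 * (norm (f x))\<^sup>2 + 2 * (norm (g x))\<^sup>2"])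
      (use assms in \<open>auto simp: L2_iff intro!: norm_add_power2_le\<close>)
  then show ?thesis by (simp add: L2_iff)
qed

lemma L2_scale: "f \<in> Lp \<mu> 2 \<Longrightarrow> (\<lambda>x. c * f x) \<in> Lp \<mu> 2"
  by (auto simp: L2_iff norm_mult power_mult_distrib)

lemma L2_diff: "f \<in> Lp \<mu> 2 \<Longrightarrow> g \<in> Lp \<mu> 2 \<Longrightarrow> (\<lambda>x. f x - g x) \<in> Lp \<mu> 2"
  using L2_add[OF _ L2_scale[of g \<mu> "-1"], of f] by simp

lemma L2_zero: "(\<lambda>x. 0) \<in> Lp \<mu> 2" by (simp add: L2_iff)

lemma L2_dominated:
  assumes "f \<in> Lp \<mu> 2" "g \<in> borel_measurable \<mu>" "\<And>x. norm (g x) \<le> norm (f x)"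
  shows "g \<in> Lp \<mu> 2"
proof -
  have "integrable \<mu> (\<lambda>x. (norm (g x))\<^sup>2)"
    by (rule Bochner_Integration.integrable_bound[where f="\<lambda>x. (norm (f x))\<^sup>2"])
      (use assms in \<open>auto simp: L2_iff intro!: power_mono\<close>)
  then show ?thesis using assms by (simp add: L2_iff)
qed

lemma L2_indicator: "f \<in> Lp \<mu> 2 \<Longrightarrow> A \<in> sets \<mu> \<Longrightarrow> (\<lambda>x. indicator A x * f x) \<in> Lp \<mu> 2"
  by (rule L2_dominated[of f]) (auto simp: L2_iff indicator_def)

lemma norm_mult_le_squares: "norm (a * b) \<le> (norm a)\<^sup>2 + (norm (b::complex))\<^sup>2"
proof -
  have "0 \<le> norm a * norm b" by simp
  then show ?thesis using sum_squares_bound[of "norm a" "norm b"] unfolding norm_mult by linarith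
qed

lemma L2_integrable_mult:
  assumes "f \<in> Lp \<mu> 2" "g \<in> Lp \<mu> 2" shows "integrable \<mu> (\<lambda>x. f x * g x)"
  by (rule Bochner_Integration.integrable_bound[where f="\<lambda>x. (norm (f x))\<^sup>2 + (norm (g x))\<^sup>2"])
    (use assms in \<open>auto simp: L2_iff intro!: norm_mult_le_squares\<close>)

lemma borel_measurable_cnj[measurable (raw)]:
  "f \<in> borel_measurable M \<Longrightarrow> (\<lambda>x. cnj (f x)) \<in> borel_measurable M"
  by (rule borel_measurable_continuous_on[OF continuous_on_cnj[OF continuous_on_id]])

lemma L2_cnj: "f \<in> Lp \<mu> 2 \<Longrightarrow> (\<lambda>x. cnj (f x)) \<in> Lp \<mu> 2"
  by (auto simp: L2_iff)

lemma L2_integrable_inner: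
  assumes "f \<in> Lp \<mu> 2" "g \<in> Lp \<mu> 2" shows "integrable \<mu> (\<lambda>x. f x * cnj (g x))"
  using L2_integrable_mult[OF assms(1) L2_cnj[OF assms(2)]] .

lemma L2_inner_add_left:
  "f \<in> Lp \<mu> 2 \<Longrightarrow> g \<in> Lp \<mu> 2 \<Longrightarrow> h \<in> Lp \<mu> 2 \<Longrightarrow>
    L2_inner \<mu> (\<lambda>x. f x + g x) h = L2_inner \<mu> f h + L2_inner \<mu> g h"
  by (simp add: L2_inner_def L2_integrable_inner distrib_right)

lemma L2_inner_diff_left:
  "f \<in> Lp \<mu> 2 \<Longrightarrow> g \<in> Lp \<mu> 2 \<Longrightarrow> h \<in> Lp \<mu> 2 \<Longrightarrow>
    L2_inner \<mu> (\<lambda>x. f x - g x) h = L2_inner \<mu> f h - L2_inner \<mu> g h"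
  by (simp add: L2_inner_def L2_integrable_inner left_diff_distrib)

lemma L2_inner_scale_left: "L2_inner \<mu> (\<lambda>x. c * f x) h = c * L2_inner \<mu> f h"
  by (simp add: L2_inner_def mult.assoc)

lemma L2_inner_cnj: "cnj (L2_inner \<mu> f g) = L2_inner \<mu> g f"
proof -
  have "cnj (L2_inner \<mu> f g) = (LINT x|\<mu>. cnj (f x * cnj (g x)))"
    unfolding L2_inner_def by (rule Bochner_Integration.integral_cnj[symmetric])
  then show ?thesis by (simp add: L2_inner_def mult.commute)
qed

lemma L2_inner_add_right:
  "f \<in> Lp \<mu> 2 \<Longrightarrow> g \<in> Lp \<mu> 2 \<Longrightarrow> h \<in> Lp \<mu> 2 \<Longrightarrow>
    L2_inner \<mu> h (\<lambda>x. f x + g x) = L2_inner \<mu> h f + L2_inner \<mu> h g"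
  by (simp add: L2_inner_def L2_integrable_inner distrib_left)

lemma L2_inner_scale_right: "L2_inner \<mu> h (\<lambda>x. c * f x) = cnj c * L2_inner \<mu> h f"
  by (simp add: L2_inner_def mult.left_commute)

lemma L2_inner_cong_left:
  assumes "AE x in \<mu>. f x = f' x" "f \<in> borel_measurable \<mu>" "f' \<in> borel_measurable \<mu>" "g \<in> borel_measurable \<mu>"
  shows "L2_inner \<mu> f g = L2_inner \<mu> f' g"
  unfolding L2_inner_def by (rule integral_cong_AE) (use assms in auto)

lemma L2_inner_self:
  assumes "f \<in> Lp \<mu> 2" shows "L2_inner \<mu> f f = complex_of_real (LINT x|\<mu>. (norm (f x))\<^sup>2)"
proof -
  have "L2_inner \<mu> f f = (LINT x|\<mu>. complex_of_real ((norm (f x))\<^sup>2))"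
    unfolding L2_inner_def complex_norm_square ..
  then show ?thesis by (simp only: integral_complex_of_real)
qed

lemma L2_inner_self_norm:
  assumes "f \<in> Lp \<mu> 2" shows "L2_inner \<mu> f f = complex_of_real ((Lp_norm \<mu> 2 f)\<^sup>2)"
  using assms by (simp add: L2_inner_self Lp_norm_2)

lemma L2_Cauchy_Schwarz_abs:
  assumes "f \<in> Lp \<mu> 2" "g \<in> Lp \<mu> 2"
  shows "(LINT x|\<mu>. norm (f x) * norm (g x)) \<le> Lp_norm \<mu> 2 f * Lp_norm \<mu> 2 g"
proof -
  have [measurable]: "f \<in> borel_measurable \<mu>" "g \<in> borel_measurable \<mu>" using assms by (auto simp: L2_iff)
  have I: "integrable \<mu> (\<lambda>x. norm (f x) * norm (g x))"
    using integrable_norm[OF L2_integrable_mult[OF assms]] by (simp add: norm_mult)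
  have "(\<integral>\<^sup>+x. ennreal (norm (f x)) * ennreal (norm (g x)) \<partial>\<mu>)\<^sup>2 \<le>
     (\<integral>\<^sup>+x. (ennreal (norm (f x)))\<^sup>2 \<partial>\<mu>) * (\<integral>\<^sup>+x. (ennreal (norm (g x)))\<^sup>2 \<partial>\<mu>)"
    by (rule Cauchy_Schwarz_nn_integral) auto
  then have "ennreal ((LINT x|\<mu>. norm (f x) * norm (g x))\<^sup>2) \<le>
     ennreal ((LINT x|\<mu>. (norm (f x))\<^sup>2) * (LINT x|\<mu>. (norm (g x))\<^sup>2))"
    using assms I by (simp add: L2_iff ennreal_mult[symmetric] ennreal_power nn_integral_eq_integral)
  then have "(LINT x|\<mu>. norm (f x) * norm (g x))\<^sup>2 \<le> (LINT x|\<mu>. (norm (f x))\<^sup>2) * (LINT x|\<mu>. (norm (g x))\<^sup>2)"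
    by (subst (asm) ennreal_le_iff) auto
  from real_sqrt_le_mono[OF this] show ?thesis
    using assms by (simp add: Lp_norm_2 real_sqrt_mult)
qed

lemma L2_Cauchy_Schwarz:
  assumes "f \<in> Lp \<mu> 2" "g \<in> Lp \<mu> 2"
  shows "norm (L2_inner \<mu> f g) \<le> Lp_norm \<mu> 2 f * Lp_norm \<mu> 2 g"
proof -
  have "norm (L2_inner \<mu> f g) \<le> (LINT x|\<mu>. norm (f x * cnj (g x)))"
    unfolding L2_inner_def by (rule integral_norm_bound)
  then show ?thesis using L2_Cauchy_Schwarz_abs[OF assms] by (simp add: norm_mult)
qed

lemma L2_AE_eqI:
  assumes "f \<in> Lp \<mu> 2" "g \<in> Lp \<mu> 2" "\<And>h. h \<in> Lp \<mu> 2 \<Longrightarrow> L2_inner \<mu> f h = L2_inner \<mu> g h"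
  shows "AE x in \<mu>. f x = g x"
proof -
  let ?d = "\<lambda>x. f x - g x"
  have d: "?d \<in> Lp \<mu> 2" using assms by (simp add: L2_diff)
  have "L2_inner \<mu> ?d ?d = 0" using assms(1,2) assms(3)[OF d] d by (simp add: L2_inner_diff_left)
  then have "(LINT x|\<mu>. (norm (?d x))\<^sup>2) = 0" using d by (simp add: L2_inner_self)
  then have "AE x in \<mu>. (norm (?d x))\<^sup>2 = 0"
    using d by (subst (asm) integral_nonneg_eq_0_iff_AE) (auto simp: L2_iff)
  then show ?thesis by eventually_elim simp
qed

text \<open>A subsequence with geometrically small increments converges almost everywhere, and
  Fatou's lemma makes its limit the limit of the whole sequence. The exponent is left free because
  completeness is used twice: q = 2 for the functional calculus, q = 1 for images of integrable
  functions.\<close>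

lemma Riesz_Fischer:
  fixes u :: "nat \<Rightarrow> 'a \<Rightarrow> complex" and q :: nat
  assumes q: "q \<ge> 1" and um[measurable]: "\<And>n. u n \<in> borel_measurable M"
    and cau: "\<And>e::real. e > 0 \<Longrightarrow> \<exists>N. \<forall>m\<ge>N. \<forall>n\<ge>N. (\<integral>\<^sup>+x. ennreal (norm (u m x - u n x) ^ q) \<partial>M) \<le> ennreal e"
  shows "\<exists>h\<in>borel_measurable M. (\<lambda>n. \<integral>\<^sup>+x. ennreal (norm (u n x - h x) ^ q) \<partial>M) \<longlonglongrightarrow> 0"
proof -
  have "\<exists>N. \<forall>k. \<forall>m\<ge>N k. \<forall>n\<ge>N k. (\<integral>\<^sup>+x. ennreal (norm (u m x - u n x) ^ q) \<partial>M) \<le> ennreal ((1/4) ^ (k*q))"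
    by (intro choice allI cau) auto
  then obtain N where N: "\<And>k m n. m \<ge> N k \<Longrightarrow> n \<ge> N k \<Longrightarrow>
      (\<integral>\<^sup>+x. ennreal (norm (u m x - u n x) ^ q) \<partial>M) \<le> ennreal ((1/4) ^ (k*q))" by blast
  \<comment> \<open>The sum of the thresholds makes \<open>r\<close> monotone and at least
    \<open>N k\<close>; the summand \<open>k\<close> makes it unbounded, which the Fatou step
    uses.\<close>
  define r where "r k = k + (\<Sum>i\<le>k. N i)" for k
  have rN: "r k \<ge> N k" for k using member_le_sum[of k "{..k}" N] by (simp add: r_def)
  have rmono: "r k \<le> r (Suc k)" for k unfolding r_def by simp
  have rN': "r (Suc k) \<ge> N k" for k using rmono[of k] rN[of k] by simp
  \<comment> \<open>The increments get the weight 2 ^ (k * q). The weighted sum still has finite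
    integral, and where it is finite its terms tend to 0, which forces \<open>d k x\<close> below
    (1/2) ^ k eventually.\<close>
  define d where "d k x = norm (u (r (Suc k)) x - u (r k) x)" for k x
  have [measurable]: "d k \<in> borel_measurable M" for k unfolding d_def by measurable
  have "(\<integral>\<^sup>+x. (\<Sum>k. ennreal (2 ^ (k*q) * d k x ^ q)) \<partial>M) = (\<Sum>k. \<integral>\<^sup>+x. ennreal (2 ^ (k*q) * d k x ^ q) \<partial>M)"
    by (intro nn_integral_suminf) auto
  also have "\<dots> = (\<Sum>k. ennreal (2 ^ (k*q)) * (\<integral>\<^sup>+x. ennreal (d k x ^ q) \<partial>M))"
    by (simp add: ennreal_mult d_def nn_integral_cmult)
  also have "\<dots> \<le> (\<Sum>k. ennreal ((1/2) ^ k))"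
  proof (intro suminf_le allI)
    fix k
    have "ennreal (2 ^ (k*q)) * (\<integral>\<^sup>+x. ennreal (d k x ^ q) \<partial>M) \<le> ennreal (2 ^ (k*q)) * ennreal ((1/4) ^ (k*q))"
      using N[OF rN' rN] by (intro mult_left_mono) (auto simp: d_def)
    also have "\<dots> = ennreal ((1/2) ^ (k*q))"
      by (simp add: ennreal_mult[symmetric] power_mult_distrib[symmetric])
    also have "\<dots> \<le> ennreal ((1/2) ^ k)"
      using q by (intro ennreal_leI power_decreasing) auto
    finally show "ennreal (2 ^ (k*q)) * (\<integral>\<^sup>+x. ennreal (d k x ^ q) \<partial>M) \<le> ennreal ((1/2) ^ k)" .
  qed auto
  also have "\<dots> < \<infinity>"
    by (subst suminf_ennreal2) (auto simp: summable_geometric ennreal_less_top)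
  finally have fin: "(\<integral>\<^sup>+x. (\<Sum>k. ennreal (2 ^ (k*q) * d k x ^ q)) \<partial>M) \<noteq> \<infinity>" by simp
  have "AE x in M. (\<Sum>k. ennreal (2 ^ (k*q) * d k x ^ q)) \<noteq> \<infinity>"
    by (rule nn_integral_noteq_infinite[OF _ fin]) auto
  then have conv: "AE x in M. convergent (\<lambda>k. u (r k) x)"
  proof eventually_elim
    case (elim x)
    have sm: "summable (\<lambda>k. 2 ^ (k*q) * d k x ^ q)"
      by (rule summable_suminf_not_top) (use elim in \<open>auto simp: d_def\<close>)
    have "(\<lambda>k. 2 ^ (k*q) * d k x ^ q) \<longlonglongrightarrow> 0" using summable_LIMSEQ_zero[OF sm] .
    then have "\<forall>\<^sub>F k in sequentially. 2 ^ (k*q) * d k x ^ q < 1"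
      by (rule order_tendstoD) simp
    then have ev: "\<forall>\<^sub>F k in sequentially. norm (u (r (Suc k)) x - u (r k) x) \<le> (1/2) ^ k"
    proof eventually_elim
      case (elim k)
      have "(2 ^ k * d k x) ^ q < 1" using elim by (simp add: power_mult_distrib power_mult)
      then have "2 ^ k * d k x < 1"
        by (metis d_def norm_ge_zero mult_nonneg_nonneg not_le one_le_power zero_le_numeral zero_le_power)
      then show ?case by (simp add: d_def field_simps power_one_over)
    qed
    have "summable (\<lambda>k. u (r (Suc k)) x - u (r k) x)"
      by (rule summable_comparison_test_ev[OF ev]) (simp add: summable_geometric)
    then obtain l where "(\<lambda>n. \<Sum>k<n. u (r (Suc k)) x - u (r k) x) \<longlonglongrightarrow> l"
      by (auto simp: summable_def sums_def)
    then have "(\<lambda>n. u (r n) x - u (r 0) x) \<longlonglongrightarrow> l" using sum_lessThan_telescope[of "\<lambda>k. u (r k) x"] by simp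
    then have "(\<lambda>n. u (r n) x - u (r 0) x + u (r 0) x) \<longlonglongrightarrow> l + u (r 0) x" by (intro tendsto_add) auto
    then show "convergent (\<lambda>k. u (r k) x)" by (auto simp: convergent_def)
  qed
  define h where "h x = lim (\<lambda>k. u (r k) x)" for x
  have hm[measurable]: "h \<in> borel_measurable M" unfolding h_def by measurable
  have lim: "AE x in M. (\<lambda>k. u (r k) x) \<longlonglongrightarrow> h x"
    using conv by eventually_elim (simp add: h_def convergent_LIMSEQ_iff)
  have "\<exists>N. \<forall>n\<ge>N. (\<integral>\<^sup>+x. ennreal (norm (u n x - h x) ^ q) \<partial>M) \<le> ennreal e" if "e > 0" for e
  proof -
    from cau[OF that] obtain N0 where N0: "\<And>m n. m \<ge> N0 \<Longrightarrow> n \<ge> N0 \<Longrightarrow>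
      (\<integral>\<^sup>+x. ennreal (norm (u m x - u n x) ^ q) \<partial>M) \<le> ennreal e" by blast
    have "(\<integral>\<^sup>+x. ennreal (norm (u n x - h x) ^ q) \<partial>M) \<le> ennreal e" if n: "n \<ge> N0" for n
    proof -
      have "(\<integral>\<^sup>+x. ennreal (norm (u n x - h x) ^ q) \<partial>M) = (\<integral>\<^sup>+x. liminf (\<lambda>k. ennreal (norm (u n x - u (r k) x) ^ q)) \<partial>M)"
      proof (rule nn_integral_cong_AE, use lim in eventually_elim)
        case (elim x)
        have "(\<lambda>k. ennreal (norm (u n x - u (r k) x) ^ q)) \<longlonglongrightarrow> ennreal (norm (u n x - h x) ^ q)"
          by (intro tendsto_intros elim)
        from lim_imp_Liminf[OF _ this] show ?case by simp
      qed
      also have "\<dots> \<le> liminf (\<lambda>k. \<integral>\<^sup>+x. ennreal (norm (u n x - u (r k) x) ^ q) \<partial>M)"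
        by (rule nn_integral_liminf) auto
      also have "\<dots> \<le> liminf (\<lambda>k::nat. ennreal e)"
      proof (rule Liminf_mono)
        show "\<forall>\<^sub>F k in sequentially. (\<integral>\<^sup>+x. ennreal (norm (u n x - u (r k) x) ^ q) \<partial>M) \<le> ennreal e"
          using eventually_ge_at_top[of N0]
          by eventually_elim (rule N0[OF n], simp add: r_def)
      qed
      finally show ?thesis by (simp add: Liminf_const)
    qed
    then show ?thesis by blast
  qed
  note ev = this
  have "(\<lambda>n. \<integral>\<^sup>+x. ennreal (norm (u n x - h x) ^ q) \<partial>M) \<longlonglongrightarrow> 0"
  proof (rule order_tendstoI)
    fix a :: ennreal assume "0 < a"
    then obtain e where e: "0 < e" "e < a" using dense by blast
    then have "e \<noteq> top" by auto
    then obtain e' where e': "e = ennreal e'" "e' > 0" using e(1) by (cases e) auto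
    from ev[OF e'(2)] obtain N0 where "\<forall>n\<ge>N0. (\<integral>\<^sup>+x. ennreal (norm (u n x - h x) ^ q) \<partial>M) \<le> ennreal e'" by blast
    then show "\<forall>\<^sub>F n in sequentially. (\<integral>\<^sup>+x. ennreal (norm (u n x - h x) ^ q) \<partial>M) < a"
      using e e' unfolding eventually_sequentially by (meson le_less_trans)
  qed auto
  then show ?thesis using hm by blast
qed

section \<open>Functional calculus of a projection-valued measure\<close>

definition bounded_borel :: "(real \<Rightarrow> complex) \<Rightarrow> bool" where
  "bounded_borel F \<longleftrightarrow> F \<in> borel_measurable borel \<and> (\<exists>B. \<forall>u. norm (F u) \<le> B)"

lemma bounded_borel_measurable[measurable_dest]: "bounded_borel F \<Longrightarrow> F \<in> borel_measurable borel"
  by (simp add: bounded_borel_def)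

lemma bounded_borelI: "F \<in> borel_measurable borel \<Longrightarrow> (\<And>u. norm (F u) \<le> B) \<Longrightarrow> bounded_borel F"
  by (auto simp: bounded_borel_def)

lemma bounded_borelD: "bounded_borel F \<Longrightarrow> \<exists>B\<ge>0. \<forall>u. norm (F u) \<le> B"
  unfolding bounded_borel_def by (meson norm_ge_zero order_trans)

lemma bounded_borel_indicator: "A \<in> sets borel \<Longrightarrow> bounded_borel (indicator A)"
  by (rule bounded_borelI[of _ 1]) (auto simp: indicator_def)

lemma bounded_borel_add: "bounded_borel F \<Longrightarrow> bounded_borel G \<Longrightarrow> bounded_borel (\<lambda>u. F u + G u)"
  unfolding bounded_borel_def by (auto, meson norm_triangle_mono)

lemma bounded_borel_mult:
  assumes "bounded_borel F" "bounded_borel G" shows "bounded_borel (\<lambda>u. F u * G u)"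
proof -
  from assms obtain A B where "A \<ge> 0" "\<And>u. norm (F u) \<le> A" "B \<ge> 0" "\<And>u. norm (G u) \<le> B"
    by (meson bounded_borelD)
  then show ?thesis using assms
    by (intro bounded_borelI[of _ "A * B"]) (auto simp: norm_mult bounded_borel_def intro!: mult_mono)
qed

lemma bounded_borel_const: "bounded_borel (\<lambda>u. c)" by (rule bounded_borelI[of _ "norm c"]) auto

lemma bounded_borel_scale: "bounded_borel F \<Longrightarrow> bounded_borel (\<lambda>u. c * F u)"
  by (intro bounded_borel_mult bounded_borel_const)

lemma bounded_borel_diff: "bounded_borel F \<Longrightarrow> bounded_borel G \<Longrightarrow> bounded_borel (\<lambda>u. F u - G u)"
  using bounded_borel_add[OF _ bounded_borel_scale[of G "-1"], of F] by simp

lemma bounded_borel_cnj: "bounded_borel F \<Longrightarrow> bounded_borel (\<lambda>u. cnj (F u))"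
  by (auto simp: bounded_borel_def)

lemma bounded_borel_norm_square: "bounded_borel F \<Longrightarrow> bounded_borel (\<lambda>u. complex_of_real ((norm (F u))\<^sup>2))"
  by (simp only: complex_norm_square bounded_borel_mult bounded_borel_cnj)

text \<open>Identities about multipliers start from indicators, where they are statements about
  projections. Uniformly bounded pointwise limits are the closure under which dominated convergence
  works for all scalar measures at once; simple functions bounded by twice the modulus of F provide
  the sequence.\<close>

lemma bounded_borel_induct [consumes 1, case_names indicator scale add lim]:
  assumes F: "bounded_borel F"
    and ind: "\<And>A. A \<in> sets borel \<Longrightarrow> P (indicator A)"
    and scale: "\<And>c G. bounded_borel G \<Longrightarrow> P G \<Longrightarrow> P (\<lambda>u. c * G u)"
    and add: "\<And>G H. bounded_borel G \<Longrightarrow> bounded_borel H \<Longrightarrow> P G \<Longrightarrow> P H \<Longrightarrow> P (\<lambda>u. G u + H u)"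
    and lim: "\<And>(Gn :: nat \<Rightarrow> _) G B. (\<And>n. bounded_borel (Gn n)) \<Longrightarrow> (\<And>n. P (Gn n)) \<Longrightarrow>
      (\<And>n u. norm (Gn n u) \<le> B) \<Longrightarrow> (\<And>u. (\<lambda>n. Gn n u) \<longlonglongrightarrow> G u) \<Longrightarrow> bounded_borel G \<Longrightarrow> P G"
  shows "P F"
proof -
  obtain B where B: "B \<ge> 0" "\<And>u. norm (F u) \<le> B" using bounded_borelD[OF F] by blast
  from borel_measurable_implies_sequence_metric[OF bounded_borel_measurable[OF F], of 0]
  obtain s where s: "\<And>i. simple_function borel (s i)" "\<And>u. (\<lambda>i. s i u) \<longlonglongrightarrow> F u"
    "\<And>i u. norm (s i u) \<le> 2 * norm (F u)" by auto
  have sB: "norm (s i u) \<le> 2 * B" for i u using s(3)[of i u] B(2)[of u] by simp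
  have sbb: "bounded_borel (s i)" for i
    using borel_measurable_simple_function[OF s(1)] sB by (rule bounded_borelI)
  have "P (s i)" for i
  proof -
    have fin: "finite (range (s i))" using s(1)[of i] by (simp add: simple_function_def)
    have lev: "s i -` {y} \<in> sets borel" for y
      using measurable_sets[OF borel_measurable_simple_function[OF s(1)[of i]], of "{y}"] by simp
    have fin_sum: "P (\<lambda>u. \<Sum>y\<in>I. y * indicator (s i -` {y}) u) \<and> bounded_borel (\<lambda>u. \<Sum>y\<in>I. y * indicator (s i -` {y}) u)"
      if "finite I" for I :: "complex set"
      using that
    proof (induction I)
      case empty
      show ?case using ind[of "{}"] bounded_borel_const[of 0] by (simp add: indicator_def[abs_def])
    next
      case (insert y I)
      have "bounded_borel (\<lambda>u. y * indicator (s i -` {y}) u)" "P (\<lambda>u. y * indicator (s i -` {y}) u)"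
        using lev ind scale bounded_borel_indicator bounded_borel_scale by blast+
      with insert add bounded_borel_add show ?case by (simp only: sum.insert[OF insert(1,2)])
    qed
    have "(\<Sum>y\<in>range (s i). y * indicator (s i -` {y}) u) = s i u" for u
    proof -
      have "(\<Sum>y\<in>range (s i). y * indicator (s i -` {y}) u) = (\<Sum>y\<in>range (s i). if y = s i u then y else 0)"
        by (intro sum.cong) (auto simp: indicator_def)
      then show ?thesis using fin by simp
    qed
    then show ?thesis using fin_sum[OF fin] by simp
  qed
  from lim[OF sbb this sB s(2) F] show ?thesis .
qed

lemma L2_linear_op_in: "linear_op \<mu> (Lp \<mu> 2) (Lp \<mu> 2) T \<Longrightarrow> f \<in> Lp \<mu> 2 \<Longrightarrow> T f \<in> Lp \<mu> 2"
  by (simp add: linear_op_def)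

lemma L2_inner_linear_op_add:
  assumes T: "linear_op \<mu> (Lp \<mu> 2) (Lp \<mu> 2) T" and f: "f \<in> Lp \<mu> 2" "g \<in> Lp \<mu> 2" "h \<in> Lp \<mu> 2"
  shows "L2_inner \<mu> (T (\<lambda>x. f x + g x)) h = L2_inner \<mu> (T f) h + L2_inner \<mu> (T g) h"
proof -
  have "L2_inner \<mu> (T (\<lambda>x. f x + g x)) h = L2_inner \<mu> (\<lambda>x. T f x + T g x) h"
    using T f by (intro L2_inner_cong_left) (auto simp: linear_op_def L2_add intro!: L2_measurable)
  then show ?thesis using T f by (simp add: L2_inner_add_left L2_linear_op_in)
qed

lemma L2_inner_linear_op_scale:
  assumes T: "linear_op \<mu> (Lp \<mu> 2) (Lp \<mu> 2) T" and f: "f \<in> Lp \<mu> 2" "h \<in> Lp \<mu> 2"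
  shows "L2_inner \<mu> (T (\<lambda>x. c * f x)) h = c * L2_inner \<mu> (T f) h"
proof -
  have "L2_inner \<mu> (T (\<lambda>x. c * f x)) h = L2_inner \<mu> (\<lambda>x. c * T f x) h"
    using T f by (intro L2_inner_cong_left) (auto simp: linear_op_def L2_scale intro!: L2_measurable)
  then show ?thesis by (simp add: L2_inner_scale_left)
qed

lemma L2_polarisation:
  assumes T: "linear_op \<mu> (Lp \<mu> 2) (Lp \<mu> 2) T" and f: "f \<in> Lp \<mu> 2" "g \<in> Lp \<mu> 2"
  shows "L2_inner \<mu> (T f) g =
    (\<Sum>c\<in>{1,-1,\<i>,-\<i>}. c * L2_inner \<mu> (T (\<lambda>x. f x + c * g x)) (\<lambda>x. f x + c * g x)) / 4"
proof -
  have "L2_inner \<mu> (T (\<lambda>x. f x + c * g x)) (\<lambda>x. f x + c * g x) =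
     L2_inner \<mu> (T f) f + cnj c * L2_inner \<mu> (T f) g + c * L2_inner \<mu> (T g) f
      + c * cnj c * L2_inner \<mu> (T g) g" for c
  proof -
    have cg: "(\<lambda>x. c * g x) \<in> Lp \<mu> 2" using f by (simp add: L2_scale)
    have *: "L2_inner \<mu> (T (\<lambda>x. f x + c * g x)) h = L2_inner \<mu> (T f) h + c * L2_inner \<mu> (T g) h" if "h \<in> Lp \<mu> 2" for h
      using L2_inner_linear_op_add[OF T f(1) cg that] L2_inner_linear_op_scale[OF T f(2) that] by simp
    have "L2_inner \<mu> (T (\<lambda>x. f x + c * g x)) (\<lambda>x. f x + c * g x) =
       L2_inner \<mu> (T (\<lambda>x. f x + c * g x)) f + cnj c * L2_inner \<mu> (T (\<lambda>x. f x + c * g x)) g"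
      using f cg T by (simp add: L2_inner_add_right L2_add L2_linear_op_in L2_inner_scale_right)
    then show ?thesis using f by (simp add: * algebra_simps)
  qed
  note expand = this
  show ?thesis unfolding expand by (simp add: algebra_simps complex_eq_iff)
qed

section \<open>Scalar measures, sesquilinear forms and operators of a multiplier\<close>

locale spectral_family =
  fixes \<mu> :: "'a measure" and E :: "real set \<Rightarrow> ('a \<Rightarrow> complex) \<Rightarrow> ('a \<Rightarrow> complex)"
  assumes E_linear: "A \<in> sets borel \<Longrightarrow> linear_op \<mu> (Lp \<mu> 2) (Lp \<mu> 2) (E A)"
    and E_sym: "A \<in> sets borel \<Longrightarrow> f \<in> Lp \<mu> 2 \<Longrightarrow> g \<in> Lp \<mu> 2 \<Longrightarrow> L2_inner \<mu> (E A f) g = L2_inner \<mu> f (E A g)"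
    and E_mult: "A \<in> sets borel \<Longrightarrow> B \<in> sets borel \<Longrightarrow> f \<in> Lp \<mu> 2 \<Longrightarrow> AE x in \<mu>. E A (E B f) x = E (A \<inter> B) f x"
    and E_sums: "range S \<subseteq> sets borel \<Longrightarrow> disjoint_family S \<Longrightarrow> f \<in> Lp \<mu> 2 \<Longrightarrow> g \<in> Lp \<mu> 2 \<Longrightarrow>
       (\<lambda>i::nat. L2_inner \<mu> (E (S i) f) g) sums L2_inner \<mu> (E (\<Union>i. S i) f) g"

lemma spectral_family_spectral_measure: "spectral_family \<mu> (spectral_measure \<mu> D L)"
proof (cases "\<exists>E. spectral_resolution \<mu> D L E")
  case True
  then have "spectral_resolution \<mu> D L (spectral_measure \<mu> D L)"
    unfolding spectral_measure_def if_P[OF True] by (rule someI_ex)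
  then have pvm: "projection_valued_measure \<mu> (spectral_measure \<mu> D L)"
    by (simp add: spectral_resolution_def)
  note [simp] = pvm[unfolded projection_valued_measure_def, THEN conjunct1, rule_format]
    pvm[unfolded projection_valued_measure_def, THEN conjunct2, THEN conjunct1, rule_format]
    pvm[unfolded projection_valued_measure_def, THEN conjunct2, THEN conjunct2, THEN conjunct1, rule_format]
  note sums = pvm[unfolded projection_valued_measure_def, THEN conjunct2, THEN conjunct2, THEN conjunct2,
      THEN conjunct2, rule_format]
  show ?thesis 
  proof
    fix S :: "nat \<Rightarrow> real set" and f g assume "range S \<subseteq> sets borel" "disjoint_family S" "f \<in> Lp \<mu> 2" "g \<in> Lp \<mu> 2"
    then show "(\<lambda>i::nat. L2_inner \<mu> (spectral_measure \<mu> D L (S i) f) g) sums L2_inner \<mu> (spectral_measure \<mu> D L (\<Union>i. S i) f) g"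
      by (rule sums)
  qed simp_all
next
  case False
  then have "spectral_measure \<mu> D L = (\<lambda>A f x. 0)" by (simp add: spectral_measure_def)
  then show ?thesis
    by unfold_locales (auto simp: linear_op_def L2_zero L2_inner_def)
qed

context spectral_family begin

abbreviation "nu f \<equiv> scalar_measure \<mu> E f"

lemma E_L2: "A \<in> sets borel \<Longrightarrow> f \<in> Lp \<mu> 2 \<Longrightarrow> E A f \<in> Lp \<mu> 2"
  using E_linear L2_linear_op_in by blast

lemma E_inner_E:
  assumes "A \<in> sets borel" "B \<in> sets borel" "f \<in> Lp \<mu> 2" "g \<in> Lp \<mu> 2"
  shows "L2_inner \<mu> (E A f) (E B g) = L2_inner \<mu> (E (A \<inter> B) f) g"
proof -
  have "L2_inner \<mu> (E A f) (E B g) = L2_inner \<mu> (E B (E A f)) g"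
    using assms by (simp add: E_sym E_L2)
  also have "\<dots> = L2_inner \<mu> (E (B \<inter> A) f) g"
    using assms E_mult[of B A f] by (intro L2_inner_cong_left L2_measurable E_L2) auto
  finally show ?thesis by (simp add: Int_commute)
qed

lemma E_inner_self: "A \<in> sets borel \<Longrightarrow> f \<in> Lp \<mu> 2 \<Longrightarrow>
    L2_inner \<mu> (E A f) f = complex_of_real ((Lp_norm \<mu> 2 (E A f))\<^sup>2)"
  using E_inner_E[of A A f f] L2_inner_self_norm[of "E A f" \<mu>] by (simp add: E_L2)

lemma E_norm_le: assumes "A \<in> sets borel" "f \<in> Lp \<mu> 2" shows "Lp_norm \<mu> 2 (E A f) \<le> Lp_norm \<mu> 2 f"
proof -
  have "(Lp_norm \<mu> 2 (E A f))\<^sup>2 = norm (L2_inner \<mu> (E A f) f)"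
    using assms by (simp add: E_inner_self norm_power)
  also have "\<dots> \<le> Lp_norm \<mu> 2 (E A f) * Lp_norm \<mu> 2 f"
    using assms by (intro L2_Cauchy_Schwarz E_L2)
  finally have *: "Lp_norm \<mu> 2 (E A f) * Lp_norm \<mu> 2 (E A f) \<le> Lp_norm \<mu> 2 (E A f) * Lp_norm \<mu> 2 f"
    by (simp add: power2_eq_square)
  show ?thesis
  proof (cases "Lp_norm \<mu> 2 (E A f) = 0")
    case True then show ?thesis by (simp add: Lp_norm_nonneg)
  next
    case False
    then have "Lp_norm \<mu> 2 (E A f) > 0" using Lp_norm_nonneg[of \<mu> 2 "E A f"] by simp
    with * show ?thesis by simp
  qed
qed

lemma E_empty: assumes "f \<in> Lp \<mu> 2" "g \<in> Lp \<mu> 2" shows "L2_inner \<mu> (E {} f) g = 0"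
proof -
  have "(\<lambda>i::nat. L2_inner \<mu> (E {} f) g) sums L2_inner \<mu> (E {} f) g"
    using E_sums[of "\<lambda>_. {}" f g] assms by (simp add: disjoint_family_on_def)
  then have "(\<lambda>i::nat. L2_inner \<mu> (E {} f) g) \<longlonglongrightarrow> 0" by (intro summable_LIMSEQ_zero sums_summable)
  then show ?thesis by (simp add: LIMSEQ_const_iff)
qed

lemma sets_nu[simp, measurable_cong]: "sets (nu f) = sets borel"
  using sets.sigma_sets_eq[of "borel :: real measure"] by (simp add: scalar_measure_def sets_measure_of)

lemma space_nu[simp]: "space (nu f) = UNIV"
  by (simp add: scalar_measure_def space_measure_of_conv)

text \<open>\<open>measure_of\<close> yields the zero measure unless the set function is positive
  and countably additive. Both hold, since <E(A) f, f> is the squared norm of E(A) f and the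
  pairings add up by \<open>E_sums\<close>.\<close>

lemma emeasure_nu:
  assumes f: "f \<in> Lp \<mu> 2" and A: "A \<in> sets borel"
  shows "emeasure (nu f) A = ennreal ((Lp_norm \<mu> 2 (E A f))\<^sup>2)"
proof -
  let ?m = "\<lambda>A. ennreal (Re (L2_inner \<mu> (E A f) f))"
  have ca: "countably_additive (sets borel) ?m"
  proof (rule countably_additiveI)
    fix A :: "nat \<Rightarrow> real set" assume A: "range A \<subseteq> sets borel" "disjoint_family A" "(\<Union>i. A i) \<in> sets borel"
    have "(\<lambda>i. Re (L2_inner \<mu> (E (A i) f) f)) sums Re (L2_inner \<mu> (E (\<Union>i. A i) f) f)"
      using E_sums[OF A(1,2) f f] by (rule sums_Re)
    moreover have "Re (L2_inner \<mu> (E (A i) f) f) \<ge> 0" for i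
      using A(1) f by (subst E_inner_self) auto
    ultimately show "(\<Sum>i. ?m (A i)) = ?m (\<Union> (range A))"
      by (intro suminf_ennreal_eq) auto
  qed
  have "emeasure (nu f) A = ?m A"
    unfolding scalar_measure_def
  proof (rule emeasure_measure_of_sigma[OF _ _ ca A])
    show "sigma_algebra (UNIV::real set) (sets borel)" using sets.sigma_algebra_axioms[of borel] by simp
    show "positive (sets borel) ?m" using f by (simp add: positive_def E_empty)
  qed
  then show ?thesis using f A by (simp add: E_inner_self)
qed

lemma finite_nu: "f \<in> Lp \<mu> 2 \<Longrightarrow> finite_measure (nu f)"
  by (rule finite_measureI) (simp add: emeasure_nu)

lemma measure_nu_le: "f \<in> Lp \<mu> 2 \<Longrightarrow> measure (nu f) UNIV \<le> (Lp_norm \<mu> 2 f)\<^sup>2"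
  using E_norm_le[of UNIV f] by (simp add: measure_def emeasure_nu power_mono Lp_norm_nonneg)

lemma integrable_nu: assumes "bounded_borel F" "f \<in> Lp \<mu> 2" shows "integrable (nu f) F"
proof -
  interpret finite_measure "nu f" by (rule finite_nu) fact
  from assms(1) obtain B where "\<And>u. norm (F u) \<le> B" by (meson bounded_borelD)
  then show ?thesis using bounded_borel_measurable[OF assms(1)]
    by (intro integrable_const_bound[of _ B]) auto
qed

text \<open>The polarised integral, which is <F(E) f, g> before any operator F(E) has been
  constructed. Linearity in F is immediate; linearity in f is not visible, because f enters through
  quadratic scalar measures, and is carried over from indicators.\<close>

definition form :: "(real \<Rightarrow> complex) \<Rightarrow> ('a \<Rightarrow> complex) \<Rightarrow> ('a \<Rightarrow> complex) \<Rightarrow> complex" where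
  "form F f g = (\<Sum>c\<in>{1,-1,\<i>,-\<i>}. c * (LINT u|nu (\<lambda>x. f x + c * g x). F u)) / 4"

lemma integral_nu_indicator:
  assumes "f \<in> Lp \<mu> 2" "A \<in> sets borel"
  shows "(LINT u|nu f. indicator A u) = L2_inner \<mu> (E A f) f"
proof -
  have "(LINT u|nu f. indicator A u :: complex) = complex_of_real (measure (nu f) A)"
  proof -
    have eq: "(\<lambda>u. indicator A u :: complex) = (\<lambda>u. complex_of_real (indicator A u))"
      by (auto simp: indicator_def)
    show ?thesis unfolding eq integral_complex_of_real by simp
  qed
  then show ?thesis using assms by (simp add: measure_def emeasure_nu E_inner_self)
qed

lemma form_indicator:
  assumes "f \<in> Lp \<mu> 2" "g \<in> Lp \<mu> 2" "A \<in> sets borel"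
  shows "form (indicator A) f g = L2_inner \<mu> (E A f) g"
  unfolding form_def using assms
  by (subst L2_polarisation[OF E_linear]) (auto simp: integral_nu_indicator L2_add L2_scale)

lemma form_add:
  assumes "f \<in> Lp \<mu> 2" "g \<in> Lp \<mu> 2" "bounded_borel F" "bounded_borel G"
  shows "form (\<lambda>u. F u + G u) f g = form F f g + form G f g"
proof -
  have "(LINT u|nu (\<lambda>x. f x + c * g x). F u + G u) =
      (LINT u|nu (\<lambda>x. f x + c * g x). F u) + (LINT u|nu (\<lambda>x. f x + c * g x). G u)" for c
    using assms by (intro Bochner_Integration.integral_add integrable_nu L2_add L2_scale)
  then show ?thesis by (simp only: form_def distrib_left sum.distrib add_divide_distrib)
qed

lemma form_scale: "form (\<lambda>u. c * F u) f g = c * form F f g"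
proof -
  have "(\<Sum>k\<in>S. k * (c * h k)) = c * (\<Sum>k\<in>S. k * h k)" for S and h :: "complex \<Rightarrow> complex"
    by (simp add: sum_distrib_left mult.left_commute)
  then show ?thesis unfolding form_def by (simp del: sum.insert)
qed

lemma form_lim:
  assumes f: "f \<in> Lp \<mu> 2" "g \<in> Lp \<mu> 2"
    and F: "\<And>n. bounded_borel (Fn n)" "\<And>n u. norm (Fn n u) \<le> B" "\<And>u. (\<lambda>n. Fn n u) \<longlonglongrightarrow> F u" "bounded_borel F"
  shows "(\<lambda>n. form (Fn n) f g) \<longlonglongrightarrow> form F f g"
  unfolding form_def
proof (intro tendsto_intros)
  fix c :: complex
  have h: "(\<lambda>x. f x + c * g x) \<in> Lp \<mu> 2" using f by (simp add: L2_add L2_scale)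
  interpret finite_measure "nu (\<lambda>x. f x + c * g x)" using finite_nu[OF h] .
  show "(\<lambda>n. LINT u|nu (\<lambda>x. f x + c * g x). Fn n u) \<longlonglongrightarrow> (LINT u|nu (\<lambda>x. f x + c * g x). F u)"
    by (rule integral_dominated_convergence[where w="\<lambda>_. B"])
      (use F bounded_borel_measurable in auto)
qed auto

lemma form_diag: assumes "f \<in> Lp \<mu> 2" "bounded_borel F" shows "form F f f = (LINT u|nu f. F u)"
  using assms(2)
proof (induction rule: bounded_borel_induct)
  case (indicator A) then show ?case using assms by (simp add: form_indicator integral_nu_indicator)
next
  case (scale c G) then show ?case by (simp add: form_scale)
next
  case (add G H) then show ?case using assms by (simp add: form_add integrable_nu)
next
  case (lim Gn G B)
  interpret finite_measure "nu f" using finite_nu[OF assms(1)] .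
  have "(\<lambda>n. LINT u|nu f. Gn n u) \<longlonglongrightarrow> (LINT u|nu f. G u)"
    by (rule integral_dominated_convergence[where w="\<lambda>_. B"])
      (use lim bounded_borel_measurable in auto)
  with form_lim[OF assms(1) assms(1) lim(1-4)] lim(5) show ?case
    by (simp add: LIMSEQ_unique)
qed

lemma form_add_left:
  assumes "bounded_borel F" and f: "f \<in> Lp \<mu> 2" "f' \<in> Lp \<mu> 2" "g \<in> Lp \<mu> 2"
  shows "form F (\<lambda>x. f x + f' x) g = form F f g + form F f' g"
  using assms(1)
proof (induction rule: bounded_borel_induct)
  case (indicator A) then show ?case
    using f by (simp add: form_indicator L2_add L2_inner_linear_op_add[OF E_linear])
next
  case (lim Gn G B)
  have "(\<lambda>n. form (Gn n) f g + form (Gn n) f' g) \<longlonglongrightarrow> form G f g + form G f' g"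
    using lim f by (intro tendsto_add form_lim) auto
  with form_lim[OF L2_add[OF f(1,2)] f(3) lim(1-4)] lim(5) show ?case
    by (simp add: LIMSEQ_unique)
qed (use f in \<open>auto simp: form_scale form_add L2_add algebra_simps\<close>)

lemma form_scale_left:
  assumes "bounded_borel F" and f: "f \<in> Lp \<mu> 2" "g \<in> Lp \<mu> 2"
  shows "form F (\<lambda>x. c * f x) g = c * form F f g"
  using assms(1)
proof (induction rule: bounded_borel_induct)
  case (indicator A) then show ?case
    using f by (simp add: form_indicator L2_scale L2_inner_linear_op_scale[OF E_linear])
next
  case (lim Gn G B)
  have "(\<lambda>n. c * form (Gn n) f g) \<longlonglongrightarrow> c * form G f g"
    using lim f by (intro tendsto_mult_left form_lim) auto
  with form_lim[OF L2_scale[OF f(1)] f(2) lim(1-4), of c] lim(5) show ?case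
    by (simp add: LIMSEQ_unique)
qed (use f in \<open>auto simp: form_scale form_add L2_scale algebra_simps\<close>)

lemma form_cnj:
  assumes "bounded_borel F" and f: "f \<in> Lp \<mu> 2" "g \<in> Lp \<mu> 2"
  shows "cnj (form F f g) = form (\<lambda>u. cnj (F u)) g f"
  using assms(1)
proof (induction rule: bounded_borel_induct)
  case (indicator A)
  have "(\<lambda>u. cnj (indicator A u)) = (indicator A :: real \<Rightarrow> complex)" by (auto simp: indicator_def)
  then show ?case using f indicator by (simp add: form_indicator L2_inner_cnj E_sym)
next
  case (lim Gn G B)
  have "(\<lambda>n. cnj (form (Gn n) f g)) \<longlonglongrightarrow> cnj (form G f g)"
    using lim f by (intro tendsto_cnj form_lim) auto
  moreover have "(\<lambda>n. form (\<lambda>u. cnj (Gn n u)) g f) \<longlonglongrightarrow> form (\<lambda>u. cnj (G u)) g f"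
    using lim f by (intro form_lim[where B=B] bounded_borel_cnj tendsto_cnj) auto
  ultimately show ?case using lim(5) by (simp add: LIMSEQ_unique)
qed (use f in \<open>auto simp: form_scale form_add bounded_borel_cnj\<close>)

text \<open>Moves a projection from the second argument into the symbol. On indicators this is the
  product rule for projections; it is the base case of \<open>represents_form\<close>.\<close>

lemma form_E_right:
  assumes "bounded_borel G" and f: "f \<in> Lp \<mu> 2" "g \<in> Lp \<mu> 2" and A: "A \<in> sets borel"
  shows "form G g (E A f) = form (\<lambda>u. indicator A u * G u) g f"
  using assms(1)
proof (induction rule: bounded_borel_induct)
  case (indicator B)
  have "(\<lambda>u. indicator A u * indicator B u) = (indicator (B \<inter> A) :: real \<Rightarrow> complex)"
    by (auto simp: indicator_def)
  then show ?case using f A indicator by (simp add: form_indicator E_L2 E_inner_E)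
next
  case (scale c G)
  have "(\<lambda>u. indicator A u * (c * G u)) = (\<lambda>u. c * (indicator A u * G u))" by auto
  then show ?case using scale f by (simp add: form_scale)
next
  case (add G H)
  then show ?case using f A
    by (simp add: form_add E_L2 distrib_left bounded_borel_mult bounded_borel_indicator)
next
  case (lim Gn G B)
  have "(\<lambda>n. form (\<lambda>u. indicator A u * Gn n u) g f) \<longlonglongrightarrow> form (\<lambda>u. indicator A u * G u) g f"
    using lim f A
    by (intro form_lim[where B=B] bounded_borel_mult bounded_borel_indicator tendsto_mult_left)
      (auto simp: indicator_def intro: order_trans[OF norm_ge_zero])
  with form_lim[OF f(2) E_L2[OF A f(1)] lim(1-4)] lim(5) show ?case
    by (simp add: LIMSEQ_unique)
qed

text \<open>h is a version of F(E) f. This is a relation because h is determined only up to null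
  sets, so different choices of an operator need not agree pointwise.\<close>

definition represents :: "(real \<Rightarrow> complex) \<Rightarrow> ('a \<Rightarrow> complex) \<Rightarrow> ('a \<Rightarrow> complex) \<Rightarrow> bool" where
  "represents F f h \<longleftrightarrow> h \<in> Lp \<mu> 2 \<and> (\<forall>g\<in>Lp \<mu> 2. L2_inner \<mu> h g = form F f g)"

text \<open>Multiplicativity in weak form: <F(E) f, G(E) g> = <(F cnj G)(E) f, g>. Only F varies in
  the induction; for an indicator the projection is moved onto f, where \<open>form_E_right\<close>
  applies.\<close>

lemma represents_form:
  assumes F: "bounded_borel F" and G: "bounded_borel G" and f: "f \<in> Lp \<mu> 2" "g \<in> Lp \<mu> 2" and k: "represents G g k"
  shows "form F f k = form (\<lambda>u. F u * cnj (G u)) f g"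
  using F
proof (induction rule: bounded_borel_induct)
  case (indicator A)
  have "form (indicator A) f k = cnj (L2_inner \<mu> k (E A f))"
    using f k indicator by (simp add: form_indicator represents_def L2_inner_cnj)
  also have "\<dots> = cnj (form (\<lambda>u. indicator A u * G u) g f)"
    using k f indicator G by (simp add: represents_def E_L2 form_E_right)
  also have "\<dots> = form (\<lambda>u. cnj (indicator A u * G u)) f g"
    using f indicator G by (intro form_cnj bounded_borel_mult bounded_borel_indicator)
  also have "(\<lambda>u. cnj (indicator A u * G u)) = (\<lambda>u. indicator A u * cnj (G u))"
    by (auto simp: indicator_def)
  finally show ?case .
next
  case (scale c H)
  then show ?case using f by (simp add: form_scale mult.assoc)
next
  case (add H K)
  have k2: "k \<in> Lp \<mu> 2" using k by (simp add: represents_def)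
  have "(\<lambda>u. (H u + K u) * cnj (G u)) = (\<lambda>u. H u * cnj (G u) + K u * cnj (G u))"
    by (simp add: distrib_right)
  then show ?case using add f G k2
    by (simp add: form_add bounded_borel_mult bounded_borel_cnj)
next
  case (lim Hn H B)
  have k2: "k \<in> Lp \<mu> 2" using k by (simp add: represents_def)
  from G obtain C where C: "C \<ge> 0" "\<And>u. norm (G u) \<le> C" by (meson bounded_borelD)
  have B: "B \<ge> 0" using lim(2)[of 0 0] norm_ge_zero order_trans by blast
  have "(\<lambda>n. form (\<lambda>u. Hn n u * cnj (G u)) f g) \<longlonglongrightarrow> form (\<lambda>u. H u * cnj (G u)) f g"
    using lim f G C B
    by (intro form_lim[where B="B * C"] bounded_borel_mult bounded_borel_cnj tendsto_mult_right)
      (auto simp: norm_mult intro!: mult_mono)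
  with form_lim[OF f(1) k2 lim(1-4)] lim(5) show ?case
    by (simp add: LIMSEQ_unique)
qed

lemma represents_norm:
  assumes "bounded_borel F" "f \<in> Lp \<mu> 2" "represents F f h"
  shows "complex_of_real (LINT x|\<mu>. (norm (h x))\<^sup>2) = (LINT u|nu f. complex_of_real ((norm (F u))\<^sup>2))"
proof -
  have "complex_of_real (LINT x|\<mu>. (norm (h x))\<^sup>2) = L2_inner \<mu> h h"
    using assms by (simp add: represents_def L2_inner_self)
  also have "\<dots> = form F f h" using assms by (simp add: represents_def)
  also have "\<dots> = form (\<lambda>u. F u * cnj (F u)) f f" using assms by (intro represents_form)
  also have "\<dots> = (LINT u|nu f. F u * cnj (F u))"
    using assms by (intro form_diag bounded_borel_mult bounded_borel_cnj)
  finally show ?thesis by (simp only: complex_norm_square)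
qed

lemma represents_norm_real:
  assumes "bounded_borel F" "f \<in> Lp \<mu> 2" "represents F f h"
  shows "(LINT x|\<mu>. (norm (h x))\<^sup>2) = (LINT u|nu f. (norm (F u))\<^sup>2)"
  using represents_norm[OF assms] by (simp only: integral_complex_of_real of_real_eq_iff)

lemma represents_diff:
  assumes "represents F f h" "represents G f k" "bounded_borel F" "bounded_borel G" "f \<in> Lp \<mu> 2"
  shows "represents (\<lambda>u. F u - G u) f (\<lambda>x. h x - k x)"
proof -
  have "form (\<lambda>u. F u + (-1) * G u) f g = form F f g + (-1) * form G f g" if "g \<in> Lp \<mu> 2" for g
    using assms that by (simp only: form_add form_scale bounded_borel_scale)
  then show ?thesis using assms by (simp add: represents_def L2_diff L2_inner_diff_left)
qed

text \<open>By \<open>represents_norm_real\<close> the passage from F to F(E) f preserves norms,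
  with the scalar measure of f on the side of the symbols. A bounded pointwise limit is Cauchy
  there, hence so are the images, and the limit given by \<open>Riesz_Fischer\<close> represents the
  limit symbol.\<close>

lemma represents_exists:
  assumes "bounded_borel F" and f: "f \<in> Lp \<mu> 2"
  shows "\<exists>h. represents F f h"
  using assms(1)
proof (induction rule: bounded_borel_induct)
  case (indicator A)
  then show ?case using f by (intro exI[of _ "E A f"]) (simp add: represents_def E_L2 form_indicator)
next
  case (scale c G)
  then obtain h where "represents G f h" by blast
  then show ?case
    by (intro exI[of _ "\<lambda>x. c * h x"]) (simp add: represents_def L2_scale form_scale L2_inner_scale_left)
next
  case (add G H)
  then obtain h k where "represents G f h" "represents H f k" by blast
  then show ?case using add f
    by (intro exI[of _ "\<lambda>x. h x + k x"]) (simp add: represents_def L2_add form_add L2_inner_add_left)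
next
  case (lim Gn G B)
  interpret finite_measure "nu f" using finite_nu[OF f] .
  obtain h where h: "\<And>n. represents (Gn n) f (h n)" using lim(5) by metis
  then have hL2: "h n \<in> Lp \<mu> 2" for n by (simp add: represents_def)
  have [measurable]: "h n \<in> borel_measurable \<mu>" for n using hL2 by (rule L2_measurable)
  have [measurable]: "Gn n \<in> borel_measurable borel" "G \<in> borel_measurable borel" for n
    using lim bounded_borel_measurable by auto
  have B0: "B \<ge> 0" using lim(2)[of 0 0] norm_ge_zero order_trans by blast
  have GB: "norm (G u) \<le> B" for u
    by (rule LIMSEQ_le_const2[OF tendsto_norm[OF lim(3)]]) (use lim(2) in auto)
  have "(\<lambda>n. LINT u|nu f. (norm (Gn n u - G u))\<^sup>2) \<longlonglongrightarrow> (LINT u|nu f. 0)"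
  proof (rule integral_dominated_convergence[where w="\<lambda>_. (2*B)\<^sup>2"])
    show "AE u in nu f. (\<lambda>n. (norm (Gn n u - G u))\<^sup>2) \<longlonglongrightarrow> 0"
    proof (rule AE_I2)
      fix u
      have "(\<lambda>n. (norm (Gn n u - G u))\<^sup>2) \<longlonglongrightarrow> (norm (G u - G u))\<^sup>2" by (intro tendsto_intros lim(3))
      then show "(\<lambda>n. (norm (Gn n u - G u))\<^sup>2) \<longlonglongrightarrow> 0" by simp
    qed
    show "AE u in nu f. norm ((norm (Gn n u - G u))\<^sup>2) \<le> (2*B)\<^sup>2" for n
    proof (rule AE_I2)
      fix u
      have "norm (Gn n u - G u) \<le> 2 * B"
        using norm_triangle_ineq4[of "Gn n u" "G u"] lim(2)[of n u] GB[of u] by linarith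
      then have "(norm (Gn n u - G u))\<^sup>2 \<le> (2*B)\<^sup>2" by (intro power_mono) auto
      then show "norm ((norm (Gn n u - G u))\<^sup>2) \<le> (2*B)\<^sup>2" by simp
    qed
  qed auto
  then have d0: "(\<lambda>n. LINT u|nu f. (norm (Gn n u - G u))\<^sup>2) \<longlonglongrightarrow> 0" by simp
  have bb: "bounded_borel (\<lambda>u. Gn n u - G u)" "bounded_borel (\<lambda>u. Gn n u - Gn m u)" for n m
    using lim by (auto intro: bounded_borel_diff)
  have int: "integrable (nu f) (\<lambda>u. (norm (H u))\<^sup>2)" if "bounded_borel H" for H
    using integrable_nu[OF bounded_borel_norm_square[OF that] f] by (simp only: complex_of_real_integrable_eq)
  have bound: "(LINT x|\<mu>. (norm (h m x - h n x))\<^sup>2) \<le>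
      2 * (LINT u|nu f. (norm (Gn m u - G u))\<^sup>2) + 2 * (LINT u|nu f. (norm (Gn n u - G u))\<^sup>2)" for m n
  proof -
    have "(LINT x|\<mu>. (norm (h m x - h n x))\<^sup>2) = (LINT u|nu f. (norm (Gn m u - Gn n u))\<^sup>2)"
      using lim f h bb by (intro represents_norm_real represents_diff)
    also have "\<dots> \<le> (LINT u|nu f. 2 * (norm (Gn m u - G u))\<^sup>2 + 2 * (norm (Gn n u - G u))\<^sup>2)"
    proof (rule integral_mono)
      fix u show "(norm (Gn m u - Gn n u))\<^sup>2 \<le> 2 * (norm (Gn m u - G u))\<^sup>2 + 2 * (norm (Gn n u - G u))\<^sup>2"
        using norm_add_power2_le[of "Gn m u - G u" "G u - Gn n u"] by (simp add: norm_minus_commute)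
    qed (use bb int in auto)
    finally show ?thesis using int[OF bb(1)] by simp
  qed
  have nn: "(\<integral>\<^sup>+x. ennreal (norm (h m x - h n x) ^ 2) \<partial>\<mu>) = ennreal (LINT x|\<mu>. (norm (h m x - h n x))\<^sup>2)" for m n
    using L2_diff[OF hL2 hL2, of m n] by (intro nn_integral_eq_integral) (auto simp: L2_iff)
  have "\<exists>N. \<forall>m\<ge>N. \<forall>n\<ge>N. (\<integral>\<^sup>+x. ennreal (norm (h m x - h n x) ^ 2) \<partial>\<mu>) \<le> ennreal e" if "e > 0" for e
  proof -
    have "\<forall>\<^sub>F n in sequentially. (LINT u|nu f. (norm (Gn n u - G u))\<^sup>2) < e / 4"
      using d0 that by (intro order_tendstoD) auto
    then obtain N where N: "\<And>n. n \<ge> N \<Longrightarrow> (LINT u|nu f. (norm (Gn n u - G u))\<^sup>2) < e / 4"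
      by (auto simp: eventually_sequentially)
    have "(LINT x|\<mu>. (norm (h m x - h n x))\<^sup>2) \<le> e" if "m \<ge> N" "n \<ge> N" for m n
      using bound[of m n] N[OF that(1)] N[OF that(2)] by linarith
    then show ?thesis unfolding nn by (intro exI[of _ N]) (auto intro: ennreal_leI)
  qed
  from Riesz_Fischer[of 2 h \<mu>, OF _ _ this] obtain k where
    k[measurable]: "k \<in> borel_measurable \<mu>" and kl: "(\<lambda>n. \<integral>\<^sup>+x. ennreal (norm (h n x - k x) ^ 2) \<partial>\<mu>) \<longlonglongrightarrow> 0"
    by auto
  have "\<forall>\<^sub>F n in sequentially. (\<integral>\<^sup>+x. ennreal (norm (h n x - k x) ^ 2) \<partial>\<mu>) < 1"
    using kl by (rule order_tendstoD) simp
  then obtain n0 where "(\<integral>\<^sup>+x. ennreal (norm (h n0 x - k x) ^ 2) \<partial>\<mu>) < 1"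
    by (auto simp: eventually_sequentially)
  \<comment> \<open>The limit is so far merely measurable; one index at finite distance from it puts
    it into the space.\<close>
  then have "(\<lambda>x. h n0 x - k x) \<in> Lp \<mu> 2"
    using less_trans[OF _ ennreal_one_less_top] by (auto simp: L2_iff integrable_iff_bounded)
  from L2_diff[OF hL2[of n0] this] have kL2: "k \<in> Lp \<mu> 2" by simp
  have nk: "(\<integral>\<^sup>+x. ennreal (norm (h n x - k x) ^ 2) \<partial>\<mu>) = ennreal ((Lp_norm \<mu> 2 (\<lambda>x. h n x - k x))\<^sup>2)" for n
    using L2_diff[OF hL2 kL2, of n] by (subst nn_integral_eq_integral) (auto simp: L2_iff Lp_norm_2)
  have "(\<lambda>n. (Lp_norm \<mu> 2 (\<lambda>x. h n x - k x))\<^sup>2) \<longlonglongrightarrow> 0"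
    using kl unfolding nk by (subst (asm) ennreal_tendsto_0_iff) auto
  from tendsto_real_sqrt[OF this] have nk0: "(\<lambda>n. Lp_norm \<mu> 2 (\<lambda>x. h n x - k x)) \<longlonglongrightarrow> 0"
    by (simp add: Lp_norm_nonneg)
  have "L2_inner \<mu> k g = form G f g" if g: "g \<in> Lp \<mu> 2" for g
  proof -
    have "(\<lambda>n. L2_inner \<mu> (h n) g - L2_inner \<mu> k g) \<longlonglongrightarrow> 0"
    proof (rule Lim_null_comparison)
      show "\<forall>\<^sub>F n in sequentially. norm (L2_inner \<mu> (h n) g - L2_inner \<mu> k g) \<le> Lp_norm \<mu> 2 (\<lambda>x. h n x - k x) * Lp_norm \<mu> 2 g"
        using L2_Cauchy_Schwarz[OF L2_diff[OF hL2 kL2] g] g hL2 kL2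
        by (intro always_eventually) (simp add: L2_inner_diff_left)
      show "(\<lambda>n. Lp_norm \<mu> 2 (\<lambda>x. h n x - k x) * Lp_norm \<mu> 2 g) \<longlonglongrightarrow> 0"
        using tendsto_mult_right[OF nk0, of "Lp_norm \<mu> 2 g"] by simp
    qed
    then have "(\<lambda>n. L2_inner \<mu> (h n) g) \<longlonglongrightarrow> L2_inner \<mu> k g" by (simp add: LIM_zero_iff)
    moreover have "(\<lambda>n. L2_inner \<mu> (h n) g) \<longlonglongrightarrow> form G f g"
      using form_lim[OF f g lim(1-4)] h g by (simp add: represents_def)
    ultimately show ?thesis by (rule LIMSEQ_unique)
  qed
  then show ?case using kL2 by (intro exI[of _ k]) (simp add: represents_def)
qed

definition op_of :: "(real \<Rightarrow> complex) \<Rightarrow> ('a \<Rightarrow> complex) \<Rightarrow> ('a \<Rightarrow> complex)" where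
  "op_of F f = (SOME h. represents F f h)"

lemma op_of_represents: "bounded_borel F \<Longrightarrow> f \<in> Lp \<mu> 2 \<Longrightarrow> represents F f (op_of F f)"
  unfolding op_of_def using represents_exists by (rule someI_ex)

lemma represents_norm_le:
  assumes "bounded_borel F" "f \<in> Lp \<mu> 2" "represents F f h" and B: "\<And>u. norm (F u) \<le> B"
  shows "Lp_norm \<mu> 2 h \<le> B * Lp_norm \<mu> 2 f"
proof -
  interpret finite_measure "nu f" using finite_nu[OF assms(2)] .
  have B0: "B \<ge> 0" using B[of 0] norm_ge_zero order_trans by blast
  have [measurable]: "F \<in> borel_measurable borel" using assms by (simp add: bounded_borel_def)
  have h: "h \<in> Lp \<mu> 2" using assms by (simp add: represents_def)
  have "(LINT x|\<mu>. (norm (h x))\<^sup>2) = (LINT u|nu f. (norm (F u))\<^sup>2)" using assms by (intro represents_norm_real)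
  also have "\<dots> \<le> (LINT u|nu f. B\<^sup>2)"
    by (intro integral_mono integrable_const_bound[of _ "B\<^sup>2"]) (auto intro!: power_mono B)
  also have "\<dots> = B\<^sup>2 * measure (nu f) UNIV" by simp
  also have "\<dots> \<le> B\<^sup>2 * (Lp_norm \<mu> 2 f)\<^sup>2" using measure_nu_le[OF assms(2)] by (intro mult_left_mono) auto
  finally have "(LINT x|\<mu>. (norm (h x))\<^sup>2) \<le> (B * Lp_norm \<mu> 2 f)\<^sup>2" by (simp add: power_mult_distrib)
  from real_sqrt_le_mono[OF this] show ?thesis using h B0 by (simp add: Lp_norm_2 Lp_norm_nonneg)
qed

lemma represents_cong_AE:
  assumes "represents F f h" "represents F f k" shows "AE x in \<mu>. h x = k x"
  using assms by (intro L2_AE_eqI) (auto simp: represents_def)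

text \<open>The scalar measures of almost everywhere equal functions are not compared directly.
  Moving the symbol onto g and representing it there turns the form into an inner product in the
  first argument.\<close>

lemma form_cong_AE:
  assumes F: "bounded_borel F" and f: "f \<in> Lp \<mu> 2" "f' \<in> Lp \<mu> 2" "g \<in> Lp \<mu> 2" "AE x in \<mu>. f x = f' x"
  shows "form F f g = form F f' g"
proof -
  obtain k where k: "represents (\<lambda>u. cnj (F u)) g k"
    using represents_exists[OF bounded_borel_cnj[OF F] f(3)] by blast
  have "form F h g = L2_inner \<mu> h k" if h: "h \<in> Lp \<mu> 2" for h
  proof -
    have "form F h g = cnj (form (\<lambda>u. cnj (F u)) g h)"
      using form_cnj[OF bounded_borel_cnj[OF F] f(3) h] by simp
    also have "\<dots> = L2_inner \<mu> h k" using k h by (simp add: represents_def L2_inner_cnj flip: L2_inner_cnj[of \<mu> k h])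
    finally show ?thesis .
  qed
  moreover have "L2_inner \<mu> f k = L2_inner \<mu> f' k"
    using f k by (intro L2_inner_cong_left L2_measurable) (auto simp: represents_def)
  ultimately show ?thesis using f by simp
qed

lemma linear_op_op_of: assumes F: "bounded_borel F" shows "linear_op \<mu> (Lp \<mu> 2) (Lp \<mu> 2) (op_of F)"
proof -
  have r: "op_of F f \<in> Lp \<mu> 2" "g \<in> Lp \<mu> 2 \<Longrightarrow> L2_inner \<mu> (op_of F f) g = form F f g" if "f \<in> Lp \<mu> 2" for f g
    using op_of_represents[OF F that] by (auto simp: represents_def)
  show ?thesis
    unfolding linear_op_def
  proof (intro conjI ballI impI allI)
    fix f g assume f: "f \<in> Lp \<mu> 2" "g \<in> Lp \<mu> 2"
    show "AE x in \<mu>. op_of F f x = op_of F g x" if "AE x in \<mu>. f x = g x"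
      using f that F by (intro L2_AE_eqI) (auto simp: r intro: form_cong_AE)
    show "AE x in \<mu>. op_of F (\<lambda>y. f y + g y) x = op_of F f x + op_of F g x"
      using f F by (intro L2_AE_eqI) (auto simp: r L2_add L2_inner_add_left form_add_left)
  next
    fix f c assume f: "f \<in> Lp \<mu> 2"
    show "op_of F f \<in> Lp \<mu> 2" using r f by simp
    show "AE x in \<mu>. op_of F (\<lambda>y. c * f y) x = c * op_of F f x"
      using f F by (intro L2_AE_eqI) (auto simp: r L2_scale L2_inner_scale_left form_scale_left)
  qed
qed

text \<open>Fubini for the parameter measure and each of the four scalar measures of the
  polarisation. These are finite, so the bound \<open>w v\<close> is integrable over the
  product.\<close>

lemma form_superposition:
  fixes G :: "'i \<Rightarrow> real \<Rightarrow> complex"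
  assumes N: "sigma_finite_measure N"
    and G[measurable]: "(\<lambda>(v,u). G v u) \<in> borel_measurable (N \<Otimes>\<^sub>M borel)"
    and w: "integrable N w" and Gw: "\<And>v u. v \<in> space N \<Longrightarrow> norm (G v u) \<le> w v"
    and F: "bounded_borel F" "\<And>u. F u = (LINT v|N. G v u)"
    and f: "f \<in> Lp \<mu> 2" "g \<in> Lp \<mu> 2"
  shows "integrable N (\<lambda>v. form (G v) f g)" "form F f g = (LINT v|N. form (G v) f g)"
proof -
  have *: "integrable N (\<lambda>v. LINT u|nu h. G v u) \<and> (LINT u|nu h. F u) = (LINT v|N. LINT u|nu h. G v u)"
    if h: "h \<in> Lp \<mu> 2" for h
  proof -
    interpret n: finite_measure "nu h" using finite_nu[OF h] .
    interpret N: sigma_finite_measure N by fact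
    interpret P: pair_sigma_finite N "nu h" ..
    have [measurable]: "(\<lambda>(v,u). G v u) \<in> borel_measurable (N \<Otimes>\<^sub>M nu h)"
      using G by (simp cong: measurable_cong_sets)
    have Gv[measurable]: "G v \<in> borel_measurable borel" if "v \<in> space N" for v
      using measurable_compose[OF measurable_Pair1'[OF that] G] by simp
    have Gi: "integrable (nu h) (G v)" if "v \<in> space N" for v
      using Gv[OF that] Gw[OF that] by (intro n.integrable_const_bound[of _ "w v"]) auto
    have "integrable (N \<Otimes>\<^sub>M nu h) (\<lambda>(v,u). G v u)"
    proof (rule P.Fubini_integrable)
      show "integrable N (\<lambda>v. LINT u|nu h. norm (case (v, u) of (v, u) \<Rightarrow> G v u))"
      proof (rule Bochner_Integration.integrable_bound[where f="\<lambda>v. w v * measure (nu h) UNIV"])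
        show "AE v in N. norm (LINT u|nu h. norm (case (v, u) of (v, u) \<Rightarrow> G v u)) \<le> norm (w v * measure (nu h) UNIV)"
        proof (rule AE_I2)
          fix v assume v: "v \<in> space N"
          have w0: "w v \<ge> 0" using Gw[OF v, of 0] norm_ge_zero order_trans by blast
          have "(LINT u|nu h. norm (G v u)) \<le> (LINT u|nu h. w v)"
            using v by (intro integral_mono integrable_norm Gi Gw) auto
          then show "norm (LINT u|nu h. norm (case (v, u) of (v, u) \<Rightarrow> G v u)) \<le> norm (w v * measure (nu h) UNIV)"
            using w0 by (simp add: mult.commute)
        qed
      qed (use w in \<open>auto intro!: n.borel_measurable_lebesgue_integral\<close>)
      show "AE v in N. integrable (nu h) (\<lambda>u. case (v, u) of (v, u) \<Rightarrow> G v u)" using Gi by (auto intro!: AE_I2)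
    qed measurable
    from P.integrable_fst'[OF this] P.Fubini_integral[OF this]
    show ?thesis by (simp add: F(2))
  qed
  have h: "(\<lambda>x. f x + c * g x) \<in> Lp \<mu> 2" for c using f by (simp add: L2_add L2_scale)
  show "integrable N (\<lambda>v. form (G v) f g)"
    unfolding form_def using *[OF h] by (auto intro!: integrable_divide integrable_sum integrable_mult_right)
  let ?S = "{1,-1,\<i>,-\<i>} :: complex set"
  let ?J = "\<lambda>c v. LINT u|nu (\<lambda>x. f x + c * g x). G v u"
  have I: "integrable N (\<lambda>v. c * ?J c v)" for c using *[OF h] by (intro integrable_mult_right) auto
  have "(LINT v|N. form (G v) f g) = (LINT v|N. (\<Sum>c\<in>?S. c * ?J c v)) / 4"
    by (simp only: form_def integral_divide_zero)
  also have "(LINT v|N. (\<Sum>c\<in>?S. c * ?J c v)) = (\<Sum>c\<in>?S. LINT v|N. c * ?J c v)"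
    by (rule Bochner_Integration.integral_sum) (rule I)
  also have "\<dots> = (\<Sum>c\<in>?S. c * (LINT v|N. ?J c v))" by (simp only: integral_mult_right_zero)
  also have "\<dots> = (\<Sum>c\<in>?S. c * (LINT u|nu (\<lambda>x. f x + c * g x). F u))"
    using *[OF h] by (intro sum.cong refl) (metis (no_types))
  finally show "form F f g = (LINT v|N. form (G v) f g)" by (simp only: form_def)
qed

text \<open>Boundedness on L^1 and on L^\<infinity>, expressed within L^2 so that no extension has
  to be chosen while symbols are superposed. Exchanging the arguments conjugates the symbol, hence
  both orders are recorded.\<close>

definition form_bounded :: "(real \<Rightarrow> complex) \<Rightarrow> real \<Rightarrow> bool" where
  "form_bounded F M \<longleftrightarrow> bounded_borel F \<and> (\<forall>f\<in>Lp \<mu> 2. \<forall>g\<in>Lp \<mu> 2. \<forall>B\<ge>0. integrable \<mu> f \<longrightarrow> (AE x in \<mu>. norm (g x) \<le> B) \<longrightarrow>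
     norm (form F f g) \<le> M * (LINT x|\<mu>. norm (f x)) * B \<and> norm (form F g f) \<le> M * (LINT x|\<mu>. norm (f x)) * B)"

text \<open>Minkowski's inequality for an integral of operators, in which only scalar forms are
  integrated.\<close>

lemma form_bounded_superposition:
  fixes G :: "'i \<Rightarrow> real \<Rightarrow> complex"
  assumes N: "sigma_finite_measure N"
    and G: "(\<lambda>(v,u). G v u) \<in> borel_measurable (N \<Otimes>\<^sub>M borel)"
    and w: "integrable N w" and Gw: "\<And>v u. v \<in> space N \<Longrightarrow> norm (G v u) \<le> w v"
    and F: "bounded_borel F" "\<And>u. F u = (LINT v|N. G v u)"
    and m: "integrable N m" and Gm: "\<And>v. v \<in> space N \<Longrightarrow> form_bounded (G v) (m v)"
  shows "form_bounded F (LINT v|N. m v)"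
  unfolding form_bounded_def
proof (intro conjI ballI allI impI)
  fix f g B assume f: "f \<in> Lp \<mu> 2" "g \<in> Lp \<mu> 2" and B: "0 \<le> (B::real)" "integrable \<mu> f" "AE x in \<mu>. norm (g x) \<le> B"
  have eq: "form F f g = (LINT v|N. form (G v) f g)"
    using form_superposition(2)[OF N G w Gw F f] .
  have "norm (form F f g) \<le> (LINT v|N. m v * (LINT x|\<mu>. norm (f x)) * B)"
    unfolding eq
  proof (rule order_trans[OF integral_norm_bound integral_mono])
    show "integrable N (\<lambda>v. norm (form (G v) f g))" using form_superposition(1)[OF N G w Gw F f] by (rule integrable_norm)
    show "norm (form (G v) f g) \<le> m v * (LINT x|\<mu>. norm (f x)) * B" if "v \<in> space N" for v
      using Gm[OF that] f B by (simp add: form_bounded_def)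
  qed (use m in simp)
  then show "norm (form F f g) \<le> (LINT v|N. m v) * (LINT x|\<mu>. norm (f x)) * B" by simp
  have eq: "form F g f = (LINT v|N. form (G v) g f)"
    using form_superposition(2)[OF N G w Gw F f(2,1)] .
  have "norm (form F g f) \<le> (LINT v|N. m v * (LINT x|\<mu>. norm (f x)) * B)"
    unfolding eq
  proof (rule order_trans[OF integral_norm_bound integral_mono])
    show "integrable N (\<lambda>v. norm (form (G v) g f))" using form_superposition(1)[OF N G w Gw F f(2,1)] by (rule integrable_norm)
    show "norm (form (G v) g f) \<le> m v * (LINT x|\<mu>. norm (f x)) * B" if "v \<in> space N" for v
      using Gm[OF that] f B by (simp add: form_bounded_def)
  qed (use m in simp)
  then show "norm (form F g f) \<le> (LINT v|N. m v) * (LINT x|\<mu>. norm (f x)) * B" by simp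
qed (rule F)

lemma form_bounded_scale: "form_bounded F M \<Longrightarrow> form_bounded (\<lambda>u. c * F u) (norm c * M)"
  by (auto simp: form_bounded_def bounded_borel_scale form_scale norm_mult mult.assoc intro!: mult_left_mono)

lemma form_bounded_mono:
  assumes "form_bounded F M" "M \<le> M'" shows "form_bounded F M'"
  unfolding form_bounded_def
proof (intro conjI ballI allI impI)
  fix f g B assume f: "f \<in> Lp \<mu> 2" "g \<in> Lp \<mu> 2" and B: "0 \<le> (B::real)" "integrable \<mu> f" "AE x in \<mu>. norm (g x) \<le> B"
  have "M * (LINT x|\<mu>. norm (f x)) * B \<le> M' * (LINT x|\<mu>. norm (f x)) * B"
    using assms(2) B by (intro mult_right_mono) auto
  then show "norm (form F f g) \<le> M' * (LINT x|\<mu>. norm (f x)) * B" "norm (form F g f) \<le> M' * (LINT x|\<mu>. norm (f x)) * B"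
    using assms(1) f B unfolding form_bounded_def by (blast intro: order_trans)+
qed (use assms in \<open>simp add: form_bounded_def\<close>)

end

text \<open>\<open>func_calc\<close> integrates over the half line only. Cutting there makes bounded
  Borel functions of symbols such as exp (- t u), which are unbounded on the negative axis.\<close>

definition half_line :: "(real \<Rightarrow> complex) \<Rightarrow> real \<Rightarrow> complex" where
  "half_line F u = (if 0 \<le> u then F u else 0)"

lemma half_line_mult: "half_line (\<lambda>u. F u * G u) = (\<lambda>u. half_line F u * half_line G u)"
  by (auto simp: half_line_def)

lemma bounded_borel_half_line:
  assumes "F \<in> borel_measurable borel" "\<And>u. u \<ge> 0 \<Longrightarrow> norm (F u) \<le> B" shows "bounded_borel (half_line F)"
proof -
  have "norm (half_line F u) \<le> B" for u
    using assms(2)[of u] assms(2)[of 0] norm_ge_zero[of "F 0"] by (auto simp: half_line_def simp del: norm_ge_zero)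
  moreover have "half_line F \<in> borel_measurable borel" using assms(1) unfolding half_line_def by measurable
  ultimately show ?thesis by (intro bounded_borelI)
qed

locale operator_calculus =
  fixes \<mu> :: "'a measure" and D :: "('a \<Rightarrow> complex) set" and L :: "('a \<Rightarrow> complex) \<Rightarrow> ('a \<Rightarrow> complex)"

sublocale operator_calculus \<subseteq> spectral_family \<mu> "spectral_measure \<mu> D L"
  by (rule spectral_family_spectral_measure)

context operator_calculus begin

abbreviation "fc \<equiv> func_calc \<mu> D L"

text \<open>The choice in \<open>func_calc\<close> is harmless: \<open>op_of\<close> shows that a
  candidate exists, and the quadratic form of any candidate fixes its sesquilinear form by
  polarisation.\<close>

lemma
  assumes F: "bounded_borel (half_line F)"
  shows fc_linear: "linear_op \<mu> (Lp \<mu> 2) (Lp \<mu> 2) (fc F)"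
    and fc_represents: "f \<in> Lp \<mu> 2 \<Longrightarrow> represents (half_line F) f (fc F f)"
proof -
  let ?P = "\<lambda>T. linear_op \<mu> (Lp \<mu> 2) (Lp \<mu> 2) T \<and>
     (\<exists>C. \<forall>f\<in>Lp \<mu> 2. Lp_norm \<mu> 2 (T f) \<le> C * Lp_norm \<mu> 2 f) \<and>
     (\<forall>f\<in>Lp \<mu> 2. L2_inner \<mu> (T f) f = (LINT u:{0..}|nu f. F u))"
  have eq: "(LINT u:{0..}|nu f. F u) = (LINT u|nu f. half_line F u)" for f
    unfolding set_lebesgue_integral_def
    by (rule Bochner_Integration.integral_cong) (auto simp: half_line_def indicator_def)
  from bounded_borelD[OF F] obtain B where B: "\<And>u. norm (half_line F u) \<le> B" by blast
  have "?P (op_of (half_line F))"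
  proof (intro conjI ballI)
    show "linear_op \<mu> (Lp \<mu> 2) (Lp \<mu> 2) (op_of (half_line F))" by (rule linear_op_op_of[OF F])
    show "\<exists>C. \<forall>f\<in>Lp \<mu> 2. Lp_norm \<mu> 2 (op_of (half_line F) f) \<le> C * Lp_norm \<mu> 2 f"
      using represents_norm_le[OF F _ op_of_represents[OF F] B] by blast
    fix f assume f: "f \<in> Lp \<mu> 2"
    show "L2_inner \<mu> (op_of (half_line F) f) f = (LINT u:{0..}|nu f. F u)"
      using op_of_represents[OF F f] f unfolding eq by (simp add: represents_def form_diag F)
  qed
  from someI[of ?P, OF this] have P: "?P (fc F)" unfolding func_calc_def .
  then show lin: "linear_op \<mu> (Lp \<mu> 2) (Lp \<mu> 2) (fc F)" by blast
  assume f: "f \<in> Lp \<mu> 2"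
  have "L2_inner \<mu> (fc F f) g = form (half_line F) f g" if "g \<in> Lp \<mu> 2" for g
  proof -
    have "L2_inner \<mu> (fc F (\<lambda>x. f x + c * g x)) (\<lambda>x. f x + c * g x) = (LINT u|nu (\<lambda>x. f x + c * g x). half_line F u)" for c
      using P L2_add[OF f L2_scale[OF that, of c]] unfolding eq by blast
    then show ?thesis unfolding L2_polarisation[OF lin f that] form_def by (simp only:)
  qed
  then show "represents (half_line F) f (fc F f)"
    using f lin by (simp add: represents_def L2_linear_op_in)
qed

lemma fc_inner: "bounded_borel (half_line F) \<Longrightarrow> f \<in> Lp \<mu> 2 \<Longrightarrow> g \<in> Lp \<mu> 2 \<Longrightarrow> L2_inner \<mu> (fc F f) g = form (half_line F) f g"
  using fc_represents by (simp add: represents_def)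

lemma fc_L2: "bounded_borel (half_line F) \<Longrightarrow> f \<in> Lp \<mu> 2 \<Longrightarrow> fc F f \<in> Lp \<mu> 2"
  using fc_represents by (simp add: represents_def)

lemma fc_norm_le:
  assumes "bounded_borel (half_line F)" "f \<in> Lp \<mu> 2" "\<And>u. u \<ge> 0 \<Longrightarrow> norm (F u) \<le> B"
  shows "Lp_norm \<mu> 2 (fc F f) \<le> B * Lp_norm \<mu> 2 f"
proof (rule represents_norm_le[OF assms(1,2) fc_represents[OF assms(1,2)]])
  show "norm (half_line F u) \<le> B" for u
    using assms(3)[of u] assms(3)[of 0] norm_ge_zero[of "F 0"] by (auto simp: half_line_def simp del: norm_ge_zero)
qed

text \<open>The outer symbol is conjugated onto the test function, so that
  \<open>represents_form\<close> can treat the inner operator as the represented one.\<close>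

lemma fc_mult:
  assumes F: "bounded_borel (half_line F)" and G: "bounded_borel (half_line G)" and f: "f \<in> Lp \<mu> 2"
  shows "represents (half_line (\<lambda>u. F u * G u)) f (fc F (fc G f))"
  unfolding represents_def
proof (intro conjI ballI)
  note Gf = fc_represents[OF G f]
  have Gf2: "fc G f \<in> Lp \<mu> 2" using fc_L2[OF G f] .
  show "fc F (fc G f) \<in> Lp \<mu> 2" by (rule fc_L2[OF F Gf2])
  fix g assume g: "g \<in> Lp \<mu> 2"
  have "L2_inner \<mu> (fc F (fc G f)) g = form (half_line F) (fc G f) g" by (rule fc_inner[OF F Gf2 g])
  also have "\<dots> = cnj (form (\<lambda>u. cnj (half_line F u)) g (fc G f))"
    using form_cnj[OF bounded_borel_cnj[OF F] g Gf2] by simp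
  also have "\<dots> = cnj (form (\<lambda>u. cnj (half_line F u) * cnj (half_line G u)) g f)"
    by (simp add: represents_form[OF bounded_borel_cnj[OF F] G g f Gf])
  also have "\<dots> = form (half_line (\<lambda>u. F u * G u)) f g"
    using form_cnj[OF bounded_borel_cnj[OF bounded_borel_mult[OF F G]] g f] by (simp add: half_line_mult)
  finally show "L2_inner \<mu> (fc F (fc G f)) g = form (half_line (\<lambda>u. F u * G u)) f g" .
qed

end

section \<open>Extension to Lebesgue spaces and interpolation\<close>

lemma linear_op_add: "linear_op \<mu> A B T \<Longrightarrow> f \<in> A \<Longrightarrow> g \<in> A \<Longrightarrow> AE x in \<mu>. T (\<lambda>y. f y + g y) x = T f x + T g x"
  by (simp add: linear_op_def)

lemma linear_op_scale: "linear_op \<mu> A B T \<Longrightarrow> f \<in> A \<Longrightarrow> AE x in \<mu>. T (\<lambda>y. c * f y) x = c * T f x"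
  by (simp add: linear_op_def)

lemma bounded_mult_integrable:
  fixes v g :: "'a \<Rightarrow> complex"
  assumes v: "integrable \<mu> v" and g[measurable]: "g \<in> borel_measurable \<mu>" and B: "B \<ge> 0" "AE x in \<mu>. norm (g x) \<le> B"
  shows "integrable \<mu> (\<lambda>x. v x * g x)" "norm (LINT x|\<mu>. v x * g x) \<le> B * (LINT x|\<mu>. norm (v x))"
proof -
  have [measurable]: "v \<in> borel_measurable \<mu>" using v by auto
  have le: "AE x in \<mu>. norm (v x * g x) \<le> B * norm (v x)"
    using B(2) by eventually_elim (simp add: norm_mult mult.commute mult_right_mono)
  have Bv: "integrable \<mu> (\<lambda>x. B * norm (v x))" using v by simp
  show i: "integrable \<mu> (\<lambda>x. v x * g x)"
  proof (rule Bochner_Integration.integrable_bound[OF Bv])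
    show "AE x in \<mu>. norm (v x * g x) \<le> norm (B * norm (v x))" using le by eventually_elim simp
  qed measurable
  have "norm (LINT x|\<mu>. v x * g x) \<le> (LINT x|\<mu>. norm (v x * g x))" by (rule integral_norm_bound)
  also have "\<dots> \<le> (LINT x|\<mu>. B * norm (v x))" by (rule integral_mono_AE[OF integrable_norm[OF i] Bv le])
  finally show "norm (LINT x|\<mu>. v x * g x) \<le> B * (LINT x|\<mu>. norm (v x))" by simp
qed

text \<open>Domination by a finite measure upgrades finite to countable additivity, because the
  tails have small measure. Adding K times the measure makes the set function nonnegative;
  Radon-Nikodym yields a density in [0, 2 K], from which K is subtracted. The lemma serves to
  represent functionals on L^1.\<close>

lemma dominated_additive_density:
  fixes \<nu> :: "'a set \<Rightarrow> real"
  assumes m: "finite_measure m"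
    and add: "\<And>A B. A \<in> sets m \<Longrightarrow> B \<in> sets m \<Longrightarrow> A \<inter> B = {} \<Longrightarrow> \<nu> (A \<union> B) = \<nu> A + \<nu> B"
    and dom: "\<And>A. A \<in> sets m \<Longrightarrow> \<bar>\<nu> A\<bar> \<le> K * measure m A"
    and K: "K \<ge> 0"
  shows "\<exists>k\<in>borel_measurable m. (\<forall>x. \<bar>k x\<bar> \<le> K) \<and> (\<forall>A\<in>sets m. \<nu> A = (LINT x|m. indicator A x * k x))"
proof -
  interpret finite_measure m by fact
  define \<rho> where "\<rho> A = \<nu> A + K * measure m A" for A
  have \<rho>0: "0 \<le> \<rho> A" and \<rho>2: "\<rho> A \<le> 2 * K * measure m A" if "A \<in> sets m" for A
    using dom[OF that] by (auto simp: \<rho>_def)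
  have empty: "\<nu> {} = 0" using add[of "{}" "{}"] by simp
  have fin_add: "\<nu> (\<Union>i<n. A i) = (\<Sum>i<n. \<nu> (A i))" if "range A \<subseteq> sets m" "disjoint_family A" for A and n :: nat
  proof (induction n)
    case (Suc n)
    have "(\<Union>i<n. A i) \<inter> A n = {}" 
    proof -
      have "A i \<inter> A n = {}" if "i < n" for i
        using \<open>disjoint_family A\<close> that by (simp add: disjoint_family_on_def)
      then show ?thesis by blast
    qed
    moreover have "(\<Union>i<n. A i) \<in> sets m" "A n \<in> sets m" using that(1) by auto
    moreover have "(\<Union>i<Suc n. A i) = (\<Union>i<n. A i) \<union> A n" by (auto simp: less_Suc_eq)
    ultimately show ?case using Suc add by simp
  qed (simp add: empty)
  have sums: "(\<lambda>i. \<nu> (A i)) sums \<nu> (\<Union>i. A i)" if A: "range A \<subseteq> sets m" "disjoint_family A" for A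
  proof -
    have ms: "(\<lambda>i. measure m (A i)) sums measure m (\<Union>i. A i)"
      using A by (intro finite_measure_UNION)
    have fm: "measure m (\<Union>i<n. A i) = (\<Sum>i<n. measure m (A i))" for n
      using A by (intro finite_measure_finite_Union) (auto simp: disjoint_family_on_def)
    have split: "\<nu> (\<Union>i. A i) - (\<Sum>i<n. \<nu> (A i)) = \<nu> ((\<Union>i. A i) - (\<Union>i<n. A i))" for n
    proof -
      have "(\<Union>i<n. A i) \<union> ((\<Union>i. A i) - (\<Union>i<n. A i)) = (\<Union>i. A i)" by auto
      then have "\<nu> (\<Union>i. A i) = \<nu> (\<Union>i<n. A i) + \<nu> ((\<Union>i. A i) - (\<Union>i<n. A i))"
        using A(1) add[of "\<Union>i<n. A i" "(\<Union>i. A i) - (\<Union>i<n. A i)"] by auto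
      then show ?thesis using fin_add[OF A] by simp
    qed
    have "(\<lambda>n. \<nu> (\<Union>i. A i) - (\<Sum>i<n. \<nu> (A i))) \<longlonglongrightarrow> 0"
    proof (rule Lim_null_comparison)
      show "\<forall>\<^sub>F n in sequentially. norm (\<nu> (\<Union>i. A i) - (\<Sum>i<n. \<nu> (A i))) \<le> K * (measure m (\<Union>i. A i) - (\<Sum>i<n. measure m (A i)))"
      proof (intro always_eventually allI)
        fix n
        have "measure m ((\<Union>i. A i) - (\<Union>i<n. A i)) = measure m (\<Union>i. A i) - (\<Sum>i<n. measure m (A i))"
          unfolding fm[symmetric] using A(1) by (intro finite_measure_Diff) auto
        then show "norm (\<nu> (\<Union>i. A i) - (\<Sum>i<n. \<nu> (A i))) \<le> K * (measure m (\<Union>i. A i) - (\<Sum>i<n. measure m (A i)))"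
          unfolding split using dom[of "(\<Union>i. A i) - (\<Union>i<n. A i)"] A(1) by auto
      qed
      have "(\<lambda>n. K * (measure m (\<Union>i. A i) - (\<Sum>i<n. measure m (A i)))) \<longlonglongrightarrow> K * (measure m (\<Union>i. A i) - measure m (\<Union>i. A i))"
        using ms unfolding sums_def by (intro tendsto_intros)
      then show "(\<lambda>n. K * (measure m (\<Union>i. A i) - (\<Sum>i<n. measure m (A i)))) \<longlonglongrightarrow> 0" by simp
    qed
    then have "(\<lambda>n. \<nu> (\<Union>i. A i) - (\<nu> (\<Union>i. A i) - (\<Sum>i<n. \<nu> (A i)))) \<longlonglongrightarrow> \<nu> (\<Union>i. A i) - 0" by (intro tendsto_diff) auto
    then show ?thesis by (simp add: sums_def)
  qed
  have \<rho>sums: "(\<lambda>i. \<rho> (A i)) sums \<rho> (\<Union>i. A i)" if A: "range A \<subseteq> sets m" "disjoint_family A" for A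
    unfolding \<rho>_def using A by (intro sums_add sums sums_mult finite_measure_UNION)
  define N where "N = measure_of (space m) (sets m) (\<lambda>A. ennreal (\<rho> A))"
  have setsN: "sets N = sets m" by (simp add: N_def sets_measure_of_conv sets.space_closed sets.sigma_sets_eq)
  have emN: "emeasure N A = ennreal (\<rho> A)" if "A \<in> sets m" for A
    unfolding N_def
  proof (rule emeasure_measure_of_sigma[OF _ _ _ that])
    show "sigma_algebra (space m) (sets m)" by (rule sets.sigma_algebra_axioms)
    show "positive (sets m) (\<lambda>A. ennreal (\<rho> A))" by (simp add: positive_def \<rho>_def empty)
    show "countably_additive (sets m) (\<lambda>A. ennreal (\<rho> A))"
    proof (rule countably_additiveI)
      fix A :: "nat \<Rightarrow> 'a set" assume "range A \<subseteq> sets m" "disjoint_family A"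
      then show "(\<Sum>i. ennreal (\<rho> (A i))) = ennreal (\<rho> (\<Union> (range A)))"
        by (intro suminf_ennreal_eq \<rho>sums \<rho>0) auto
    qed
  qed
  have "absolutely_continuous m N"
    unfolding absolutely_continuous_def
  proof
    fix A assume A: "A \<in> null_sets m"
    then have "measure m A = 0" by (simp add: null_sets_def measure_def)
    then have "\<rho> A = 0" using \<rho>0[of A] \<rho>2[of A] A by auto
    then show "A \<in> null_sets N" using A emN[of A] setsN by (auto simp: null_sets_def)
  qed
  from Radon_Nikodym[OF this setsN] obtain \<phi> where \<phi>[measurable]: "\<phi> \<in> borel_measurable m" and N: "density m \<phi> = N" by blast
  have \<phi>A: "(\<integral>\<^sup>+x. \<phi> x * indicator A x \<partial>m) = ennreal (\<rho> A)" if "A \<in> sets m" for A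
    using emeasure_density[OF \<phi> that] emN[OF that] N by simp
  have "AE x in m. \<phi> x \<le> ennreal (2 * K)"
  proof -
    let ?A = "{x\<in>space m. \<phi> x > ennreal (2 * K)}"
    have [measurable]: "?A \<in> sets m" by measurable
    have eqK: "(\<integral>\<^sup>+x. ennreal (2 * K) * indicator ?A x \<partial>m) = ennreal (2 * K * measure m ?A)"
      using K by (simp add: nn_integral_cmult_indicator emeasure_eq_measure ennreal_mult)
    have "ennreal (\<rho> ?A) \<le> ennreal (2 * K * measure m ?A)" using \<rho>2[of ?A] by (intro ennreal_leI) simp
    then have le: "(\<integral>\<^sup>+x. \<phi> x * indicator ?A x \<partial>m) \<le> (\<integral>\<^sup>+x. ennreal (2 * K) * indicator ?A x \<partial>m)"
      unfolding eqK using \<phi>A[of ?A] by simp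
    have "(\<integral>\<^sup>+x. (\<phi> x - ennreal (2 * K)) * indicator ?A x \<partial>m) = (\<integral>\<^sup>+x. \<phi> x * indicator ?A x - ennreal (2 * K) * indicator ?A x \<partial>m)"
      by (intro nn_integral_cong) (auto simp: indicator_def)
    also have "\<dots> = (\<integral>\<^sup>+x. \<phi> x * indicator ?A x \<partial>m) - (\<integral>\<^sup>+x. ennreal (2 * K) * indicator ?A x \<partial>m)"
    proof (rule nn_integral_diff)
      show "(\<integral>\<^sup>+x. ennreal (2 * K) * indicator ?A x \<partial>m) \<noteq> \<infinity>" unfolding eqK by simp
      show "AE x in m. ennreal (2 * K) * indicator ?A x \<le> \<phi> x * indicator ?A x"
        by (auto simp: indicator_def)
    qed auto
    also have "\<dots> = 0" using le by (simp add: diff_eq_0_ennreal less_top[symmetric] \<phi>A)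
    finally have "AE x in m. (\<phi> x - ennreal (2 * K)) * indicator ?A x = 0"
      by (subst (asm) nn_integral_0_iff_AE) auto
    then show ?thesis using AE_space
    proof eventually_elim
      case (elim x)
      show ?case
      proof (rule ccontr)
        assume "\<not> \<phi> x \<le> ennreal (2 * K)"
        then have "\<phi> x > ennreal (2 * K)" by simp
        moreover from this have "\<phi> x - ennreal (2 * K) = 0" using elim by (simp add: indicator_def)
        ultimately show False using diff_gr0_ennreal[of "ennreal (2 * K)" "\<phi> x"] by simp
      qed
    qed
  qed
  then have bnd: "AE x in m. \<phi> x \<le> ennreal (2 * K)" .
  \<comment> \<open>Clamping makes the bound hold at every point; by \<open>bnd\<close> it alters
    the shifted density only on a null set.\<close>
  define k where "k x = max (-K) (min K (enn2real (\<phi> x) - K))" for x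
  have [measurable]: "k \<in> borel_measurable m" unfolding k_def by measurable
  have kb: "\<bar>k x\<bar> \<le> K" for x using K enn2real_nonneg[of "\<phi> x"] by (simp add: k_def abs_le_iff min_def max_def)
  have keq: "AE x in m. \<phi> x = ennreal (k x + K) \<and> k x + K \<ge> 0"
    using bnd
  proof eventually_elim
    case (elim x)
    then obtain c where c: "\<phi> x = ennreal c" "c \<ge> 0" by (cases "\<phi> x") (auto simp: top_unique)
    with elim K have "c \<le> 2 * K" by (simp add: ennreal_le_iff)
    then show ?case using c by (auto simp: k_def)
  qed
  have ki: "integrable m (\<lambda>x. indicator A x * k x)" if "A \<in> sets m" for A
    using that kb K by (intro integrable_const_bound[of _ K]) (auto simp: indicator_def)
  have "\<nu> A = (LINT x|m. indicator A x * k x)" if A: "A \<in> sets m" for A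
  proof -
    have i2: "integrable m (\<lambda>x. indicator A x * K)" using A by (intro integrable_const_bound[of _ K]) (auto simp: indicator_def K)
    have "ennreal (\<rho> A) = (\<integral>\<^sup>+x. ennreal (indicator A x * k x + indicator A x * K) \<partial>m)"
      unfolding \<phi>A[OF A, symmetric]
      by (rule nn_integral_cong_AE, use keq in eventually_elim) (auto simp: indicator_def)
    also have "\<dots> = ennreal (LINT x|m. indicator A x * k x + indicator A x * K)"
    proof (rule nn_integral_eq_integral)
      show "integrable m (\<lambda>x. indicator A x * k x + indicator A x * K)" using ki[OF A] i2 by simp
      show "AE x in m. 0 \<le> indicator A x * k x + indicator A x * K"
        using keq by eventually_elim (auto simp: indicator_def)
    qed
    also have "(LINT x|m. indicator A x * k x + indicator A x * K) = (LINT x|m. indicator A x * k x) + measure m A * K"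
      using ki[OF A] i2 A by simp
    finally have "\<rho> A = (LINT x|m. indicator A x * k x) + measure m A * K"
    proof (rule ennreal_inj[THEN iffD1, rotated -1])
      have "\<bar>LINT x|m. indicator A x * k x\<bar> \<le> (LINT x|m. indicator A x * K)"
        using kb K ki[OF A] i2
        by (intro order_trans[OF integral_abs_bound integral_mono]) (auto simp: indicator_def)
      then show "0 \<le> (LINT x|m. indicator A x * k x) + measure m A * K" using A by simp
    qed (rule \<rho>0[OF A])
    then show ?thesis by (simp add: \<rho>_def)
  qed
  then show ?thesis using kb by (intro bexI[of _ k]) auto
qed

text \<open>The space L^1 \<inter> L^\<infinity>, which lies in L^2: the operators act on it and
  keep both bounds, so functions in L^1 + L^\<infinity> can be paired with it and with its
  images.\<close>

definition test_fun :: "'a measure \<Rightarrow> ('a \<Rightarrow> complex) \<Rightarrow> bool" where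
  "test_fun \<mu> g \<longleftrightarrow> integrable \<mu> g \<and> (\<exists>B\<ge>0. AE x in \<mu>. norm (g x) \<le> B)"

lemma test_fun_L2: assumes "test_fun \<mu> g" shows "g \<in> Lp \<mu> 2"
proof -
  from assms obtain B where B: "integrable \<mu> g" "B \<ge> 0" "AE x in \<mu>. norm (g x) \<le> B" by (auto simp: test_fun_def)
  have "integrable \<mu> (\<lambda>x. (norm (g x))\<^sup>2)"
    by (rule Bochner_Integration.integrable_bound[where f="\<lambda>x. B * norm (g x)"])
      (use B in \<open>auto simp: power2_eq_square intro!: mult_right_mono elim!: eventually_mono\<close>)
  then show ?thesis using B by (auto simp: L2_iff)
qed

lemma test_fun_phase:
  assumes "h \<in> borel_measurable \<mu>" "A \<in> sets \<mu>" "emeasure \<mu> A < \<infinity>"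
  shows "test_fun \<mu> (\<lambda>x. indicator A x * sgn (h x))"
  unfolding test_fun_def
proof (intro conjI exI[of _ 1])
  show "integrable \<mu> (\<lambda>x. indicator A x * sgn (h x))"
    by (rule Bochner_Integration.integrable_bound[where f="indicator A :: _ \<Rightarrow> real"])
      (use assms in \<open>auto simp: indicator_def norm_sgn\<close>)
qed (auto simp: indicator_def norm_sgn)

lemma mult_cnj_sgn: "z * cnj (sgn z) = complex_of_real (norm z)"
proof (cases "z = 0")
  case False
  have "z * cnj (sgn z) = (z * cnj z) / complex_of_real (norm z)"
    by (simp add: sgn_div_norm scaleR_conv_of_real divide_inverse mult_ac)
  also have "\<dots> = complex_of_real ((norm z)\<^sup>2) / complex_of_real (norm z)"
    by (simp only: complex_norm_square)
  also have "\<dots> = complex_of_real (norm z)" using False by (simp add: power2_eq_square)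
  finally show ?thesis .
qed simp

text \<open>h is T f in the weak sense, with T moved onto the test function as its adjoint
  \<open>T'\<close>; this makes sense for f outside L^2. Integrability is part of the definition
  because the integral of a nonintegrable function is 0 by convention.\<close>

definition weak_image :: "'a measure \<Rightarrow> (('a \<Rightarrow> complex) \<Rightarrow> ('a \<Rightarrow> complex)) \<Rightarrow> ('a \<Rightarrow> complex) \<Rightarrow> ('a \<Rightarrow> complex) \<Rightarrow> bool" where
  "weak_image \<mu> T' f h \<longleftrightarrow> h \<in> borel_measurable \<mu> \<and>
     (\<forall>g. test_fun \<mu> g \<longrightarrow> integrable \<mu> (\<lambda>x. h x * cnj (g x)) \<and> integrable \<mu> (\<lambda>x. f x * cnj (T' g x)) \<and>
        (LINT x|\<mu>. h x * cnj (g x)) = (LINT x|\<mu>. f x * cnj (T' g x)))"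

section \<open>Extension from L^2 by duality with test functions\<close>

locale form_bounded_pair = sigma_finite_measure \<mu> for \<mu> :: "'a measure" +
  fixes T T' :: "('a \<Rightarrow> complex) \<Rightarrow> ('a \<Rightarrow> complex)" and M :: real
  assumes M: "M \<ge> 0"
    and T: "linear_op \<mu> (Lp \<mu> 2) (Lp \<mu> 2) T" and T': "linear_op \<mu> (Lp \<mu> 2) (Lp \<mu> 2) T'"
    and adj: "f \<in> Lp \<mu> 2 \<Longrightarrow> g \<in> Lp \<mu> 2 \<Longrightarrow> L2_inner \<mu> (T f) g = L2_inner \<mu> f (T' g)"
    and bound: "f \<in> Lp \<mu> 2 \<Longrightarrow> g \<in> Lp \<mu> 2 \<Longrightarrow> integrable \<mu> f \<Longrightarrow> 0 \<le> B \<Longrightarrow> AE x in \<mu>. norm (g x) \<le> B \<Longrightarrow>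
      norm (L2_inner \<mu> (T f) g) \<le> M * (LINT x|\<mu>. norm (f x)) * B \<and>
      norm (L2_inner \<mu> (T g) f) \<le> M * (LINT x|\<mu>. norm (f x)) * B"
begin

lemma T_L2: "f \<in> Lp \<mu> 2 \<Longrightarrow> T f \<in> Lp \<mu> 2" using T by (simp add: linear_op_def)
lemma T'_L2: "f \<in> Lp \<mu> 2 \<Longrightarrow> T' f \<in> Lp \<mu> 2" using T' by (simp add: linear_op_def)

text \<open>Every result on T then holds for its adjoint too: images of integrable functions rely on
  the sup bound of \<open>T'\<close>, images of bounded functions on the L^1 extension of
  \<open>T'\<close>.\<close>

lemma form_bounded_pair_swap: "form_bounded_pair \<mu> T' T M"
proof (unfold_locales, rule M, rule T', rule T)
  fix f g assume f: "f \<in> Lp \<mu> 2" "g \<in> Lp \<mu> 2"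
  show adj': "L2_inner \<mu> (T' f) g = L2_inner \<mu> f (T g)"
    using adj[OF f(2,1)] L2_inner_cnj by metis
next
  fix f g B assume f: "f \<in> Lp \<mu> 2" "g \<in> Lp \<mu> 2" "integrable \<mu> f" "0 \<le> B" "AE x in \<mu>. norm (g x) \<le> B"
  have "norm (L2_inner \<mu> (T' f) g) = norm (L2_inner \<mu> (T g) f)" "norm (L2_inner \<mu> (T' g) f) = norm (L2_inner \<mu> (T f) g)"
    using adj[OF f(2,1)] adj[OF f(1,2)] L2_inner_cnj complex_mod_cnj by metis+
  then show "norm (L2_inner \<mu> (T' f) g) \<le> M * (LINT x|\<mu>. norm (f x)) * B \<and>
      norm (L2_inner \<mu> (T' g) f) \<le> M * (LINT x|\<mu>. norm (f x)) * B"
    using bound[OF f] by simp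
qed

text \<open>Testing with the phase of h on a set of finite measure where |h| > K makes the integral
  of |h| - K over that set both nonnegative and nonpositive.\<close>

lemma AE_bound_of_tests:
  assumes h[measurable]: "h \<in> borel_measurable \<mu>" and K: "K \<ge> 0"
    and b: "\<And>g. test_fun \<mu> g \<Longrightarrow> integrable \<mu> (\<lambda>x. h x * cnj (g x)) \<and> norm (LINT x|\<mu>. h x * cnj (g x)) \<le> K * (LINT x|\<mu>. norm (g x))"
  shows "AE x in \<mu>. norm (h x) \<le> K"
proof -
  obtain A :: "nat \<Rightarrow> 'a set" where A: "range A \<subseteq> sets \<mu>" "(\<Union>i. A i) = space \<mu>" "\<And>i. emeasure \<mu> (A i) \<noteq> \<infinity>"
    using sigma_finite_incseq by metis
  have "AE x in \<mu>. x \<in> A n \<longrightarrow> norm (h x) \<le> K" for n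
  proof -
    let ?S = "A n \<inter> {x\<in>space \<mu>. norm (h x) > K}"
    have An[measurable]: "A n \<in> sets \<mu>" using A by auto
    have S[measurable]: "?S \<in> sets \<mu>" by measurable
    have Sf: "emeasure \<mu> ?S < \<infinity>"
      using A(3)[of n] emeasure_mono[of ?S "A n" \<mu>] An by (auto simp: less_top[symmetric] top_unique)
    let ?g = "\<lambda>x. indicator ?S x * sgn (h x)"
    have g: "test_fun \<mu> ?g" using h S Sf by (rule test_fun_phase)
    have hg: "h x * cnj (?g x) = complex_of_real (indicator ?S x * norm (h x))" for x
      using mult_cnj_sgn[of "h x"] by (simp add: indicator_def)
    have ng: "norm (?g x) = indicator ?S x" for x using K by (auto simp: indicator_def norm_sgn)
    have i1: "integrable \<mu> (\<lambda>x. indicator ?S x * norm (h x))"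
      using b[OF g] unfolding hg complex_of_real_integrable_eq by blast
    have i2: "integrable \<mu> (\<lambda>x. indicator ?S x * K)" using S Sf by (simp add: integrable_real_indicator)
    have nn: "0 \<le> (LINT x|\<mu>. indicator ?S x * norm (h x))" by (intro integral_nonneg_AE) auto
    have "(LINT x|\<mu>. indicator ?S x * norm (h x)) \<le> K * (LINT x|\<mu>. indicator ?S x)"
      using b[OF g] nn unfolding hg ng integral_complex_of_real by simp
    then have "(LINT x|\<mu>. indicator ?S x * norm (h x) - indicator ?S x * K) \<le> 0"
      using i1 i2 by (simp add: mult.commute)
    moreover have n0: "AE x in \<mu>. 0 \<le> indicator ?S x * norm (h x) - indicator ?S x * K" by (auto simp: indicator_def)
    ultimately have "(LINT x|\<mu>. indicator ?S x * norm (h x) - indicator ?S x * K) = 0"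
      using integral_nonneg_AE[OF n0] by simp
    then have "AE x in \<mu>. indicator ?S x * norm (h x) - indicator ?S x * K = 0"
      using i1 i2 n0 by (subst (asm) integral_nonneg_eq_0_iff_AE) auto
    then show ?thesis using AE_space by eventually_elim (auto simp: indicator_def split: if_splits)
  qed
  then have "AE x in \<mu>. \<forall>n. x \<in> A n \<longrightarrow> norm (h x) \<le> K" by (subst AE_all_countable) simp
  then show ?thesis using AE_space by eventually_elim (use A(2) in blast)
qed

text \<open>The tests are the phase of h on sets of finite measure that exhaust the space; monotone
  convergence then gives integrability and bound together.\<close>

lemma L1_bound_of_tests:
  assumes h[measurable]: "h \<in> borel_measurable \<mu>"
    and b: "\<And>g. test_fun \<mu> g \<Longrightarrow> (\<And>x. norm (g x) \<le> 1) \<Longrightarrow> integrable \<mu> (\<lambda>x. h x * cnj (g x)) \<and> norm (LINT x|\<mu>. h x * cnj (g x)) \<le> K"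
  shows "integrable \<mu> h" "(LINT x|\<mu>. norm (h x)) \<le> K"
proof -
  obtain A :: "nat \<Rightarrow> 'a set" where A: "range A \<subseteq> sets \<mu>" "(\<Union>i. A i) = space \<mu>" "\<And>i. emeasure \<mu> (A i) \<noteq> \<infinity>" "incseq A"
    using sigma_finite_incseq by metis
  have An[measurable]: "A n \<in> sets \<mu>" for n using A by auto
  have K0: "K \<ge> 0" using b[of "\<lambda>_. 0"] by (auto simp: test_fun_def)
  have n: "(\<integral>\<^sup>+x. ennreal (indicator (A n) x * norm (h x)) \<partial>\<mu>) \<le> ennreal K" for n
  proof -
    let ?g = "\<lambda>x. indicator (A n) x * sgn (h x)"
    have g: "test_fun \<mu> ?g" using h An A(3)[of n] by (intro test_fun_phase) (auto simp: less_top)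
    have g1: "norm (?g x) \<le> 1" for x by (auto simp: indicator_def norm_sgn)
    have hg: "h x * cnj (?g x) = complex_of_real (indicator (A n) x * norm (h x))" for x
      using mult_cnj_sgn[of "h x"] by (simp add: indicator_def)
    have i1: "integrable \<mu> (\<lambda>x. indicator (A n) x * norm (h x))"
      using b[OF g g1] unfolding hg complex_of_real_integrable_eq by blast
    have "(LINT x|\<mu>. indicator (A n) x * norm (h x)) \<le> K"
      using b[OF g g1] unfolding hg integral_complex_of_real by simp
    then show ?thesis using i1 by (subst nn_integral_eq_integral) (auto intro: ennreal_leI)
  qed
  have "(\<integral>\<^sup>+x. ennreal (norm (h x)) \<partial>\<mu>) = (\<integral>\<^sup>+x. (SUP n. ennreal (indicator (A n) x * norm (h x))) \<partial>\<mu>)"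
  proof (rule nn_integral_cong)
    fix x assume "x \<in> space \<mu>"
    then obtain n where n: "x \<in> A n" using A(2) by blast
    show "ennreal (norm (h x)) = (SUP n. ennreal (indicator (A n) x * norm (h x)))"
    proof (rule antisym)
      show "ennreal (norm (h x)) \<le> (SUP n. ennreal (indicator (A n) x * norm (h x)))"
        using n by (intro SUP_upper2[of n]) auto
      show "(SUP n. ennreal (indicator (A n) x * norm (h x))) \<le> ennreal (norm (h x))"
        by (intro SUP_least ennreal_leI) (auto simp: indicator_def)
    qed
  qed
  also have "\<dots> = (SUP n. \<integral>\<^sup>+x. ennreal (indicator (A n) x * norm (h x)) \<partial>\<mu>)"
  proof (rule nn_integral_monotone_convergence_SUP)
    show "incseq (\<lambda>n x. ennreal (indicator (A n) x * norm (h x)))"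
      using A(4) by (auto simp: incseq_def le_fun_def indicator_def intro!: ennreal_leI)
  qed auto
  also have "\<dots> \<le> ennreal K" by (intro SUP_least n)
  finally have *: "(\<integral>\<^sup>+x. ennreal (norm (h x)) \<partial>\<mu>) \<le> ennreal K" .
  then show i: "integrable \<mu> h" using le_less_trans[OF * ennreal_less_top] by (auto simp: integrable_iff_bounded)
  from * show "(LINT x|\<mu>. norm (h x)) \<le> K"
    using i K0 by (subst (asm) nn_integral_eq_integral) auto
qed

lemma T_L1: assumes f: "f \<in> Lp \<mu> 2" "integrable \<mu> f"
  shows "integrable \<mu> (T f)" "(LINT x|\<mu>. norm (T f x)) \<le> M * (LINT x|\<mu>. norm (f x))"
proof -
  have "integrable \<mu> (\<lambda>x. T f x * cnj (g x)) \<and> norm (LINT x|\<mu>. T f x * cnj (g x)) \<le> M * (LINT x|\<mu>. norm (f x))"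
    if "test_fun \<mu> g" "\<And>x. norm (g x) \<le> 1" for g
    using L2_integrable_inner[OF T_L2[OF f(1)] test_fun_L2[OF that(1)]] bound[OF f(1) test_fun_L2[OF that(1)] f(2), of 1] that
    by (auto simp: L2_inner_def)
  from L1_bound_of_tests[OF L2_measurable[OF T_L2[OF f(1)]] this]
  show "integrable \<mu> (T f)" "(LINT x|\<mu>. norm (T f x)) \<le> M * (LINT x|\<mu>. norm (f x))" by auto
qed

lemma T_Linf: assumes f: "f \<in> Lp \<mu> 2" and B: "B \<ge> 0" "AE x in \<mu>. norm (f x) \<le> B"
  shows "AE x in \<mu>. norm (T f x) \<le> M * B"
proof (rule AE_bound_of_tests)
  show "T f \<in> borel_measurable \<mu>" "0 \<le> M * B" using T_L2[OF f] M B by (auto intro: L2_measurable)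
  fix g assume g: "test_fun \<mu> g"
  have i: "integrable \<mu> (\<lambda>x. T f x * cnj (g x))" using L2_integrable_inner[OF T_L2[OF f] test_fun_L2[OF g]] .
  have "norm (L2_inner \<mu> (T f) g) \<le> M * (LINT x|\<mu>. norm (g x)) * B"
    using bound[OF test_fun_L2[OF g] f _ B] g by (auto simp: test_fun_def)
  then show "integrable \<mu> (\<lambda>x. T f x * cnj (g x)) \<and>
      norm (LINT x|\<mu>. T f x * cnj (g x)) \<le> M * B * (LINT x|\<mu>. norm (g x))"
    using i by (simp add: L2_inner_def mult_ac)
qed

lemma weak_image_L2: assumes "f \<in> Lp \<mu> 2" shows "weak_image \<mu> T' f (T f)"
  unfolding weak_image_def
proof (intro conjI allI impI)
  show "T f \<in> borel_measurable \<mu>" using T_L2[OF assms] by (rule L2_measurable)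
  fix g assume "test_fun \<mu> g"
  note g = test_fun_L2[OF this]
  show "integrable \<mu> (\<lambda>x. T f x * cnj (g x))" by (rule L2_integrable_inner[OF T_L2[OF assms] g])
  show "integrable \<mu> (\<lambda>x. f x * cnj (T' g x))" by (rule L2_integrable_inner[OF assms T'_L2[OF g]])
  show "(LINT x|\<mu>. T f x * cnj (g x)) = (LINT x|\<mu>. f x * cnj (T' g x))"
    using adj[OF assms g] by (simp add: L2_inner_def)
qed

lemma weak_image_unique:
  assumes "weak_image \<mu> T' f h" "weak_image \<mu> T' f k" shows "AE x in \<mu>. h x = k x"
proof -
  have "AE x in \<mu>. norm (h x - k x) \<le> 0"
  proof (rule AE_bound_of_tests)
    show "(\<lambda>x. h x - k x) \<in> borel_measurable \<mu>" using assms by (auto simp: weak_image_def)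
    fix g assume "test_fun \<mu> g"
    then show "integrable \<mu> (\<lambda>x. (h x - k x) * cnj (g x)) \<and> norm (LINT x|\<mu>. (h x - k x) * cnj (g x)) \<le> 0 * (LINT x|\<mu>. norm (g x))"
      using assms by (simp add: weak_image_def left_diff_distrib)
  qed simp
  then show ?thesis by eventually_elim simp
qed

lemma weak_image_cong:
  assumes "weak_image \<mu> T' f h" "AE x in \<mu>. f x = f' x" "f \<in> borel_measurable \<mu>" "f' \<in> borel_measurable \<mu>"
  shows "weak_image \<mu> T' f' h"
proof -
  have "integrable \<mu> (\<lambda>x. f' x * cnj (T' g x)) \<and> (LINT x|\<mu>. f' x * cnj (T' g x)) = (LINT x|\<mu>. f x * cnj (T' g x))"
    if g: "test_fun \<mu> g" for g
  proof -
    have [measurable]: "T' g \<in> borel_measurable \<mu>" using T'_L2[OF test_fun_L2[OF g]] by (rule L2_measurable)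
    have "AE x in \<mu>. f x * cnj (T' g x) = f' x * cnj (T' g x)" using assms(2) by eventually_elim simp
    note ae = this
    have i: "integrable \<mu> (\<lambda>x. f x * cnj (T' g x))" using assms g by (simp add: weak_image_def)
    have "integrable \<mu> (\<lambda>x. f' x * cnj (T' g x))"
      by (rule integrable_cong_AE_imp[OF i]) (use assms ae in auto)
    moreover have "(LINT x|\<mu>. f' x * cnj (T' g x)) = (LINT x|\<mu>. f x * cnj (T' g x))"
      by (rule integral_cong_AE) (use assms ae in auto)
    ultimately show ?thesis by simp
  qed
  then show ?thesis using assms(1) by (simp add: weak_image_def)
qed

lemma weak_image_add:
  "weak_image \<mu> T' f h \<Longrightarrow> weak_image \<mu> T' g k \<Longrightarrow> weak_image \<mu> T' (\<lambda>x. f x + g x) (\<lambda>x. h x + k x)"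
  by (auto simp: weak_image_def distrib_right)

lemma weak_image_scale: "weak_image \<mu> T' f h \<Longrightarrow> weak_image \<mu> T' (\<lambda>x. c * f x) (\<lambda>x. c * h x)"
  by (auto simp: weak_image_def mult.assoc)

text \<open>The truncations of f by height are test functions converging to f in L^1.
  \<open>T_L1\<close> makes their images Cauchy, and both sides of the weak identity pass to the
  limit.\<close>

lemma weak_image_L1:
  assumes f: "integrable \<mu> f"
  shows "\<exists>h. weak_image \<mu> T' f h \<and> integrable \<mu> h \<and> (LINT x|\<mu>. norm (h x)) \<le> M * (LINT x|\<mu>. norm (f x))"
proof -
  have [measurable]: "f \<in> borel_measurable \<mu>" using f by auto
  obtain A :: "nat \<Rightarrow> 'a set" where A: "range A \<subseteq> sets \<mu>" "(\<Union>i. A i) = space \<mu>" "\<And>i. emeasure \<mu> (A i) \<noteq> \<infinity>" "incseq A"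
    using sigma_finite_incseq by metis
  have An[measurable]: "A n \<in> sets \<mu>" for n using A by auto
  define u where "u n x = (if norm (f x) \<le> real n then f x else 0)" for n x
  have um[measurable]: "u n \<in> borel_measurable \<mu>" for n unfolding u_def by measurable
  have ul: "norm (u n x) \<le> norm (f x)" for n x by (simp add: u_def)
  have ui: "integrable \<mu> (u n)" for n by (rule Bochner_Integration.integrable_bound[OF f]) (auto simp: ul)
  have ut: "test_fun \<mu> (u n)" for n
    unfolding test_fun_def using ui by (auto intro!: exI[of _ "real n"] simp: u_def)
  note u2 = test_fun_L2[OF ut]
  have ulim: "(\<lambda>n. u n x) \<longlonglongrightarrow> f x" for x
  proof (rule tendsto_eventually)
    obtain N where "norm (f x) \<le> real N" using real_arch_simple by blast
    then show "\<forall>\<^sub>F n in sequentially. u n x = f x"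
      unfolding eventually_sequentially by (intro exI[of _ N]) (auto simp: u_def)
  qed
  have d0: "(\<lambda>n. LINT x|\<mu>. norm (u n x - f x)) \<longlonglongrightarrow> 0"
  proof -
    have "(\<lambda>n. LINT x|\<mu>. norm (u n x - f x)) \<longlonglongrightarrow> (LINT x|\<mu>. 0)"
    proof (rule integral_dominated_convergence[where w="\<lambda>x. 2 * norm (f x)"])
      show "AE x in \<mu>. (\<lambda>n. norm (u n x - f x)) \<longlonglongrightarrow> 0"
        using ulim by (intro AE_I2 tendsto_norm_zero LIM_zero)
      show "AE x in \<mu>. norm (norm (u n x - f x)) \<le> 2 * norm (f x)" for n
      proof (rule AE_I2)
        fix x show "norm (norm (u n x - f x)) \<le> 2 * norm (f x)"
          using norm_triangle_ineq4[of "u n x" "f x"] ul[of n x] by simp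
      qed
    qed (use f in auto)
    then show ?thesis by simp
  qed
  have di: "integrable \<mu> (\<lambda>x. u m x - u n x)" for m n using ui by simp
  have Tm[measurable]: "T (u n) \<in> borel_measurable \<mu>" "T (\<lambda>x. u m x - u n x) \<in> borel_measurable \<mu>" for m n
    using T_L2[OF u2] T_L2[OF L2_diff[OF u2 u2]] by (auto intro: L2_measurable)
  have Td: "(LINT x|\<mu>. norm (T (u m) x - T (u n) x)) \<le> M * ((LINT x|\<mu>. norm (u m x - f x)) + (LINT x|\<mu>. norm (u n x - f x)))" for m n
  proof -
    have "AE x in \<mu>. T (\<lambda>x. u m x + (-1) * u n x) x = T (u m) x + T (\<lambda>x. (-1) * u n x) x"
      by (rule linear_op_add[OF T u2 L2_scale[OF u2]])
    moreover have "AE x in \<mu>. T (\<lambda>x. (-1) * u n x) x = (-1) * T (u n) x"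
      by (rule linear_op_scale[OF T u2])
    ultimately have e: "AE x in \<mu>. norm (T (\<lambda>x. u m x - u n x) x) = norm (T (u m) x - T (u n) x)"
      by eventually_elim simp
    have "(LINT x|\<mu>. norm (T (u m) x - T (u n) x)) = (LINT x|\<mu>. norm (T (\<lambda>x. u m x - u n x) x))"
      using e by (intro integral_cong_AE) (auto elim: eventually_mono)
    also have "\<dots> \<le> M * (LINT x|\<mu>. norm (u m x - u n x))" by (intro T_L1 L2_diff u2 di)
    also have "\<dots> \<le> M * (LINT x|\<mu>. norm (u m x - f x) + norm (u n x - f x))"
    proof (intro mult_left_mono integral_mono M)
      fix x show "norm (u m x - u n x) \<le> norm (u m x - f x) + norm (u n x - f x)"
        using norm_triangle_ineq4[of "u m x - f x" "u n x - f x"] by simp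
    qed (use ui f in auto)
    also have "\<dots> = M * ((LINT x|\<mu>. norm (u m x - f x)) + (LINT x|\<mu>. norm (u n x - f x)))" using ui f by simp
    finally show ?thesis .
  qed
  note Tu = T_L1(1)[OF u2 ui]
  have "\<exists>N. \<forall>m\<ge>N. \<forall>n\<ge>N. (\<integral>\<^sup>+x. ennreal (norm (T (u m) x - T (u n) x) ^ 1) \<partial>\<mu>) \<le> ennreal e" if "e > 0" for e
  proof -
    have "(\<lambda>n. M * (LINT x|\<mu>. norm (u n x - f x))) \<longlonglongrightarrow> M * 0" by (intro tendsto_intros d0)
    then have "\<forall>\<^sub>F n in sequentially. M * (LINT x|\<mu>. norm (u n x - f x)) < e / 2"
      using that by (intro order_tendstoD) auto
    then obtain N where N: "\<And>n. n \<ge> N \<Longrightarrow> M * (LINT x|\<mu>. norm (u n x - f x)) < e / 2"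
      by (auto simp: eventually_sequentially)
    have "(LINT x|\<mu>. norm (T (u m) x - T (u n) x)) \<le> e" if "m \<ge> N" "n \<ge> N" for m n
      using Td[of m n] N[OF that(1)] N[OF that(2)] by (simp add: distrib_left)
    then show ?thesis using Tu by (intro exI[of _ N]) (auto simp: nn_integral_eq_integral intro!: ennreal_leI)
  qed
  from Riesz_Fischer[of 1 "\<lambda>n. T (u n)" \<mu>, OF _ _ this] obtain h where
    h[measurable]: "h \<in> borel_measurable \<mu>" and hl: "(\<lambda>n. \<integral>\<^sup>+x. ennreal (norm (T (u n) x - h x) ^ 1) \<partial>\<mu>) \<longlonglongrightarrow> 0"
    using L2_measurable[OF T_L2[OF u2]] by auto
  have "\<forall>\<^sub>F n in sequentially. (\<integral>\<^sup>+x. ennreal (norm (T (u n) x - h x) ^ 1) \<partial>\<mu>) < 1"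
    using hl by (rule order_tendstoD) simp
  then obtain n0 where "(\<integral>\<^sup>+x. ennreal (norm (T (u n0) x - h x) ^ 1) \<partial>\<mu>) < 1"
    by (auto simp: eventually_sequentially)
  then have "integrable \<mu> (\<lambda>x. T (u n0) x - h x)"
    using less_trans[OF _ ennreal_one_less_top] L2_measurable[OF T_L2[OF u2]] by (auto simp: integrable_iff_bounded)
  from Bochner_Integration.integrable_diff[OF Tu[of n0] this] have hi: "integrable \<mu> h" by simp
  have "(\<lambda>n. LINT x|\<mu>. norm (T (u n) x - h x)) \<longlonglongrightarrow> 0"
  proof -
    have "(\<integral>\<^sup>+x. ennreal (norm (T (u n) x - h x) ^ 1) \<partial>\<mu>) = ennreal (LINT x|\<mu>. norm (T (u n) x - h x))" for n
      using Tu hi by (simp add: nn_integral_eq_integral)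
    then show ?thesis using hl by (simp add: ennreal_tendsto_0_iff integral_nonneg_AE)
  qed
  note h0 = this
  have lim_int: "(\<lambda>n. LINT x|\<mu>. v n x * cnj (g x)) \<longlonglongrightarrow> (LINT x|\<mu>. w x * cnj (g x))"
    if v: "\<And>n. integrable \<mu> (v n)" "integrable \<mu> w" "(\<lambda>n. LINT x|\<mu>. norm (v n x - w x)) \<longlonglongrightarrow> 0"
      and g: "g \<in> borel_measurable \<mu>" "B \<ge> 0" "AE x in \<mu>. norm (g x) \<le> B"
    for v :: "nat \<Rightarrow> 'a \<Rightarrow> complex" and w g B
  proof -
    have g': "(\<lambda>x. cnj (g x)) \<in> borel_measurable \<mu>" "AE x in \<mu>. norm (cnj (g x)) \<le> B" using g by auto
    note gi = bounded_mult_integrable[OF _ g'(1) g(2) g'(2)]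
    have "(\<lambda>n. (LINT x|\<mu>. v n x * cnj (g x)) - (LINT x|\<mu>. w x * cnj (g x))) \<longlonglongrightarrow> 0"
    proof (rule Lim_null_comparison)
      show "\<forall>\<^sub>F n in sequentially. norm ((LINT x|\<mu>. v n x * cnj (g x)) - (LINT x|\<mu>. w x * cnj (g x))) \<le> B * (LINT x|\<mu>. norm (v n x - w x))"
      proof (intro always_eventually allI)
        fix n
        have "(LINT x|\<mu>. v n x * cnj (g x)) - (LINT x|\<mu>. w x * cnj (g x)) = (LINT x|\<mu>. (v n x - w x) * cnj (g x))"
          using gi(1)[OF v(1)] gi(1)[OF v(2)] by (simp add: left_diff_distrib)
        then show "norm ((LINT x|\<mu>. v n x * cnj (g x)) - (LINT x|\<mu>. w x * cnj (g x))) \<le> B * (LINT x|\<mu>. norm (v n x - w x))"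
          using gi(2)[OF Bochner_Integration.integrable_diff[OF v(1) v(2)]] by simp
      qed
      show "(\<lambda>n. B * (LINT x|\<mu>. norm (v n x - w x))) \<longlonglongrightarrow> 0" using tendsto_mult_left[OF v(3), of B] by simp
    qed
    then show ?thesis by (simp add: LIM_zero_iff)
  qed
  have bi: "integrable \<mu> (\<lambda>x. k x * cnj (g x))" if k: "integrable \<mu> k" "g \<in> borel_measurable \<mu>" "AE x in \<mu>. norm (g x) \<le> B" "B \<ge> 0" for k g B
    using k by (intro bounded_mult_integrable[of _ _ _ B]) auto
  interpret sw: form_bounded_pair \<mu> T' T M by (rule form_bounded_pair_swap)
  have wi: "weak_image \<mu> T' f h"
    unfolding weak_image_def
  proof (intro conjI allI impI h)
    fix g assume g: "test_fun \<mu> g"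
    then obtain B where B: "B \<ge> 0" "AE x in \<mu>. norm (g x) \<le> B" "g \<in> borel_measurable \<mu>" by (auto simp: test_fun_def)
    note g2 = test_fun_L2[OF g]
    have Tg: "AE x in \<mu>. norm (T' g x) \<le> M * B" "T' g \<in> borel_measurable \<mu>" "M * B \<ge> 0"
      using sw.T_Linf[OF g2 B(1,2)] L2_measurable[OF T'_L2[OF g2]] M B by auto
    show "integrable \<mu> (\<lambda>x. h x * cnj (g x))" "integrable \<mu> (\<lambda>x. f x * cnj (T' g x))"
      using bi[OF hi B(3,2,1)] bi[OF f Tg(2,1,3)] by auto
    have "(\<lambda>n. LINT x|\<mu>. T (u n) x * cnj (g x)) \<longlonglongrightarrow> (LINT x|\<mu>. h x * cnj (g x))"
      by (rule lim_int[OF Tu hi h0 B(3,1,2)])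
    moreover have "(\<lambda>n. LINT x|\<mu>. u n x * cnj (T' g x)) \<longlonglongrightarrow> (LINT x|\<mu>. f x * cnj (T' g x))"
      by (rule lim_int[OF ui f d0 Tg(2,3,1)])
    moreover have "(LINT x|\<mu>. T (u n) x * cnj (g x)) = (LINT x|\<mu>. u n x * cnj (T' g x))" for n
      using adj[OF u2 g2] by (simp add: L2_inner_def)
    ultimately show "(LINT x|\<mu>. h x * cnj (g x)) = (LINT x|\<mu>. f x * cnj (T' g x))"
      using LIMSEQ_unique by simp
  qed
  have "(LINT x|\<mu>. norm (h x)) \<le> M * (LINT x|\<mu>. norm (f x))"
  proof (rule L1_bound_of_tests[OF h])
    fix g assume g: "test_fun \<mu> g" "\<And>x. norm (g x) \<le> 1"
    have T1: "AE x in \<mu>. norm (T' g x) \<le> M" using sw.T_Linf[OF test_fun_L2[OF g(1)], of 1] g(2) by simp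
    have "norm (LINT x|\<mu>. f x * cnj (T' g x)) \<le> M * (LINT x|\<mu>. norm (f x))"
      using T1 M L2_measurable[OF T'_L2[OF test_fun_L2[OF g(1)]]] by (intro bounded_mult_integrable(2)[OF f]) auto
    then show "integrable \<mu> (\<lambda>x. h x * cnj (g x)) \<and> norm (LINT x|\<mu>. h x * cnj (g x)) \<le> M * (LINT x|\<mu>. norm (f x))"
      using wi g(1) by (simp add: weak_image_def)
  qed
  with wi hi show ?thesis by blast
qed

text \<open>Norm limits of test functions do not exhaust L^\<infinity>, so the image is found by
  duality. With U the L^1 extension of \<open>T'\<close>, the pairing of f with U g is a
  conjugate-linear functional of g, at most M B times its L^1 norm, and a bounded function
  represents it.\<close>

lemma weak_image_Linf:
  assumes f[measurable]: "f \<in> borel_measurable \<mu>" and B: "B \<ge> 0" "AE x in \<mu>. norm (f x) \<le> B"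
  shows "\<exists>h. weak_image \<mu> T' f h \<and> (AE x in \<mu>. norm (h x) \<le> M * B)"
proof -
  interpret sw: form_bounded_pair \<mu> T' T M by (rule form_bounded_pair_swap)
  \<comment> \<open>The value is chosen for each g separately, so U is linear only almost
    everywhere; that suffices under the integral against f.\<close>
  define U where "U g = (SOME k. weak_image \<mu> T g k \<and> integrable \<mu> k \<and> (LINT x|\<mu>. norm (k x)) \<le> M * (LINT x|\<mu>. norm (g x)))" for g
  have U: "weak_image \<mu> T g (U g)" "integrable \<mu> (U g)" "(LINT x|\<mu>. norm (U g x)) \<le> M * (LINT x|\<mu>. norm (g x))"
    if "integrable \<mu> g" for g
    using someI_ex[OF sw.weak_image_L1[OF that]] unfolding U_def by auto
  have Uadd: "AE x in \<mu>. U (\<lambda>x. g x + k x) x = U g x + U k x" if "integrable \<mu> g" "integrable \<mu> k" for g k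
    using that by (intro sw.weak_image_unique[OF U(1) sw.weak_image_add[OF U(1) U(1)]]) auto
  have Uscale: "AE x in \<mu>. U (\<lambda>x. c * g x) x = c * U g x" if "integrable \<mu> g" for g c
    using that by (intro sw.weak_image_unique[OF U(1) sw.weak_image_scale[OF U(1)]]) auto
  have Ucong: "AE x in \<mu>. U g x = U k x" if "integrable \<mu> g" "integrable \<mu> k" "AE x in \<mu>. g x = k x" for g k
    using that by (intro sw.weak_image_unique[OF sw.weak_image_cong[OF U(1)] U(1)]) auto
  have UT: "AE x in \<mu>. U g x = T' g x" if "test_fun \<mu> g" for g
    using that by (intro sw.weak_image_unique[OF U(1) sw.weak_image_L2[OF test_fun_L2]]) (auto simp: test_fun_def)
  have fi: "integrable \<mu> (\<lambda>x. f x * cnj (k x))" "norm (LINT x|\<mu>. f x * cnj (k x)) \<le> B * (LINT x|\<mu>. norm (k x))"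
    if k: "integrable \<mu> k" for k
    using bounded_mult_integrable[OF _ f B, of "\<lambda>x. cnj (k x)"] k by (auto simp: mult.commute)
  define l where "l g = (LINT x|\<mu>. f x * cnj (U g x))" for g
  have lb: "norm (l g) \<le> M * B * (LINT x|\<mu>. norm (g x))" if g: "integrable \<mu> g" for g
  proof -
    have "norm (l g) \<le> B * (LINT x|\<mu>. norm (U g x))" unfolding l_def by (rule fi(2)[OF U(2)[OF g]])
    also have "\<dots> \<le> B * (M * (LINT x|\<mu>. norm (g x)))" using U(3)[OF g] B by (simp add: mult_left_mono)
    finally show ?thesis by (simp add: mult_ac)
  qed
  have ladd: "l (\<lambda>x. g x + k x) = l g + l k" if g: "integrable \<mu> g" "integrable \<mu> k" for g k
  proof -
    have "l (\<lambda>x. g x + k x) = (LINT x|\<mu>. f x * cnj (U g x) + f x * cnj (U k x))"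
      unfolding l_def
    proof (rule integral_cong_AE)
      show "AE x in \<mu>. f x * cnj (U (\<lambda>x. g x + k x) x) = f x * cnj (U g x) + f x * cnj (U k x)"
        using Uadd[OF g] by eventually_elim (simp add: distrib_left)
    qed (use fi(1) U(2) g in \<open>auto intro!: borel_measurable_integrable\<close>)
    then show ?thesis using fi(1) U(2) g by (simp add: l_def)
  qed
  have lscale: "l (\<lambda>x. c * g x) = cnj c * l g" if g: "integrable \<mu> g" for g c
  proof -
    have "l (\<lambda>x. c * g x) = (LINT x|\<mu>. cnj c * (f x * cnj (U g x)))"
      unfolding l_def
    proof (rule integral_cong_AE)
      show "AE x in \<mu>. f x * cnj (U (\<lambda>x. c * g x) x) = cnj c * (f x * cnj (U g x))"
        using Uscale[OF g, of c] by eventually_elim simp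
    qed (use fi(1) U(2) g in \<open>auto intro!: borel_measurable_integrable\<close>)
    then show ?thesis by (simp add: l_def)
  qed
  have lcong: "l g = l k" if g: "integrable \<mu> g" "integrable \<mu> k" "AE x in \<mu>. g x = k x" for g k
    unfolding l_def
  proof (rule integral_cong_AE)
    show "AE x in \<mu>. f x * cnj (U g x) = f x * cnj (U k x)" using Ucong[OF g] by eventually_elim simp
  qed (use fi(1) U(2) g in \<open>auto intro!: borel_measurable_integrable\<close>)
  \<comment> \<open>A positive integrable weight turns the sigma-finite \<mu> into the finite
    measure \<open>m\<close> that \<open>dominated_additive_density\<close> asks for.\<close>
  obtain w0 :: "'a \<Rightarrow> ennreal" where w0: "w0 \<in> borel_measurable \<mu>" "(\<integral>\<^sup>+x. w0 x \<partial>\<mu>) \<noteq> \<infinity>"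
    "\<And>x. x \<in> space \<mu> \<Longrightarrow> 0 < w0 x" "\<And>x. x \<in> space \<mu> \<Longrightarrow> w0 x < \<infinity>"
    using Ex_finite_integrable_function by metis
  define w where "w x = enn2real (w0 x)" for x
  have [measurable]: "w \<in> borel_measurable \<mu>" unfolding w_def using w0(1) by measurable
  have wpos: "w x > 0" if "x \<in> space \<mu>" for x
    using w0(3,4)[OF that] by (simp add: w_def enn2real_positive_iff)
  have wnn: "w x \<ge> 0" for x by (simp add: w_def)
  have "(\<integral>\<^sup>+x. ennreal (w x) \<partial>\<mu>) = (\<integral>\<^sup>+x. w0 x \<partial>\<mu>)"
    using w0(4) by (intro nn_integral_cong) (auto simp: w_def)
  then have wfin: "(\<integral>\<^sup>+x. ennreal (w x) \<partial>\<mu>) < \<infinity>" using w0(2) by (simp add: less_top)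
  then have wi: "integrable \<mu> w" using wnn by (auto simp: integrable_iff_bounded)
  define m where "m = density \<mu> (\<lambda>x. ennreal (w x))"
  have [simp, measurable_cong]: "sets m = sets \<mu>" and [simp]: "space m = space \<mu>" by (auto simp: m_def)
  have "finite_measure m"
    by (rule finite_measureI) (use wfin in \<open>simp add: m_def emeasure_density cong: nn_integral_cong\<close>)
  then interpret m: finite_measure m .
  have m_int: "integrable m \<phi> \<longleftrightarrow> integrable \<mu> (\<lambda>x. complex_of_real (w x) * \<phi> x)"
    "(LINT x|m. \<phi> x) = (LINT x|\<mu>. complex_of_real (w x) * \<phi> x)"
    if "\<phi> \<in> borel_measurable \<mu>" for \<phi> :: "'a \<Rightarrow> complex"
    using that wnn unfolding m_def by (auto simp: integrable_density integral_density scaleR_conv_of_real)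
  have m_int_real: "(LINT x|m. \<phi> x) = (LINT x|\<mu>. w x * \<phi> x)" if "\<phi> \<in> borel_measurable \<mu>" for \<phi> :: "'a \<Rightarrow> real"
    using that wnn unfolding m_def by (simp add: integral_density)
  \<comment> \<open>The weighted indicator has L^1 norm \<open>measure m A\<close>, so the bound on
    the functional becomes domination by \<open>m\<close>.\<close>
  define e where "e A x = complex_of_real (w x) * indicator A x" for A x
  have ei: "integrable \<mu> (e A)" if "A \<in> sets \<mu>" for A
    unfolding e_def using that by (subst m_int(1)[symmetric]) (auto intro!: m.integrable_const_bound[of _ 1] simp: indicator_def)
  have en: "(LINT x|\<mu>. norm (e A x)) = measure m A" if A: "A \<in> sets \<mu>" for A
  proof -
    have "measure m A = (LINT x|m. indicator A x)" using A sets.sets_into_space[OF A] by (simp add: Int_absorb2)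
    also have "\<dots> = (LINT x|\<mu>. w x * indicator A x)" using A by (intro m_int_real) auto
    also have "\<dots> = (LINT x|\<mu>. norm (e A x))"
      using wnn by (intro Bochner_Integration.integral_cong) (auto simp: e_def indicator_def norm_mult)
    finally show ?thesis by simp
  qed
  define K where "K = M * B"
  have K0: "K \<ge> 0" using M B by (simp add: K_def)
  have eadd: "e (A \<union> A') = (\<lambda>x. e A x + e A' x)" if "A \<inter> A' = {}" for A A'
    using that by (auto simp: e_def indicator_def fun_eq_iff)
  have \<nu>b: "norm (l (e A)) \<le> K * measure m A" if "A \<in> sets m" for A
    using lb[OF ei, of A] en[of A] that by (simp add: K_def)
  \<comment> \<open>The density lemma is real, so the real and the imaginary part of the functional
    are represented separately.\<close>
  have ex: "\<exists>k\<in>borel_measurable m. (\<forall>x. \<bar>k x\<bar> \<le> K) \<and> (\<forall>A\<in>sets m. R (l (e A)) = (LINT x|m. indicator A x * k x))"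
    if R: "\<And>a b. R (a + b) = R a + R b" "\<And>a. \<bar>R a\<bar> \<le> norm a" for R :: "complex \<Rightarrow> real"
  proof (rule dominated_additive_density[OF m.finite_measure_axioms _ _ K0])
    fix A A' assume "A \<in> sets m" "A' \<in> sets m" "A \<inter> A' = {}"
    then show "R (l (e (A \<union> A'))) = R (l (e A)) + R (l (e A'))"
      using ei by (simp add: eadd ladd R(1))
  next
    fix A assume "A \<in> sets m"
    then show "\<bar>R (l (e A))\<bar> \<le> K * measure m A" using \<nu>b[of A] R(2)[of "l (e A)"] by simp
  qed
  obtain k1 where k1[measurable]: "k1 \<in> borel_measurable m" and k1b: "\<And>x. \<bar>k1 x\<bar> \<le> K"
    and k1e: "\<And>A. A \<in> sets m \<Longrightarrow> Re (l (e A)) = (LINT x|m. indicator A x * k1 x)"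
    using ex[of Re] abs_Re_le_cmod by auto
  obtain k2 where k2[measurable]: "k2 \<in> borel_measurable m" and k2b: "\<And>x. \<bar>k2 x\<bar> \<le> K"
    and k2e: "\<And>A. A \<in> sets m \<Longrightarrow> Im (l (e A)) = (LINT x|m. indicator A x * k2 x)"
    using ex[of Im] abs_Im_le_cmod by auto
  define h where "h x = Complex (k1 x) (k2 x)" for x
  have h_eq: "h = (\<lambda>x. complex_of_real (k1 x) + \<i> * complex_of_real (k2 x))" by (auto simp: h_def Complex_eq)
  have [measurable]: "h \<in> borel_measurable \<mu>"
    using k1 k2 unfolding h_eq by (auto simp: measurable_cong_sets[OF \<open>sets m = sets \<mu>\<close> refl])
  \<comment> \<open>The factor 2 comes from adding the two parts. This crude bound only secures
    integrability; the bound M B is recovered by testing at the end.\<close>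
  have hb: "norm (h x) \<le> 2 * K" for x
    using cmod_le[of "h x"] k1b[of x] k2b[of x] by (simp add: h_def)
  have hi: "integrable m (\<lambda>x. h x * \<phi> x)" if "integrable m \<phi>" for \<phi>
    using bounded_mult_integrable(1)[OF that, of h "2 * K"] hb K0 by (simp add: mult.commute)
  have hA: "(LINT x|m. h x * indicator A x) = l (e A)" if A: "A \<in> sets \<mu>" for A
  proof -
    have i: "integrable m (\<lambda>x. indicator A x * k1 x)" "integrable m (\<lambda>x. indicator A x * k2 x)"
      using A k1b k2b K0 by (auto intro!: m.integrable_const_bound[of _ K] simp: indicator_def)
    have "(LINT x|m. h x * indicator A x) = (LINT x|m. complex_of_real (indicator A x * k1 x) + \<i> * complex_of_real (indicator A x * k2 x))"
      by (intro Bochner_Integration.integral_cong) (auto simp: h_eq indicator_def)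
    also have "\<dots> = (LINT x|m. complex_of_real (indicator A x * k1 x)) + (LINT x|m. \<i> * complex_of_real (indicator A x * k2 x))"
      by (intro Bochner_Integration.integral_add integrable_of_real i integrable_mult_right)
    also have "\<dots> = complex_of_real (LINT x|m. indicator A x * k1 x) + \<i> * complex_of_real (LINT x|m. indicator A x * k2 x)"
      by (simp only: integral_complex_of_real integral_mult_right_zero)
    also have "\<dots> = l (e A)" using k1e[of A] k2e[of A] A by (simp add: complex_eq_iff)
    finally show ?thesis .
  qed
  have w\<phi>: "integrable \<mu> (\<lambda>x. complex_of_real (w x) * \<phi> x)" if "integrable m \<phi>" for \<phi>
    using that m_int(1)[of \<phi>] borel_measurable_integrable[OF that] by (simp add: measurable_cong_sets[OF \<open>sets m = sets \<mu>\<close> refl])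
  have n\<phi>: "(LINT x|\<mu>. norm (complex_of_real (w x) * \<phi> x)) = (LINT x|m. norm (\<phi> x))" if "integrable m \<phi>" for \<phi>
  proof -
    have "(\<lambda>x. norm (\<phi> x)) \<in> borel_measurable \<mu>"
      using borel_measurable_integrable[OF that] by (simp add: measurable_cong_sets[OF \<open>sets m = sets \<mu>\<close> refl])
    from m_int_real[OF this] show ?thesis using wnn by (simp add: norm_mult)
  qed
  have rep: "(LINT x|m. h x * cnj (\<phi> x)) = l (\<lambda>x. complex_of_real (w x) * \<phi> x)" if "integrable m \<phi>" for \<phi>
    using that
  proof (induction rule: integrable_induct)
    case (base A c)
    have "(LINT x|m. h x * cnj (indicator A x *\<^sub>R c)) = (LINT x|m. cnj c * (h x * indicator A x))"
      by (intro Bochner_Integration.integral_cong) (auto simp: indicator_def)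
    also have "\<dots> = cnj c * l (e A)" using hA base by simp
    also have "\<dots> = l (\<lambda>x. c * e A x)" using base by (simp add: lscale ei)
    also have "(\<lambda>x. c * e A x) = (\<lambda>x. complex_of_real (w x) * (indicator A x *\<^sub>R c))"
      by (auto simp: e_def indicator_def)
    finally show ?case .
  next
    case (add \<phi> \<psi>)
    have i: "integrable m (\<lambda>x. h x * cnj (\<phi> x))" "integrable m (\<lambda>x. h x * cnj (\<psi> x))"
      using add by (auto intro!: hi)
    have "(LINT x|m. h x * cnj (\<phi> x + \<psi> x)) = l (\<lambda>x. complex_of_real (w x) * \<phi> x) + l (\<lambda>x. complex_of_real (w x) * \<psi> x)"
      using add i by (simp add: distrib_left)
    also have "\<dots> = l (\<lambda>x. complex_of_real (w x) * \<phi> x + complex_of_real (w x) * \<psi> x)"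
      using add by (simp add: ladd w\<phi>)
    finally show ?case by (simp add: distrib_left)
  next
    case (lim \<phi> s)
    have [measurable]: "s i \<in> borel_measurable m" "\<phi> \<in> borel_measurable m" for i using lim by auto
    have "(\<lambda>i. LINT x|m. norm (s i x - \<phi> x)) \<longlonglongrightarrow> (LINT x|m. 0)"
    proof (rule integral_dominated_convergence[where w="\<lambda>x. 3 * norm (\<phi> x)"])
      show "AE x in m. (\<lambda>i. norm (s i x - \<phi> x)) \<longlonglongrightarrow> 0" using lim by (intro AE_I2 tendsto_norm_zero LIM_zero) auto
      show "AE x in m. norm (norm (s i x - \<phi> x)) \<le> 3 * norm (\<phi> x)" for i
      proof (rule AE_I2)
        fix x assume "x \<in> space m"
        then have "norm (s i x) \<le> 2 * norm (\<phi> x)" using lim by auto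
        then show "norm (norm (s i x - \<phi> x)) \<le> 3 * norm (\<phi> x)" using norm_triangle_ineq4[of "s i x" "\<phi> x"] by simp
      qed
    qed (use lim in auto)
    then have d0: "(\<lambda>i. LINT x|m. norm (s i x - \<phi> x)) \<longlonglongrightarrow> 0" by simp
    have c: "(\<lambda>i. C * (LINT x|m. norm (s i x - \<phi> x))) \<longlonglongrightarrow> 0" for C using tendsto_mult_left[OF d0, of C] by simp
    have di: "integrable m (\<lambda>x. s i x - \<phi> x)" for i using lim by auto
    have "(\<lambda>i. (LINT x|m. h x * cnj (s i x)) - (LINT x|m. h x * cnj (\<phi> x))) \<longlonglongrightarrow> 0"
    proof (rule Lim_null_comparison[OF always_eventually c, rule_format])
      fix i
      have "(LINT x|m. h x * cnj (s i x)) - (LINT x|m. h x * cnj (\<phi> x)) = (LINT x|m. h x * cnj (s i x - \<phi> x))"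
        using hi[of "\<lambda>x. cnj (s i x)"] hi[of "\<lambda>x. cnj (\<phi> x)"] lim by (simp add: right_diff_distrib)
      also have "norm \<dots> \<le> (LINT x|m. norm (h x * cnj (s i x - \<phi> x)))" by (rule integral_norm_bound)
      also have "\<dots> \<le> (LINT x|m. 2 * K * norm (s i x - \<phi> x))"
      proof (rule integral_mono)
        have "integrable m (\<lambda>x. cnj (s i x - \<phi> x))" using integrable_cnj[of m "\<lambda>x. s i x - \<phi> x"] di[of i] by (simp only:)
        then show "integrable m (\<lambda>x. norm (h x * cnj (s i x - \<phi> x)))" by (intro integrable_norm hi)
        show "norm (h x * cnj (s i x - \<phi> x)) \<le> 2 * K * norm (s i x - \<phi> x)" for x
          unfolding norm_mult complex_mod_cnj using hb by (intro mult_right_mono) auto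
      qed (use di in auto)
      also have "\<dots> = 2 * K * (LINT x|m. norm (s i x - \<phi> x))" by simp
      finally show "norm ((LINT x|m. h x * cnj (s i x)) - (LINT x|m. h x * cnj (\<phi> x))) \<le> 2 * K * (LINT x|m. norm (s i x - \<phi> x))" .
    qed
    then have 1: "(\<lambda>i. LINT x|m. h x * cnj (s i x)) \<longlonglongrightarrow> (LINT x|m. h x * cnj (\<phi> x))" by (simp add: LIM_zero_iff)
    let ?w = "\<lambda>\<phi> x. complex_of_real (w x) * \<phi> x"
    have "(\<lambda>i. l (?w (s i)) - l (?w \<phi>)) \<longlonglongrightarrow> 0"
    proof (rule Lim_null_comparison[OF always_eventually c, rule_format])
      fix i
      have "l (?w (s i)) = l (\<lambda>x. ?w \<phi> x + ?w (\<lambda>x. s i x - \<phi> x) x)" by (simp add: algebra_simps)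
      also have "\<dots> = l (?w \<phi>) + l (?w (\<lambda>x. s i x - \<phi> x))" using lim di by (intro ladd w\<phi>)
      finally have "l (?w (s i)) - l (?w \<phi>) = l (?w (\<lambda>x. s i x - \<phi> x))" by simp
      then show "norm (l (?w (s i)) - l (?w \<phi>)) \<le> K * (LINT x|m. norm (s i x - \<phi> x))"
        using lb[OF w\<phi>[OF di[of i]]] n\<phi>[OF di[of i]] by (simp add: K_def)
    qed
    then have 2: "(\<lambda>i. l (?w (s i))) \<longlonglongrightarrow> l (?w \<phi>)" by (simp add: LIM_zero_iff)
    from 1 2 lim show ?case by (simp add: LIMSEQ_unique)
  qed
  \<comment> \<open>Every \<mu>-integrable g is w times the \<open>m\<close>-integrable function g /
    w, which carries \<open>rep\<close> back to \<mu>.\<close>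
  have lg: "integrable \<mu> (\<lambda>x. h x * cnj (g x)) \<and> (LINT x|\<mu>. h x * cnj (g x)) = l g" if g: "integrable \<mu> g" for g
  proof -
    have [measurable]: "g \<in> borel_measurable \<mu>" using g by auto
    let ?\<phi> = "\<lambda>x. g x / complex_of_real (w x)"
    have e: "complex_of_real (w x) * ?\<phi> x = g x" if "x \<in> space \<mu>" for x using wpos[OF that] by simp
    have wi: "integrable \<mu> (\<lambda>x. complex_of_real (w x) * ?\<phi> x)" using g by (rule Bochner_Integration.integrable_cong[THEN iffD1, rotated -1]) (auto simp: e simp del: times_divide_eq_right)
    then have \<phi>: "integrable m ?\<phi>" by (subst m_int(1)) auto
    have i: "integrable \<mu> (\<lambda>x. h x * cnj (g x))"
      using bounded_mult_integrable(1)[of \<mu> "\<lambda>x. cnj (g x)" h "2 * K"] g hb K0 by (simp add: mult.commute)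
    have "(LINT x|\<mu>. h x * cnj (g x)) = (LINT x|\<mu>. complex_of_real (w x) * (h x * cnj (?\<phi> x)))"
    proof (rule Bochner_Integration.integral_cong[OF refl])
      fix x assume "x \<in> space \<mu>"
      then show "h x * cnj (g x) = complex_of_real (w x) * (h x * cnj (?\<phi> x))" using wpos[of x] by simp
    qed
    also have "\<dots> = (LINT x|m. h x * cnj (?\<phi> x))" by (rule m_int(2)[symmetric]) auto
    also have "\<dots> = l (\<lambda>x. complex_of_real (w x) * ?\<phi> x)" by (rule rep[OF \<phi>])
    also have "\<dots> = l g" using e by (intro lcong wi g AE_I2) auto
    finally show ?thesis using i by simp
  qed
  have "weak_image \<mu> T' f h"
    unfolding weak_image_def
  proof (intro conjI allI impI)
    fix g assume g: "test_fun \<mu> g"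
    then have gi: "integrable \<mu> g" by (simp add: test_fun_def)
    have [measurable]: "T' g \<in> borel_measurable \<mu>" using T'_L2[OF test_fun_L2[OF g]] by (rule L2_measurable)
    have Ug: "AE x in \<mu>. f x * cnj (U g x) = f x * cnj (T' g x)" using UT[OF g] by eventually_elim simp
    show "integrable \<mu> (\<lambda>x. h x * cnj (g x))" using lg[OF gi] by simp
    show "integrable \<mu> (\<lambda>x. f x * cnj (T' g x))"
      by (rule integrable_cong_AE_imp[OF fi(1)[OF U(2)[OF gi]]]) (use Ug in \<open>auto elim: eventually_mono\<close>)
    have "l g = (LINT x|\<mu>. f x * cnj (T' g x))"
      unfolding l_def by (rule integral_cong_AE) (use Ug fi(1)[OF U(2)[OF gi]] in auto)
    then show "(LINT x|\<mu>. h x * cnj (g x)) = (LINT x|\<mu>. f x * cnj (T' g x))" using lg[OF gi] by simp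
  qed measurable
  moreover have "AE x in \<mu>. norm (h x) \<le> M * B"
  proof (rule AE_bound_of_tests)
    fix g assume "test_fun \<mu> g"
    then have "integrable \<mu> g" by (simp add: test_fun_def)
    then show "integrable \<mu> (\<lambda>x. h x * cnj (g x)) \<and> norm (LINT x|\<mu>. h x * cnj (g x)) \<le> M * B * (LINT x|\<mu>. norm (g x))"
      using lg[of g] lb[of g] by simp
  qed (use M B in auto)
  ultimately show ?thesis by blast
qed

definition extension :: "('a \<Rightarrow> complex) \<Rightarrow> ('a \<Rightarrow> complex)" where
  "extension f = (SOME h. weak_image \<mu> T' f h)"

lemma extension_eq: assumes "weak_image \<mu> T' f h" shows "AE x in \<mu>. extension f x = h x"
  using weak_image_unique[OF someI[of "weak_image \<mu> T' f"] assms, OF assms] by (simp add: extension_def)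

lemma weak_image_extension: "weak_image \<mu> T' f h \<Longrightarrow> weak_image \<mu> T' f (extension f)"
  unfolding extension_def by (rule someI[of "weak_image \<mu> T' f"])

text \<open>The modulus is lowered by s instead of cutting out the large values: the norm of
  \<open>f1\<close> is then the integrand of \<open>Beta_layer\<close>, and the constant M survives
  on every L^p. \<open>f1\<close> is integrable because where |f| > s, |f| is at most s powr (1 - q)
  times |f| powr q.\<close>

lemma soft_truncation:
  fixes f :: "'a \<Rightarrow> complex"
  assumes f[measurable]: "f \<in> borel_measurable \<mu>" and fin: "(\<integral>\<^sup>+x. ennreal (norm (f x) powr q) \<partial>\<mu>) < \<infinity>" and q: "q \<ge> 1"
    and s: "s > (0::real)"
  shows "\<exists>f1 f2. integrable \<mu> f1 \<and> f2 \<in> borel_measurable \<mu> \<and> (\<forall>x. f x = f1 x + f2 x) \<and>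
    (\<forall>x. norm (f2 x) \<le> s) \<and> (\<forall>x. norm (f1 x) = max 0 (norm (f x) - s))"
proof -
  define f1 where "f1 x = complex_of_real (max 0 (norm (f x) - s)) * sgn (f x)" for x
  define f2 where "f2 x = f x - f1 x" for x
  have m[measurable]: "f1 \<in> borel_measurable \<mu>" "f2 \<in> borel_measurable \<mu>" unfolding f1_def f2_def by measurable
  have n1: "norm (f1 x) = max 0 (norm (f x) - s)" for x
    using s by (auto simp: f1_def norm_mult norm_sgn)
  have fs: "f x = complex_of_real (norm (f x)) * sgn (f x)" for x
    by (cases "f x = 0") (simp_all add: sgn_div_norm scaleR_conv_of_real)
  have n2: "norm (f2 x) \<le> s" for x
  proof -
    have "f2 x = complex_of_real (norm (f x) - max 0 (norm (f x) - s)) * sgn (f x)"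
      unfolding f2_def f1_def by (subst fs) (simp add: left_diff_distrib)
    then have "norm (f2 x) = \<bar>norm (f x) - max 0 (norm (f x) - s)\<bar> * norm (sgn (f x))"
      by (simp only: norm_mult norm_of_real)
    also have "\<dots> \<le> s * 1" using s by (intro mult_mono) (auto simp: norm_sgn)
    finally show ?thesis by simp
  qed
  have "norm (f1 x) \<le> s powr (1 - q) * norm (f x) powr q" for x
  proof (cases "norm (f x) > s")
    case True
    have "norm (f1 x) \<le> norm (f x)" using n1 True s by simp
    also have "\<dots> = norm (f x) powr (1 - q) * norm (f x) powr q" using True s by (simp add: powr_add[symmetric])
    also have "\<dots> \<le> s powr (1 - q) * norm (f x) powr q"
      using True s q by (intro mult_right_mono powr_mono2') auto
    finally show ?thesis .
  qed (use n1 in auto)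
  then have "(\<integral>\<^sup>+x. ennreal (norm (f1 x)) \<partial>\<mu>) \<le> (\<integral>\<^sup>+x. ennreal (s powr (1 - q)) * ennreal (norm (f x) powr q) \<partial>\<mu>)"
    by (intro nn_integral_mono) (simp add: ennreal_mult[symmetric])
  also have "\<dots> < \<infinity>" using fin by (simp add: nn_integral_cmult ennreal_mult_less_top)
  finally have "integrable \<mu> f1" by (auto simp: integrable_iff_bounded)
  then show ?thesis using n1 n2 by (intro exI[of _ f1] exI[of _ f2]) (auto simp: f2_def)
qed

lemma weak_image_exists:
  assumes "1 \<le> p" "f \<in> Lp \<mu> p" shows "\<exists>h. weak_image \<mu> T' f h"
proof (cases "p = \<infinity>")
  case True
  then show ?thesis using assms weak_image_Linf unfolding True Linf_iff by blast
next
  case False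
  have q: "enn2real p \<ge> 1" using enn2real_mono[of 1 p] assms(1) False by (simp add: less_top)
  have "f \<in> borel_measurable \<mu>" "(\<integral>\<^sup>+x. ennreal (norm (f x) powr enn2real p) \<partial>\<mu>) < \<infinity>"
    using assms False by (auto simp: Lp_def)
  from soft_truncation[OF this q zero_less_one] obtain f1 f2 where
    f12: "integrable \<mu> f1" "f2 \<in> borel_measurable \<mu>" "\<forall>x. f x = f1 x + f2 x" "\<forall>x. norm (f2 x) \<le> 1" by blast
  obtain h1 where "weak_image \<mu> T' f1 h1" using weak_image_L1[OF f12(1)] by blast
  moreover obtain h2 where "weak_image \<mu> T' f2 h2" using weak_image_Linf[OF f12(2), of 1] f12(4) by auto
  ultimately have "weak_image \<mu> T' (\<lambda>x. f1 x + f2 x) (\<lambda>x. h1 x + h2 x)" by (rule weak_image_add)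
  moreover have "(\<lambda>x. f1 x + f2 x) = f" using f12(3) by auto
  ultimately show ?thesis by auto
qed

end

text \<open>Substituting s = y t leaves the Beta integral with parameters q - 1 and 2, which
  converges for q > 1; the endpoint p = 1 is treated apart.\<close>

lemma Beta_layer:
  fixes q y :: real
  assumes q: "q > 1" and y: "y \<ge> 0"
  shows "(\<integral>\<^sup>+s. ennreal (indicator {0<..} s * (max 0 (y - s) * s powr (q - 2))) \<partial>lborel) = ennreal (Beta (q - 1) 2 * y powr q)"
proof (cases "y = 0")
  case True
  have "(\<integral>\<^sup>+s. ennreal (indicator {0<..} s * (max 0 (y - s) * s powr (q - 2))) \<partial>lborel) = (\<integral>\<^sup>+(s::real). 0 \<partial>lborel)"
    by (intro nn_integral_cong) (auto simp: True indicator_def)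
  then show ?thesis using True by simp
next
  case False
  then have y: "y > 0" using y by simp
  have I: "((\<lambda>t. t powr (q - 2) * (1 - t)) has_integral Beta (q - 1) 2) {0..1}"
  proof -
    have "((\<lambda>t. t powr (q - 1 - 1) * (1 - t) powr (2 - 1)) has_integral Beta (q - 1) 2) {0..1}"
      using q by (intro has_integral_Beta_real) auto
    then show ?thesis by (rule has_integral_eq[rotated]) auto
  qed
  have "(\<integral>\<^sup>+t. ennreal (t powr (q - 2) * (1 - t)) * indicator {0..1} t \<partial>lborel) = ennreal (Beta (q - 1) 2)"
    by (rule nn_integral_has_integral_lebesgue'[OF _ I]) auto
  note B = this
  have "(\<integral>\<^sup>+s. ennreal (indicator {0<..} s * (max 0 (y - s) * s powr (q - 2))) \<partial>lborel) =
     ennreal y * (\<integral>\<^sup>+t. ennreal (indicator {0<..} (0 + y * t) * (max 0 (y - (0 + y * t)) * (0 + y * t) powr (q - 2))) \<partial>lborel)"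
    using y by (subst nn_integral_real_affine[of _ y 0]) auto
  also have "(\<integral>\<^sup>+t. ennreal (indicator {0<..} (0 + y * t) * (max 0 (y - (0 + y * t)) * (0 + y * t) powr (q - 2))) \<partial>lborel)
      = (\<integral>\<^sup>+t. ennreal (y powr (q - 1)) * (ennreal (t powr (q - 2) * (1 - t)) * indicator {0..1} t) \<partial>lborel)"
  proof (rule nn_integral_cong)
    fix t :: real
    show "ennreal (indicator {0<..} (0 + y * t) * (max 0 (y - (0 + y * t)) * (0 + y * t) powr (q - 2))) =
        ennreal (y powr (q - 1)) * (ennreal (t powr (q - 2) * (1 - t)) * indicator {0..1} t)"
    proof (cases "0 < t \<and> t \<le> 1")
      case True
      have "y * t \<le> y" using True y by (simp add: mult_left_le)
      then have "max 0 (y - y * t) = y * (1 - t)" by (simp add: right_diff_distrib)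
      moreover have "(y * t) powr (q - 2) = y powr (q - 2) * t powr (q - 2)" using True y by (simp add: powr_mult)
      moreover have "y powr (q - 1) = y * y powr (q - 2)" using y by (simp add: powr_mult_base)
      ultimately show ?thesis using True y by (simp add: ennreal_mult[symmetric] indicator_def mult_ac)
    next
      case False
      have "y * t > 0 \<longleftrightarrow> t > 0" using y by (simp add: zero_less_mult_iff)
      moreover have "max 0 (y - y * t) = 0" if "t > 1" using y that by (simp add: max_def mult_le_cancel_left1)
      ultimately show ?thesis using False by (cases "t = 0") (auto simp: indicator_def not_le)
    qed
  qed
  also have "ennreal y * \<dots> = ennreal (Beta (q - 1) 2 * y powr q)"
  proof -
    have "y powr q = y * y powr (q - 1)" using y by (simp add: powr_mult_base)
    moreover have "Beta (q - 1) 2 \<ge> 0" using has_integral_nonneg[OF I] by auto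
    ultimately show ?thesis using y
      unfolding nn_integral_cmult[of "\<lambda>t. ennreal (t powr (q - 2) * (1 - t)) * indicator {0..1} t" lborel, simplified] B
      by (simp add: ennreal_mult[symmetric] mult_ac)
  qed
  finally show ?thesis .
qed

section \<open>Bounds of the extension on L^p and the operator norm\<close>

context form_bounded_pair begin

text \<open>Each height s has its own decomposition and image, but all the images agree almost
  everywhere with \<open>extension f\<close>. So the layer inequalities concern one function and can
  be integrated in s; the common Beta factor is positive and finite and cancels.\<close>

lemma extension_Lp_bound:
  assumes q: "q > 1" and Mpos: "M > 0" and f[measurable]: "f \<in> borel_measurable \<mu>"
    and fin: "(\<integral>\<^sup>+x. ennreal (norm (f x) powr q) \<partial>\<mu>) < \<infinity>"
  shows "(\<integral>\<^sup>+x. ennreal (norm (extension f x) powr q) \<partial>\<mu>) \<le> ennreal (M powr q) * (\<integral>\<^sup>+x. ennreal (norm (f x) powr q) \<partial>\<mu>)"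
proof -
  have q1: "q \<ge> 1" using q by simp
  have "\<exists>h. weak_image \<mu> T' f h \<and> (\<integral>\<^sup>+x. ennreal (max 0 (norm (h x) - M * s)) \<partial>\<mu>) \<le> ennreal M * (\<integral>\<^sup>+x. ennreal (max 0 (norm (f x) - s)) \<partial>\<mu>)"
    if s: "s > 0" for s
  proof -
    from soft_truncation[OF f fin q1 s] obtain f1 f2 where
      f12: "integrable \<mu> f1" "f2 \<in> borel_measurable \<mu>" "\<And>x. f x = f1 x + f2 x" "\<And>x. norm (f2 x) \<le> s"
       "\<And>x. norm (f1 x) = max 0 (norm (f x) - s)" by blast
    obtain h1 where h1: "weak_image \<mu> T' f1 h1" "integrable \<mu> h1" "(LINT x|\<mu>. norm (h1 x)) \<le> M * (LINT x|\<mu>. norm (f1 x))"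
      using weak_image_L1[OF f12(1)] by blast
    \<comment> \<open>As \<open>h2\<close> is bounded by M s, the excess of |h1 + h2| over M s is at
      most |h1|.\<close>
    obtain h2 where h2: "weak_image \<mu> T' f2 h2" "AE x in \<mu>. norm (h2 x) \<le> M * s"
      using weak_image_Linf[OF f12(2), of s] f12(4) s by auto
    have w: "weak_image \<mu> T' f (\<lambda>x. h1 x + h2 x)"
      using weak_image_add[OF h1(1) h2(1)] unfolding f12(3)[abs_def, symmetric] .
    have "(\<integral>\<^sup>+x. ennreal (max 0 (norm (h1 x + h2 x) - M * s)) \<partial>\<mu>) \<le> (\<integral>\<^sup>+x. ennreal (norm (h1 x)) \<partial>\<mu>)"
    proof (rule nn_integral_mono_AE, use h2(2) in eventually_elim)
      case (elim x)
      then show ?case using norm_triangle_ineq[of "h1 x" "h2 x"] by (intro ennreal_leI) auto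
    qed
    also have "\<dots> = ennreal (LINT x|\<mu>. norm (h1 x))" using h1(2) by (intro nn_integral_eq_integral) auto
    also have "\<dots> \<le> ennreal (M * (LINT x|\<mu>. norm (f1 x)))" using h1(3) by (rule ennreal_leI)
    also have "\<dots> = ennreal M * (\<integral>\<^sup>+x. ennreal (norm (f1 x)) \<partial>\<mu>)"
      using f12(1) M by (subst nn_integral_eq_integral) (auto simp: ennreal_mult)
    finally show ?thesis using w unfolding f12(5) by blast
  qed
  note ex = this
  obtain h0 where w0: "weak_image \<mu> T' f h0" using ex[OF zero_less_one] by blast
  define g where "g = extension f"
  have gm[measurable]: "g \<in> borel_measurable \<mu>"
    using weak_image_extension[OF w0] by (simp add: g_def weak_image_def)
  have key: "(\<integral>\<^sup>+x. ennreal (max 0 (norm (g x) / M - s)) \<partial>\<mu>) \<le> (\<integral>\<^sup>+x. ennreal (max 0 (norm (f x) - s)) \<partial>\<mu>)" if s: "s > 0" for s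
  proof -
    from ex[OF s] obtain h where h: "weak_image \<mu> T' f h"
      "(\<integral>\<^sup>+x. ennreal (max 0 (norm (h x) - M * s)) \<partial>\<mu>) \<le> ennreal M * (\<integral>\<^sup>+x. ennreal (max 0 (norm (f x) - s)) \<partial>\<mu>)" by blast
    have "(\<integral>\<^sup>+x. ennreal (max 0 (norm (g x) / M - s)) \<partial>\<mu>) = (\<integral>\<^sup>+x. ennreal (1 / M) * ennreal (max 0 (norm (h x) - M * s)) \<partial>\<mu>)"
    proof (rule nn_integral_cong_AE, use extension_eq[OF h(1)] in eventually_elim)
      case (elim x)
      have "max 0 (norm (h x) / M - s) = (1 / M) * max 0 (norm (h x) - M * s)"
        using Mpos by (simp add: max_def field_simps)
      then have "ennreal (max 0 (norm (h x) / M - s)) = ennreal (1 / M) * ennreal (max 0 (norm (h x) - M * s))"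
        using Mpos by (simp only:) (rule ennreal_mult, auto)
      then show ?case using elim by (simp only: g_def)
    qed
    also have "\<dots> = ennreal (1 / M) * (\<integral>\<^sup>+x. ennreal (max 0 (norm (h x) - M * s)) \<partial>\<mu>)"
      using h(1) by (intro nn_integral_cmult) (auto simp: weak_image_def)
    also have "\<dots> \<le> ennreal (1 / M) * (ennreal M * (\<integral>\<^sup>+x. ennreal (max 0 (norm (f x) - s)) \<partial>\<mu>))"
      using h(2) by (rule mult_left_mono) simp
    also have "\<dots> = (\<integral>\<^sup>+x. ennreal (max 0 (norm (f x) - s)) \<partial>\<mu>)"
      using Mpos by (simp add: mult.assoc[symmetric] ennreal_mult[symmetric])
    finally show ?thesis .
  qed
  interpret P: pair_sigma_finite \<mu> lborel ..
  have layer: "(\<integral>\<^sup>+s. ennreal (indicator {0<..} s * s powr (q - 2)) * (\<integral>\<^sup>+x. ennreal (max 0 (k x - s)) \<partial>\<mu>) \<partial>lborel)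
      = ennreal (Beta (q - 1) 2) * (\<integral>\<^sup>+x. ennreal (k x powr q) \<partial>\<mu>)"
    if [measurable]: "k \<in> borel_measurable \<mu>" and k: "\<And>x. k x \<ge> 0" for k
  proof -
    have B: "Beta (q - 1) 2 \<ge> 0" using Beta_layer[OF q, of 1] q by (simp add: Beta_def Gamma_real_pos less_imp_le)
    have "(\<integral>\<^sup>+s. ennreal (indicator {0<..} s * s powr (q - 2)) * (\<integral>\<^sup>+x. ennreal (max 0 (k x - s)) \<partial>\<mu>) \<partial>lborel) =
        (\<integral>\<^sup>+s. \<integral>\<^sup>+x. ennreal (indicator {0<..} s * (max 0 (k x - s) * s powr (q - 2))) \<partial>\<mu> \<partial>lborel)"
    proof (rule nn_integral_cong)
      fix s :: real
      have "ennreal (indicator {0<..} s * s powr (q - 2)) * (\<integral>\<^sup>+x. ennreal (max 0 (k x - s)) \<partial>\<mu>) =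
        (\<integral>\<^sup>+x. ennreal (indicator {0<..} s * s powr (q - 2)) * ennreal (max 0 (k x - s)) \<partial>\<mu>)"
        by (rule nn_integral_cmult[symmetric]) measurable
      also have "\<dots> = (\<integral>\<^sup>+x. ennreal (indicator {0<..} s * (max 0 (k x - s) * s powr (q - 2))) \<partial>\<mu>)"
        by (intro nn_integral_cong) (subst ennreal_mult[symmetric], auto simp: mult_ac)
      finally show "ennreal (indicator {0<..} s * s powr (q - 2)) * (\<integral>\<^sup>+x. ennreal (max 0 (k x - s)) \<partial>\<mu>) =
        (\<integral>\<^sup>+x. ennreal (indicator {0<..} s * (max 0 (k x - s) * s powr (q - 2))) \<partial>\<mu>)" .
    qed
    also have "\<dots> = (\<integral>\<^sup>+x. \<integral>\<^sup>+s. ennreal (indicator {0<..} s * (max 0 (k x - s) * s powr (q - 2))) \<partial>lborel \<partial>\<mu>)"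
      by (rule P.Fubini') measurable
    also have "\<dots> = (\<integral>\<^sup>+x. ennreal (Beta (q - 1) 2) * ennreal (k x powr q) \<partial>\<mu>)"
      using B by (intro nn_integral_cong) (subst Beta_layer[OF q k], rule ennreal_mult, auto)
    finally show ?thesis by (simp add: nn_integral_cmult)
  qed
  have "ennreal (Beta (q - 1) 2) * (\<integral>\<^sup>+x. ennreal ((norm (g x) / M) powr q) \<partial>\<mu>) =
     (\<integral>\<^sup>+s. ennreal (indicator {0<..} s * s powr (q - 2)) * (\<integral>\<^sup>+x. ennreal (max 0 (norm (g x) / M - s)) \<partial>\<mu>) \<partial>lborel)"
    using Mpos by (intro layer[symmetric]) auto
  also have "\<dots> \<le> (\<integral>\<^sup>+s. ennreal (indicator {0<..} s * s powr (q - 2)) * (\<integral>\<^sup>+x. ennreal (max 0 (norm (f x) - s)) \<partial>\<mu>) \<partial>lborel)"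
  proof (rule nn_integral_mono)
    fix s :: real
    show "ennreal (indicator {0<..} s * s powr (q - 2)) * (\<integral>\<^sup>+x. ennreal (max 0 (norm (g x) / M - s)) \<partial>\<mu>)
      \<le> ennreal (indicator {0<..} s * s powr (q - 2)) * (\<integral>\<^sup>+x. ennreal (max 0 (norm (f x) - s)) \<partial>\<mu>)"
      using key[of s] by (cases "s > 0") (auto intro: mult_left_mono)
  qed
  also have "\<dots> = ennreal (Beta (q - 1) 2) * (\<integral>\<^sup>+x. ennreal (norm (f x) powr q) \<partial>\<mu>)"
    by (intro layer) auto
  finally have le: "(\<integral>\<^sup>+x. ennreal ((norm (g x) / M) powr q) \<partial>\<mu>) \<le> (\<integral>\<^sup>+x. ennreal (norm (f x) powr q) \<partial>\<mu>)"
  proof (rule ennreal_mult_le_mult_iff[THEN iffD1, rotated -1])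
    have "Beta (q - 1) 2 > 0" unfolding Beta_def using q by (intro divide_pos_pos mult_pos_pos Gamma_real_pos) auto
    then show "ennreal (Beta (q - 1) 2) \<noteq> 0" by simp
  qed simp
  have "(\<integral>\<^sup>+x. ennreal (norm (g x) powr q) \<partial>\<mu>) = (\<integral>\<^sup>+x. ennreal (M powr q) * ennreal ((norm (g x) / M) powr q) \<partial>\<mu>)"
    using Mpos by (intro nn_integral_cong) (simp add: ennreal_mult[symmetric] powr_divide)
  also have "\<dots> = ennreal (M powr q) * (\<integral>\<^sup>+x. ennreal ((norm (g x) / M) powr q) \<partial>\<mu>)" by (rule nn_integral_cmult) measurable
  also have "\<dots> \<le> ennreal (M powr q) * (\<integral>\<^sup>+x. ennreal (norm (f x) powr q) \<partial>\<mu>)" using le by (rule mult_left_mono) simp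
  finally show ?thesis by (simp add: g_def)
qed

lemma extension_bounded:
  assumes p: "1 \<le> p" and Mpos: "M > 0" and f: "f \<in> Lp \<mu> p"
  shows "extension f \<in> Lp \<mu> p \<and> Lp_norm \<mu> p (extension f) \<le> M * Lp_norm \<mu> p f"
proof -
  obtain h0 where w0: "weak_image \<mu> T' f h0" using weak_image_exists[OF p f] by blast
  have gm[measurable]: "extension f \<in> borel_measurable \<mu>"
    using weak_image_extension[OF w0] by (simp add: weak_image_def)
  have fm[measurable]: "f \<in> borel_measurable \<mu>" using f by (simp add: Lp_def)
  consider "p = \<infinity>" | "p = 1" | "p \<noteq> \<infinity>" "p > 1" using p by fastforce
  then show ?thesis
  proof cases
    case 1
    have "AE x in \<mu>. norm (f x) \<le> Lp_norm \<mu> \<infinity> f" using f 1 by (intro Linf_bound) simp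
    from weak_image_Linf[OF fm Lp_norm_nonneg this] obtain h where
      h: "weak_image \<mu> T' f h" "AE x in \<mu>. norm (h x) \<le> M * Lp_norm \<mu> \<infinity> f" by blast
    have b: "AE x in \<mu>. norm (extension f x) \<le> M * Lp_norm \<mu> \<infinity> f"
      using h(2) extension_eq[OF h(1)] by eventually_elim simp
    have M0: "0 \<le> M * Lp_norm \<mu> \<infinity> f" using M by (simp add: Lp_norm_nonneg)
    have "extension f \<in> Lp \<mu> \<infinity>" unfolding Linf_iff using b M0 gm by blast
    then show ?thesis using Lp_norm_infinity_le[OF gm M0 b] 1 by simp
  next
    case 2
    have fi: "integrable \<mu> f" using f 2 by (simp add: L1_iff)
    from weak_image_L1[OF fi] obtain h where
      h: "weak_image \<mu> T' f h" "integrable \<mu> h" "(LINT x|\<mu>. norm (h x)) \<le> M * (LINT x|\<mu>. norm (f x))" by blast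
    have e: "AE x in \<mu>. h x = extension f x" using extension_eq[OF h(1)] by eventually_elim simp
    have i: "integrable \<mu> (extension f)" by (rule integrable_cong_AE_imp[OF h(2) gm]) (use e in \<open>auto elim: eventually_mono\<close>)
    have "(LINT x|\<mu>. norm (extension f x)) = (LINT x|\<mu>. norm (h x))"
      using h(2) e by (intro integral_cong_AE) (auto elim: eventually_mono)
    then show ?thesis using h(3) i fi 2 by (simp add: L1_iff Lp_norm_1)
  next
    case 3
    let ?q = "enn2real p"
    have q: "?q > 1" using 3 by (cases p) auto
    have fin: "(\<integral>\<^sup>+x. ennreal (norm (f x) powr ?q) \<partial>\<mu>) < \<infinity>" using f 3 by (auto simp: Lp_def)
    note le = extension_Lp_bound[OF q Mpos fm fin]
    then have fin2: "(\<integral>\<^sup>+x. ennreal (norm (extension f x) powr ?q) \<partial>\<mu>) < \<infinity>"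
      using fin by (auto simp: ennreal_mult_less_top intro: le_less_trans)
    have "enn2real (\<integral>\<^sup>+x. ennreal (norm (extension f x) powr ?q) \<partial>\<mu>) \<le> M powr ?q * enn2real (\<integral>\<^sup>+x. ennreal (norm (f x) powr ?q) \<partial>\<mu>)"
      using enn2real_mono[OF le] fin by (simp add: enn2real_mult ennreal_mult_less_top)
    then have "enn2real (\<integral>\<^sup>+x. ennreal (norm (extension f x) powr ?q) \<partial>\<mu>) powr (1 / ?q) \<le>
        (M powr ?q * enn2real (\<integral>\<^sup>+x. ennreal (norm (f x) powr ?q) \<partial>\<mu>)) powr (1 / ?q)"
      using q by (intro powr_mono2) auto
    also have "\<dots> = M * enn2real (\<integral>\<^sup>+x. ennreal (norm (f x) powr ?q) \<partial>\<mu>) powr (1 / ?q)"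
      using q Mpos by (simp add: powr_mult powr_powr)
    finally show ?thesis using fin2 3 by (simp add: Lp_def Lp_norm_def)
  qed
qed

end

lemma (in form_bounded_pair) op_norm_le:
  assumes p: "1 \<le> p" and Mpos: "M > 0" and U: "\<And>f. f \<in> Lp \<mu> 2 \<Longrightarrow> AE x in \<mu>. U f x = T f x"
  shows "op_norm \<mu> p p U \<le> ennreal M"
  unfolding op_norm_def
proof (rule Inf_lower, intro CollectI exI[of _ M] exI[of _ extension] conjI ballI)
  have w: "weak_image \<mu> T' f (extension f)" if "f \<in> Lp \<mu> p" for f
    using weak_image_exists[OF p that] weak_image_extension by blast
  have m: "f \<in> borel_measurable \<mu>" if "f \<in> Lp \<mu> p" for f using that by (simp add: Lp_def)
  show "linear_op \<mu> (Lp \<mu> p) (Lp \<mu> p) extension"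
    unfolding linear_op_def
  proof (intro conjI ballI impI allI)
    fix f g assume f: "f \<in> Lp \<mu> p" "g \<in> Lp \<mu> p"
    show "AE x in \<mu>. extension f x = extension g x" if "AE x in \<mu>. f x = g x"
      by (rule extension_eq[OF weak_image_cong[OF w[OF f(2)]]]) (use that f m in \<open>auto elim: eventually_mono\<close>)
    show "AE x in \<mu>. extension (\<lambda>y. f y + g y) x = extension f x + extension g x"
      by (rule extension_eq[OF weak_image_add[OF w[OF f(1)] w[OF f(2)]]])
  next
    fix f c assume f: "f \<in> Lp \<mu> p"
    show "extension f \<in> Lp \<mu> p" using extension_bounded[OF p Mpos f] by simp
    show "AE x in \<mu>. extension (\<lambda>y. c * f y) x = c * extension f x"
      by (rule extension_eq[OF weak_image_scale[OF w[OF f]]])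
  qed
  fix f assume f: "f \<in> Lp \<mu> 2 \<inter> Lp \<mu> p"
  then show "AE x in \<mu>. extension f x = U f x"
    using extension_eq[OF weak_image_L2[of f]] U[of f] by (auto elim: eventually_elim2)
next
  fix f assume f: "f \<in> Lp \<mu> p"
  show "Lp_norm \<mu> p (extension f) \<le> M * Lp_norm \<mu> p f" using extension_bounded[OF p Mpos f] by simp
qed (use M in auto)

section \<open>Laplace and cosine representations of a Bessel-type function\<close>

text \<open>The Gamma integrand with complex rate p. Multiplying it by v ^ n only raises b by n, so
  power series in v integrate term by term to Gamma values.\<close>

definition gamma_kernel :: "real \<Rightarrow> complex \<Rightarrow> real \<Rightarrow> complex" where
  "gamma_kernel b p v = indicator {0<..} v *\<^sub>R (complex_of_real (v powr (b - 1)) * exp (- (p * complex_of_real v)))"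

lemma gamma_kernel_measurable[measurable]: "gamma_kernel b p \<in> borel_measurable borel"
proof -
  have "(\<lambda>v. exp (- (p * complex_of_real v))) \<in> borel_measurable borel"
    by (intro borel_measurable_continuous_onI continuous_intros)
  then show ?thesis unfolding gamma_kernel_def by measurable
qed

lemma norm_gamma_kernel: "norm (gamma_kernel b p v) = indicator {0<..} v * (v powr (b - 1) * exp (- Re p * v))"
  by (auto simp: gamma_kernel_def norm_mult indicator_def)

lemma nn_integral_gamma_kernel:
  assumes b: "b > 0" and r: "r > 0"
  shows "(\<integral>\<^sup>+v. ennreal (indicator {0<..} v * (v powr (b - 1) * exp (- r * v))) \<partial>lborel) = ennreal (Gamma b * r powr (- b))"
proof -
  have "ennreal (Gamma b) = (\<integral>\<^sup>+t. ennreal (indicator {0..} t * t powr (b - 1) / exp t) \<partial>lborel)"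
    using b by (rule Gamma_conv_nn_integral_real)
  also have "\<dots> = ennreal r * (\<integral>\<^sup>+v. ennreal (indicator {0..} (0 + r * v) * (0 + r * v) powr (b - 1) / exp (0 + r * v)) \<partial>lborel)"
    using r by (subst nn_integral_real_affine[of _ r 0]) auto
  also have "(\<integral>\<^sup>+v. ennreal (indicator {0..} (0 + r * v) * (0 + r * v) powr (b - 1) / exp (0 + r * v)) \<partial>lborel)
    = (\<integral>\<^sup>+v. ennreal (r powr (b - 1)) * ennreal (indicator {0<..} v * (v powr (b - 1) * exp (- r * v))) \<partial>lborel)"
  proof (rule nn_integral_cong)
    fix v :: real
    show "ennreal (indicator {0..} (0 + r * v) * (0 + r * v) powr (b - 1) / exp (0 + r * v)) =
      ennreal (r powr (b - 1)) * ennreal (indicator {0<..} v * (v powr (b - 1) * exp (- r * v)))"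
    proof (cases "v > 0")
      case True
      then show ?thesis using r
        by (simp add: ennreal_mult[symmetric] powr_mult exp_minus divide_inverse mult_ac)
    next
      case False
      then show ?thesis using r by (cases "v = 0") (auto simp: indicator_def zero_le_mult_iff)
    qed
  qed
  also have "\<dots> = ennreal (r powr (b - 1)) * (\<integral>\<^sup>+v. ennreal (indicator {0<..} v * (v powr (b - 1) * exp (- r * v))) \<partial>lborel)"
    by (rule nn_integral_cmult) measurable
  finally have "ennreal (Gamma b) = ennreal (r powr b) * (\<integral>\<^sup>+v. ennreal (indicator {0<..} v * (v powr (b - 1) * exp (- r * v))) \<partial>lborel)"
    using r by (simp add: mult.assoc[symmetric] ennreal_mult[symmetric] powr_mult_base)
  then have "ennreal (r powr (- b)) * ennreal (Gamma b) =
      ennreal (r powr (- b)) * ennreal (r powr b) * (\<integral>\<^sup>+v. ennreal (indicator {0<..} v * (v powr (b - 1) * exp (- r * v))) \<partial>lborel)"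
    by (simp add: mult.assoc)
  moreover have "ennreal (r powr (- b)) * ennreal (r powr b) = 1"
    using r by (simp add: ennreal_mult[symmetric] powr_add[symmetric])
  ultimately show ?thesis using b by (simp add: ennreal_mult[symmetric] mult.commute Gamma_real_nonneg)
qed

lemma integrable_gamma_kernel:
  assumes b: "b > 0" and p: "Re p > 0"
  shows "integrable lborel (gamma_kernel b p)"
    and "(LINT v|lborel. norm (gamma_kernel b p v)) = Gamma b * Re p powr (- b)"
proof -
  have nn: "(\<integral>\<^sup>+v. ennreal (norm (gamma_kernel b p v)) \<partial>lborel) = ennreal (Gamma b * Re p powr (- b))"
    unfolding norm_gamma_kernel by (rule nn_integral_gamma_kernel[OF b p])
  then show "integrable lborel (gamma_kernel b p)" by (simp add: integrable_iff_bounded)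
  show "(LINT v|lborel. norm (gamma_kernel b p v)) = Gamma b * Re p powr (- b)"
    using nn b by (subst integral_eq_nn_integral) (auto simp: Gamma_real_nonneg)
qed

lemma gamma_kernel_of_real: "gamma_kernel b (complex_of_real r) v = complex_of_real (indicator {0<..} v * (v powr (b - 1) * exp (- r * v)))"
  by (simp add: gamma_kernel_def indicator_def exp_of_real[symmetric])

lemma gamma_kernel_power:
  "gamma_kernel b p v * complex_of_real v ^ n = gamma_kernel (b + real n) p v"
proof (cases "v > 0")
  case True
  have "v powr (b + real n - 1) = v powr (b - 1) * v ^ n"
    using powr_add[of v "b - 1" "real n"] True by (simp add: powr_realpow algebra_simps)
  then show ?thesis using True by (simp add: gamma_kernel_def mult_ac)
qed (simp add: gamma_kernel_def)

lemma integral_gamma_kernel_real: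
  assumes b: "b > 0" and r: "r > 0"
  shows "(LINT v|lborel. gamma_kernel b (complex_of_real r) v) = complex_of_real (Gamma b * r powr (- b))"
proof -
  have "(LINT v|lborel. gamma_kernel b (complex_of_real r) v) = complex_of_real (LINT v|lborel. norm (gamma_kernel b (complex_of_real r) v))"
    unfolding norm_gamma_kernel unfolding gamma_kernel_of_real integral_complex_of_real by simp
  then show ?thesis using integrable_gamma_kernel(2)[of b "complex_of_real r"] b r by simp
qed

lemma Gamma_add_nat: "b > (0::real) \<Longrightarrow> Gamma (b + real n) = Gamma b * pochhammer b n"
proof -
  assume b: "b > 0"
  then have "b \<notin> \<int>\<^sub>\<le>\<^sub>0" by (auto elim!: nonpos_Ints_cases)
  then show ?thesis using pochhammer_Gamma[of b n] Gamma_real_pos[OF b] by simp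
qed

text \<open>Expanding the exponential about a large real point \<open>p\<^sub>0\<close> with \<open>|p - p\<^sub>0| < p\<^sub>0\<close>
  turns the claim into the binomial series.\<close>
lemma integral_gamma_kernel:
  assumes b: "b > 0" and p: "Re p > 0"
  shows "(LINT v|lborel. gamma_kernel b p v) = complex_of_real (Gamma b) * p powr (- complex_of_real b)"
proof -
  \<comment> \<open>|p0 - p|^2 = p0^2 - 2 p0 Re p + |p|^2 is below p0^2 as soon as 2 p0 Re p >
    |p|^2; this choice exceeds the requirement by 2 Re p.\<close>
  define p0 where "p0 = (norm p)\<^sup>2 / (2 * Re p) + 1"
  define h where "h = complex_of_real p0 - p"
  have p0: "p0 > 0" using p by (simp add: p0_def add_nonneg_pos)
  have "(norm h)\<^sup>2 = p0\<^sup>2 - 2 * p0 * Re p + (norm p)\<^sup>2"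
    unfolding h_def cmod_power2 by (simp add: power2_eq_square algebra_simps)
  also have "2 * p0 * Re p = (norm p)\<^sup>2 + 2 * Re p" using p by (simp add: p0_def field_simps)
  finally have "(norm h)\<^sup>2 < p0\<^sup>2" using p by simp
  then have hlt: "norm h < p0" using p0 by (simp add: power2_less_imp_less)
  define f where "f n v = (h ^ n / fact n) * gamma_kernel (b + real n) (complex_of_real p0) v" for n v
  have fsums: "(\<lambda>n. f n v) sums gamma_kernel b p v" for v
  proof -
    have "(\<lambda>n. (h * complex_of_real v) ^ n /\<^sub>R fact n) sums exp (h * complex_of_real v)" by (rule exp_converges)
    then have "(\<lambda>n. gamma_kernel b (complex_of_real p0) v * ((h * complex_of_real v) ^ n /\<^sub>R fact n)) sums
        (gamma_kernel b (complex_of_real p0) v * exp (h * complex_of_real v))" by (rule sums_mult)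
    moreover have "gamma_kernel b (complex_of_real p0) v * exp (h * complex_of_real v) = gamma_kernel b p v"
      by (simp add: gamma_kernel_def h_def mult.assoc exp_add[symmetric] left_diff_distrib)
    moreover have "gamma_kernel b (complex_of_real p0) v * ((h * complex_of_real v) ^ n /\<^sub>R fact n) = f n v" for n
      unfolding f_def gamma_kernel_power[symmetric]
      by (simp add: scaleR_conv_of_real power_mult_distrib divide_inverse mult_ac)
    ultimately show ?thesis by simp
  qed
  have fi: "integrable lborel (f n)" for n
    unfolding f_def using b p0 by (intro integrable_mult_right integrable_gamma_kernel) auto
  have fint: "(LINT v|lborel. f n v) = complex_of_real (Gamma b * p0 powr (- b)) * (((- complex_of_real b) gchoose n) * (- h / complex_of_real p0) ^ n)" for n
  proof -
    have "(LINT v|lborel. f n v) = (h ^ n / fact n) * complex_of_real (Gamma (b + real n) * p0 powr (- (b + real n)))"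
      unfolding f_def using b p0 by (simp add: integral_gamma_kernel_real)
    also have "Gamma (b + real n) * p0 powr (- (b + real n)) = Gamma b * p0 powr (- b) * (pochhammer b n / p0 ^ n)"
      using b p0 by (simp add: Gamma_add_nat powr_diff powr_realpow)
    finally show ?thesis
      by (simp add: gbinomial_pochhammer power_divide power_minus[of h] pochhammer_of_real[symmetric] field_simps power_mult_distrib[symmetric])
  qed
  have fnorm: "(LINT v|lborel. norm (f n v)) = (Gamma b * p0 powr (- b)) * (((- b) gchoose n) * (- norm h / p0) ^ n)" for n
  proof -
    have "(LINT v|lborel. norm (f n v)) = (norm h ^ n / fact n) * (Gamma (b + real n) * p0 powr (- (b + real n)))"
      unfolding f_def using b p0 integrable_gamma_kernel(2)[of "b + real n" "complex_of_real p0"]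
      by (simp add: norm_mult norm_divide norm_power)
    also have "Gamma (b + real n) * p0 powr (- (b + real n)) = Gamma b * p0 powr (- b) * (pochhammer b n / p0 ^ n)"
      using b p0 by (simp add: Gamma_add_nat powr_diff powr_realpow)
    finally show ?thesis
      by (simp add: gbinomial_pochhammer power_divide power_minus[of "norm h"] field_simps power_mult_distrib[symmetric])
  qed
  have "norm (- h / complex_of_real p0) < 1" using hlt p0 by (simp add: norm_divide)
  from gen_binomial_complex[OF this, of "- complex_of_real b"]
  have s1: "(\<lambda>n. LINT v|lborel. f n v) sums (complex_of_real (Gamma b * p0 powr (- b)) * (1 + - h / complex_of_real p0) powr (- complex_of_real b))"
    unfolding fint by (rule sums_mult)
  have "\<bar>- norm h / p0\<bar> < 1" using hlt p0 by simp
  from sums_summable[OF gen_binomial_real[OF this, of "- b"]]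
  have s2: "summable (\<lambda>n. LINT v|lborel. norm (f n v))" unfolding fnorm by (rule summable_mult)
  have s3: "summable (\<lambda>n. norm (f n v))" for v
  proof -
    have "(\<lambda>n. (norm h * v) ^ n /\<^sub>R fact n) sums exp (norm h * v)" by (rule exp_converges)
    then have "summable (\<lambda>n. norm (gamma_kernel b (complex_of_real p0) v) * ((norm h * v) ^ n /\<^sub>R fact n))"
      by (intro summable_mult sums_summable)
    moreover have "norm (gamma_kernel b (complex_of_real p0) v) * ((norm h * v) ^ n /\<^sub>R fact n) = norm (f n v)" for n
      unfolding f_def gamma_kernel_power[symmetric]
      by (cases "v > 0") (simp_all add: norm_gamma_kernel norm_mult norm_divide norm_inverse norm_power power_mult_distrib divide_inverse mult_ac)
    ultimately show ?thesis by (simp only:)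
  qed
  have "(\<lambda>n. LINT v|lborel. f n v) sums (LINT v|lborel. (\<Sum>n. f n v))"
    by (rule sums_integral[OF fi AE_I2[OF s3] s2])
  also have "(\<lambda>v. \<Sum>n. f n v) = gamma_kernel b p" using fsums by (auto simp: sums_iff)
  finally have "(LINT v|lborel. gamma_kernel b p v) = complex_of_real (Gamma b * p0 powr (- b)) * (1 + - h / complex_of_real p0) powr (- complex_of_real b)"
    using s1 by (auto dest: sums_unique2)
  also have "1 + - h / complex_of_real p0 = p / complex_of_real p0" using p0 by (simp add: h_def field_simps)
  also have "complex_of_real (Gamma b * p0 powr (- b)) * (p / complex_of_real p0) powr (- complex_of_real b) =
     complex_of_real (Gamma b) * (complex_of_real p0 powr (- complex_of_real b) * (p / complex_of_real p0) powr (- complex_of_real b))"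
    using p0 by (simp add: powr_of_real[symmetric] mult.assoc)
  also have "complex_of_real p0 powr (- complex_of_real b) * (p / complex_of_real p0) powr (- complex_of_real b) = p powr (- complex_of_real b)"
    using p0 by (subst powr_times_real_left[symmetric]) auto
  finally show ?thesis .
qed

definition psi_coeff :: "real \<Rightarrow> nat \<Rightarrow> real" where
  "psi_coeff b k = (- 1 / 4) ^ k / (fact k * Gamma (b + real k))"

text \<open>For x > 0, \<open>psi b (x\<^sup>2)\<close> is (x / 2) powr (1 - b) times the Bessel
  function of the first kind of order b - 1.\<close>

definition psi :: "real \<Rightarrow> real \<Rightarrow> real" where
  "psi b y = (\<Sum>k. psi_coeff b k * y ^ k)"

text \<open>Each factor b + i of the Pochhammer symbol is at least 1/2, so dividing by Gamma (b + k)
  costs at most 2 ^ k, and k! still makes the series entire.\<close>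

lemma psi_coeff_bound:
  assumes b: "b \<ge> 1/2" shows "\<bar>psi_coeff b k\<bar> \<le> (1/2) ^ k / (fact k * Gamma b)"
proof -
  have G: "Gamma b > 0" using b by (intro Gamma_real_pos) auto
  have "(1/2) ^ k \<le> pochhammer b k"
    unfolding pochhammer_prod using b prod_mono[of "{0..<k}" "\<lambda>_. 1/2" "\<lambda>i. b + real i"] by simp
  then have "Gamma b * (1/2) ^ k \<le> Gamma (b + real k)" using b G by (simp add: Gamma_add_nat)
  moreover have "Gamma b * (1/2) ^ k > 0" using G by simp
  ultimately have "1 / Gamma (b + real k) \<le> 1 / (Gamma b * (1/2) ^ k)" by (intro divide_left_mono) auto
  then have "(1/4) ^ k / fact k * (1 / Gamma (b + real k)) \<le> (1/4) ^ k / fact k * (1 / (Gamma b * (1/2) ^ k))"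
    by (intro mult_left_mono) auto
  also have "\<dots> = (1/2) ^ k / (fact k * Gamma b)"
  proof -
    have "(1/4::real) ^ k = (1/2) ^ k * (1/2) ^ k" by (simp add: power_mult_distrib[symmetric])
    then show ?thesis by simp
  qed
  finally show ?thesis
    using b by (simp add: psi_coeff_def abs_mult power_abs Gamma_real_nonneg)
qed

lemma summable_psi_norm: assumes b: "b \<ge> 1/2" shows "summable (\<lambda>k. \<bar>psi_coeff b k * y ^ k\<bar>)"
proof (rule summable_comparison_test')
  show "summable (\<lambda>k. (\<bar>y\<bar> / 2) ^ k /\<^sub>R fact k * (1 / Gamma b))"
    by (intro summable_mult2 sums_summable[OF exp_converges])
  fix k
  have "\<bar>psi_coeff b k\<bar> * \<bar>y\<bar> ^ k \<le> (1/2) ^ k / (fact k * Gamma b) * \<bar>y\<bar> ^ k"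
    using psi_coeff_bound[OF b] by (intro mult_right_mono) auto
  also have "(1/2) ^ k / (fact k * Gamma b) * \<bar>y\<bar> ^ k = (\<bar>y\<bar> / 2) ^ k /\<^sub>R fact k * (1 / Gamma b)"
    by (simp add: power_divide field_simps)
  also have "\<bar>psi_coeff b k\<bar> * \<bar>y\<bar> ^ k = norm \<bar>psi_coeff b k * y ^ k\<bar>" by (simp add: abs_mult power_abs)
  finally show "norm \<bar>psi_coeff b k * y ^ k\<bar> \<le> (\<bar>y\<bar> / 2) ^ k /\<^sub>R fact k * (1 / Gamma b)" .
qed

lemma summable_psi: "b \<ge> 1/2 \<Longrightarrow> summable (\<lambda>k. psi_coeff b k * y ^ k)"
  by (rule summable_rabs_cancel[OF summable_psi_norm])

lemma psi_sums: "b \<ge> 1/2 \<Longrightarrow> (\<lambda>k. psi_coeff b k * y ^ k) sums psi b y"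
  unfolding psi_def by (rule summable_sums[OF summable_psi])

text \<open>Term by term, the moment of \<open>gamma_kernel\<close> produces Gamma (b + k), which
  cancels the one in \<open>psi_coeff\<close> and leaves the exponential series. The same
  computation with Re p gives absolute convergence.\<close>

lemma Laplace_psi:
  assumes b: "b \<ge> 1/2" and p: "Re p > 0" and u: "u \<ge> 0"
  shows "integrable lborel (\<lambda>v. gamma_kernel b p v * complex_of_real (psi b (v * u)))"
    and "(LINT v|lborel. gamma_kernel b p v * complex_of_real (psi b (v * u))) =
      p powr (- complex_of_real b) * exp (- complex_of_real u / (4 * p))"
proof -
  have b0: "b > 0" using b by simp
  define f where "f k v = complex_of_real (psi_coeff b k * u ^ k) * gamma_kernel (b + real k) p v" for k v
  have fe: "f k v = gamma_kernel b p v * complex_of_real (psi_coeff b k * (v * u) ^ k)" for k v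
    unfolding f_def gamma_kernel_power[symmetric] by (simp add: power_mult_distrib mult_ac)
  have fsums: "(\<lambda>k. f k v) sums (gamma_kernel b p v * complex_of_real (psi b (v * u)))" for v
    unfolding fe by (intro sums_mult sums_of_real psi_sums b)
  have fi: "integrable lborel (f k)" for k
    unfolding f_def using b0 p by (intro integrable_mult_right integrable_gamma_kernel) auto
  have s3: "summable (\<lambda>k. norm (f k v))" for v
    unfolding fe norm_mult norm_of_real by (intro summable_mult summable_psi_norm b)
  have G: "Gamma (b + real k) > 0" for k using b0 by (intro Gamma_real_pos) auto
  have pn: "p \<noteq> 0" using p by auto
  have fint: "(LINT v|lborel. f k v) = p powr (- complex_of_real b) * ((- complex_of_real u / (4 * p)) ^ k /\<^sub>R fact k)" for k
  proof -
    have "(LINT v|lborel. f k v) = complex_of_real (psi_coeff b k * u ^ k) * (complex_of_real (Gamma (b + real k)) * p powr (- complex_of_real (b + real k)))"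
      unfolding f_def using b0 p by (simp add: integral_gamma_kernel)
    also have "p powr (- complex_of_real (b + real k)) = p powr (- complex_of_real b) / p ^ k"
      using pn by (simp add: powr_diff powr_nat')
    also have "complex_of_real (psi_coeff b k * u ^ k) * (complex_of_real (Gamma (b + real k)) * (p powr (- complex_of_real b) / p ^ k)) =
       p powr (- complex_of_real b) * (complex_of_real (psi_coeff b k * Gamma (b + real k)) * complex_of_real u ^ k / p ^ k)"
      by (simp add: mult_ac)
    also have "psi_coeff b k * Gamma (b + real k) = (- 1 / 4) ^ k / fact k" using G[of k] by (simp add: psi_coeff_def)
    also have "complex_of_real ((- 1 / 4) ^ k / fact k) * complex_of_real u ^ k / p ^ k = (- complex_of_real u / (4 * p)) ^ k /\<^sub>R fact k"
    proof -
      have "- complex_of_real u / (4 * p) = complex_of_real (- 1 / 4) * complex_of_real u / p" by simp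
      then have "(- complex_of_real u / (4 * p)) ^ k = complex_of_real (- 1 / 4) ^ k * complex_of_real u ^ k / p ^ k"
        by (simp only: power_divide power_mult_distrib)
      also have "complex_of_real (- 1 / 4) ^ k = complex_of_real ((- 1 / 4) ^ k)" by (rule of_real_power[symmetric])
      finally have e: "(- complex_of_real u / (4 * p)) ^ k = complex_of_real ((- 1 / 4) ^ k) * complex_of_real u ^ k / p ^ k" .
      have "complex_of_real (c / d) * U / P = (complex_of_real c * U / P) /\<^sub>R d" for c d U P
        by (simp add: scaleR_conv_of_real divide_inverse mult_ac)
      then show ?thesis unfolding e by blast
    qed
    finally show ?thesis .
  qed
  have fnorm: "(LINT v|lborel. norm (f k v)) = Re p powr (- b) * ((u / (4 * Re p)) ^ k /\<^sub>R fact k)" for k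
  proof -
    have "(LINT v|lborel. norm (f k v)) = \<bar>psi_coeff b k * u ^ k\<bar> * (Gamma (b + real k) * Re p powr (- (b + real k)))"
      unfolding f_def norm_mult norm_of_real using b0 p integrable_gamma_kernel(2)[of "b + real k" p] by simp
    also have "Re p powr (- (b + real k)) = Re p powr (- b) / Re p ^ k" using p by (simp add: powr_diff powr_realpow)
    also have "\<bar>psi_coeff b k * u ^ k\<bar> = (1 / 4) ^ k / (fact k * Gamma (b + real k)) * u ^ k"
      using G[of k] u by (simp add: psi_coeff_def abs_mult power_abs)
    finally have "(LINT v|lborel. norm (f k v)) = Re p powr (- b) * (((1 / 4) ^ k * u ^ k / Re p ^ k) / fact k)"
      using G[of k] by (simp add: mult_ac)
    moreover have "(u / (4 * Re p)) ^ k = (1 / 4 * u / Re p) ^ k" by simp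
    then have "(u / (4 * Re p)) ^ k = (1 / 4) ^ k * u ^ k / Re p ^ k" by (simp only: power_divide power_mult_distrib)
    moreover have "R * (X / d) = R * (X /\<^sub>R d)" for R X d :: real by (simp add: divide_inverse)
    ultimately show ?thesis by (simp only:)
  qed
  have s2: "summable (\<lambda>k. LINT v|lborel. norm (f k v))"
    unfolding fnorm by (intro summable_mult sums_summable[OF exp_converges])
  have eq: "(\<lambda>v. \<Sum>k. f k v) = (\<lambda>v. gamma_kernel b p v * complex_of_real (psi b (v * u)))"
    using fsums by (auto simp: sums_iff)
  show "integrable lborel (\<lambda>v. gamma_kernel b p v * complex_of_real (psi b (v * u)))"
    using integrable_suminf[OF fi AE_I2[OF s3] s2] unfolding eq .
  have "(\<lambda>k. LINT v|lborel. f k v) sums (LINT v|lborel. gamma_kernel b p v * complex_of_real (psi b (v * u)))"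
    using sums_integral[OF fi AE_I2[OF s3] s2] unfolding eq .
  moreover have "(\<lambda>k. LINT v|lborel. f k v) sums (p powr (- complex_of_real b) * exp (- complex_of_real u / (4 * p)))"
    unfolding fint by (intro sums_mult exp_converges)
  ultimately show "(LINT v|lborel. gamma_kernel b p v * complex_of_real (psi b (v * u))) =
      p powr (- complex_of_real b) * exp (- complex_of_real u / (4 * p))" by (rule sums_unique2)
qed

section \<open>Differential equation and decay of \<open>psi\<close>\<close>

lemma psi_coeff_Suc:
  assumes b: "b > 0"
  shows "4 * (real k + 1) * (b + real k) * psi_coeff b (Suc k) = - psi_coeff b k"
proof -
  have "b + real k \<notin> \<int>\<^sub>\<le>\<^sub>0" using b by (auto elim!: nonpos_Ints_cases)
  then have "Gamma (b + real k + 1) = (b + real k) * Gamma (b + real k)" by (rule Gamma_plus1)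
  then have G: "Gamma (b + real (Suc k)) = (b + real k) * Gamma (b + real k)" by (simp add: add_ac)
  have gen: "4 * x * y * ((- 1 / 4) * e / (x * F * (y * g))) = - (e / (F * g))" if "x \<noteq> 0" "y \<noteq> 0" for x y e F g :: real
    using that by simp
  have pc: "psi_coeff b (Suc k) = (- 1 / 4) * (- 1 / 4) ^ k / ((real k + 1) * fact k * ((b + real k) * Gamma (b + real k)))"
    unfolding psi_coeff_def G by (simp only: power_Suc fact_Suc of_nat_Suc add_ac)
  have "real k + 1 \<noteq> 0" "b + real k \<noteq> 0" using b by auto
  from gen[OF this] show ?thesis unfolding pc psi_coeff_def[of b k] .
qed

definition psi1 :: "real \<Rightarrow> real \<Rightarrow> real" where "psi1 b y = (\<Sum>k. diffs (psi_coeff b) k * y ^ k)"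
definition psi2 :: "real \<Rightarrow> real \<Rightarrow> real" where "psi2 b y = (\<Sum>k. diffs (diffs (psi_coeff b)) k * y ^ k)"

lemma summable_psi1: "b \<ge> 1/2 \<Longrightarrow> summable (\<lambda>k. diffs (psi_coeff b) k * y ^ k)"
  by (rule termdiff_converges_all) (rule summable_psi)

lemma summable_psi2: "b \<ge> 1/2 \<Longrightarrow> summable (\<lambda>k. diffs (diffs (psi_coeff b)) k * y ^ k)"
  by (rule termdiff_converges_all) (rule summable_psi1)

lemma psi_deriv: "b \<ge> 1/2 \<Longrightarrow> (psi b has_real_derivative psi1 b y) (at y)"
  unfolding psi_def[abs_def] psi1_def by (rule termdiffs_strong_converges_everywhere) (rule summable_psi)

lemma psi1_deriv: "b \<ge> 1/2 \<Longrightarrow> (psi1 b has_real_derivative psi2 b y) (at y)"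
  unfolding psi1_def[abs_def] psi2_def by (rule termdiffs_strong_converges_everywhere) (rule summable_psi1)

text \<open>Bessel's equation in the variable y = x^2, read off from the recursion of the
  coefficients.\<close>

lemma psi_ode: assumes b: "b \<ge> 1/2" shows "4 * y * psi2 b y + 4 * b * psi1 b y + psi b y = 0"
proof -
  let ?c = "psi_coeff b"
  have "(\<lambda>k. diffs (diffs ?c) k * y ^ k) sums psi2 b y"
    unfolding psi2_def by (rule summable_sums[OF summable_psi2[OF b]])
  then have "(\<lambda>k. y * (diffs (diffs ?c) k * y ^ k)) sums (y * psi2 b y)" by (rule sums_mult)
  then have "(\<lambda>k. (\<lambda>k. real k * diffs ?c k * y ^ k) (Suc k)) sums (y * psi2 b y)"
    by (simp add: diffs_def mult_ac)
  then have 1: "(\<lambda>k. real k * diffs ?c k * y ^ k) sums (y * psi2 b y)"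
    by (subst (asm) sums_Suc_iff) simp
  have 2: "(\<lambda>k. diffs ?c k * y ^ k) sums psi1 b y"
    unfolding psi1_def by (rule summable_sums[OF summable_psi1[OF b]])
  have "(\<lambda>k. 4 * (real k * diffs ?c k * y ^ k) + 4 * b * (diffs ?c k * y ^ k) + ?c k * y ^ k) sums
      (4 * (y * psi2 b y) + 4 * b * psi1 b y + psi b y)"
    by (intro sums_add sums_mult 1 2 psi_sums b)
  moreover have "4 * (real k * diffs ?c k * y ^ k) + 4 * b * (diffs ?c k * y ^ k) + ?c k * y ^ k = 0" for k
  proof -
    have "4 * (real k * diffs ?c k * y ^ k) + 4 * b * (diffs ?c k * y ^ k) + ?c k * y ^ k =
        (4 * (real k + 1) * (b + real k) * ?c (Suc k) + ?c k) * y ^ k"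
      by (simp add: diffs_def algebra_simps)
    then show ?thesis using psi_coeff_Suc[of b k] b by simp
  qed
  ultimately have "(\<lambda>k::nat. 0) sums (4 * (y * psi2 b y) + 4 * b * psi1 b y + psi b y)" by simp
  then show ?thesis using sums_unique2[OF sums_zero] by (simp add: mult.assoc)
qed

text \<open>With \<open>w x = x\<^sup>a \<psi>(x\<^sup>2)\<close> the differential equation reads \<open>w'' = - w + a (a - 1) w / x\<^sup>2\<close>,
  so the energy \<open>w\<^sup>2 + w'\<^sup>2\<close> stays bounded at infinity.\<close>
lemma psi_decay_at_top:
  assumes a: "a > 0"
  shows "\<exists>K. \<forall>x\<ge>1. \<bar>x powr a * psi (a + 1/2) (x\<^sup>2)\<bar> \<le> K"
proof -
  let ?b = "a + 1/2"
  have b: "?b \<ge> 1/2" using a by simp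
  define w where "w x = x powr a * psi ?b (x\<^sup>2)" for x
  define v where "v x = a * x powr (a - 1) * psi ?b (x\<^sup>2) + 2 * x powr (a + 1) * psi1 ?b (x\<^sup>2)" for x
  define c where "c = \<bar>a * (a - 1)\<bar>"
  \<comment> \<open>The derivative of w^2 + v^2 is at most c / x^2 times w^2 + v^2, because 2 |w v|
    \<le> w^2 + v^2; exp (c / x) is the integrating factor that makes the product
    nonincreasing.\<close>
  define En where "En x = ((w x)\<^sup>2 + (v x)\<^sup>2) * exp (c / x)" for x
  have dw: "(w has_real_derivative v x) (at x)" if x: "x > 0" for x
  proof -
    have "(w has_real_derivative (a * x powr (a - 1)) * psi ?b (x\<^sup>2) + x powr a * (psi1 ?b (x\<^sup>2) * (2 * x))) (at x)"
      unfolding w_def using x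
      by (auto intro!: derivative_eq_intros DERIV_chain2[OF psi_deriv[OF b]] simp: has_real_derivative_powr)
    moreover have "x powr (a + 1) = x powr a * x" using x by (simp add: powr_add)
    ultimately show ?thesis by (simp add: v_def mult_ac)
  qed
  have dv: "(v has_real_derivative (- w x + a * (a - 1) * w x / x\<^sup>2)) (at x)" if x: "x > 0" for x
  proof -
    have "(v has_real_derivative (a * ((a - 1) * x powr (a - 1 - 1)) * psi ?b (x\<^sup>2) + a * x powr (a - 1) * (psi1 ?b (x\<^sup>2) * (2 * x))
       + (2 * ((a + 1) * x powr (a + 1 - 1)) * psi1 ?b (x\<^sup>2) + 2 * x powr (a + 1) * (psi2 ?b (x\<^sup>2) * (2 * x))))) (at x)"
      unfolding v_def using x
      by (auto intro!: derivative_eq_intros DERIV_chain2[OF psi_deriv[OF b]] DERIV_chain2[OF psi1_deriv[OF b]] simp: has_real_derivative_powr)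
    moreover have "a * ((a - 1) * x powr (a - 1 - 1)) * psi ?b (x\<^sup>2) + a * x powr (a - 1) * (psi1 ?b (x\<^sup>2) * (2 * x))
       + (2 * ((a + 1) * x powr (a + 1 - 1)) * psi1 ?b (x\<^sup>2) + 2 * x powr (a + 1) * (psi2 ?b (x\<^sup>2) * (2 * x)))
       = - w x + a * (a - 1) * w x / x\<^sup>2"
    proof -
      have p: "x powr (a - 1 - 1) = x powr a / x\<^sup>2" "x powr (a - 1) = x powr a / x" "x powr (a + 1) = x powr a * x"
        using x by (auto simp: powr_diff powr_add power2_eq_square)
      have e: "4 * (a + 1/2) = 4 * a + 2" by simp
      have ode: "4 * x\<^sup>2 * psi2 ?b (x\<^sup>2) + (4 * a + 2) * psi1 ?b (x\<^sup>2) = - psi ?b (x\<^sup>2)"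
        using psi_ode[OF b, of "x\<^sup>2"] unfolding e by linarith
      have "a * ((a - 1) * x powr (a - 1 - 1)) * psi ?b (x\<^sup>2) + a * x powr (a - 1) * (psi1 ?b (x\<^sup>2) * (2 * x))
       + (2 * ((a + 1) * x powr (a + 1 - 1)) * psi1 ?b (x\<^sup>2) + 2 * x powr (a + 1) * (psi2 ?b (x\<^sup>2) * (2 * x)))
        = a * (a - 1) * (x powr a * psi ?b (x\<^sup>2)) / x\<^sup>2 + x powr a * (4 * x\<^sup>2 * psi2 ?b (x\<^sup>2) + (4 * a + 2) * psi1 ?b (x\<^sup>2))"
        unfolding p using x by (simp add: field_simps power2_eq_square)
      then show ?thesis unfolding ode w_def by simp
    qed
    ultimately show ?thesis by simp
  qed
  have dE: "\<exists>y. (En has_real_derivative y) (at x) \<and> y \<le> 0" if x: "x \<ge> 1" for x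
  proof -
    have x0: "x > 0" using x by simp
    let ?y = "(2 * w x * v x + 2 * v x * (- w x + a * (a - 1) * w x / x\<^sup>2)) * exp (c / x) + ((w x)\<^sup>2 + (v x)\<^sup>2) * (exp (c / x) * (- c / x\<^sup>2))"
    have "((\<lambda>x. exp (c / x)) has_real_derivative exp (c / x) * (- c / x\<^sup>2)) (at x)"
      using x0 by (auto intro!: derivative_eq_intros simp: power2_eq_square)
    then have "(En has_real_derivative ?y) (at x)"
      unfolding En_def using dw[OF x0] dv[OF x0] x0 by (auto intro!: derivative_eq_intros simp: power2_eq_square algebra_simps)
    moreover have "?y \<le> 0"
    proof -
      have "?y = exp (c / x) / x\<^sup>2 * (2 * (a * (a - 1)) * (w x * v x) - c * ((w x)\<^sup>2 + (v x)\<^sup>2))"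
        using x0 by (simp add: field_simps)
      moreover have le: "2 * (a * (a - 1)) * (w x * v x) \<le> c * ((w x)\<^sup>2 + (v x)\<^sup>2)"
      proof -
        have "2 * (a * (a - 1)) * (w x * v x) \<le> \<bar>a * (a - 1)\<bar> * \<bar>2 * w x * v x\<bar>"
          using abs_ge_self[of "(a * (a - 1)) * (2 * w x * v x)"] unfolding abs_mult[of "a * (a - 1)"] by (simp add: mult_ac)
        also have "\<dots> \<le> c * ((w x)\<^sup>2 + (v x)\<^sup>2)"
          unfolding c_def using sum_squares_bound[of "\<bar>w x\<bar>" "\<bar>v x\<bar>"] by (intro mult_left_mono) (auto simp: abs_mult)
        finally show ?thesis .
      qed
      moreover have "exp (c / x) / x\<^sup>2 * (2 * (a * (a - 1)) * (w x * v x) - c * ((w x)\<^sup>2 + (v x)\<^sup>2)) \<le> 0"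
        using le by (intro mult_nonneg_nonpos) auto
      ultimately show ?thesis by (simp only:)
    qed
    ultimately show ?thesis by blast
  qed
  have "\<bar>w x\<bar> \<le> sqrt (En 1)" if x: "x \<ge> 1" for x
  proof -
    have "En x \<le> En 1"
      using x dE by (intro DERIV_nonpos_imp_nonincreasing[of 1 x En]) auto
    moreover have "(w x)\<^sup>2 \<le> En x"
    proof -
      have "(w x)\<^sup>2 * 1 \<le> ((w x)\<^sup>2 + (v x)\<^sup>2) * exp (c / x)"
        using x by (intro mult_mono) (auto simp: c_def)
      then show ?thesis by (simp add: En_def)
    qed
    ultimately have "(w x)\<^sup>2 \<le> En 1" by simp
    then show ?thesis by (metis real_sqrt_abs real_sqrt_le_iff)
  qed
  then show ?thesis unfolding w_def by blast
qed

text \<open>With t = 2 \<surd>v and y = v u the weight 1 + 4 y is 1 + t^2 u, the base of the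
  resolvent power in the hypothesis. Compactness covers y \<le> 1; beyond, 1 + 4 y \<le> 5 y reduces
  the claim to the decay at infinity.\<close>

lemma psi_decay:
  assumes s: "s > 0"
  shows "\<exists>K\<ge>0. \<forall>y\<ge>0. (1 + 4 * y) powr s * \<bar>psi (2 * s + 1/2) y\<bar> \<le> K"
proof -
  let ?b = "2 * s + 1/2"
  obtain K where K: "\<And>x. x \<ge> 1 \<Longrightarrow> \<bar>x powr (2 * s) * psi ?b (x\<^sup>2)\<bar> \<le> K"
    using psi_decay_at_top[of "2 * s"] s by auto
  have K0: "K \<ge> 0" using K[of 1] by linarith
  have "continuous_on {0..1} (psi ?b)"
    using psi_deriv[of ?b] s by (intro continuous_at_imp_continuous_on ballI DERIV_isCont) auto
  then have "compact (psi ?b ` {0..1})" by (intro compact_continuous_image) auto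
  then obtain K' where K': "\<And>y. y \<in> {0..1} \<Longrightarrow> \<bar>psi ?b y\<bar> \<le> K'"
    using compact_imp_bounded bounded_iff by (metis imageI real_norm_def)
  have K'0: "K' \<ge> 0" using K'[of 0] by (auto intro: order_trans[OF abs_ge_zero])
  have "(1 + 4 * y) powr s * \<bar>psi ?b y\<bar> \<le> 5 powr s * (K + K')" if y: "y \<ge> 0" for y
  proof (cases "y \<le> 1")
    case True
    have "(1 + 4 * y) powr s * \<bar>psi ?b y\<bar> \<le> 5 powr s * K'"
      using True y s K' by (intro mult_mono powr_mono2) auto
    also have "\<dots> \<le> 5 powr s * (K + K')" using K0 by (intro mult_left_mono) auto
    finally show ?thesis .
  next
    case False
    have "(1 + 4 * y) powr s \<le> (5 * y) powr s" using False s by (intro powr_mono2) auto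
    then have "(1 + 4 * y) powr s * \<bar>psi ?b y\<bar> \<le> (5 * y) powr s * \<bar>psi ?b y\<bar>" by (intro mult_right_mono) auto
    also have "\<dots> = 5 powr s * (y powr s * \<bar>psi ?b y\<bar>)" using False by (simp add: powr_mult)
    also have "y powr s * \<bar>psi ?b y\<bar> = \<bar>sqrt y powr (2 * s) * psi ?b ((sqrt y)\<^sup>2)\<bar>"
    proof -
      have "sqrt y powr (2 * s) = (y powr (1/2)) powr (2 * s)" using False by (simp add: powr_half_sqrt)
      also have "\<dots> = y powr s" by (simp add: powr_powr)
      finally show ?thesis using False by (simp add: abs_mult)
    qed
    also have "5 powr s * \<dots> \<le> 5 powr s * (K + K')"
      using K[of "sqrt y"] False K'0 by (intro mult_left_mono) auto
    finally show ?thesis .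
  qed
  then show ?thesis using K0 K'0 by (intro exI[of _ "5 powr s * (K + K')"]) auto
qed

text \<open>Converts Gamma (k + 1/2), which the Beta moments produce, into the factorial (2 k)! of
  the cosine series.\<close>

lemma Gamma_half_nat: "Gamma (real k + 1/2) = sqrt pi * fact (2 * k) / (4 ^ k * fact k)"
proof (induction k)
  case 0 then show ?case by (simp add: Gamma_one_half_real)
next
  case (Suc k)
  have "real k + 1/2 \<notin> \<int>\<^sub>\<le>\<^sub>0" by (auto elim!: nonpos_Ints_cases)
  then have "Gamma (real k + 1/2 + 1) = (real k + 1/2) * Gamma (real k + 1/2)" by (rule Gamma_plus1)
  then have "Gamma (real (Suc k) + 1/2) = (real k + 1/2) * (sqrt pi * fact (2 * k) / (4 ^ k * fact k))"
    using Suc by (simp add: add_ac)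
  also have "\<dots> = sqrt pi * fact (2 * Suc k) / (4 ^ Suc k * fact (Suc k))"
  proof -
    have gen: "(y - 1/2) * (S * f / (P * F)) = S * ((2 * y) * ((2 * y - 1) * f)) / ((4 * P) * (y * F))"
      if "y \<noteq> 0" "P \<noteq> 0" "F \<noteq> 0" for y S f P F :: real
      using that by (simp add: field_simps)
    have f2: "fact (2 * Suc k) = (2 * real (Suc k)) * ((2 * real (Suc k) - 1) * (fact (2 * k) :: real))"
      by (simp add: algebra_simps)
    have "real k + 1/2 = real (Suc k) - 1/2" by simp
    then show ?thesis
      using gen[of "real (Suc k)" "4 ^ k" "fact k" "sqrt pi" "fact (2 * k)"] unfolding f2 fact_Suc power_Suc by (simp add: add.commute)
  qed
  finally show ?case .
qed

text \<open>The density of Poisson's integral for Bessel functions, written in t = s^2; the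
  frequencies s = \<surd>t stay below 1.\<close>

definition beta_weight :: "real \<Rightarrow> real \<Rightarrow> real" where
  "beta_weight a t = indicator {0<..<1} t * (t powr (- (1/2)) * (1 - t) powr (a - 1))"

lemma beta_weight_measurable[measurable]: "beta_weight a \<in> borel_measurable borel"
  unfolding beta_weight_def by measurable

lemma beta_weight_nonneg: "beta_weight a t \<ge> 0" by (simp add: beta_weight_def)

lemma beta_weight_moment:
  assumes a: "a > 0"
  shows "integrable lborel (\<lambda>t. beta_weight a t * t ^ k)" "(LINT t|lborel. beta_weight a t * t ^ k) = Beta (real k + 1/2) a"
proof -
  have eq: "ennreal (beta_weight a t * t ^ k) = ennreal (t powr (real k + 1/2 - 1) * (1 - t) powr (a - 1)) * indicator {0..1} t" for t
  proof (cases "0 < t \<and> t < 1")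
    case True
    have "t powr (real k + 1/2 - 1) = t powr (- (1/2)) * t ^ k"
      using powr_add[of t "- (1/2)" "real k"] True by (simp add: powr_realpow algebra_simps)
    then show ?thesis using True by (simp add: beta_weight_def mult_ac)
  next
    case False
    then show ?thesis by (cases "t = 0"; cases "t = 1") (auto simp: beta_weight_def indicator_def)
  qed
  have I: "((\<lambda>t. t powr (real k + 1/2 - 1) * (1 - t) powr (a - 1)) has_integral Beta (real k + 1/2) a) {0..1}"
    using a by (intro has_integral_Beta_real) auto
  have nn: "(\<integral>\<^sup>+t. ennreal (beta_weight a t * t ^ k) \<partial>lborel) = ennreal (Beta (real k + 1/2) a)"
    unfolding eq by (rule nn_integral_has_integral_lebesgue'[OF _ I]) auto
  have n0: "0 \<le> beta_weight a t * t ^ k" for t by (auto simp: beta_weight_def indicator_def)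
  show "integrable lborel (\<lambda>t. beta_weight a t * t ^ k)"
    using nn n0 by (intro integrableI_nonneg) auto
  have "Beta (real k + 1/2) a \<ge> 0" by (rule has_integral_nonneg[OF I]) auto
  then show "(LINT t|lborel. beta_weight a t * t ^ k) = Beta (real k + 1/2) a"
    using nn n0 by (subst integral_eq_nn_integral) auto
qed

text \<open>The moment Beta (k + 1/2) a divided by (2 k)! is, up to sign and a constant, the
  coefficient of \<open>psi\<close>. This is the bridge from cosines, which the propagation
  hypothesis controls, to \<open>psi\<close>.\<close>

lemma cosine_representation:
  assumes a: "a > 0"
  shows "(LINT t|lborel. beta_weight a t * cos (x * sqrt t)) = sqrt pi * Gamma a * psi (a + 1/2) (x\<^sup>2)"
proof -
  have b: "a + 1/2 \<ge> 1/2" using a by simp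
  define f where "f k t = ((- 1) ^ k / fact (2 * k) * x ^ (2 * k)) * (beta_weight a t * t ^ k)" for k t
  have fe: "f k t = beta_weight a t * ((- 1) ^ k / fact (2 * k) * (x * sqrt t) ^ (2 * k))" for k t
  proof (cases "t > 0")
    case True
    then have "(sqrt t) ^ (2 * k) = t ^ k" by (simp add: power_mult)
    then show ?thesis by (simp add: f_def power_mult_distrib mult_ac)
  qed (simp add: f_def beta_weight_def)
  have fsums: "(\<lambda>k. f k t) sums (beta_weight a t * cos (x * sqrt t))" for t
    unfolding fe by (intro sums_mult cos_paired)
  have fi: "integrable lborel (f k)" for k
    unfolding f_def by (intro integrable_mult_right beta_weight_moment a)
  have coeff: "Beta (real k + 1/2) a / fact (2 * k) * (-1) ^ k = sqrt pi * Gamma a * psi_coeff (a + 1/2) k" for k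
  proof -
    have "Beta (real k + 1/2) a = (sqrt pi * fact (2 * k) / (4 ^ k * fact k)) * Gamma a / Gamma (a + 1/2 + real k)"
      by (simp add: Beta_def Gamma_half_nat add_ac)
    moreover have "(- 1 / 4) ^ k = (-1) ^ k / (4::real) ^ k" by (rule power_divide)
    ultimately show ?thesis by (simp add: psi_coeff_def)
  qed
  have fint: "(LINT t|lborel. f k t) = sqrt pi * Gamma a * (psi_coeff (a + 1/2) k * (x\<^sup>2) ^ k)" for k
    unfolding f_def integral_mult_right_zero beta_weight_moment(2)[OF a]
    using coeff[of k] by (simp add: power_mult[symmetric] mult_ac) (simp add: field_simps)
  have fnorm: "(LINT t|lborel. norm (f k t)) = sqrt pi * Gamma a * \<bar>psi_coeff (a + 1/2) k * (x\<^sup>2) ^ k\<bar>" for k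
  proof -
    \<comment> \<open>The k-th term has the sign (-1) ^ k for every t, so the integrals of the
      absolute values follow from \<open>fint\<close>.\<close>
    have "norm (f k t) = ((-1) ^ k) * f k t" for t
    proof -
      have h1: "0 \<le> beta_weight a t * t ^ k" by (auto simp: beta_weight_def indicator_def)
      have h2: "0 \<le> x ^ (2 * k)" by (simp add: power_mult)
      have n: "0 \<le> (1 / fact (2 * k) * x ^ (2 * k)) * (beta_weight a t * t ^ k)"
        by (rule mult_nonneg_nonneg[OF mult_nonneg_nonneg[OF _ h2] h1]) simp
      have "f k t = (-1) ^ k * ((1 / fact (2 * k) * x ^ (2 * k)) * (beta_weight a t * t ^ k))" by (simp add: f_def)
      moreover have "norm ((-1) ^ k * y) = (-1) ^ k * ((-1) ^ k * y)" if "0 \<le> y" for y :: real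
        using that by (simp add: abs_mult power_abs mult.assoc[symmetric] power_mult_distrib[symmetric])
      ultimately show ?thesis using n by (simp only:)
    qed
    then have "(LINT t|lborel. norm (f k t)) = (-1) ^ k * (LINT t|lborel. f k t)" by simp
    also have "\<dots> = sqrt pi * Gamma a * ((-1) ^ k * psi_coeff (a + 1/2) k * (x\<^sup>2) ^ k)" unfolding fint by simp
    also have "(-1) ^ k * psi_coeff (a + 1/2) k = \<bar>psi_coeff (a + 1/2) k\<bar>"
    proof -
      have "Gamma (a + 1/2 + real k) \<ge> 0" using a by (intro Gamma_real_nonneg) auto
      then show ?thesis by (simp add: psi_coeff_def abs_mult power_abs power_mult_distrib[symmetric])
    qed
    finally show ?thesis by (simp add: abs_mult)
  qed
  have s2: "summable (\<lambda>k. LINT t|lborel. norm (f k t))"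
    unfolding fnorm by (intro summable_mult summable_psi_norm b)
  have s3: "summable (\<lambda>k. norm (f k t))" for t
  proof -
    have ne: "norm (f k t) = beta_weight a t * ((x * sqrt \<bar>t\<bar>) ^ (2 * k) / fact (2 * k))" for k
      by (cases "t > 0") (auto simp: fe abs_mult power_abs beta_weight_def indicator_def power_mult power_mult_distrib)
    have sm: "summable (\<lambda>k. (x * sqrt \<bar>t\<bar>) ^ (2 * k) / fact (2 * k))"
    proof -
      let ?z = "(x * sqrt \<bar>t\<bar>)\<^sup>2"
      have "summable (\<lambda>n. ?z ^ n /\<^sub>R fact n)" by (rule sums_summable[OF exp_converges])
      moreover have "norm ((x * sqrt \<bar>t\<bar>) ^ (2 * k) / fact (2 * k)) \<le> ?z ^ k /\<^sub>R fact k" for k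
      proof -
        have "?z ^ k / fact (2 * k) \<le> ?z ^ k / fact k"
          by (intro divide_left_mono fact_mono) auto
        moreover have "norm ((x * sqrt \<bar>t\<bar>) ^ (2 * k) / fact (2 * k)) = ?z ^ k / fact (2 * k)"
          unfolding power_mult by simp
        ultimately show ?thesis by (simp add: divide_inverse mult.commute)
      qed
      ultimately show ?thesis by (rule summable_comparison_test')
    qed
    show ?thesis unfolding ne by (rule summable_mult[OF sm])
  qed
  have eq: "(\<lambda>t. \<Sum>k. f k t) = (\<lambda>t. beta_weight a t * cos (x * sqrt t))" using fsums by (auto simp: sums_iff)
  have "(\<lambda>k. LINT t|lborel. f k t) sums (LINT t|lborel. beta_weight a t * cos (x * sqrt t))"
    using sums_integral[OF fi AE_I2[OF s3] s2] unfolding eq .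
  moreover have "(\<lambda>k. LINT t|lborel. f k t) sums (sqrt pi * Gamma a * psi (a + 1/2) (x\<^sup>2))"
    unfolding fint by (intro sums_mult psi_sums b)
  ultimately show ?thesis by (rule sums_unique2)
qed

section \<open>Fourier transform on the line\<close>

definition fourier :: "(real \<Rightarrow> complex) \<Rightarrow> real \<Rightarrow> complex" where
  "fourier f \<xi> = (LINT x|lborel. f x * exp (- (\<i> * of_real (x * \<xi>))))"

definition gauss :: "real \<Rightarrow> real \<Rightarrow> real" where "gauss e \<xi> = exp (- ((e * \<xi>)\<^sup>2 / 2))"

lemma gauss_measurable[measurable]: "gauss e \<in> borel_measurable borel"
  unfolding gauss_def by measurable

lemma gauss_bounds: "0 < gauss e \<xi>" "gauss e \<xi> \<le> 1" by (auto simp: gauss_def)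

lemma gauss_std: "std_normal_density x = gauss 1 x / sqrt (2 * pi)"
  by (simp add: std_normal_density_def gauss_def)

lemma exp_i_measurable[measurable]: "(\<lambda>x. exp (\<i> * complex_of_real x)) \<in> borel_measurable borel"
  by (intro borel_measurable_continuous_onI continuous_intros)

lemma exp_i_measurable'[measurable]: "(\<lambda>x. exp (- (\<i> * complex_of_real x))) \<in> borel_measurable borel"
  by (intro borel_measurable_continuous_onI continuous_intros)

lemma gauss_integral_1: "integrable lborel (gauss 1)" "(LINT x|lborel. gauss 1 x) = sqrt (2 * pi)"
proof -
  have e: "gauss 1 = (\<lambda>x. sqrt (2 * pi) * std_normal_density x)" by (auto simp: gauss_std)
  show "integrable lborel (gauss 1)" unfolding e
    using integrable_normal_density[of 1 0] by (intro integrable_mult_right) simp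
  show "(LINT x|lborel. gauss 1 x) = sqrt (2 * pi)" unfolding e
    using integral_normal_density[of 1 0] by simp
qed

lemma gauss_fourier_1: "(LINT x|lborel. complex_of_real (gauss 1 x) * exp (\<i> * complex_of_real (t * x))) = complex_of_real (sqrt (2 * pi) * gauss 1 t)"
proof -
  have "complex_of_real (gauss 1 t) = char std_normal_distribution t"
    by (simp add: char_std_normal_distribution gauss_def)
  also have "\<dots> = (LINT x|lborel. std_normal_density x *\<^sub>R exp (\<i> * complex_of_real (t * x)))"
    unfolding char_def by (subst integral_density) auto
  also have "\<dots> = (LINT x|lborel. complex_of_real (1 / sqrt (2 * pi)) * (complex_of_real (gauss 1 x) * exp (\<i> * complex_of_real (t * x))))"
    by (intro Bochner_Integration.integral_cong) (auto simp: gauss_std scaleR_conv_of_real)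
  finally have "complex_of_real (gauss 1 t) = complex_of_real (1 / sqrt (2 * pi)) * (LINT x|lborel. complex_of_real (gauss 1 x) * exp (\<i> * complex_of_real (t * x)))"
    by simp
  then show ?thesis by (simp add: field_simps)
qed

lemma gauss_integrable: assumes e: "e > 0" shows "integrable lborel (gauss e)"
proof -
  have "gauss e = (\<lambda>x. gauss 1 (0 + e * x))" by (auto simp: gauss_def)
  then show ?thesis using lborel_integrable_real_affine[OF gauss_integral_1(1), of e 0] e by simp
qed

lemma gauss_fourier:
  assumes e: "e > 0"
  shows "(LINT \<xi>|lborel. complex_of_real (gauss e \<xi>) * exp (\<i> * complex_of_real (y * \<xi>))) = complex_of_real (sqrt (2 * pi) / e * gauss (1 / e) y)"
proof -
  have "complex_of_real (sqrt (2 * pi) * gauss 1 (y / e)) = (LINT x|lborel. complex_of_real (gauss 1 x) * exp (\<i> * complex_of_real (y / e * x)))"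
    by (rule gauss_fourier_1[symmetric])
  also have "\<dots> = \<bar>e\<bar> *\<^sub>R (LINT \<xi>|lborel. complex_of_real (gauss 1 (0 + e * \<xi>)) * exp (\<i> * complex_of_real (y / e * (0 + e * \<xi>))))"
    using e by (subst lborel_integral_real_affine[of e _ 0]) auto
  also have "(LINT \<xi>|lborel. complex_of_real (gauss 1 (0 + e * \<xi>)) * exp (\<i> * complex_of_real (y / e * (0 + e * \<xi>)))) =
     (LINT \<xi>|lborel. complex_of_real (gauss e \<xi>) * exp (\<i> * complex_of_real (y * \<xi>)))"
    using e by (intro Bochner_Integration.integral_cong) (auto simp: gauss_def)
  also have "gauss 1 (y / e) = gauss (1 / e) y" by (simp add: gauss_def)
  finally show ?thesis using e by (simp add: scaleR_conv_of_real field_simps)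
qed

lemma norm_fourier_le: assumes f: "integrable lborel f" shows "norm (fourier f \<xi>) \<le> (LINT x|lborel. norm (f x))"
proof -
  have "norm (fourier f \<xi>) \<le> (LINT x|lborel. norm (f x * exp (- (\<i> * of_real (x * \<xi>)))))"
    unfolding fourier_def by (rule integral_norm_bound)
  then show ?thesis by (simp add: norm_mult)
qed

lemma fourier_measurable: assumes "f \<in> borel_measurable borel" shows "fourier f \<in> borel_measurable borel"
proof -
  have [measurable]: "f \<in> borel_measurable borel" by fact
  show ?thesis unfolding fourier_def by measurable
qed

text \<open>Damping the frequencies by a Gaussian makes Fubini applicable and averages f against a
  Gaussian of width e and mass 2 pi.\<close>

lemma gauss_regularised:
  assumes f: "integrable lborel f" and e: "e > 0"
  shows "(LINT \<xi>|lborel. fourier f \<xi> * exp (\<i> * complex_of_real (u * \<xi>)) * complex_of_real (gauss e \<xi>)) =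
     (LINT x|lborel. f x * complex_of_real (sqrt (2 * pi) / e * gauss (1 / e) (u - x)))"
proof -
  have [measurable]: "f \<in> borel_measurable borel" using f by auto
  let ?H = "\<lambda>x \<xi>. f x * (complex_of_real (gauss e \<xi>) * exp (\<i> * complex_of_real ((u - x) * \<xi>)))"
  have m: "(\<lambda>(x, \<xi>). ?H x \<xi>) \<in> borel_measurable (lborel \<Otimes>\<^sub>M lborel)" by measurable
  have nH: "norm (?H x \<xi>) = norm (f x) * gauss e \<xi>" for x \<xi> using gauss_bounds[of e \<xi>] by (simp add: norm_mult)
  have int: "integrable (lborel \<Otimes>\<^sub>M lborel) (\<lambda>(x, \<xi>). ?H x \<xi>)"
  proof (rule lborel_pair.Fubini_integrable[OF m])
    have "(LINT \<xi>|lborel. norm (case (x, \<xi>) of (x, \<xi>) \<Rightarrow> ?H x \<xi>)) = norm (f x) * (LINT \<xi>|lborel. gauss e \<xi>)" for x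
      using nH[of x] by simp
    then show "integrable lborel (\<lambda>x. LINT \<xi>|lborel. norm (case (x, \<xi>) of (x, \<xi>) \<Rightarrow> ?H x \<xi>))"
      using f by simp
    show "AE x in lborel. integrable lborel (\<lambda>\<xi>. case (x, \<xi>) of (x, \<xi>) \<Rightarrow> ?H x \<xi>)"
    proof (rule AE_I2)
      fix x :: real
      have "integrable lborel (\<lambda>\<xi>. ?H x \<xi>)"
      proof (rule Bochner_Integration.integrable_bound[OF integrable_mult_right[OF gauss_integrable[OF e], of "norm (f x)"]])
        show "AE \<xi> in lborel. norm (?H x \<xi>) \<le> norm (norm (f x) * gauss e \<xi>)" using nH[of x] by simp
      qed measurable
      then show "integrable lborel (\<lambda>\<xi>. case (x, \<xi>) of (x, \<xi>) \<Rightarrow> ?H x \<xi>)" by simp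
    qed
  qed
  have "(LINT \<xi>|lborel. fourier f \<xi> * exp (\<i> * complex_of_real (u * \<xi>)) * complex_of_real (gauss e \<xi>)) = (LINT \<xi>|lborel. LINT x|lborel. ?H x \<xi>)"
  proof (rule Bochner_Integration.integral_cong[OF refl])
    fix \<xi>
    have Heq: "?H x \<xi> = (f x * exp (- (\<i> * of_real (x * \<xi>)))) * (exp (\<i> * complex_of_real (u * \<xi>)) * complex_of_real (gauss e \<xi>))" for x
    proof -
      have "exp (\<i> * complex_of_real ((u - x) * \<xi>)) = exp (- (\<i> * of_real (x * \<xi>))) * exp (\<i> * complex_of_real (u * \<xi>))"
        unfolding exp_add[symmetric] by (simp add: algebra_simps)
      then show ?thesis by (simp add: mult_ac)
    qed
    show "fourier f \<xi> * exp (\<i> * complex_of_real (u * \<xi>)) * complex_of_real (gauss e \<xi>) = (LINT x|lborel. ?H x \<xi>)"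
      unfolding Heq integral_mult_left_zero fourier_def by (rule mult.assoc)
  qed
  also have "\<dots> = (LINT x|lborel. LINT \<xi>|lborel. ?H x \<xi>)"
    by (rule lborel_pair.Fubini_integral[OF int])
  also have "\<dots> = (LINT x|lborel. f x * complex_of_real (sqrt (2 * pi) / e * gauss (1 / e) (u - x)))"
    by (simp only: integral_mult_right_zero gauss_fourier[OF e])
  finally show ?thesis .
qed

text \<open>Rescaling moves e into the argument of f and leaves a fixed Gaussian, which can dominate
  as e tends to 0.\<close>

lemma gauss_average:
  assumes [measurable]: "f \<in> borel_measurable borel" and e: "e > 0"
  shows "(LINT x|lborel. f x * complex_of_real (sqrt (2 * pi) / e * gauss (1 / e) (u - x))) =
    (LINT y|lborel. f (u + e * y) * complex_of_real (sqrt (2 * pi) * gauss 1 y))"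
proof -
  have "(LINT x|lborel. f x * complex_of_real (sqrt (2 * pi) / e * gauss (1 / e) (u - x))) =
     \<bar>e\<bar> *\<^sub>R (LINT y|lborel. f (u + e * y) * complex_of_real (sqrt (2 * pi) / e * gauss (1 / e) (u - (u + e * y))))"
    using e by (intro lborel_integral_real_affine) auto
  also have "\<dots> = (LINT y|lborel. \<bar>e\<bar> *\<^sub>R (f (u + e * y) * complex_of_real (sqrt (2 * pi) / e * gauss (1 / e) (u - (u + e * y)))))"
    by (rule integral_scaleR_right[symmetric])
  also have "\<dots> = (LINT y|lborel. f (u + e * y) * complex_of_real (sqrt (2 * pi) * gauss 1 y))"
    using e by (intro Bochner_Integration.integral_cong) (auto simp: gauss_def scaleR_conv_of_real)
  finally show ?thesis .
qed

text \<open>Both sides of the regularised identity converge as e tends to 0, the left dominated by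
  the integrable transform, the right by a Gaussian. Continuity of f yields the identity at every
  point.\<close>

lemma fourier_inversion:
  fixes f :: "real \<Rightarrow> complex"
  assumes f: "integrable lborel f" and cont: "continuous_on UNIV f" and B: "\<And>x. norm (f x) \<le> B"
    and hat: "integrable lborel (fourier f)"
  shows "(LINT \<xi>|lborel. fourier f \<xi> * exp (\<i> * complex_of_real (u * \<xi>))) = 2 * pi * f u"
proof -
  have [measurable]: "f \<in> borel_measurable borel" using f by auto
  have [measurable]: "fourier f \<in> borel_measurable borel" by (rule fourier_measurable) simp
  define e where "e n = inverse (real (Suc n))" for n
  have e0: "e n > 0" for n by (simp add: e_def)
  have elim: "e \<longlonglongrightarrow> 0" unfolding e_def by (rule LIMSEQ_inverse_real_of_nat)
  have B0: "B \<ge> 0" using B[of 0] norm_ge_zero order_trans by blast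
  have "(\<lambda>n. LINT \<xi>|lborel. fourier f \<xi> * exp (\<i> * complex_of_real (u * \<xi>)) * complex_of_real (gauss (e n) \<xi>)) \<longlonglongrightarrow>
     (LINT \<xi>|lborel. fourier f \<xi> * exp (\<i> * complex_of_real (u * \<xi>)))"
  proof (rule integral_dominated_convergence[where w="\<lambda>\<xi>. norm (fourier f \<xi>)"])
    show "AE \<xi> in lborel. (\<lambda>n. fourier f \<xi> * exp (\<i> * complex_of_real (u * \<xi>)) * complex_of_real (gauss (e n) \<xi>)) \<longlonglongrightarrow> fourier f \<xi> * exp (\<i> * complex_of_real (u * \<xi>))"
    proof (rule AE_I2)
      fix \<xi>
      have "(\<lambda>n. gauss (e n) \<xi>) \<longlonglongrightarrow> exp (- ((0 * \<xi>)\<^sup>2 / 2))"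
        unfolding gauss_def by (intro tendsto_intros elim) auto
      then have "(\<lambda>n. gauss (e n) \<xi>) \<longlonglongrightarrow> 1" by simp
      then have "(\<lambda>n. fourier f \<xi> * exp (\<i> * complex_of_real (u * \<xi>)) * complex_of_real (gauss (e n) \<xi>)) \<longlonglongrightarrow> fourier f \<xi> * exp (\<i> * complex_of_real (u * \<xi>)) * complex_of_real 1"
        by (intro tendsto_intros)
      then show "(\<lambda>n. fourier f \<xi> * exp (\<i> * complex_of_real (u * \<xi>)) * complex_of_real (gauss (e n) \<xi>)) \<longlonglongrightarrow> fourier f \<xi> * exp (\<i> * complex_of_real (u * \<xi>))"
        by simp
    qed
    show "AE \<xi> in lborel. norm (fourier f \<xi> * exp (\<i> * complex_of_real (u * \<xi>)) * complex_of_real (gauss (e n) \<xi>)) \<le> norm (fourier f \<xi>)" for n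
    proof (rule AE_I2)
      fix \<xi>
      have "norm (fourier f \<xi>) * gauss (e n) \<xi> \<le> norm (fourier f \<xi>) * 1"
        using gauss_bounds[of "e n" \<xi>] by (intro mult_left_mono) auto
      then show "norm (fourier f \<xi> * exp (\<i> * complex_of_real (u * \<xi>)) * complex_of_real (gauss (e n) \<xi>)) \<le> norm (fourier f \<xi>)"
        using gauss_bounds[of "e n" \<xi>] by (simp add: norm_mult)
    qed
  qed (use hat in auto)
  moreover have "(\<lambda>n. LINT \<xi>|lborel. fourier f \<xi> * exp (\<i> * complex_of_real (u * \<xi>)) * complex_of_real (gauss (e n) \<xi>)) \<longlonglongrightarrow> 2 * pi * f u"
  proof -
    have "(\<lambda>n. LINT y|lborel. f (u + e n * y) * complex_of_real (sqrt (2 * pi) * gauss 1 y)) \<longlonglongrightarrow>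
       (LINT y|lborel. f u * complex_of_real (sqrt (2 * pi) * gauss 1 y))"
    proof (rule integral_dominated_convergence[where w="\<lambda>y. B * (sqrt (2 * pi) * gauss 1 y)"])
      show "AE y in lborel. (\<lambda>n. f (u + e n * y) * complex_of_real (sqrt (2 * pi) * gauss 1 y)) \<longlonglongrightarrow> f u * complex_of_real (sqrt (2 * pi) * gauss 1 y)"
      proof (rule AE_I2)
        fix y
        have "(\<lambda>n. u + e n * y) \<longlonglongrightarrow> u + 0 * y" by (intro tendsto_intros elim)
        then have "(\<lambda>n. f (u + e n * y)) \<longlonglongrightarrow> f u"
          using cont by (intro isCont_tendsto_compose[of u f]) (auto simp: continuous_on_eq_continuous_at)
        then show "(\<lambda>n. f (u + e n * y) * complex_of_real (sqrt (2 * pi) * gauss 1 y)) \<longlonglongrightarrow> f u * complex_of_real (sqrt (2 * pi) * gauss 1 y)"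
          by (intro tendsto_intros)
      qed
      show "AE y in lborel. norm (f (u + e n * y) * complex_of_real (sqrt (2 * pi) * gauss 1 y)) \<le> B * (sqrt (2 * pi) * gauss 1 y)" for n
        unfolding norm_mult norm_of_real using B gauss_bounds[of 1] by (intro AE_I2 mult_mono) (auto simp: B0 abs_mult less_imp_le)
    qed (use gauss_integral_1(1) in auto)
    also have "(LINT y|lborel. f u * complex_of_real (sqrt (2 * pi) * gauss 1 y)) = f u * complex_of_real (sqrt (2 * pi) * sqrt (2 * pi))"
      by (simp only: integral_mult_right_zero integral_complex_of_real gauss_integral_1(2))
    also have "\<dots> = 2 * pi * f u" by simp
    finally show ?thesis
      unfolding gauss_regularised[OF f e0] by (subst gauss_average[OF _ e0]) auto
  qed
  ultimately show ?thesis by (rule LIMSEQ_unique)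
qed

text \<open>Makes the Fourier integral a candidate in \<open>plancherel_transform\<close>. With a
  Gaussian cutoff, the squared transform integrates to an average of cnj (f y) * f (y + e z), at
  most 2 pi B N for every e; Fatou removes the cutoff.\<close>

lemma fourier_square_integrable:
  assumes f: "integrable lborel f" and B: "\<And>x. norm (f x) \<le> B"
  shows "integrable lborel (\<lambda>\<xi>. (norm (fourier f \<xi>))\<^sup>2)"
proof -
  have [measurable]: "f \<in> borel_measurable borel" using f by auto
  have [measurable]: "fourier f \<in> borel_measurable borel" by (rule fourier_measurable) simp
  define N where "N = (LINT x|lborel. norm (f x))"
  have B0: "B \<ge> 0" using B[of 0] norm_ge_zero order_trans by blast
  have N0: "N \<ge> 0" by (simp add: N_def)
  have hatN: "norm (fourier f \<xi>) \<le> N" for \<xi> unfolding N_def by (rule norm_fourier_le[OF f])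
  have bound: "(\<integral>\<^sup>+\<xi>. ennreal ((norm (fourier f \<xi>))\<^sup>2 * gauss e \<xi>) \<partial>lborel) \<le> ennreal (2 * pi * B * N)" if e: "e > 0" for e
  proof -
    let ?H = "\<lambda>y \<xi>. cnj (f y) * (fourier f \<xi> * exp (\<i> * complex_of_real (y * \<xi>)) * complex_of_real (gauss e \<xi>))"
    have m: "(\<lambda>(y, \<xi>). ?H y \<xi>) \<in> borel_measurable (lborel \<Otimes>\<^sub>M lborel)"
    proof -
      have [measurable]: "(\<lambda>y. cnj (f y)) \<in> borel_measurable borel"
        by (rule borel_measurable_continuous_on[OF continuous_on_cnj[OF continuous_on_id]]) simp
      show ?thesis by measurable
    qed
    have nH: "norm (?H y \<xi>) = norm (f y) * (norm (fourier f \<xi>) * gauss e \<xi>)" for y \<xi>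
      using gauss_bounds[of e \<xi>] by (simp add: norm_mult)
    have gi: "integrable lborel (\<lambda>\<xi>. norm (fourier f \<xi>) * gauss e \<xi>)"
    proof (rule Bochner_Integration.integrable_bound[OF integrable_mult_right[OF gauss_integrable[OF e], of N]])
      show "AE \<xi> in lborel. norm (norm (fourier f \<xi>) * gauss e \<xi>) \<le> norm (N * gauss e \<xi>)"
        using hatN gauss_bounds[of e] N0 by (intro AE_I2) (auto simp: abs_mult less_imp_le intro!: mult_right_mono)
    qed measurable
    have int: "integrable (lborel \<Otimes>\<^sub>M lborel) (\<lambda>(y, \<xi>). ?H y \<xi>)"
    proof (rule lborel_pair.Fubini_integrable[OF m])
      have "(LINT \<xi>|lborel. norm (case (y, \<xi>) of (y, \<xi>) \<Rightarrow> ?H y \<xi>)) = norm (f y) * (LINT \<xi>|lborel. norm (fourier f \<xi>) * gauss e \<xi>)" for y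
        unfolding prod.case nH by (rule integral_mult_right_zero)
      then show "integrable lborel (\<lambda>y. LINT \<xi>|lborel. norm (case (y, \<xi>) of (y, \<xi>) \<Rightarrow> ?H y \<xi>))"
        using f by simp
      show "AE y in lborel. integrable lborel (\<lambda>\<xi>. case (y, \<xi>) of (y, \<xi>) \<Rightarrow> ?H y \<xi>)"
      proof (rule AE_I2)
        fix y :: real
        have "integrable lborel (\<lambda>\<xi>. ?H y \<xi>)"
        proof (rule Bochner_Integration.integrable_bound[OF integrable_mult_right[OF gi, of "norm (f y)"]])
          show "AE \<xi> in lborel. norm (?H y \<xi>) \<le> norm (norm (f y) * (norm (fourier f \<xi>) * gauss e \<xi>))"
            unfolding nH by simp
        qed measurable
        then show "integrable lborel (\<lambda>\<xi>. case (y, \<xi>) of (y, \<xi>) \<Rightarrow> ?H y \<xi>)" by simp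
      qed
    qed
    have inner: "(LINT \<xi>|lborel. ?H y \<xi>) = cnj (f y) * (LINT z|lborel. f (y + e * z) * complex_of_real (sqrt (2 * pi) * gauss 1 z))" for y
      using gauss_regularised[OF f e, of y] gauss_average[of f e y] e by simp
    have ib: "norm (LINT z|lborel. f (y + e * z) * complex_of_real (sqrt (2 * pi) * gauss 1 z)) \<le> 2 * pi * B" for y
    proof -
      have "norm (LINT z|lborel. f (y + e * z) * complex_of_real (sqrt (2 * pi) * gauss 1 z)) \<le>
         (LINT z|lborel. norm (f (y + e * z) * complex_of_real (sqrt (2 * pi) * gauss 1 z)))" by (rule integral_norm_bound)
      also have "\<dots> \<le> (LINT z|lborel. B * (sqrt (2 * pi) * gauss 1 z))"
      proof (rule integral_mono_AE')
        show "integrable lborel (\<lambda>z. B * (sqrt (2 * pi) * gauss 1 z))" using gauss_integral_1(1) by simp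
        show "AE z in lborel. norm (f (y + e * z) * complex_of_real (sqrt (2 * pi) * gauss 1 z)) \<le> B * (sqrt (2 * pi) * gauss 1 z)"
          unfolding norm_mult norm_of_real using B gauss_bounds[of 1] by (intro AE_I2 mult_mono) (auto simp: B0 abs_mult less_imp_le)
      qed (simp add: B0 less_imp_le[OF gauss_bounds(1)])
      also have "\<dots> = 2 * pi * B" by (simp add: gauss_integral_1(2))
      finally show ?thesis .
    qed
    have sq: "(norm (fourier f \<xi>))\<^sup>2 * gauss e \<xi> = Re (LINT y|lborel. ?H y \<xi>)" for \<xi>
    proof -
      have "cnj (fourier f \<xi>) = (LINT y|lborel. cnj (f y) * exp (\<i> * complex_of_real (y * \<xi>)))"
        unfolding fourier_def by (subst Bochner_Integration.integral_cnj[symmetric]) (simp add: exp_cnj)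
      then have "(LINT y|lborel. ?H y \<xi>) = cnj (fourier f \<xi>) * (fourier f \<xi> * complex_of_real (gauss e \<xi>))"
        by (simp add: mult_ac flip: integral_mult_left_zero integral_mult_right_zero)
      also have "\<dots> = complex_of_real ((norm (fourier f \<xi>))\<^sup>2) * complex_of_real (gauss e \<xi>)"
        unfolding complex_norm_square by (simp add: mult_ac)
      also have "\<dots> = complex_of_real ((norm (fourier f \<xi>))\<^sup>2 * gauss e \<xi>)" by (rule of_real_mult[symmetric])
      finally show ?thesis by simp
    qed
    have "(LINT \<xi>|lborel. (norm (fourier f \<xi>))\<^sup>2 * gauss e \<xi>) = Re (LINT \<xi>|lborel. LINT y|lborel. ?H y \<xi>)"
      unfolding sq using lborel_pair.integrable_snd[OF int] by (intro integral_Re) simp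
    also have "(LINT \<xi>|lborel. LINT y|lborel. ?H y \<xi>) = (LINT y|lborel. LINT \<xi>|lborel. ?H y \<xi>)"
      by (rule lborel_pair.Fubini_integral[OF int])
    also have "Re \<dots> \<le> norm (LINT y|lborel. LINT \<xi>|lborel. ?H y \<xi>)" by (rule complex_Re_le_cmod)
    also have "\<dots> \<le> (LINT y|lborel. norm (LINT \<xi>|lborel. ?H y \<xi>))" by (rule integral_norm_bound)
    also have "\<dots> \<le> (LINT y|lborel. 2 * pi * B * norm (f y))"
    proof (rule integral_mono_AE')
      show "integrable lborel (\<lambda>y. 2 * pi * B * norm (f y))" using f by simp
      show "AE y in lborel. norm (LINT \<xi>|lborel. ?H y \<xi>) \<le> 2 * pi * B * norm (f y)"
        unfolding inner norm_mult using ib by (intro AE_I2) (auto simp: mult.commute intro!: mult_left_mono)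
    qed (simp add: B0)
    also have "\<dots> = 2 * pi * B * N" by (simp add: N_def)
    finally have le: "(LINT \<xi>|lborel. (norm (fourier f \<xi>))\<^sup>2 * gauss e \<xi>) \<le> 2 * pi * B * N" .
    have "integrable lborel (\<lambda>\<xi>. (norm (fourier f \<xi>))\<^sup>2 * gauss e \<xi>)"
      unfolding sq using lborel_pair.integrable_snd[OF int] by (intro integrable_Re) simp
    then show ?thesis using le gauss_bounds[of e]
      by (subst nn_integral_eq_integral) (auto intro: ennreal_leI simp: less_imp_le)
  qed
  define e where "e n = inverse (real (Suc n))" for n
  have e0: "e n > 0" for n by (simp add: e_def)
  have elim: "e \<longlonglongrightarrow> 0" unfolding e_def by (rule LIMSEQ_inverse_real_of_nat)
  have "(\<integral>\<^sup>+\<xi>. ennreal ((norm (fourier f \<xi>))\<^sup>2) \<partial>lborel) = (\<integral>\<^sup>+\<xi>. liminf (\<lambda>n. ennreal ((norm (fourier f \<xi>))\<^sup>2 * gauss (e n) \<xi>)) \<partial>lborel)"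
  proof (rule nn_integral_cong)
    fix \<xi>
    have "(\<lambda>n. gauss (e n) \<xi>) \<longlonglongrightarrow> exp (- ((0 * \<xi>)\<^sup>2 / 2))"
      unfolding gauss_def by (intro tendsto_intros elim) auto
    then have "(\<lambda>n. gauss (e n) \<xi>) \<longlonglongrightarrow> 1" by simp
    then have "(\<lambda>n. ennreal ((norm (fourier f \<xi>))\<^sup>2 * gauss (e n) \<xi>)) \<longlonglongrightarrow> ennreal ((norm (fourier f \<xi>))\<^sup>2 * 1)"
      by (intro tendsto_ennrealI tendsto_intros)
    from lim_imp_Liminf[OF _ this] show "ennreal ((norm (fourier f \<xi>))\<^sup>2) = liminf (\<lambda>n. ennreal ((norm (fourier f \<xi>))\<^sup>2 * gauss (e n) \<xi>))"
      by simp
  qed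
  also have "\<dots> \<le> liminf (\<lambda>n. \<integral>\<^sup>+\<xi>. ennreal ((norm (fourier f \<xi>))\<^sup>2 * gauss (e n) \<xi>) \<partial>lborel)"
    by (rule nn_integral_liminf) auto
  also have "\<dots> \<le> liminf (\<lambda>n::nat. ennreal (2 * pi * B * N))"
    using bound[OF e0] by (intro Liminf_mono always_eventually) auto
  also have "\<dots> < \<infinity>" by (simp add: Liminf_const)
  finally show ?thesis by (auto simp: integrable_iff_bounded)
qed

lemma integrable_one_plus_square_powr:
  assumes q: "q > 1/2" shows "integrable lborel (\<lambda>x::real. (1 + x\<^sup>2) powr (- q))"
proof -
  \<comment> \<open>A one-sided tail; h (1 + x) and h (1 - x) are (1 + |x|) powr (- 2 q) on the two
    half lines.\<close>
  define h where "h x = indicator {1..} x * x powr (- 2 * q)" for x :: real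
  have [measurable]: "h \<in> borel_measurable borel" unfolding h_def by measurable
  have I: "((\<lambda>x. x powr (- 2 * q)) has_integral - (1 powr (- 2 * q + 1)) / (- 2 * q + 1)) {1::real..}"
    using q by (intro has_integral_powr_to_inf) auto
  have "(\<integral>\<^sup>+x. ennreal (h x) \<partial>lborel) = (\<integral>\<^sup>+x. ennreal (x powr (- 2 * q)) * indicator {1..} x \<partial>lborel)"
    by (intro nn_integral_cong) (auto simp: h_def indicator_def)
  also have "\<dots> < \<infinity>" by (subst nn_integral_has_integral_lebesgue'[OF _ I]) auto
  finally have hi: "integrable lborel h" by (intro integrableI_nonneg) (auto simp: h_def)
  have i2: "integrable lborel (\<lambda>x. h (1 + 1 * x))" "integrable lborel (\<lambda>x. h (1 + (-1) * x))"
    by (rule lborel_integrable_real_affine[OF hi], simp)+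
  have "integrable lborel (\<lambda>x. 2 powr q * (h (1 + 1 * x) + h (1 + (-1) * x)))"
    by (intro integrable_mult_right Bochner_Integration.integrable_add i2)
  then show ?thesis
  proof (rule Bochner_Integration.integrable_bound)
    show "AE x in lborel. norm ((1 + x\<^sup>2) powr (- q)) \<le> norm (2 powr q * (h (1 + 1 * x) + h (1 + (-1) * x)))"
    proof (rule AE_I2)
      fix x :: real
      have le: "(1 + x\<^sup>2) powr (- q) \<le> 2 powr q * (1 + \<bar>x\<bar>) powr (- 2 * q)"
      proof -
        have "(1 + \<bar>x\<bar>)\<^sup>2 \<le> 2 * (1 + x\<^sup>2)" using sum_squares_bound[of 1 "\<bar>x\<bar>"] by (simp add: power2_sum)
        then have "(2 * (1 + x\<^sup>2)) powr (- q) \<le> ((1 + \<bar>x\<bar>)\<^sup>2) powr (- q)" using q by (intro powr_mono2') auto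
        also have "((1 + \<bar>x\<bar>)\<^sup>2) powr (- q) = (1 + \<bar>x\<bar>) powr (- 2 * q)"
        proof -
          have "(1 + \<bar>x\<bar>)\<^sup>2 = (1 + \<bar>x\<bar>) powr 2" by simp
          then have "((1 + \<bar>x\<bar>)\<^sup>2) powr (- q) = (1 + \<bar>x\<bar>) powr (2 * - q)" by (simp only: powr_powr)
          then show ?thesis by simp
        qed
        finally have "2 powr (- q) * (1 + x\<^sup>2) powr (- q) \<le> (1 + \<bar>x\<bar>) powr (- 2 * q)"
          by (subst (asm) powr_mult) auto
        then have "2 powr q * (2 powr (- q) * (1 + x\<^sup>2) powr (- q)) \<le> 2 powr q * (1 + \<bar>x\<bar>) powr (- 2 * q)"
          by (intro mult_left_mono) auto
        then show ?thesis by (simp add: mult.assoc[symmetric] powr_add[symmetric])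
      qed
      have "(1 + \<bar>x\<bar>) powr (- 2 * q) \<le> h (1 + 1 * x) + h (1 + (-1) * x)"
        by (cases "x \<ge> 0") (auto simp: h_def indicator_def)
      then have "2 powr q * (1 + \<bar>x\<bar>) powr (- 2 * q) \<le> 2 powr q * (h (1 + 1 * x) + h (1 + (-1) * x))"
        by (intro mult_left_mono) auto
      from order_trans[OF le this]
      have "\<bar>(1 + x\<^sup>2) powr (- q)\<bar> \<le> 2 powr q * (h (1 + 1 * x) + h (1 + (-1) * x))" by (simp only: abs_of_nonneg powr_ge_zero)
      then show "norm ((1 + x\<^sup>2) powr (- q)) \<le> norm (2 powr q * (h (1 + 1 * x) + h (1 + (-1) * x)))"
        unfolding real_norm_def by (rule order_trans) (rule abs_ge_self)
    qed
  qed measurable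
qed

section \<open>Explicit Fourier pairs\<close>

lemma integral_gamma_kernel_nat:
  assumes p: "Re p > 0"
  shows "(LINT v|lborel. gamma_kernel (real m + 1) p v) = fact m / p ^ Suc m"
proof -
  have pn: "p \<noteq> 0" using p by auto
  have "Gamma (real m + 1) = fact m" using Gamma_fact[of m, where ?'a=real] by (simp add: add.commute)
  moreover have "p powr (- complex_of_real (real m + 1)) = inverse (p ^ Suc m)"
  proof -
    have e: "complex_of_real (real m + 1) = of_nat (Suc m)" by simp
    have "p powr of_nat (Suc m) = p ^ Suc m" using pn by (intro powr_nat') auto
    then show ?thesis by (simp only: e powr_minus)
  qed
  ultimately show ?thesis using integral_gamma_kernel[of "real m + 1" p] p by (simp add: divide_inverse)
qed

lemma gamma_kernel_shift: "gamma_kernel b p v * exp (- (\<i> * of_real (v * \<xi>))) = gamma_kernel b (p + \<i> * of_real \<xi>) v"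
  by (simp add: gamma_kernel_def exp_add[symmetric] mult.assoc distrib_right) (simp add: algebra_simps)

lemma fourier_exp_abs: "fourier (\<lambda>x. complex_of_real (exp (- \<bar>x\<bar>))) \<xi> = 2 / complex_of_real (1 + \<xi>\<^sup>2)"
proof -
  let ?p = "1 + \<i> * complex_of_real \<xi>" and ?q = "1 - \<i> * complex_of_real \<xi>"
  have i1: "integrable lborel (gamma_kernel 1 ?p)" "integrable lborel (gamma_kernel 1 ?q)"
    by (auto intro!: integrable_gamma_kernel)
  have i2: "integrable lborel (\<lambda>x. gamma_kernel 1 ?q (0 + (-1) * x))"
    by (rule lborel_integrable_real_affine[OF i1(2)]) simp
  have "fourier (\<lambda>x. complex_of_real (exp (- \<bar>x\<bar>))) \<xi> = (LINT x|lborel. gamma_kernel 1 ?p x + gamma_kernel 1 ?q (0 + (-1) * x))"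
    unfolding fourier_def
  proof (rule integral_cong_AE)
    have "AE x in lborel. x \<noteq> (0::real)" by (rule AE_lborel_singleton)
    then show "AE x in lborel. complex_of_real (exp (- \<bar>x\<bar>)) * exp (- (\<i> * of_real (x * \<xi>))) = gamma_kernel 1 ?p x + gamma_kernel 1 ?q (0 + (-1) * x)"
    proof eventually_elim
      case (elim x)
      have e: "complex_of_real (exp (- \<bar>x\<bar>)) * exp (- (\<i> * of_real (x * \<xi>))) = exp (complex_of_real (- \<bar>x\<bar>) - \<i> * of_real (x * \<xi>))"
        unfolding exp_of_real[symmetric] exp_add[symmetric] by simp
      show ?case
      proof (cases "x > 0")
        case True
        then show ?thesis unfolding e by (simp add: gamma_kernel_def algebra_simps)
      next
        case False
        then have "x < 0" using elim by simp
        then show ?thesis unfolding e by (simp add: gamma_kernel_def algebra_simps)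
      qed
    qed
  next
    show "(\<lambda>x. gamma_kernel 1 ?p x + gamma_kernel 1 ?q (0 + (-1) * x)) \<in> borel_measurable lborel"
      using i1(1) i2 by (intro borel_measurable_integrable Bochner_Integration.integrable_add)
  qed measurable
  also have "\<dots> = (LINT x|lborel. gamma_kernel 1 ?p x) + (LINT x|lborel. gamma_kernel 1 ?q (0 + (-1) * x))"
    by (rule Bochner_Integration.integral_add[OF i1(1) i2])
  also have "(LINT x|lborel. gamma_kernel 1 ?q (0 + (-1) * x)) = (LINT x|lborel. gamma_kernel 1 ?q x)"
    using lborel_integral_real_affine[of "-1" "gamma_kernel 1 ?q" 0] by simp
  also have "(LINT x|lborel. gamma_kernel 1 ?p x) = 1 / ?p"
    using integral_gamma_kernel_nat[of ?p 0] by simp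
  also have "(LINT x|lborel. gamma_kernel 1 ?q x) = 1 / ?q"
    using integral_gamma_kernel_nat[of ?q 0] by simp
  also have "1 / ?p + 1 / ?q = 2 / complex_of_real (1 + \<xi>\<^sup>2)"
  proof -
    have "?p \<noteq> 0" "?q \<noteq> 0" by (auto simp: complex_eq_iff)
    then have "1 / ?p + 1 / ?q = (?p + ?q) / (?p * ?q)" by (simp add: add_frac_eq)
    also have "?p * ?q = complex_of_real (1 + \<xi>\<^sup>2)" by (simp add: algebra_simps power2_eq_square)
    finally show ?thesis by simp
  qed
  finally show ?thesis .
qed

lemma power_exp_minus_le: assumes "x \<ge> (0::real)" shows "x ^ m * exp (- x) \<le> fact m"
proof -
  have "(\<Sum>n\<in>{m}. x ^ n /\<^sub>R fact n) \<le> (\<Sum>n. x ^ n /\<^sub>R fact n)"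
    using assms by (intro sum_le_suminf sums_summable[OF exp_converges]) auto
  also have "\<dots> = exp x" by (rule sums_unique[OF exp_converges, symmetric])
  finally have "x ^ m \<le> fact m * exp x" by (simp add: field_simps)
  then show ?thesis by (simp add: exp_minus field_simps)
qed

text \<open>Up to m! this is the transform of x ^ m * exp (- x) on the positive half line, which
  vanishes at u \<le> 0. The condition m \<ge> 1 secures the continuity at 0 and the integrability
  that inversion asks for.\<close>

lemma inversion_gamma:
  assumes m: "m \<ge> 1" and u: "u \<le> 0"
  shows "integrable lborel (\<lambda>\<xi>. 1 / (1 + \<i> * complex_of_real \<xi>) ^ Suc m)"
    and "(LINT \<xi>|lborel. 1 / (1 + \<i> * complex_of_real \<xi>) ^ Suc m * exp (\<i> * complex_of_real (u * \<xi>))) = 0"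
proof -
  let ?f = "gamma_kernel (real m + 1) 1"
  have fe: "?f x = complex_of_real ((max 0 x) ^ m * exp (- x))" for x
  proof (cases "x > 0")
    case True
    then have "x powr real m = x ^ m" by (simp add: powr_realpow)
    then show ?thesis using True by (simp add: gamma_kernel_def exp_of_real[symmetric])
  next
    case False
    then show ?thesis using m by (simp add: gamma_kernel_def max_def power_0_left)
  qed
  have hat: "fourier ?f \<xi> = fact m * (1 / (1 + \<i> * complex_of_real \<xi>) ^ Suc m)" for \<xi>
    unfolding fourier_def gamma_kernel_shift using integral_gamma_kernel_nat[of "1 + \<i> * complex_of_real \<xi>" m] by simp
  have nz: "1 + \<i> * complex_of_real \<xi> \<noteq> 0" for \<xi> by (simp add: complex_eq_iff)
  have nrm: "norm (1 + \<i> * complex_of_real \<xi>) = sqrt (1 + \<xi>\<^sup>2)" for \<xi> by (simp add: cmod_def)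
  show int: "integrable lborel (\<lambda>\<xi>. 1 / (1 + \<i> * complex_of_real \<xi>) ^ Suc m)"
  proof (rule Bochner_Integration.integrable_bound[OF integrable_one_plus_square_powr[of 1]])
    show "(\<lambda>\<xi>. 1 / (1 + \<i> * complex_of_real \<xi>) ^ Suc m) \<in> borel_measurable lborel"
      using nz by (auto intro!: borel_measurable_continuous_onI continuous_intros)
    show "AE \<xi> in lborel. norm (1 / (1 + \<i> * complex_of_real \<xi>) ^ Suc m) \<le> norm ((1 + \<xi>\<^sup>2) powr (- 1))"
    proof (rule AE_I2)
      fix \<xi>
      have "1 \<le> sqrt (1 + \<xi>\<^sup>2)" by simp
      then have "sqrt (1 + \<xi>\<^sup>2) ^ 2 \<le> sqrt (1 + \<xi>\<^sup>2) ^ Suc m" using m by (intro power_increasing) auto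
      then have "1 + \<xi>\<^sup>2 \<le> sqrt (1 + \<xi>\<^sup>2) ^ Suc m" by simp
      then have "1 / sqrt (1 + \<xi>\<^sup>2) ^ Suc m \<le> 1 / (1 + \<xi>\<^sup>2)" by (intro divide_left_mono) (auto intro!: mult_pos_pos add_pos_nonneg zero_less_power)
      then show "norm (1 / (1 + \<i> * complex_of_real \<xi>) ^ Suc m) \<le> norm ((1 + \<xi>\<^sup>2) powr (- 1))"
        unfolding norm_divide norm_power nrm by (simp add: powr_minus_divide)
    qed
  qed simp
  have "(LINT \<xi>|lborel. fourier ?f \<xi> * exp (\<i> * complex_of_real (u * \<xi>))) = 2 * pi * ?f u"
  proof (rule fourier_inversion)
    show "integrable lborel ?f" by (intro integrable_gamma_kernel) auto
    show "continuous_on UNIV ?f" unfolding fe[abs_def] by (intro continuous_intros)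
    show "norm (?f x) \<le> fact m" for x
    proof (cases "x \<ge> 0")
      case True
      then show ?thesis unfolding fe norm_of_real using power_exp_minus_le[OF True, of m] by (simp add: max_def abs_mult)
    next
      case False
      then show ?thesis unfolding fe using m by (simp add: max_def power_0_left)
    qed
    show "integrable lborel (fourier ?f)" unfolding hat[abs_def] using int by (rule integrable_mult_right)
  qed
  moreover have "?f u = 0" using u by (simp add: gamma_kernel_def)
  ultimately have "(LINT \<xi>|lborel. fact m * (1 / (1 + \<i> * complex_of_real \<xi>) ^ Suc m * exp (\<i> * complex_of_real (u * \<xi>)))) = 0"
    unfolding hat by (simp add: mult.assoc)
  then show "(LINT \<xi>|lborel. 1 / (1 + \<i> * complex_of_real \<xi>) ^ Suc m * exp (\<i> * complex_of_real (u * \<xi>))) = 0"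
    unfolding integral_mult_right_zero by simp
qed

text \<open>In partial fractions only the term with 1 - \<i> \<omega> has an inverse transform on
  the negative half line, a multiple of exp u. The factors 1 + \<i> \<omega> bring decay and change
  the function's shape for u > 0 only.\<close>

definition cutoff_kernel :: "nat \<Rightarrow> real \<Rightarrow> complex" where
  "cutoff_kernel m \<omega> = 1 / ((1 - \<i> * complex_of_real \<omega>) * (1 + \<i> * complex_of_real \<omega>) ^ m)"

lemma norm_cutoff_kernel: "norm (cutoff_kernel m \<omega>) = (1 + \<omega>\<^sup>2) powr (- ((real m + 1) / 2))"
proof -
  have n: "norm (1 + \<i> * complex_of_real \<omega>) = sqrt (1 + \<omega>\<^sup>2)" "norm (1 - \<i> * complex_of_real \<omega>) = sqrt (1 + \<omega>\<^sup>2)"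
    by (simp_all add: cmod_def)
  have pos: "1 + \<omega>\<^sup>2 > 0" by (simp add: add_pos_nonneg)
  have "norm (cutoff_kernel m \<omega>) = 1 / sqrt (1 + \<omega>\<^sup>2) ^ Suc m"
    unfolding cutoff_kernel_def norm_divide norm_mult norm_power n by simp
  also have "sqrt (1 + \<omega>\<^sup>2) ^ Suc m = ((1 + \<omega>\<^sup>2) powr (1/2)) powr real (Suc m)"
    using pos by (subst powr_realpow) (auto simp: powr_half_sqrt)
  also have "\<dots> = (1 + \<omega>\<^sup>2) powr ((real m + 1) / 2)" by (simp add: powr_powr add.commute)
  finally show ?thesis by (simp add: powr_minus_divide)
qed

lemma cutoff_kernel_measurable[measurable]: "cutoff_kernel m \<in> borel_measurable borel"
proof -
  have "1 - \<i> * complex_of_real \<omega> \<noteq> 0" "1 + \<i> * complex_of_real \<omega> \<noteq> 0" for \<omega> by (auto simp: complex_eq_iff)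
  then show ?thesis unfolding cutoff_kernel_def[abs_def]
    by (intro borel_measurable_continuous_onI continuous_intros) auto
qed

lemma integrable_cutoff_kernel: assumes "m \<ge> 1" shows "integrable lborel (cutoff_kernel m)"
proof (rule Bochner_Integration.integrable_bound[OF integrable_one_plus_square_powr[of "(real m + 1) / 2"]])
  show "AE \<omega> in lborel. norm (cutoff_kernel m \<omega>) \<le> norm ((1 + \<omega>\<^sup>2) powr (- ((real m + 1) / 2)))"
    by (simp add: norm_cutoff_kernel)
qed (use assms in auto)

text \<open>Since (1 - \<i> \<omega>) + (1 + \<i> \<omega>) = 2, each kernel is half the sum of its
  predecessor and a term that \<open>inversion_gamma\<close> sends to 0. The induction starts from
  the pair exp (- |x|) and 2 / (1 + \<omega>^2).\<close>

lemma inverse_fourier_cutoff_kernel: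
  assumes u: "u \<le> 0"
  shows "(LINT \<omega>|lborel. cutoff_kernel (Suc m) \<omega> * exp (\<i> * complex_of_real (u * \<omega>))) = complex_of_real (2 * pi / 2 ^ Suc m * exp u)"
proof (induction m)
  case 0
  let ?f = "\<lambda>x. complex_of_real (exp (- \<bar>x\<bar>))"
  have ke: "fourier ?f \<omega> = 2 * cutoff_kernel 1 \<omega>" for \<omega>
  proof -
    have "(1 - \<i> * complex_of_real \<omega>) * (1 + \<i> * complex_of_real \<omega>) = complex_of_real (1 + \<omega>\<^sup>2)"
      by (simp add: algebra_simps power2_eq_square)
    then show ?thesis by (simp add: fourier_exp_abs cutoff_kernel_def)
  qed
  have fi: "integrable lborel ?f"
  proof -
    have i: "integrable lborel (gamma_kernel 1 1)" by (intro integrable_gamma_kernel) auto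
    have "integrable lborel (\<lambda>x. gamma_kernel 1 1 x + gamma_kernel 1 1 (0 + (-1) * x))"
      by (intro Bochner_Integration.integrable_add i lborel_integrable_real_affine[OF i]) simp
    then show ?thesis
    proof (rule integrable_cong_AE_imp)
      have "AE x in lborel. x \<noteq> (0::real)" by (rule AE_lborel_singleton)
      then show "AE x in lborel. gamma_kernel 1 1 x + gamma_kernel 1 1 (0 + (-1) * x) = ?f x"
        by eventually_elim (auto simp: gamma_kernel_def exp_of_real[symmetric] indicator_def)
    qed measurable
  qed
  have "(LINT \<omega>|lborel. fourier ?f \<omega> * exp (\<i> * complex_of_real (u * \<omega>))) = 2 * pi * ?f u"
  proof (rule fourier_inversion[OF fi, of 1])
    show "continuous_on UNIV ?f" by (intro continuous_intros)
    show "integrable lborel (fourier ?f)" unfolding ke[abs_def] by (intro integrable_mult_right integrable_cutoff_kernel) simp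
  qed simp
  then have "2 * (LINT \<omega>|lborel. cutoff_kernel 1 \<omega> * exp (\<i> * complex_of_real (u * \<omega>))) = 2 * pi * complex_of_real (exp u)"
    unfolding ke mult.assoc integral_mult_right_zero using u by simp
  then show ?case by simp
next
  case (Suc m)
  let ?a = "\<lambda>\<omega>. 1 - \<i> * complex_of_real \<omega>" and ?b = "\<lambda>\<omega>. 1 + \<i> * complex_of_real \<omega>"
  have rec: "cutoff_kernel (Suc (Suc m)) \<omega> = (cutoff_kernel (Suc m) \<omega> + 1 / ?b \<omega> ^ Suc (Suc m)) / 2" for \<omega>
  proof -
    have nz: "?a \<omega> \<noteq> 0" "?b \<omega> \<noteq> 0" by (auto simp: complex_eq_iff)
    have "(1 / (a * B) + 1 / (B * b)) / 2 = (a + b) / 2 / (a * (B * b))" if "a \<noteq> 0" "b \<noteq> 0" "B \<noteq> 0" for a b B :: complex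
      using that by (simp add: field_simps)
    from this[of "?a \<omega>" "?b \<omega>" "?b \<omega> ^ Suc m"] nz show ?thesis
      unfolding cutoff_kernel_def power_Suc2[of _ "Suc m"] by simp
  qed
  have i1: "integrable lborel (\<lambda>\<omega>. cutoff_kernel (Suc m) \<omega> * exp (\<i> * complex_of_real (u * \<omega>)))"
    by (rule Bochner_Integration.integrable_bound[OF integrable_norm[OF integrable_cutoff_kernel[of "Suc m"]]]) (auto simp: norm_mult)
  have i2: "integrable lborel (\<lambda>\<omega>. 1 / ?b \<omega> ^ Suc (Suc m) * exp (\<i> * complex_of_real (u * \<omega>)))"
  proof (rule Bochner_Integration.integrable_bound[OF integrable_norm[OF inversion_gamma(1)[of "Suc m" u]]])
    show "(\<lambda>\<omega>. 1 / ?b \<omega> ^ Suc (Suc m) * exp (\<i> * complex_of_real (u * \<omega>))) \<in> borel_measurable lborel"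
      using borel_measurable_integrable[OF inversion_gamma(1)[of "Suc m" u]] u by (intro borel_measurable_times) auto
    show "AE \<omega> in lborel. norm (1 / ?b \<omega> ^ Suc (Suc m) * exp (\<i> * complex_of_real (u * \<omega>))) \<le> norm (norm (1 / ?b \<omega> ^ Suc (Suc m)))"
      unfolding norm_mult by (intro AE_I2) simp
  qed (use u in auto)
  have "(LINT \<omega>|lborel. cutoff_kernel (Suc (Suc m)) \<omega> * exp (\<i> * complex_of_real (u * \<omega>))) =
    (LINT \<omega>|lborel. (cutoff_kernel (Suc m) \<omega> * exp (\<i> * complex_of_real (u * \<omega>)) + 1 / ?b \<omega> ^ Suc (Suc m) * exp (\<i> * complex_of_real (u * \<omega>))) / 2)"
    by (intro Bochner_Integration.integral_cong refl) (simp add: rec distrib_right add_divide_distrib)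
  also have "\<dots> = ((LINT \<omega>|lborel. cutoff_kernel (Suc m) \<omega> * exp (\<i> * complex_of_real (u * \<omega>))) + (LINT \<omega>|lborel. 1 / ?b \<omega> ^ Suc (Suc m) * exp (\<i> * complex_of_real (u * \<omega>)))) / 2"
    unfolding integral_divide_zero Bochner_Integration.integral_add[OF i1 i2] ..
  also have "\<dots> = complex_of_real (2 * pi / 2 ^ Suc (Suc m) * exp u)"
    unfolding Suc inversion_gamma(2)[of "Suc m" u, OF _ u, simplified] using inversion_gamma(2)[of "Suc m" u] u by simp
  finally show ?case .
qed

section \<open>Finite propagation speed\<close>

text \<open>Zorn's lemma gives a maximal separated set; a point far from it could be added, so it is
  a net. The alternative \<open>z = x\<close> covers the points of the net itself also when e \<le>
  0.\<close>

lemma maximal_separated_subset: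
  fixes S :: "'a::metric_space set"
  shows "\<exists>Z\<subseteq>S. (\<forall>x\<in>Z. \<forall>y\<in>Z. x \<noteq> y \<longrightarrow> e \<le> dist x y) \<and> (\<forall>x\<in>S. \<exists>z\<in>Z. z = x \<or> dist z x < e)"
proof -
  define \<A> where "\<A> = {Z. Z \<subseteq> S \<and> (\<forall>x\<in>Z. \<forall>y\<in>Z. x \<noteq> y \<longrightarrow> e \<le> dist x y)}"
  have "\<exists>M\<in>\<A>. \<forall>X\<in>\<A>. M \<subseteq> X \<longrightarrow> X = M"
  proof (rule subset_Zorn')
    fix \<C> assume c: "subset.chain \<A> \<C>"
    then have sub: "\<C> \<subseteq> \<A>" and lin: "\<And>X Y. X \<in> \<C> \<Longrightarrow> Y \<in> \<C> \<Longrightarrow> X \<subseteq> Y \<or> Y \<subseteq> X"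
      by (auto simp: subset.chain_def)
    have "e \<le> dist x y" if xy: "x \<in> \<Union>\<C>" "y \<in> \<Union>\<C>" "x \<noteq> y" for x y
    proof -
      from xy obtain X Y where X: "X \<in> \<C>" "x \<in> X" "Y \<in> \<C>" "y \<in> Y" by blast
      from lin[OF X(1,3)] obtain W where "W \<in> \<C>" "x \<in> W" "y \<in> W" using X by blast
      then show ?thesis using sub xy(3) unfolding \<A>_def by blast
    qed
    moreover have "\<Union>\<C> \<subseteq> S" using sub by (auto simp: \<A>_def)
    ultimately show "\<Union>\<C> \<in> \<A>" unfolding \<A>_def by blast
  qed
  then obtain Z where Z: "Z \<in> \<A>" and max: "\<And>X. X \<in> \<A> \<Longrightarrow> Z \<subseteq> X \<Longrightarrow> X = Z" by blast
  have "\<exists>z\<in>Z. z = x \<or> dist z x < e" if x: "x \<in> S" for x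
  proof (rule ccontr)
    assume n: "\<not> (\<exists>z\<in>Z. z = x \<or> dist z x < e)"
    then have far: "x \<notin> Z" "\<And>z. z \<in> Z \<Longrightarrow> e \<le> dist z x" by (auto simp: not_less)
    then have "insert x Z \<in> \<A>" using Z x by (auto simp: \<A>_def dist_commute)
    with max[of "insert x Z"] far(1) show False by blast
  qed
  moreover have "Z \<subseteq> S" "\<forall>x\<in>Z. \<forall>y\<in>Z. x \<noteq> y \<longrightarrow> e \<le> dist x y" using Z by (auto simp: \<A>_def)
  ultimately show ?thesis by (intro exI[of _ Z] conjI ballI) auto
qed

text \<open>At most (k + 1) times the measure of W many of the disjoint sets can have measure above
  1 / (k + 1), and every positive measure exceeds one of these levels.\<close>

lemma countable_disjoint_positive_measure:
  fixes A :: "'b \<Rightarrow> 'a set"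
  assumes W: "W \<in> sets \<mu>" "emeasure \<mu> W < \<infinity>" and A: "\<And>z. z \<in> Z \<Longrightarrow> A z \<in> sets \<mu>" "\<And>z. z \<in> Z \<Longrightarrow> A z \<subseteq> W"
    "\<And>z. z \<in> Z \<Longrightarrow> 0 < emeasure \<mu> (A z)" and disj: "disjoint_family_on A Z"
  shows "countable Z"
proof -
  have mpos: "0 < measure \<mu> (A z)" if "z \<in> Z" for z
  proof -
    have "emeasure \<mu> (A z) \<le> emeasure \<mu> W" using A(2)[OF that] W(1) by (rule emeasure_mono)
    then have "emeasure \<mu> (A z) \<noteq> top" using W(2) by (auto simp: top_unique)
    then show ?thesis using A(3)[OF that] by (simp add: measure_def enn2real_positive_iff less_top)
  qed
  have card_le: "real (card F) \<le> real (Suc k) * measure \<mu> W"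
    if F: "finite F" "F \<subseteq> {z\<in>Z. measure \<mu> (A z) > 1 / real (Suc k)}" for F k
  proof -
    have fin: "emeasure \<mu> (A z) \<noteq> \<infinity>" if "z \<in> F" for z
      using emeasure_mono[of "A z" W \<mu>] A(2)[of z] W that F(2) by (auto simp: top_unique)
    have "real (card F) * (1 / real (Suc k)) = (\<Sum>z\<in>F. 1 / real (Suc k))" by simp
    also have "\<dots> \<le> (\<Sum>z\<in>F. measure \<mu> (A z))" using F(2) by (intro sum_mono) auto
    also have "\<dots> = measure \<mu> (\<Union>z\<in>F. A z)"
      using F A(1) fin disjoint_family_on_mono[OF _ disj, of F] by (intro measure_finite_Union[symmetric]) auto
    also have "\<dots> \<le> measure \<mu> W"
      using F A(1,2) W by (intro measure_mono_fmeasurable) (auto simp: fmeasurable_def intro!: sets.finite_UN)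
    finally show ?thesis by (simp add: field_simps)
  qed
  have "finite {z\<in>Z. measure \<mu> (A z) > 1 / real (Suc k)}" (is "finite ?Y") for k
  proof (rule ccontr)
    assume "infinite ?Y"
    then obtain F where F: "finite F" "card F = Suc (nat \<lceil>real (Suc k) * measure \<mu> W\<rceil>)" "F \<subseteq> ?Y"
      using infinite_arbitrarily_large by blast
    have "real (card F) > real (Suc k) * measure \<mu> W" unfolding F(2) by linarith
    with card_le[OF F(1,3)] show False by simp
  qed
  then have "countable (\<Union>k. {z\<in>Z. measure \<mu> (A z) > 1 / real (Suc k)})"
    by (intro countable_UN[OF countableI_type] countable_finite)
  moreover have "Z \<subseteq> (\<Union>k. {z\<in>Z. measure \<mu> (A z) > 1 / real (Suc k)})"
  proof
    fix z assume z: "z \<in> Z"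
    obtain k where "inverse (real (Suc k)) < measure \<mu> (A z)" using reals_Archimedean[OF mpos[OF z]] by blast
    then show "z \<in> (\<Union>k. {z\<in>Z. measure \<mu> (A z) > 1 / real (Suc k)})" using z by (auto simp: inverse_eq_divide)
  qed
  ultimately show ?thesis by (rule countable_subset[rotated])
qed

text \<open>A substitute for separability of the space: separated points of the support carry
  disjoint balls of positive measure inside a ball of finite measure, so a net of the support is
  countable.\<close>

lemma metric_measure_space_cover:
  fixes \<mu> :: "'a::metric_space measure"
  assumes mms: "metric_measure_space \<mu>" and e: "e > 0"
  shows "\<exists>Z :: nat \<Rightarrow> 'a. AE x in \<mu>. \<exists>n. dist (Z n) x < e"
proof -
  have sets[simp, measurable_cong]: "sets \<mu> = sets borel" and fin: "\<And>x r. 0 < r \<Longrightarrow> emeasure \<mu> (ball x r) < \<infinity>"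
    and pos: "AE x in \<mu>. \<forall>r>0. 0 < emeasure \<mu> (ball x r)"
    using mms by (auto simp: metric_measure_space_def)
  define S where "S n = {x \<in> ball undefined (real n). \<forall>r>0. 0 < emeasure \<mu> (ball x r)}" for n
  have "\<exists>Z. \<forall>n. Z n \<subseteq> S n \<and> (\<forall>x\<in>Z n. \<forall>y\<in>Z n. x \<noteq> y \<longrightarrow> e \<le> dist x y) \<and> (\<forall>x\<in>S n. \<exists>z\<in>Z n. z = x \<or> dist z x < e)"
    by (rule choice, rule allI, rule maximal_separated_subset)
  then obtain Z where Z: "\<forall>n. Z n \<subseteq> S n \<and> (\<forall>x\<in>Z n. \<forall>y\<in>Z n. x \<noteq> y \<longrightarrow> e \<le> dist x y) \<and> (\<forall>x\<in>S n. \<exists>z\<in>Z n. z = x \<or> dist z x < e)"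
    by (rule exE)
  note Z = Z[rule_format, THEN conjunct1] Z[rule_format, THEN conjunct2, THEN conjunct1, rule_format]
    Z[rule_format, THEN conjunct2, THEN conjunct2, rule_format]
  have "countable (Z n)" for n
  proof (rule countable_disjoint_positive_measure[where A="\<lambda>z. ball z (e/2)" and W="ball undefined (real n + e)" and \<mu>=\<mu>])
    show "emeasure \<mu> (ball undefined (real n + e)) < \<infinity>" using e by (intro fin) simp
    show "ball z (e/2) \<subseteq> ball undefined (real n + e)" if "z \<in> Z n" for z
    proof
      fix x assume "x \<in> ball z (e/2)"
      moreover have "dist undefined z < real n" using Z(1) that by (auto simp: S_def)
      ultimately show "x \<in> ball undefined (real n + e)"
        using dist_triangle[of undefined x z] e by auto
    qed
    show "0 < emeasure \<mu> (ball z (e/2))" if "z \<in> Z n" for z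
    proof -
      have "z \<in> S n" using Z(1)[of n] that by blast
      then show ?thesis using e by (simp add: S_def)
    qed
    show "disjoint_family_on (\<lambda>z. ball z (e/2)) (Z n)"
      unfolding disjoint_family_on_def
    proof (intro ballI impI)
      fix x y assume xy: "x \<in> Z n" "y \<in> Z n" "x \<noteq> y"
      show "ball x (e/2) \<inter> ball y (e/2) = {}"
      proof (rule ccontr)
        assume "ball x (e/2) \<inter> ball y (e/2) \<noteq> {}"
        then obtain w where "dist x w < e/2" "dist y w < e/2" by auto
        then have "dist x y < e" using dist_triangle[of x y w] by (simp add: dist_commute)
        with Z(2)[OF xy] show False by simp
      qed
    qed
  qed auto
  \<comment> \<open>Inserting \<open>undefined\<close> makes the set nonempty, so that it can be
    enumerated by a sequence.\<close>
  then have cnt: "countable (insert undefined (\<Union>n. Z n))" by simp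
  define z where "z = from_nat_into (insert undefined (\<Union>n. Z n))"
  have rz: "range z = insert undefined (\<Union>n. Z n)" unfolding z_def using cnt by (intro range_from_nat_into) auto
  have "AE x in \<mu>. \<exists>n. dist (z n) x < e"
    using pos
  proof eventually_elim
    case (elim x)
    obtain n where "dist undefined x < real n" using reals_Archimedean2 by blast
    then have "x \<in> S n" using elim by (simp add: S_def)
    from Z(3)[OF this] obtain w where w: "w \<in> Z n" "w = x \<or> dist w x < e" by blast
    then have "w \<in> range z" unfolding rz by blast
    moreover have "dist w x < e" using w(2) e by auto
    ultimately show ?case by auto
  qed
  then show ?thesis by blast
qed

section \<open>The operators of the symbols \<open>\<Psi> v\<close> under the hypotheses of the
  theorem\<close>

locale propagation = operator_calculus \<mu> D L
  for \<mu> :: "'a::metric_space measure" and D :: "('a \<Rightarrow> complex) set" and L :: "('a \<Rightarrow> complex) \<Rightarrow> ('a \<Rightarrow> complex)" +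
  fixes \<sigma> \<kappa> C\<^sub>0 :: real
  assumes mms: "metric_measure_space \<mu>" and fps: "finite_propagation_speed \<mu> D L"
    and \<sigma>: "\<sigma> > 0" and \<kappa>: "\<kappa> \<ge> 0"
    and hyp: "\<forall>t>0. op_norm \<mu> 2 \<infinity>
           (\<lambda>f x. complex_of_real (sqrt (vol \<mu> t x)) * fc (\<lambda>u. complex_of_real ((1 + t\<^sup>2 * u) powr (- \<sigma>))) f x)
         \<le> ennreal (C\<^sub>0 * (1 + t\<^sup>2) powr \<kappa>)"
begin

lemma sets_mu[simp, measurable_cong]: "sets \<mu> = sets borel"
  using mms by (simp add: metric_measure_space_def)

lemma ball_finite: "0 < r \<Longrightarrow> emeasure \<mu> (ball x r) < \<infinity>"
  using mms by (simp add: metric_measure_space_def)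

lemma sigma_finite_mu: "sigma_finite_measure \<mu>"
proof
  let ?A = "range (\<lambda>n::nat. ball (undefined::'a) (real (Suc n)))"
  have "\<Union>?A = UNIV"
  proof -
    have "x \<in> \<Union>?A" for x
    proof -
      obtain n where "dist undefined x < real n" using reals_Archimedean2 by blast
      then have "x \<in> ball undefined (real (Suc n))" by simp
      then show ?thesis by blast
    qed
    then show ?thesis by blast
  qed
  moreover have "space \<mu> = UNIV" using sets_eq_imp_space_eq[OF sets_mu] by simp
  ultimately show "\<exists>A. countable A \<and> A \<subseteq> sets \<mu> \<and> \<Union>A = space \<mu> \<and> (\<forall>a\<in>A. emeasure \<mu> a \<noteq> \<infinity>)"
    using ball_finite by (intro exI[of _ ?A]) (force simp: less_top)
qed

text \<open>Positive and strictly larger than \<open>C\<^sub>0\<close>: the operator norm is an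
  infimum, and only a strict upper bound on it produces an actual extension in
  \<open>hyp_AE\<close>.\<close>

definition C\<^sub>1 :: real where "C\<^sub>1 = \<bar>C\<^sub>0\<bar> + 1"

abbreviation "resolvent t \<equiv> (\<lambda>u. complex_of_real ((1 + t\<^sup>2 * u) powr (- \<sigma>)))"

lemma bounded_borel_resolvent: "bounded_borel (half_line (resolvent t))"
proof (rule bounded_borel_half_line[of _ 1])
  fix u :: real assume "u \<ge> 0"
  then have "(1 + t\<^sup>2 * u) powr (- \<sigma>) \<le> 1 powr (- \<sigma>)" using \<sigma> by (intro powr_mono2') auto
  then show "norm (resolvent t u) \<le> 1" by simp
qed measurable

lemma hyp_AE:
  assumes t: "t > 0" and h: "h \<in> Lp \<mu> 2"
  shows "AE x in \<mu>. sqrt (vol \<mu> t x) * norm (fc (resolvent t) h x) \<le> C\<^sub>1 * (1 + t\<^sup>2) powr \<kappa> * Lp_norm \<mu> 2 h"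
proof -
  let ?T = "\<lambda>f x. complex_of_real (sqrt (vol \<mu> t x)) * fc (resolvent t) f x"
  have "1 + t\<^sup>2 > 0" by (simp add: add_pos_nonneg)
  then have p: "(1 + t\<^sup>2) powr \<kappa> > 0" by simp
  have "op_norm \<mu> 2 \<infinity> ?T \<le> ennreal (C\<^sub>0 * (1 + t\<^sup>2) powr \<kappa>)" using hyp t by blast
  also have "\<dots> < ennreal (C\<^sub>1 * (1 + t\<^sup>2) powr \<kappa>)"
    using p by (intro ennreal_lessI mult_pos_pos mult_strict_right_mono) (auto simp: C\<^sub>1_def)
  finally obtain C S where C: "0 \<le> C" "ennreal C < ennreal (C\<^sub>1 * (1 + t\<^sup>2) powr \<kappa>)"
     and S: "linear_op \<mu> (Lp \<mu> 2) (Lp \<mu> \<infinity>) S" "\<And>f. f \<in> Lp \<mu> 2 \<Longrightarrow> AE x in \<mu>. S f x = ?T f x"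
       "\<And>f. f \<in> Lp \<mu> 2 \<Longrightarrow> Lp_norm \<mu> \<infinity> (S f) \<le> C * Lp_norm \<mu> 2 f"
    unfolding op_norm_def Inf_less_iff by auto
  have Clt: "C \<le> C\<^sub>1 * (1 + t\<^sup>2) powr \<kappa>" using C by (simp add: ennreal_less_iff)
  have "S h \<in> Lp \<mu> \<infinity>" using S(1) h by (simp add: linear_op_def)
  from Linf_bound[OF this] S(2)[OF h] show ?thesis
  proof eventually_elim
    case (elim x)
    have "vol \<mu> t x \<ge> 0" by (simp add: vol_def)
    then have "sqrt (vol \<mu> t x) * norm (fc (resolvent t) h x) = norm (S h x)" using elim(2) by (simp add: norm_mult)
    also have "\<dots> \<le> C * Lp_norm \<mu> 2 h" using elim(1) S(3)[OF h] by simp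
    also have "\<dots> \<le> C\<^sub>1 * (1 + t\<^sup>2) powr \<kappa> * Lp_norm \<mu> 2 h" using Clt by (intro mult_right_mono Lp_norm_nonneg)
    finally show ?case .
  qed
qed

definition \<Psi> :: "real \<Rightarrow> real \<Rightarrow> complex" where "\<Psi> v u = complex_of_real (psi (2 * \<sigma> + 1/2) (v * u))"

definition K\<^sub>\<psi> :: real where
  "K\<^sub>\<psi> = (SOME K. K \<ge> 0 \<and> (\<forall>y\<ge>0. (1 + 4 * y) powr \<sigma> * \<bar>psi (2 * \<sigma> + 1/2) y\<bar> \<le> K))"

lemma K\<^sub>\<psi>_bound: "K\<^sub>\<psi> \<ge> 0" "y \<ge> 0 \<Longrightarrow> (1 + 4 * y) powr \<sigma> * \<bar>psi (2 * \<sigma> + 1/2) y\<bar> \<le> K\<^sub>\<psi>"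
proof -
  have "\<exists>K. K \<ge> 0 \<and> (\<forall>y\<ge>0. (1 + 4 * y) powr \<sigma> * \<bar>psi (2 * \<sigma> + 1/2) y\<bar> \<le> K)" using psi_decay[OF \<sigma>] by blast
  from someI_ex[OF this] show "K\<^sub>\<psi> \<ge> 0" "y \<ge> 0 \<Longrightarrow> (1 + 4 * y) powr \<sigma> * \<bar>psi (2 * \<sigma> + 1/2) y\<bar> \<le> K\<^sub>\<psi>"
    unfolding K\<^sub>\<psi>_def by auto
qed

lemma psi_bound: assumes "y \<ge> 0" shows "\<bar>psi (2 * \<sigma> + 1/2) y\<bar> \<le> K\<^sub>\<psi>"
proof -
  have "1 * \<bar>psi (2 * \<sigma> + 1/2) y\<bar> \<le> (1 + 4 * y) powr \<sigma> * \<bar>psi (2 * \<sigma> + 1/2) y\<bar>"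
    using assms \<sigma> by (intro mult_right_mono ge_one_powr_ge_zero) auto
  then show ?thesis using K\<^sub>\<psi>_bound(2)[OF assms] by simp
qed

lemma psi_measurable[measurable]: "psi (2 * \<sigma> + 1/2) \<in> borel_measurable borel"
  using psi_deriv[of "2 * \<sigma> + 1/2"] \<sigma>
  by (intro borel_measurable_continuous_onI continuous_at_imp_continuous_on ballI DERIV_isCont) auto

lemma bounded_borel_\<Psi>: assumes "v \<ge> 0" shows "bounded_borel (half_line (\<Psi> v))"
proof (rule bounded_borel_half_line[of _ K\<^sub>\<psi>])
  show "\<Psi> v \<in> borel_measurable borel" unfolding \<Psi>_def by measurable
  show "norm (\<Psi> v u) \<le> K\<^sub>\<psi>" if "u \<ge> 0" for u using psi_bound[of "v * u"] assms that by (simp add: \<Psi>_def)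
qed

lemma \<Psi>_sup_bound:
  assumes v: "v > 0" and h: "h \<in> Lp \<mu> 2"
  shows "AE x in \<mu>. sqrt (vol \<mu> (2 * sqrt v) x) * norm (fc (\<Psi> v) h x) \<le> C\<^sub>1 * (1 + 4 * v) powr \<kappa> * K\<^sub>\<psi> * Lp_norm \<mu> 2 h"
proof -
  \<comment> \<open>Twice the propagation distance of \<open>\<Psi> v\<close>; the margin is spent
    in \<open>\<Psi>_Linf\<close> on the cover by small balls. The symbol \<open>m\<close> below is
    the quotient of \<open>\<Psi> v\<close> by the resolvent.\<close>
  let ?t = "2 * sqrt v"
  have t: "?t > 0" "?t\<^sup>2 = 4 * v" using v by (auto simp: power_mult_distrib)
  define m where "m u = complex_of_real ((1 + 4 * v * u) powr \<sigma> * psi (2 * \<sigma> + 1/2) (v * u))" for u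
  have mb: "norm (m u) \<le> K\<^sub>\<psi>" if "u \<ge> 0" for u
    unfolding m_def norm_of_real using K\<^sub>\<psi>_bound(2)[of "v * u"] v that by (simp add: abs_mult mult.assoc)
  have bm: "bounded_borel (half_line m)" by (rule bounded_borel_half_line[OF _ mb]) (unfold m_def, measurable)
  have ceq: "half_line (\<lambda>u. resolvent ?t u * m u) = half_line (\<Psi> v)"
  proof
    fix u
    have "(1 + 4 * v * u) powr (- \<sigma>) * (1 + 4 * v * u) powr \<sigma> = 1" if "u \<ge> 0"
      using v that by (simp add: powr_add[symmetric] add_nonneg_eq_0_iff)
    then show "half_line (\<lambda>u. resolvent ?t u * m u) u = half_line (\<Psi> v) u"
      unfolding t(2) by (simp add: half_line_def m_def \<Psi>_def mult.assoc[symmetric] flip: of_real_mult)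
  qed
  have r: "represents (half_line (\<Psi> v)) h (fc (resolvent ?t) (fc m h))"
    using fc_mult[OF bounded_borel_resolvent[of ?t] bm h] unfolding ceq .
  have eq: "AE x in \<mu>. fc (\<Psi> v) h x = fc (resolvent ?t) (fc m h) x"
    using v by (intro represents_cong_AE[OF fc_represents[OF bounded_borel_\<Psi> h] r]) simp
  have mh: "fc m h \<in> Lp \<mu> 2" by (rule fc_L2[OF bm h])
  have mn: "Lp_norm \<mu> 2 (fc m h) \<le> K\<^sub>\<psi> * Lp_norm \<mu> 2 h" by (rule fc_norm_le[OF bm h mb])
  from hyp_AE[OF t(1) mh] eq show ?thesis
  proof eventually_elim
    case (elim x)
    have "sqrt (vol \<mu> ?t x) * norm (fc (\<Psi> v) h x) \<le> C\<^sub>1 * (1 + 4 * v) powr \<kappa> * Lp_norm \<mu> 2 (fc m h)"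
      using elim unfolding t(2) by simp
    also have "\<dots> \<le> C\<^sub>1 * (1 + 4 * v) powr \<kappa> * (K\<^sub>\<psi> * Lp_norm \<mu> 2 h)"
      using mn by (intro mult_left_mono) (auto simp: C\<^sub>1_def)
    finally show ?case by (simp add: mult.assoc)
  qed
qed

text \<open>\<open>\<Psi> v\<close> superposes the cosines with parameter r = \<surd>(v s) for 0 < s
  < 1, each of which the propagation hypothesis controls; the weight vanishes for all other
  s.\<close>

lemma \<Psi>_propagation:
  assumes v: "v > 0" and f: "f \<in> Lp \<mu> 2" "\<And>x. x \<notin> ball y e \<Longrightarrow> f x = 0" and g: "g \<in> Lp \<mu> 2" "\<And>x. x \<notin> ball z e \<Longrightarrow> g x = 0"
    and e: "e > 0" and d: "dist y z \<ge> sqrt v + 3 * e"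
  shows "form (half_line (\<Psi> v)) f g = 0"
proof -
  let ?a = "2 * \<sigma>"
  define c where "c = sqrt pi * Gamma ?a"
  have c0: "c > 0" using \<sigma> by (simp add: c_def Gamma_real_pos)
  define cs where "cs s u = complex_of_real (cos (sqrt (v * s) * sqrt u))" for s u :: real
  define G where "G s u = complex_of_real (beta_weight ?a s / c) * half_line (cs s) u" for s u
  \<comment> \<open>The two radii use up 2 e of the margin 3 e, and the rest keeps the separation
    above \<surd>v.\<close>
  have sd: "setdist (ball y e) (ball z e) \<ge> sqrt v + e"
  proof (rule le_setdistI)
    fix x x' assume "x \<in> ball y e" "x' \<in> ball z e"
    then show "sqrt v + e \<le> dist x x'"
      using d dist_triangle[of y z x] dist_triangle[of x z x'] by (simp add: dist_commute)
  qed (use e in auto)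
  have bcs: "bounded_borel (half_line (cs s))" for s
  proof (rule bounded_borel_half_line[of _ 1])
    show "cs s \<in> borel_measurable borel" unfolding cs_def by measurable
  qed (simp add: cs_def)
  have "form (G s) f g = 0" for s
  proof (cases "0 < s \<and> s < 1")
    case True
    have "sqrt (v * s) < sqrt v" using v True by simp
    then have "setdist (ball y e) (ball z e) > sqrt (v * s)" using sd e by linarith
    moreover have "sqrt (v * s) > 0" using v True by simp
    ultimately have "L2_inner \<mu> (fc (\<lambda>u. complex_of_real (cos (sqrt (v * s) * sqrt u))) f) g = 0"
      using fps f g unfolding finite_propagation_speed_def by blast
    then have "form (half_line (cs s)) f g = 0" using fc_inner[OF bcs f(1) g(1)] by (simp add: cs_def[abs_def])
    then show ?thesis unfolding G_def form_scale by simp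
  next
    case False
    then show ?thesis unfolding G_def form_scale by (auto simp: beta_weight_def indicator_def)
  qed
  moreover have "form (half_line (\<Psi> v)) f g = (LINT s|lborel. form (G s) f g)"
  proof (rule form_superposition(2)[OF _ _ _ _ bounded_borel_\<Psi> _ f(1) g(1)])
    show "sigma_finite_measure (lborel :: real measure)" by (rule lborel.sigma_finite_measure_axioms)
    show "(\<lambda>(s, u). G s u) \<in> borel_measurable (lborel \<Otimes>\<^sub>M borel)"
      unfolding G_def half_line_def cs_def by measurable
    show "integrable lborel (\<lambda>s. beta_weight ?a s / c)" using beta_weight_moment(1)[of ?a 0] \<sigma> by simp
    show "norm (G s u) \<le> beta_weight ?a s / c" for s u
    proof -
      have "norm (half_line (cs s) u) \<le> 1" by (simp add: half_line_def cs_def)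
      then have "\<bar>beta_weight ?a s / c\<bar> * norm (half_line (cs s) u) \<le> beta_weight ?a s / c * 1"
        using beta_weight_nonneg[of ?a s] c0 by (intro mult_mono) auto
      then show ?thesis unfolding G_def norm_mult norm_of_real by simp
    qed
    show "half_line (\<Psi> v) u = (LINT s|lborel. G s u)" for u
    proof (cases "u \<ge> 0")
      case True
      have "(LINT s|lborel. G s u) = (LINT s|lborel. complex_of_real (1 / c * (beta_weight ?a s * cos (sqrt (v * u) * sqrt s))))"
        using True by (intro Bochner_Integration.integral_cong) (auto simp: G_def half_line_def cs_def real_sqrt_mult mult_ac)
      also have "\<dots> = complex_of_real (1 / c * (LINT s|lborel. beta_weight ?a s * cos (sqrt (v * u) * sqrt s)))"
        by (simp only: integral_complex_of_real integral_mult_right_zero)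
      also have "(LINT s|lborel. beta_weight ?a s * cos (sqrt (v * u) * sqrt s)) = c * psi (?a + 1/2) ((sqrt (v * u))\<^sup>2)"
        unfolding c_def using \<sigma> by (intro cosine_representation) simp
      finally show ?thesis using True v c0 by (simp add: half_line_def \<Psi>_def)
    next
      case False
      then show ?thesis by (simp add: G_def half_line_def)
    qed
  qed (use v in auto)
  ultimately show ?thesis by simp
qed

end

context propagation begin

lemma \<Psi>_symmetric:
  assumes v: "v > 0" and f: "f \<in> Lp \<mu> 2" "g \<in> Lp \<mu> 2"
  shows "form (half_line (\<Psi> v)) g f = cnj (form (half_line (\<Psi> v)) f g)"
proof -
  have "(\<lambda>u. cnj (half_line (\<Psi> v) u)) = half_line (\<Psi> v)" by (auto simp: half_line_def \<Psi>_def)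
  then show ?thesis using form_cnj[OF bounded_borel_\<Psi> f] v by simp
qed

text \<open>The image is tested against its own restriction to the distant ball, which therefore has
  norm zero.\<close>

lemma \<Psi>_vanishes:
  assumes v: "v > 0" and f: "f \<in> Lp \<mu> 2" "\<And>x. x \<notin> ball y e \<Longrightarrow> f x = 0" and e: "e > 0" and d: "dist y z \<ge> sqrt v + 3 * e"
  shows "AE x in \<mu>. x \<in> ball z e \<longrightarrow> fc (\<Psi> v) f x = 0"
proof -
  have b: "bounded_borel (half_line (\<Psi> v))" using v by (intro bounded_borel_\<Psi>) simp
  define g where "g x = indicator (ball z e) x * fc (\<Psi> v) f x" for x
  have Tf: "fc (\<Psi> v) f \<in> Lp \<mu> 2" by (rule fc_L2[OF b f(1)])
  have g: "g \<in> Lp \<mu> 2" unfolding g_def by (intro L2_indicator Tf) simp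
  have "L2_inner \<mu> (fc (\<Psi> v) f) g = 0"
    unfolding fc_inner[OF b f(1) g] by (rule \<Psi>_propagation[OF v f g _ e d]) (auto simp: g_def indicator_def)
  moreover have "L2_inner \<mu> (fc (\<Psi> v) f) g = L2_inner \<mu> g g"
    unfolding L2_inner_def by (intro Bochner_Integration.integral_cong) (auto simp: g_def indicator_def)
  ultimately have "(LINT x|\<mu>. (norm (g x))\<^sup>2) = 0" using L2_inner_self[OF g] by simp
  then have "AE x in \<mu>. (norm (g x))\<^sup>2 = 0"
    using g by (subst (asm) integral_nonneg_eq_0_iff_AE) (auto simp: L2_iff)
  then show ?thesis by eventually_elim (auto simp: g_def indicator_def split: if_splits)
qed

definition C\<^sub>\<Psi> :: real where "C\<^sub>\<Psi> = C\<^sub>1 * 4 powr \<kappa> * K\<^sub>\<psi>"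

lemma C\<^sub>\<Psi>_nonneg: "C\<^sub>\<Psi> \<ge> 0" using K\<^sub>\<psi>_bound(1) by (simp add: C\<^sub>\<Psi>_def C\<^sub>1_def)

text \<open>Near a point of \<open>ball z e\<close> only the part of \<open>g\<close> at distance about \<open>\<surd>v\<close> from \<open>z\<close> is seen, and
  its \<open>L\<^sup>2\<close> norm is at most \<open>B\<close> times the square root of the volume in the hypothesis.\<close>
lemma \<Psi>_Linf:
  assumes v: "v > 0" and g: "g \<in> Lp \<mu> 2" and B: "B \<ge> 0" "AE x in \<mu>. norm (g x) \<le> B"
  shows "AE x in \<mu>. norm (fc (\<Psi> v) g x) \<le> C\<^sub>\<Psi> * (1 + v) powr \<kappa> * B"
proof -
  define r where "r = sqrt v"
  \<comment> \<open>Chosen so that r + 5 e = 2 r: for x within e of a net point, the ball of radius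
    r + 4 e about that point lies in the ball of radius 2 r about x.\<close>
  define e where "e = r / 5"
  have r0: "r > 0" and e0: "e > 0" using v by (auto simp: r_def e_def)
  define M where "M = C\<^sub>1 * (1 + 4 * v) powr \<kappa> * K\<^sub>\<psi>"
  have M0: "M \<ge> 0" using K\<^sub>\<psi>_bound(1) by (simp add: M_def C\<^sub>1_def)
  have b: "bounded_borel (half_line (\<Psi> v))" using v by (intro bounded_borel_\<Psi>) simp
  obtain Z :: "nat \<Rightarrow> 'a" where Z: "AE x in \<mu>. \<exists>n. dist (Z n) x < e"
    using metric_measure_space_cover[OF mms e0] by blast
  have main: "AE x in \<mu>. x \<in> ball (Z j) e \<longrightarrow> norm (fc (\<Psi> v) g x) \<le> M * B" for j
  proof -
    \<comment> \<open>The net balls within reach of \<open>Z j\<close>. Almost every point outside A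
      lies in a net ball whose centre is at least r + 3 e away, the separation that
      \<open>\<Psi>_vanishes\<close> asks for.\<close>
    define A where "A = (\<Union>k\<in>{k. dist (Z j) (Z k) < r + 3 * e}. ball (Z k) e)"
    have Am[measurable]: "A \<in> sets borel" unfolding A_def by (intro sets.countable_UN'' countableI_type) auto
    have Asub: "A \<subseteq> ball (Z j) (r + 4 * e)"
    proof
      fix x assume "x \<in> A"
      then obtain k where "dist (Z j) (Z k) < r + 3 * e" "dist (Z k) x < e" by (auto simp: A_def)
      then show "x \<in> ball (Z j) (r + 4 * e)" using dist_triangle[of "Z j" x "Z k"] by simp
    qed
    define g1 where "g1 x = indicator A x * g x" for x
    define g2 where "g2 x = indicator (- A) x * g x" for x
    have g12: "g1 \<in> Lp \<mu> 2" "g2 \<in> Lp \<mu> 2"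
      unfolding g1_def g2_def by (auto intro!: L2_indicator g)
    have geq: "(\<lambda>x. g1 x + g2 x) = g" by (auto simp: g1_def g2_def indicator_def)
    have Tadd: "AE x in \<mu>. fc (\<Psi> v) g x = fc (\<Psi> v) g1 x + fc (\<Psi> v) g2 x"
      using linear_op_add[OF fc_linear[OF b] g12] unfolding geq .
    \<comment> \<open>\<open>g2\<close> is not supported in one ball, so the roles are exchanged:
      \<phi> lives in the ball about \<open>Z j\<close>, its image vanishes on each distant net
      ball, hence almost everywhere where \<open>g2\<close> lives, and symmetry of the form
      transfers this to the image of \<open>g2\<close>.\<close>
    have far: "AE x in \<mu>. x \<in> ball (Z j) e \<longrightarrow> fc (\<Psi> v) g2 x = 0"
    proof -
      define \<phi> where "\<phi> x = indicator (ball (Z j) e) x * fc (\<Psi> v) g2 x" for x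
      have T2: "fc (\<Psi> v) g2 \<in> Lp \<mu> 2" by (rule fc_L2[OF b g12(2)])
      have \<phi>: "\<phi> \<in> Lp \<mu> 2" unfolding \<phi>_def by (intro L2_indicator T2) simp
      have "AE x in \<mu>. \<forall>k. dist (Z j) (Z k) \<ge> r + 3 * e \<longrightarrow> x \<in> ball (Z k) e \<longrightarrow> fc (\<Psi> v) \<phi> x = 0"
        unfolding AE_all_countable
      proof
        fix k
        show "AE x in \<mu>. dist (Z j) (Z k) \<ge> r + 3 * e \<longrightarrow> x \<in> ball (Z k) e \<longrightarrow> fc (\<Psi> v) \<phi> x = 0"
        proof (cases "dist (Z j) (Z k) \<ge> r + 3 * e")
          case True
          have "AE x in \<mu>. x \<in> ball (Z k) e \<longrightarrow> fc (\<Psi> v) \<phi> x = 0"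
            using True by (intro \<Psi>_vanishes[OF v \<phi> _ e0, of "Z j"]) (auto simp: \<phi>_def r_def)
          then show ?thesis by eventually_elim simp
        qed simp
      qed
      then have van: "AE x in \<mu>. fc (\<Psi> v) \<phi> x * cnj (g2 x) = 0"
        using Z
      proof eventually_elim
        case (elim x)
        then obtain k where k: "dist (Z k) x < e" by blast
        show ?case
        proof (cases "x \<in> A")
          case True then show ?thesis by (simp add: g2_def)
        next
          case False
          then have "dist (Z j) (Z k) \<ge> r + 3 * e" using k by (auto simp: A_def not_less)
          then show ?thesis using elim(1) k by simp
        qed
      qed
      have "L2_inner \<mu> (fc (\<Psi> v) \<phi>) g2 = 0"
        unfolding L2_inner_def using van by (rule integral_eq_zero_AE)
      then have "form (half_line (\<Psi> v)) \<phi> g2 = 0" using fc_inner[OF b \<phi> g12(2)] by simp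
      then have "L2_inner \<mu> (fc (\<Psi> v) g2) \<phi> = 0"
        unfolding fc_inner[OF b g12(2) \<phi>] \<Psi>_symmetric[OF v \<phi> g12(2)] by simp
      moreover have "L2_inner \<mu> (fc (\<Psi> v) g2) \<phi> = L2_inner \<mu> \<phi> \<phi>"
        unfolding L2_inner_def by (intro Bochner_Integration.integral_cong) (auto simp: \<phi>_def indicator_def)
      ultimately have "(LINT x|\<mu>. (norm (\<phi> x))\<^sup>2) = 0" using L2_inner_self[OF \<phi>] by simp
      then have "AE x in \<mu>. (norm (\<phi> x))\<^sup>2 = 0"
        using \<phi> by (subst (asm) integral_nonneg_eq_0_iff_AE) (auto simp: L2_iff)
      then show ?thesis by eventually_elim (auto simp: \<phi>_def indicator_def split: if_splits)
    qed
    define m where "m = measure \<mu> (ball (Z j) (r + 4 * e))"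
    have bf: "emeasure \<mu> (ball (Z j) (r + 4 * e)) < \<infinity>" using r0 e0 by (intro ball_finite) simp
    have n1: "Lp_norm \<mu> 2 g1 \<le> B * sqrt m"
    proof -
      have "(LINT x|\<mu>. (norm (g1 x))\<^sup>2) \<le> (LINT x|\<mu>. B\<^sup>2 * indicator (ball (Z j) (r + 4 * e)) x)"
      proof (rule integral_mono_AE)
        show "integrable \<mu> (\<lambda>x. (norm (g1 x))\<^sup>2)" using g12(1) by (simp add: L2_iff)
        show "integrable \<mu> (\<lambda>x. B\<^sup>2 * indicator (ball (Z j) (r + 4 * e)) x)"
          using bf by (intro integrable_mult_right integrable_real_indicator) auto
        show "AE x in \<mu>. (norm (g1 x))\<^sup>2 \<le> B\<^sup>2 * indicator (ball (Z j) (r + 4 * e)) x"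
          using B(2)
        proof eventually_elim
          case (elim x)
          then show ?case using Asub by (cases "x \<in> A") (auto simp: g1_def power_mono)
        qed
      qed
      also have "\<dots> = B\<^sup>2 * m" using bf by (simp add: m_def)
      finally have "(LINT x|\<mu>. (norm (g1 x))\<^sup>2) \<le> B\<^sup>2 * m" .
      from real_sqrt_le_mono[OF this] show ?thesis
        using B(1) by (simp add: Lp_norm_2[OF g12(1)] real_sqrt_mult)
    qed
    have pos: "AE x in \<mu>. \<forall>s>0. 0 < emeasure \<mu> (ball x s)" using mms by (simp add: metric_measure_space_def)
    from \<Psi>_sup_bound[OF v g12(1)] Tadd far pos show ?thesis
    proof eventually_elim
      case (elim x)
      show ?case
      proof
        assume x: "x \<in> ball (Z j) e"
        have fin: "emeasure \<mu> (ball x (2 * r)) < \<infinity>" using r0 by (intro ball_finite) simp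
        \<comment> \<open>Almost every point has balls of positive measure, so the volume factor can
          be divided out.\<close>
        have vpos: "vol \<mu> (2 * r) x > 0"
          using elim(4) fin r0 by (simp add: vol_def measure_def enn2real_positive_iff)
        have "ball (Z j) (r + 4 * e) \<subseteq> ball x (2 * r)"
        proof
          fix y assume "y \<in> ball (Z j) (r + 4 * e)"
          then show "y \<in> ball x (2 * r)" using x dist_triangle[of x y "Z j"] by (simp add: dist_commute e_def)
        qed
        then have "m \<le> vol \<mu> (2 * r) x"
          unfolding m_def vol_def using fin by (intro measure_mono_fmeasurable) (auto simp: fmeasurable_def)
        then have "B * sqrt m \<le> B * sqrt (vol \<mu> (2 * r) x)" using B(1) by (intro mult_left_mono) auto
        then have "Lp_norm \<mu> 2 g1 \<le> B * sqrt (vol \<mu> (2 * r) x)" using n1 by linarith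
        then have "M * Lp_norm \<mu> 2 g1 \<le> M * (B * sqrt (vol \<mu> (2 * r) x))" using M0 by (intro mult_left_mono)
        then have "sqrt (vol \<mu> (2 * r) x) * norm (fc (\<Psi> v) g1 x) \<le> sqrt (vol \<mu> (2 * r) x) * (M * B)"
          using elim(1) unfolding M_def[symmetric] r_def[symmetric] by (simp add: mult_ac)
        then have "norm (fc (\<Psi> v) g1 x) \<le> M * B" using vpos by simp
        then show "norm (fc (\<Psi> v) g x) \<le> M * B" using elim(2,3) x by simp
      qed
    qed
  qed
  have all: "AE x in \<mu>. \<forall>j. x \<in> ball (Z j) e \<longrightarrow> norm (fc (\<Psi> v) g x) \<le> M * B"
    unfolding AE_all_countable using main by blast
  have "M \<le> C\<^sub>\<Psi> * (1 + v) powr \<kappa>"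
  proof -
    have "(1 + 4 * v) powr \<kappa> \<le> (4 * (1 + v)) powr \<kappa>" using v \<kappa> by (intro powr_mono2) auto
    also have "\<dots> = 4 powr \<kappa> * (1 + v) powr \<kappa>" by (rule powr_mult)
    finally have "C\<^sub>1 * (1 + 4 * v) powr \<kappa> * K\<^sub>\<psi> \<le> C\<^sub>1 * (4 powr \<kappa> * (1 + v) powr \<kappa>) * K\<^sub>\<psi>"
      using K\<^sub>\<psi>_bound(1) by (intro mult_right_mono mult_left_mono) (auto simp: C\<^sub>1_def)
    then show ?thesis by (simp add: M_def C\<^sub>\<Psi>_def mult_ac)
  qed
  then have MB: "M * B \<le> C\<^sub>\<Psi> * (1 + v) powr \<kappa> * B" using B(1) by (rule mult_right_mono)
  from all Z show ?thesis
  proof eventually_elim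
    case (elim x)
    then obtain n where "x \<in> ball (Z n) e" by auto
    with elim(1) have "norm (fc (\<Psi> v) g x) \<le> M * B" by blast
    then show ?case using MB by (rule order_trans)
  qed
qed

text \<open>Pairing the sup bound with f gives one order of the arguments; the other is its
  conjugate because \<open>\<Psi> v\<close> is real.\<close>

lemma \<Psi>_form_bounded:
  assumes v: "v > 0" shows "form_bounded (half_line (\<Psi> v)) (C\<^sub>\<Psi> * (1 + v) powr \<kappa>)"
  unfolding form_bounded_def
proof (intro conjI ballI allI impI)
  show b: "bounded_borel (half_line (\<Psi> v))" using v by (intro bounded_borel_\<Psi>) simp
  fix f g B assume f: "f \<in> Lp \<mu> 2" "g \<in> Lp \<mu> 2" and B: "0 \<le> (B::real)" "integrable \<mu> f" "AE x in \<mu>. norm (g x) \<le> B"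
  let ?M = "C\<^sub>\<Psi> * (1 + v) powr \<kappa>"
  have Tg: "fc (\<Psi> v) g \<in> Lp \<mu> 2" by (rule fc_L2[OF b f(2)])
  have fb: "(\<lambda>x. cnj (f x)) \<in> borel_measurable \<mu>" "integrable \<mu> (\<lambda>x. cnj (f x))" using B(2) by auto
  have "norm (LINT x|\<mu>. cnj (f x) * fc (\<Psi> v) g x) \<le> (?M * B) * (LINT x|\<mu>. norm (cnj (f x)))"
    using B(1) C\<^sub>\<Psi>_nonneg by (intro bounded_mult_integrable[OF fb(2) L2_measurable[OF Tg] _ \<Psi>_Linf[OF v f(2) B(1,3)]]) auto
  moreover have "form (half_line (\<Psi> v)) g f = (LINT x|\<mu>. cnj (f x) * fc (\<Psi> v) g x)"
    unfolding fc_inner[OF b f(2,1), symmetric] L2_inner_def by (simp add: mult.commute)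
  ultimately show 1: "norm (form (half_line (\<Psi> v)) g f) \<le> ?M * (LINT x|\<mu>. norm (f x)) * B" by (simp add: mult_ac)
  show "norm (form (half_line (\<Psi> v)) f g) \<le> ?M * (LINT x|\<mu>. norm (f x)) * B"
    using 1 unfolding \<Psi>_symmetric[OF v f] by simp
qed

section \<open>Damped waves exp (- t (1 - \<i> \<xi>) u)\<close>

lemma form_bounded_zero: "form_bounded (\<lambda>u. 0) 0"
  using bounded_borel_const[of 0] by (auto simp: form_bounded_def form_def)

abbreviation "\<beta> \<equiv> \<sigma> + \<kappa> + 1/4"

abbreviation wave :: "real \<Rightarrow> real \<Rightarrow> real \<Rightarrow> complex" where
  "wave t \<xi> \<equiv> (\<lambda>u. exp (- (complex_of_real t * (1 - \<i> * complex_of_real \<xi>) * complex_of_real u)))"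

lemma norm_wave: "norm (wave t \<xi> u) = exp (- t * u)"
  by simp

lemma bounded_borel_wave: "t > 0 \<Longrightarrow> bounded_borel (half_line (wave t \<xi>))"
  by (rule bounded_borel_half_line[of _ 1]) (auto intro!: borel_measurable_continuous_onI continuous_intros)

text \<open>The two Gamma values come from (1 + v) powr \<kappa> \<le> 2 powr \<kappa> * (1 + v powr
  \<kappa>): integrated against \<open>gamma_kernel\<close>, the two terms have parameters b and b +
  \<kappa>.\<close>

definition C\<^sub>H :: real where
  "C\<^sub>H = C\<^sub>\<Psi> * 2 powr \<kappa> * (Gamma (2 * \<sigma> + 1/2) + Gamma (2 * \<sigma> + 1/2 + \<kappa>) * 4 powr \<kappa>)"

text \<open>With X = 1 + \<xi>^2 one has Re p = 1 / (4 t X) and |p| = \<surd>X * Re p. The prefactor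
  and the Gamma integral combine to (|p| / Re p) powr b = X powr (\<sigma> + 1/4), and the growth in
  v adds (Re p) powr (- \<kappa>) = (4 t X) powr \<kappa>.\<close>

lemma wave_form_bounded:
  assumes t: "t > 0"
  shows "form_bounded (half_line (wave t \<xi>)) (C\<^sub>H * (1 + \<xi>\<^sup>2) powr \<beta> * (1 + t) powr \<kappa>)"
proof -
  let ?b = "2 * \<sigma> + 1/2"
  have b: "?b \<ge> 1/2" "?b > 0" using \<sigma> by auto
  define z where "z = complex_of_real t * (1 - \<i> * complex_of_real \<xi>)"
  define X where "X = 1 + \<xi>\<^sup>2"
  have X: "X \<ge> 1" by (simp add: X_def)
  have z0: "z \<noteq> 0" using t by (auto simp: z_def complex_eq_iff)
  define p where "p = 1 / (4 * z)"
  have pe: "p = Complex (1 / (4 * t * X)) (\<xi> / (4 * t * X))"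
  proof -
    have "4 * z * Complex (1 / (4 * t * X)) (\<xi> / (4 * t * X)) = Complex ((1 + \<xi>\<^sup>2) / X) 0"
      using t X by (simp add: z_def complex_eq_iff field_simps power2_eq_square)
    also have "\<dots> = 1" using X by (simp add: X_def[symmetric] complex_eq_iff)
    finally have "4 * z * Complex (1 / (4 * t * X)) (\<xi> / (4 * t * X)) = 1" .
    then show ?thesis using z0 unfolding p_def by (metis nonzero_mult_div_cancel_left mult_eq_0_iff zero_neq_numeral)
  qed
  have \<rho>: "Re p = 1 / (4 * t * X)" by (simp add: pe)
  have \<rho>0: "Re p > 0" using t X by (simp add: \<rho>)
  have np: "norm p = sqrt X * Re p"
  proof -
    have "Im p = \<xi> * Re p" by (simp add: pe)
    then have "(norm p)\<^sup>2 = X * (Re p)\<^sup>2" unfolding cmod_power2 by (simp add: X_def power_mult_distrib distrib_right)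
    then have "norm p = sqrt (X * (Re p)\<^sup>2)" by (metis norm_ge_zero real_sqrt_unique)
    then show ?thesis using \<rho>0 by (simp add: real_sqrt_mult)
  qed
  have p4: "1 / (4 * p) = z" using z0 by (simp add: p_def)
  define P where "P = p powr complex_of_real ?b"
  have Pn: "norm P = norm p powr ?b" unfolding P_def by (subst norm_powr_real_powr') auto
  have p0: "p \<noteq> 0" using \<rho>0 by auto
  define G where "G v u = (P * gamma_kernel ?b p v) * half_line (\<Psi> v) u" for v u
  define w where "w v = norm P * norm (gamma_kernel ?b p v) * K\<^sub>\<psi>" for v
  define m where "m v = norm P * (C\<^sub>\<Psi> * 2 powr \<kappa>) * (norm (gamma_kernel ?b p v) + norm (gamma_kernel (?b + \<kappa>) p v))" for v
  have gi: "integrable lborel (\<lambda>v. norm (gamma_kernel ?b p v))" "integrable lborel (\<lambda>v. norm (gamma_kernel (?b + \<kappa>) p v))"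
    using b \<rho>0 \<kappa> by (auto intro!: integrable_norm integrable_gamma_kernel)
  have "form_bounded (half_line (wave t \<xi>)) (LINT v|lborel. m v)"
  proof (rule form_bounded_superposition[where G=G and w=w])
    show "sigma_finite_measure (lborel :: real measure)" by (rule lborel.sigma_finite_measure_axioms)
    show "(\<lambda>(v, u). G v u) \<in> borel_measurable (lborel \<Otimes>\<^sub>M borel)"
      unfolding G_def half_line_def \<Psi>_def by measurable
    show "integrable lborel w" unfolding w_def using gi by simp
    show "integrable lborel m" unfolding m_def using gi by simp
    show "norm (G v u) \<le> w v" for v u
    proof (cases "v > 0")
      case True
      have "norm (half_line (\<Psi> v) u) \<le> K\<^sub>\<psi>" using psi_bound[of "v * u"] True K\<^sub>\<psi>_bound(1) by (simp add: half_line_def \<Psi>_def)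
      then show ?thesis unfolding G_def w_def norm_mult by (intro mult_left_mono) auto
    qed (simp add: G_def w_def gamma_kernel_def)
    show "bounded_borel (half_line (wave t \<xi>))" using t by (rule bounded_borel_wave)
    show "half_line (wave t \<xi>) u = (LINT v|lborel. G v u)" for u
    proof (cases "u \<ge> 0")
      case True
      have "(LINT v|lborel. G v u) = P * (LINT v|lborel. gamma_kernel ?b p v * complex_of_real (psi ?b (v * u)))"
        unfolding G_def half_line_def \<Psi>_def using True by (simp add: mult.assoc)
      also have "\<dots> = P * (p powr (- complex_of_real ?b) * exp (- complex_of_real u / (4 * p)))"
        using Laplace_psi(2)[OF b(1) \<rho>0 True] by simp
      also have "P * (p powr (- complex_of_real ?b) * exp (- complex_of_real u / (4 * p))) = exp (- complex_of_real u / (4 * p))"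
        unfolding P_def using p0 by (simp add: mult.assoc[symmetric] powr_add[symmetric])
      also have "- complex_of_real u / (4 * p) = - (z * complex_of_real u)" unfolding p4[symmetric] by simp
      finally show ?thesis using True by (simp add: half_line_def z_def)
    next
      case False
      then show ?thesis by (simp add: G_def half_line_def)
    qed
    show "form_bounded (G v) (m v)" for v
    proof (cases "v > 0")
      case True
      have "form_bounded (G v) (norm (P * gamma_kernel ?b p v) * (C\<^sub>\<Psi> * (1 + v) powr \<kappa>))"
        unfolding G_def by (rule form_bounded_scale[OF \<Psi>_form_bounded[OF True]])
      moreover have "norm (P * gamma_kernel ?b p v) * (C\<^sub>\<Psi> * (1 + v) powr \<kappa>) \<le> m v"
      proof -
        have "(1 + v) powr \<kappa> \<le> (2 * max 1 v) powr \<kappa>" using True \<kappa> by (intro powr_mono2) auto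
        also have "\<dots> = 2 powr \<kappa> * max 1 v powr \<kappa>" using True by (simp add: powr_mult)
        also have "max 1 v powr \<kappa> \<le> 1 + v powr \<kappa>" using True \<kappa> by (auto simp: max_def)
        finally have le: "(1 + v) powr \<kappa> \<le> 2 powr \<kappa> * (1 + v powr \<kappa>)" by (simp add: mult_left_mono)
        have gk: "norm (gamma_kernel ?b p v) * v powr \<kappa> = norm (gamma_kernel (?b + \<kappa>) p v)"
        proof -
          have "v powr (?b - 1) * v powr \<kappa> = v powr (?b + \<kappa> - 1)" using True by (simp add: powr_add[symmetric] algebra_simps)
          then show ?thesis unfolding norm_gamma_kernel using True by (simp add: mult_ac)
        qed
        have "norm (P * gamma_kernel ?b p v) * (C\<^sub>\<Psi> * (1 + v) powr \<kappa>) \<le> norm (P * gamma_kernel ?b p v) * (C\<^sub>\<Psi> * (2 powr \<kappa> * (1 + v powr \<kappa>)))"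
          using le C\<^sub>\<Psi>_nonneg by (intro mult_left_mono) auto
        also have "\<dots> = norm P * (C\<^sub>\<Psi> * 2 powr \<kappa>) * (norm (gamma_kernel ?b p v) + norm (gamma_kernel ?b p v) * v powr \<kappa>)"
          by (simp add: norm_mult algebra_simps)
        finally show ?thesis unfolding m_def gk .
      qed
      ultimately show ?thesis by (rule form_bounded_mono)
    next
      case False
      then have "G v = (\<lambda>u. 0)" "m v = 0" by (auto simp: G_def m_def gamma_kernel_def)
      then show ?thesis using form_bounded_zero by simp
    qed
  qed
  moreover have "(LINT v|lborel. m v) \<le> C\<^sub>H * (1 + \<xi>\<^sup>2) powr \<beta> * (1 + t) powr \<kappa>"
  proof -
    have G0: "Gamma ?b \<ge> 0" "Gamma (?b + \<kappa>) \<ge> 0" using b \<kappa> by (auto intro!: Gamma_real_nonneg)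
    have "(LINT v|lborel. m v) = norm P * (C\<^sub>\<Psi> * 2 powr \<kappa>) * (Gamma ?b * Re p powr (- ?b) + Gamma (?b + \<kappa>) * Re p powr (- (?b + \<kappa>)))"
      unfolding m_def using gi b \<kappa> \<rho>0 integrable_gamma_kernel(2)[of ?b p] integrable_gamma_kernel(2)[of "?b + \<kappa>" p] by simp
    also have "\<dots> = (C\<^sub>\<Psi> * 2 powr \<kappa>) * X powr (\<sigma> + 1/4) * (Gamma ?b + Gamma (?b + \<kappa>) * Re p powr (- \<kappa>))"
    proof -
      have e1: "norm P = X powr (\<sigma> + 1/4) * Re p powr ?b"
      proof -
        have "norm P = (X powr (1/2)) powr ?b * Re p powr ?b"
          unfolding Pn np using X \<rho>0 by (simp add: powr_mult powr_half_sqrt)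
        also have "(X powr (1/2)) powr ?b = X powr (\<sigma> + 1/4)" by (simp add: powr_powr algebra_simps)
        finally show ?thesis .
      qed
      have e2: "Re p powr (- (?b + \<kappa>)) = Re p powr (- ?b) * Re p powr (- \<kappa>)" by (simp add: powr_add[symmetric])
      have e3: "Re p powr ?b * Re p powr (- ?b) = 1" using \<rho>0 by (simp add: powr_add[symmetric])
      have gen: "(x * r) * c * (g * r' + g' * (r' * k)) = c * x * (r * r') * (g + g' * k)" for x r c g r' g' k :: real
        by (simp add: algebra_simps)
      show ?thesis unfolding e1 e2 gen e3 by simp
    qed
    also have "Re p powr (- \<kappa>) \<le> 4 powr \<kappa> * X powr \<kappa> * (1 + t) powr \<kappa>"
    proof -
      have "Re p powr (- \<kappa>) = (4 * t * X) powr \<kappa>"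
        unfolding \<rho> using t X by (simp add: powr_minus powr_divide)
      also have "\<dots> \<le> (4 * X * (1 + t)) powr \<kappa>" using t X \<kappa> by (intro powr_mono2) (auto simp: algebra_simps)
      also have "\<dots> = 4 powr \<kappa> * X powr \<kappa> * (1 + t) powr \<kappa>" by (simp only: powr_mult)
      finally show ?thesis .
    qed
    also have "Gamma ?b + Gamma (?b + \<kappa>) * (4 powr \<kappa> * X powr \<kappa> * (1 + t) powr \<kappa>) \<le>
       (Gamma ?b + Gamma (?b + \<kappa>) * 4 powr \<kappa>) * (X powr \<kappa> * (1 + t) powr \<kappa>)"
    proof -
      have "1 * 1 \<le> X powr \<kappa> * (1 + t) powr \<kappa>" using X t \<kappa> by (intro mult_mono ge_one_powr_ge_zero) auto
      then have "Gamma ?b * 1 \<le> Gamma ?b * (X powr \<kappa> * (1 + t) powr \<kappa>)" using G0(1) by (intro mult_left_mono) auto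
      then show ?thesis by (simp add: algebra_simps)
    qed
    finally have "(LINT v|lborel. m v) \<le> (C\<^sub>\<Psi> * 2 powr \<kappa>) * X powr (\<sigma> + 1/4) * ((Gamma ?b + Gamma (?b + \<kappa>) * 4 powr \<kappa>) * (X powr \<kappa> * (1 + t) powr \<kappa>))"
      using C\<^sub>\<Psi>_nonneg G0 by (simp add: mult_left_mono)
    also have "\<dots> = C\<^sub>H * X powr \<beta> * (1 + t) powr \<kappa>"
    proof -
      have "X powr \<beta> = X powr (\<sigma> + 1/4) * X powr \<kappa>" by (simp add: powr_add[symmetric] algebra_simps)
      then show ?thesis by (simp add: C\<^sub>H_def mult_ac)
    qed
    finally show ?thesis by (simp add: X_def)
  qed
  ultimately show ?thesis by (rule form_bounded_mono)
qed

lemma C\<^sub>H_nonneg: "C\<^sub>H \<ge> 0"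
  unfolding C\<^sub>H_def using C\<^sub>\<Psi>_nonneg \<sigma> \<kappa>
  by (intro mult_nonneg_nonneg add_nonneg_nonneg Gamma_real_nonneg) auto

lemma op_norm_of_form_bounded:
  assumes fb: "form_bounded (half_line F) M" and M: "M > 0" and p: "1 \<le> p"
    and U: "\<And>f. f \<in> Lp \<mu> 2 \<Longrightarrow> represents (half_line F) f (U f)"
  shows "op_norm \<mu> p p U \<le> ennreal M"
proof -
  have b: "bounded_borel (half_line F)" using fb by (simp add: form_bounded_def)
  let ?F' = "\<lambda>u. cnj (F u)"
  have ce: "half_line ?F' = (\<lambda>u. cnj (half_line F u))" by (auto simp: half_line_def)
  have b': "bounded_borel (half_line ?F')" unfolding ce by (rule bounded_borel_cnj[OF b])
  interpret sigma_finite_measure \<mu> by (rule sigma_finite_mu)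
  interpret fp: form_bounded_pair \<mu> "fc F" "fc ?F'" M
  proof
    show "0 \<le> M" using M by simp
    show "linear_op \<mu> (Lp \<mu> 2) (Lp \<mu> 2) (fc F)" by (rule fc_linear[OF b])
    show "linear_op \<mu> (Lp \<mu> 2) (Lp \<mu> 2) (fc ?F')" by (rule fc_linear[OF b'])
    show "L2_inner \<mu> (fc F f) g = L2_inner \<mu> f (fc ?F' g)" if f: "f \<in> Lp \<mu> 2" "g \<in> Lp \<mu> 2" for f g
    proof -
      have "L2_inner \<mu> f (fc ?F' g) = cnj (L2_inner \<mu> (fc ?F' g) f)" by (rule L2_inner_cnj[symmetric])
      also have "\<dots> = cnj (form (half_line ?F') g f)" unfolding fc_inner[OF b' f(2,1)] ..
      also have "\<dots> = form (half_line F) f g" unfolding ce using form_cnj[OF bounded_borel_cnj[OF b] f(2,1)] by simp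
      finally show ?thesis unfolding fc_inner[OF b f] ..
    qed
    show "norm (L2_inner \<mu> (fc F f) g) \<le> M * (LINT x|\<mu>. norm (f x)) * B \<and> norm (L2_inner \<mu> (fc F g) f) \<le> M * (LINT x|\<mu>. norm (f x)) * B"
      if "f \<in> Lp \<mu> 2" "g \<in> Lp \<mu> 2" "integrable \<mu> f" "0 \<le> B" "AE x in \<mu>. norm (g x) \<le> B" for f g B
      using fb that unfolding form_bounded_def by (simp add: fc_inner[OF b])
  qed
  show ?thesis
    by (rule fp.op_norm_le[OF p M]) (rule represents_cong_AE[OF U fc_represents[OF b]])
qed

end

section \<open>Spectral multipliers\<close>

lemma compact_support_integrable:
  fixes F :: "real \<Rightarrow> complex"
  assumes [measurable]: "F \<in> borel_measurable borel" and B: "\<And>x. norm (F x) \<le> B" and supp: "\<And>x. \<bar>x\<bar> > 1 \<Longrightarrow> F x = 0"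
  shows "integrable lborel F" "F \<in> Lp lborel 2"
proof -
  have B0: "B \<ge> 0" using B[of 0] norm_ge_zero order_trans by blast
  have i: "integrable lborel (\<lambda>x. C * indicator {-1..1::real} x :: real)" for C
    by (intro integrable_mult_right integrable_real_indicator) auto
  show "integrable lborel F"
  proof (rule Bochner_Integration.integrable_bound[OF i[of B]])
    show "AE x in lborel. norm (F x) \<le> norm (B * indicator {-1..1} x)"
      using B supp B0 by (intro AE_I2) (auto simp: indicator_def)
  qed simp
  have "integrable lborel (\<lambda>x. (norm (F x))\<^sup>2)"
  proof (rule Bochner_Integration.integrable_bound[OF i[of "B\<^sup>2"]])
    show "AE x in lborel. norm ((norm (F x))\<^sup>2) \<le> norm (B\<^sup>2 * indicator {-1..1} x)"
      using B supp by (intro AE_I2) (auto simp: indicator_def intro!: power_mono)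
  qed simp
  then show "F \<in> Lp lborel 2" by (simp add: L2_iff)
qed

text \<open>For a function supported in [-1, 1] the truncated integrals no longer change from n = 1
  on, so the defining limit becomes an equality; the chosen transform is determined only almost
  everywhere.\<close>

lemma plancherel_transform_eq_fourier:
  fixes F :: "real \<Rightarrow> complex"
  assumes Fm[measurable]: "F \<in> borel_measurable borel" and B: "\<And>x. norm (F x) \<le> B" and supp: "\<And>x. \<bar>x\<bar> > 1 \<Longrightarrow> F x = 0"
  shows "plancherel_transform F \<in> borel_measurable borel"
    and "AE \<xi> in lborel. plancherel_transform F \<xi> = complex_of_real (1 / sqrt (2 * pi)) * fourier F \<xi>"
proof -
  let ?c = "complex_of_real (1 / sqrt (2 * pi))"
  have Fi1: "integrable lborel F" by (rule compact_support_integrable(1)[OF Fm B supp])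
  have Fi2: "F \<in> Lp lborel 2" by (rule compact_support_integrable(2)[OF Fm B supp])
  have [measurable]: "fourier F \<in> borel_measurable borel" by (rule fourier_measurable[OF Fm])
  have F2: "fourier F \<in> Lp lborel 2" using fourier_square_integrable[OF Fi1 B] by (simp add: L2_iff)
  have trunc: "(LINT x:{- real n..real n}|lborel. F x * exp (- (\<i> * of_real (x * \<xi>)))) = fourier F \<xi>" if "n \<ge> 1" for n \<xi>
    unfolding fourier_def set_lebesgue_integral_def
  proof (rule Bochner_Integration.integral_cong[OF refl])
    fix x :: real
    show "indicator {- real n..real n} x *\<^sub>R (F x * exp (- (\<i> * of_real (x * \<xi>)))) = F x * exp (- (\<i> * of_real (x * \<xi>)))"
    proof (cases "\<bar>x\<bar> > 1")
      case True then show ?thesis using supp by simp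
    next
      case False
      then have "x \<in> {- real n..real n}" using that by auto
      then show ?thesis by simp
    qed
  qed
  have "is_plancherel_transform F (\<lambda>\<xi>. ?c * fourier F \<xi>)"
    unfolding is_plancherel_transform_def
  proof (intro conjI Fi2 L2_scale F2)
    show "(\<lambda>n::nat. \<integral>\<^sup>+\<xi>. ennreal ((norm (?c * fourier F \<xi> - ?c * (LINT x:{- real n..real n}|lborel. F x * exp (- (\<i> * of_real (x * \<xi>))))))\<^sup>2) \<partial>lborel) \<longlonglongrightarrow> 0"
    proof (rule tendsto_eventually)
      show "\<forall>\<^sub>F n in sequentially. (\<integral>\<^sup>+\<xi>. ennreal ((norm (?c * fourier F \<xi> - ?c * (LINT x:{- real n..real n}|lborel. F x * exp (- (\<i> * of_real (x * \<xi>))))))\<^sup>2) \<partial>lborel) = 0"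
        using eventually_ge_at_top[of "1::nat"]
      proof eventually_elim
        case (elim n)
        show ?case unfolding trunc[OF elim] by simp
      qed
    qed
  qed
  then have P: "is_plancherel_transform F (plancherel_transform F)"
    unfolding plancherel_transform_def by (rule someI[where P="is_plancherel_transform F"])
  then show m[measurable]: "plancherel_transform F \<in> borel_measurable borel"
    by (simp add: is_plancherel_transform_def L2_iff)
  let ?G = "plancherel_transform F"
  have "(\<lambda>n::nat. \<integral>\<^sup>+\<xi>. ennreal ((norm (?G \<xi> - ?c * (LINT x:{- real n..real n}|lborel. F x * exp (- (\<i> * of_real (x * \<xi>))))))\<^sup>2) \<partial>lborel) \<longlonglongrightarrow> 0"
    using P unfolding is_plancherel_transform_def by blast
  moreover have "(\<lambda>n::nat. \<integral>\<^sup>+\<xi>. ennreal ((norm (?G \<xi> - ?c * (LINT x:{- real n..real n}|lborel. F x * exp (- (\<i> * of_real (x * \<xi>))))))\<^sup>2) \<partial>lborel)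
     \<longlonglongrightarrow> (\<integral>\<^sup>+\<xi>. ennreal ((norm (?G \<xi> - ?c * fourier F \<xi>))\<^sup>2) \<partial>lborel)"
  proof (rule tendsto_eventually)
    show "\<forall>\<^sub>F n in sequentially. (\<integral>\<^sup>+\<xi>. ennreal ((norm (?G \<xi> - ?c * (LINT x:{- real n..real n}|lborel. F x * exp (- (\<i> * of_real (x * \<xi>))))))\<^sup>2) \<partial>lborel)
       = (\<integral>\<^sup>+\<xi>. ennreal ((norm (?G \<xi> - ?c * fourier F \<xi>))\<^sup>2) \<partial>lborel)"
      using eventually_ge_at_top[of "1::nat"]
    proof eventually_elim
      case (elim n)
      show ?case unfolding trunc[OF elim] ..
    qed
  qed
  ultimately have "(\<integral>\<^sup>+\<xi>. ennreal ((norm (?G \<xi> - ?c * fourier F \<xi>))\<^sup>2) \<partial>lborel) = 0" by (rule LIMSEQ_unique[rotated])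
  then have "AE \<xi> in lborel. ennreal ((norm (?G \<xi> - ?c * fourier F \<xi>))\<^sup>2) = 0"
    by (subst (asm) nn_integral_0_iff_AE) auto
  then show "AE \<xi> in lborel. ?G \<xi> = ?c * fourier F \<xi>"
    by eventually_elim (simp add: ennreal_eq_0_iff)
qed

text \<open>Cauchy-Schwarz with the weight split into the exponents s / 2 and b - s / 2; the second
  factor is square integrable because s - 2 b > 1/2. Taking b = \<sigma> + \<kappa> + 1/4 gives the
  threshold for s.\<close>

lemma sobolev_fourier_bound:
  fixes F :: "real \<Rightarrow> complex"
  assumes Fm[measurable]: "F \<in> borel_measurable borel" and B: "\<And>x. norm (F x) \<le> B" and supp: "\<And>x. \<bar>x\<bar> > 1 \<Longrightarrow> F x = 0"
    and S: "F \<in> sobolev_space s" and s: "s > 2 * b + 1/2"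
  shows "integrable lborel (\<lambda>\<xi>. (1 + \<xi>\<^sup>2) powr b * norm (fourier F \<xi>))"
    and "(LINT \<xi>|lborel. (1 + \<xi>\<^sup>2) powr b * norm (fourier F \<xi>)) \<le>
      sqrt (2 * pi) * sqrt (LINT \<xi>|lborel. (1 + \<xi>\<^sup>2) powr (2 * b - s)) * sobolev_norm s F"
proof -
  let ?G = "plancherel_transform F"
  note [measurable] = fourier_measurable[OF Fm]
  have [measurable]: "?G \<in> borel_measurable borel"
    by (rule plancherel_transform_eq_fourier(1)[OF Fm B supp])
  have AEq: "AE \<xi> in lborel. ?G \<xi> = complex_of_real (1 / sqrt (2 * pi)) * fourier F \<xi>"
    by (rule plancherel_transform_eq_fourier(2)[OF Fm B supp])
  have iG: "integrable lborel (\<lambda>\<xi>. (1 + \<xi>\<^sup>2) powr s * (norm (?G \<xi>))\<^sup>2)"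
    using S by (intro integrableI_nonneg) (auto simp: sobolev_space_def)
  have eq: "AE \<xi> in lborel. 2 * pi * ((1 + \<xi>\<^sup>2) powr s * (norm (?G \<xi>))\<^sup>2) = (1 + \<xi>\<^sup>2) powr s * (norm (fourier F \<xi>))\<^sup>2"
    using AEq by eventually_elim (simp add: norm_mult norm_divide power_mult_distrib power_divide)
  have iF: "integrable lborel (\<lambda>\<xi>. (1 + \<xi>\<^sup>2) powr s * (norm (fourier F \<xi>))\<^sup>2)"
    by (rule integrable_cong_AE_imp[OF integrable_mult_right[OF iG, of "2 * pi"]]) (use eq in auto)
  have intF: "(LINT \<xi>|lborel. (1 + \<xi>\<^sup>2) powr s * (norm (fourier F \<xi>))\<^sup>2) = 2 * pi * (sobolev_norm s F)\<^sup>2"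
  proof -
    have "(LINT \<xi>|lborel. (1 + \<xi>\<^sup>2) powr s * (norm (fourier F \<xi>))\<^sup>2) = (LINT \<xi>|lborel. 2 * pi * ((1 + \<xi>\<^sup>2) powr s * (norm (?G \<xi>))\<^sup>2))"
      by (rule integral_cong_AE) (use eq in auto)
    also have "\<dots> = 2 * pi * (LINT \<xi>|lborel. (1 + \<xi>\<^sup>2) powr s * (norm (?G \<xi>))\<^sup>2)" by (rule integral_mult_right_zero)
    also have "(LINT \<xi>|lborel. (1 + \<xi>\<^sup>2) powr s * (norm (?G \<xi>))\<^sup>2) = (sobolev_norm s F)\<^sup>2"
      unfolding sobolev_norm_def by (subst real_sqrt_pow2) (auto intro!: integral_nonneg_AE)
    finally show ?thesis .
  qed
  have sn: "sobolev_norm s F \<ge> 0" unfolding sobolev_norm_def by (auto intro!: integral_nonneg_AE)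
  have pw: "((1 + \<xi>\<^sup>2) powr (a / 2))\<^sup>2 = (1 + \<xi>\<^sup>2) powr a" for \<xi> a :: real
    by (simp add: power2_eq_square powr_add[symmetric])
  define f where "f \<xi> = complex_of_real ((1 + \<xi>\<^sup>2) powr (s / 2)) * fourier F \<xi>" for \<xi>
  define g where "g \<xi> = complex_of_real ((1 + \<xi>\<^sup>2) powr ((2 * b - s) / 2))" for \<xi> :: real
  have nf: "(norm (f \<xi>))\<^sup>2 = (1 + \<xi>\<^sup>2) powr s * (norm (fourier F \<xi>))\<^sup>2" for \<xi>
    unfolding f_def norm_mult norm_of_real power_mult_distrib power2_abs pw ..
  have ng: "(norm (g \<xi>))\<^sup>2 = (1 + \<xi>\<^sup>2) powr (2 * b - s)" for \<xi>
    unfolding g_def norm_of_real power2_abs pw ..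
  have iW: "integrable lborel (\<lambda>\<xi>. (1 + \<xi>\<^sup>2) powr (2 * b - s))"
    using integrable_one_plus_square_powr[of "s - 2 * b"] s by simp
  have fgm: "f \<in> borel_measurable borel" "g \<in> borel_measurable borel" unfolding f_def g_def by measurable
  have f2: "f \<in> Lp lborel 2" unfolding L2_iff nf using iF fgm by simp
  have g2: "g \<in> Lp lborel 2" unfolding L2_iff ng using iW fgm by simp
  have fg: "norm (f \<xi>) * norm (g \<xi>) = (1 + \<xi>\<^sup>2) powr b * norm (fourier F \<xi>)" for \<xi>
  proof -
    have "(1 + \<xi>\<^sup>2) powr (s / 2) * (1 + \<xi>\<^sup>2) powr ((2 * b - s) / 2) = (1 + \<xi>\<^sup>2) powr b"
      unfolding powr_add[symmetric] by (simp add: field_simps)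
    then show ?thesis unfolding f_def g_def norm_mult norm_of_real by (simp add: mult_ac)
  qed
  show "integrable lborel (\<lambda>\<xi>. (1 + \<xi>\<^sup>2) powr b * norm (fourier F \<xi>))"
    using integrable_norm[OF L2_integrable_mult[OF f2 g2]] unfolding norm_mult fg .
  have "(LINT \<xi>|lborel. (1 + \<xi>\<^sup>2) powr b * norm (fourier F \<xi>)) \<le> Lp_norm lborel 2 f * Lp_norm lborel 2 g"
    using L2_Cauchy_Schwarz_abs[OF f2 g2] unfolding fg .
  also have "Lp_norm lborel 2 f = sqrt (2 * pi) * sobolev_norm s F"
    unfolding Lp_norm_2[OF f2] nf intF using sn by (simp add: real_sqrt_mult)
  also have "Lp_norm lborel 2 g = sqrt (LINT \<xi>|lborel. (1 + \<xi>\<^sup>2) powr (2 * b - s))"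
    unfolding Lp_norm_2[OF g2] ng ..
  finally show "(LINT \<xi>|lborel. (1 + \<xi>\<^sup>2) powr b * norm (fourier F \<xi>)) \<le>
      sqrt (2 * pi) * sqrt (LINT \<xi>|lborel. (1 + \<xi>\<^sup>2) powr (2 * b - s)) * sobolev_norm s F" by (simp add: mult_ac)
qed

text \<open>The damping factor \<open>exp (- u)\<close> is undone on the support of the multiplier by \<open>bump m\<close>, a smooth function
  equal to \<open>exp u\<close> for \<open>u \<le> 1\<close> whose Fourier transform decays like \<open>|\<omega>|\<close> to the power \<open>- m - 1\<close>.\<close>
definition bump_hat :: "nat \<Rightarrow> real \<Rightarrow> complex" where
  "bump_hat m \<omega> = complex_of_real (exp 1 * 2 ^ m / (2 * pi)) * (exp (- (\<i> * complex_of_real \<omega>)) * cutoff_kernel m \<omega>)"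

definition bump :: "nat \<Rightarrow> real \<Rightarrow> complex" where
  "bump m u = (LINT \<omega>|lborel. bump_hat m \<omega> * exp (\<i> * complex_of_real (u * \<omega>)))"

lemma bump_hat_measurable[measurable]: "bump_hat m \<in> borel_measurable borel"
  unfolding bump_hat_def by measurable

lemma norm_bump_hat: "norm (bump_hat m \<omega>) = exp 1 * 2 ^ m / (2 * pi) * (1 + \<omega>\<^sup>2) powr (- ((real m + 1) / 2))"
  unfolding bump_hat_def norm_mult norm_of_real norm_cutoff_kernel by simp

lemma bump_eq_exp: assumes "u \<le> 1" shows "bump (Suc m) u = complex_of_real (exp u)"
proof -
  \<comment> \<open>The phase exp (- \<i> \<omega>) in \<open>bump_hat\<close> translates by 1,
    which moves the range of the exponential identity from u \<le> 0 to u \<le> 1.\<close>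
  have "bump (Suc m) u = (LINT \<omega>|lborel. complex_of_real (exp 1 * 2 ^ Suc m / (2 * pi)) * (cutoff_kernel (Suc m) \<omega> * exp (\<i> * complex_of_real ((u - 1) * \<omega>))))"
    unfolding bump_def
  proof (rule Bochner_Integration.integral_cong[OF refl])
    fix \<omega> :: real
    have "exp (\<i> * complex_of_real ((u - 1) * \<omega>)) = exp (- (\<i> * complex_of_real \<omega>)) * exp (\<i> * complex_of_real (u * \<omega>))"
      unfolding exp_add[symmetric] by (simp add: algebra_simps)
    then show "bump_hat (Suc m) \<omega> * exp (\<i> * complex_of_real (u * \<omega>)) =
      complex_of_real (exp 1 * 2 ^ Suc m / (2 * pi)) * (cutoff_kernel (Suc m) \<omega> * exp (\<i> * complex_of_real ((u - 1) * \<omega>)))"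
      unfolding bump_hat_def by (simp only: mult_ac)
  qed
  also have "\<dots> = complex_of_real (exp 1 * 2 ^ Suc m / (2 * pi)) * complex_of_real (2 * pi / 2 ^ Suc m * exp (u - 1))"
    unfolding integral_mult_right_zero using assms by (subst inverse_fourier_cutoff_kernel) auto
  also have "\<dots> = complex_of_real ((exp 1 * 2 ^ Suc m / (2 * pi)) * (2 * pi / 2 ^ Suc m * exp (u - 1)))" by (rule of_real_mult[symmetric])
  also have "(exp 1 * 2 ^ Suc m / (2 * pi)) * (2 * pi / 2 ^ Suc m * exp (u - 1)) = exp 1 * exp (u - 1)"
    by (simp add: field_simps del: power_Suc)
  also have "\<dots> = exp u" by (simp add: exp_add[symmetric])
  finally show ?thesis .
qed

lemma integrable_bump_hat:
  assumes "real m > 2 * b"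
  shows "integrable lborel (\<lambda>\<omega>. norm (bump_hat m \<omega>) * (1 + \<omega>\<^sup>2) powr b)"
proof -
  have "norm (bump_hat m \<omega>) * (1 + \<omega>\<^sup>2) powr b = exp 1 * 2 ^ m / (2 * pi) * (1 + \<omega>\<^sup>2) powr (- ((real m + 1) / 2 - b))" for \<omega>
    unfolding norm_bump_hat mult.assoc powr_add[symmetric] by simp
  moreover have "integrable lborel (\<lambda>\<omega>::real. exp 1 * 2 ^ m / (2 * pi) * (1 + \<omega>\<^sup>2) powr (- ((real m + 1) / 2 - b)))"
    using assms by (intro integrable_mult_right integrable_one_plus_square_powr) (simp add: field_simps)
  ultimately show ?thesis by simp
qed

text \<open>Peetre's inequality: it splits the weight at a shifted frequency into a factor that
  stays outside and one that \<open>bump_hat\<close> integrates.\<close>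

lemma one_plus_square_add_powr:
  fixes x y b :: real assumes "b \<ge> 0"
  shows "(1 + (x + y)\<^sup>2) powr b \<le> 2 powr b * (1 + x\<^sup>2) powr b * (1 + y\<^sup>2) powr b"
proof -
  have "(x + y)\<^sup>2 \<le> 2 * x\<^sup>2 + 2 * y\<^sup>2" using sum_squares_bound[of x y] by (simp add: power2_sum)
  moreover have "0 \<le> x\<^sup>2 * y\<^sup>2" by simp
  moreover have "2 * (1 + x\<^sup>2) * (1 + y\<^sup>2) = 2 + 2 * x\<^sup>2 + 2 * y\<^sup>2 + 2 * (x\<^sup>2 * y\<^sup>2)" by (simp add: algebra_simps)
  ultimately have "1 + (x + y)\<^sup>2 \<le> 2 * (1 + x\<^sup>2) * (1 + y\<^sup>2)" by linarith
  then have "(1 + (x + y)\<^sup>2) powr b \<le> (2 * (1 + x\<^sup>2) * (1 + y\<^sup>2)) powr b" using assms by (intro powr_mono2) auto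
  then show ?thesis by (simp only: powr_mult)
qed

context propagation begin

lemma wave_op_norm_L1:
  "\<exists>C>0. \<forall>t>0. \<forall>\<xi>::real. op_norm \<mu> 1 1
      (fc (\<lambda>u. exp (\<i> * of_real (\<xi> * t * u))) \<circ> fc (\<lambda>u. exp (- of_real (t * u))))
    \<le> ennreal (C * (1 + \<xi>\<^sup>2) powr (\<sigma> + \<kappa> + 1/4) * (1 + t) powr \<kappa>)"
\<comment> \<open>\<open>C\<^sub>H\<close> is only known to be nonnegative, while the claim and
  \<open>op_norm_of_form_bounded\<close> ask for a positive constant.\<close>
proof (intro exI[of _ "C\<^sub>H + 1"] conjI allI impI)
  show "C\<^sub>H + 1 > 0" using C\<^sub>H_nonneg by simp
  fix t \<xi> :: real assume t: "t > 0"
  let ?F = "\<lambda>u. exp (\<i> * of_real (\<xi> * t * u)) :: complex" and ?G = "\<lambda>u. exp (- of_real (t * u)) :: complex"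
  have pos: "(1 + \<xi>\<^sup>2) powr \<beta> * (1 + t) powr \<kappa> > 0"
  proof -
    have "1 + \<xi>\<^sup>2 > 0" by (simp add: add_pos_nonneg)
    then show ?thesis using t by simp
  qed
  have bF: "bounded_borel (half_line ?F)"
    by (rule bounded_borel_half_line[of _ 1]) (auto intro!: borel_measurable_continuous_onI continuous_intros)
  have bG: "bounded_borel (half_line ?G)"
    using t by (intro bounded_borel_half_line[of _ 1]) (auto intro!: borel_measurable_continuous_onI continuous_intros)
  have prod: "half_line (\<lambda>u. ?F u * ?G u) = half_line (wave t \<xi>)"
    unfolding exp_add[symmetric] by (simp add: algebra_simps)
  show "op_norm \<mu> 1 1 (fc ?F \<circ> fc ?G) \<le> ennreal ((C\<^sub>H + 1) * (1 + \<xi>\<^sup>2) powr \<beta> * (1 + t) powr \<kappa>)"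
  proof (rule op_norm_of_form_bounded[where F="wave t \<xi>"])
    show "form_bounded (half_line (wave t \<xi>)) ((C\<^sub>H + 1) * (1 + \<xi>\<^sup>2) powr \<beta> * (1 + t) powr \<kappa>)"
      using pos by (intro form_bounded_mono[OF wave_form_bounded[OF t]]) (simp add: mult.assoc distrib_right)
    show "0 < (C\<^sub>H + 1) * (1 + \<xi>\<^sup>2) powr \<beta> * (1 + t) powr \<kappa>" using pos C\<^sub>H_nonneg by (simp add: mult.assoc)
    show "represents (half_line (wave t \<xi>)) f ((fc ?F \<circ> fc ?G) f)" if "f \<in> Lp \<mu> 2" for f
      using fc_mult[OF bF bG that] unfolding prod by simp
  qed simp
qed

text \<open>The symbol is the integral over \<omega> of \<open>bump_hat m\<close> times the damped
  wave at frequency \<zeta> + \<omega>. The condition on m lets \<open>bump_hat\<close> beat the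
  polynomial growth of the wave bounds.\<close>

lemma bump_form_bounded:
  assumes m: "real m > 2 * \<beta>" "m \<ge> 1"
  shows "\<exists>A\<ge>0. \<forall>t>0. \<forall>\<zeta>. form_bounded (half_line (\<lambda>u. exp (\<i> * of_real (\<zeta> * (t * u))) * (bump m (t * u) * exp (- of_real (t * u)))))
     (A * (1 + \<zeta>\<^sup>2) powr \<beta> * (1 + t) powr \<kappa>)"
proof -
  have \<beta>0: "\<beta> \<ge> 0" using \<sigma> \<kappa> by simp
  define J where "J = (LINT \<omega>|lborel. norm (bump_hat m \<omega>) * (1 + \<omega>\<^sup>2) powr \<beta>)"
  define A where "A = J * (C\<^sub>H * 2 powr \<beta>)"
  have J0: "J \<ge> 0" unfolding J_def by (auto intro!: integral_nonneg_AE)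
  have A0: "A \<ge> 0" using J0 C\<^sub>H_nonneg by (simp add: A_def)
  have ik: "integrable lborel (bump_hat m)"
  proof -
    have "integrable lborel (\<lambda>\<omega>. norm (bump_hat m \<omega>) * (1 + \<omega>\<^sup>2) powr 0)"
      using m by (intro integrable_bump_hat) auto
    moreover have "(1 + \<omega>\<^sup>2) powr 0 = 1" for \<omega> :: real by (simp add: add_nonneg_eq_0_iff)
    ultimately have "integrable lborel (\<lambda>\<omega>. norm (bump_hat m \<omega>))" by simp
    then show ?thesis by (rule Bochner_Integration.integrable_bound) auto
  qed
  have bm[measurable]: "bump m \<in> borel_measurable borel" unfolding bump_def by measurable
  have bb: "norm (bump m u) \<le> (LINT \<omega>|lborel. norm (bump_hat m \<omega>))" for u
  proof -
    have "norm (bump m u) \<le> (LINT \<omega>|lborel. norm (bump_hat m \<omega> * exp (\<i> * complex_of_real (u * \<omega>))))"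
      unfolding bump_def by (rule integral_norm_bound)
    then show ?thesis by (simp add: norm_mult)
  qed
  have "form_bounded (half_line (\<lambda>u. exp (\<i> * of_real (\<zeta> * (t * u))) * (bump m (t * u) * exp (- of_real (t * u)))))
     (A * (1 + \<zeta>\<^sup>2) powr \<beta> * (1 + t) powr \<kappa>)" if t: "t > 0" for t \<zeta>
  proof -
    let ?F = "\<lambda>u. exp (\<i> * of_real (\<zeta> * (t * u))) * (bump m (t * u) * exp (- of_real (t * u)))"
    define M where "M \<omega> = norm (bump_hat m \<omega>) * (1 + \<omega>\<^sup>2) powr \<beta> * (C\<^sub>H * 2 powr \<beta> * (1 + \<zeta>\<^sup>2) powr \<beta> * (1 + t) powr \<kappa>)" for \<omega>
    have "form_bounded (half_line ?F) (LINT \<omega>|lborel. M \<omega>)"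
    proof (rule form_bounded_superposition[where G="\<lambda>\<omega> u. bump_hat m \<omega> * half_line (wave t (\<zeta> + \<omega>)) u" and w="\<lambda>\<omega>. norm (bump_hat m \<omega>)"])
      show "sigma_finite_measure (lborel :: real measure)" by (rule lborel.sigma_finite_measure_axioms)
      have [measurable]: "(\<lambda>x. exp (- (complex_of_real t * (1 - \<i> * complex_of_real (\<zeta> + fst x)) * complex_of_real (snd x)))) \<in> borel_measurable (lborel \<Otimes>\<^sub>M borel)"
      proof -
        have "(\<lambda>x::real \<times> real. exp (- (complex_of_real t * (1 - \<i> * complex_of_real (\<zeta> + fst x)) * complex_of_real (snd x)))) \<in> borel_measurable borel"
          by (intro borel_measurable_continuous_onI continuous_intros)
        moreover have "sets (lborel \<Otimes>\<^sub>M borel :: (real \<times> real) measure) = sets borel"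
          unfolding borel_prod[symmetric] by (intro sets_pair_measure_cong) simp_all
        ultimately show ?thesis by (simp cong: measurable_cong_sets)
      qed
      show "(\<lambda>(\<omega>, u). bump_hat m \<omega> * half_line (wave t (\<zeta> + \<omega>)) u) \<in> borel_measurable (lborel \<Otimes>\<^sub>M borel)"
        unfolding half_line_def split_beta by measurable
      show "integrable lborel (\<lambda>\<omega>. norm (bump_hat m \<omega>))" using ik by simp
      show "norm (bump_hat m \<omega> * half_line (wave t (\<zeta> + \<omega>)) u) \<le> norm (bump_hat m \<omega>)" for \<omega> u
      proof -
        have "norm (half_line (wave t (\<zeta> + \<omega>)) u) \<le> 1" using t by (simp add: half_line_def norm_wave)
        then have "norm (bump_hat m \<omega>) * norm (half_line (wave t (\<zeta> + \<omega>)) u) \<le> norm (bump_hat m \<omega>) * 1"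
          by (intro mult_left_mono) auto
        then show ?thesis by (simp add: norm_mult)
      qed
      show "bounded_borel (half_line ?F)"
      proof (rule bounded_borel_half_line)
        have [measurable]: "(\<lambda>u. exp (\<i> * of_real (\<zeta> * (t * u))) :: complex) \<in> borel_measurable borel" "(\<lambda>u. exp (- of_real (t * u)) :: complex) \<in> borel_measurable borel"
          by (auto intro!: borel_measurable_continuous_onI continuous_intros)
        show "?F \<in> borel_measurable borel" by measurable
        fix u :: real assume u: "u \<ge> 0"
        have "norm (?F u) = norm (bump m (t * u)) * exp (- (t * u))"
          by (simp add: norm_mult flip: of_real_mult)
        also have "\<dots> \<le> (LINT \<omega>|lborel. norm (bump_hat m \<omega>)) * 1"
          using bb[of "t * u"] t u by (intro mult_mono) auto
        finally show "norm (?F u) \<le> (LINT \<omega>|lborel. norm (bump_hat m \<omega>))" by simp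
      qed
      show "half_line ?F u = (LINT \<omega>|lborel. bump_hat m \<omega> * half_line (wave t (\<zeta> + \<omega>)) u)" for u
      proof (cases "u \<ge> 0")
        case True
        have HW: "bump_hat m \<omega> * half_line (wave t (\<zeta> + \<omega>)) u =
          (bump_hat m \<omega> * exp (\<i> * complex_of_real ((t * u) * \<omega>))) * (exp (\<i> * of_real (\<zeta> * (t * u))) * exp (- of_real (t * u)))" for \<omega>
        proof -
          have "wave t (\<zeta> + \<omega>) u = exp (\<i> * complex_of_real ((t * u) * \<omega>)) * (exp (\<i> * of_real (\<zeta> * (t * u))) * exp (- of_real (t * u)))"
            unfolding exp_add[symmetric] by (simp add: algebra_simps)
          then show ?thesis using True by (simp only: half_line_def if_True mult.assoc)
        qed
        show ?thesis unfolding HW integral_mult_left_zero bump_def[symmetric]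
          using True by (simp only: half_line_def if_True mult_ac)
      qed (simp add: half_line_def)
      show "integrable lborel M" unfolding M_def using m by (intro integrable_mult_left integrable_bump_hat) auto
      show "form_bounded (\<lambda>u. bump_hat m \<omega> * half_line (wave t (\<zeta> + \<omega>)) u) (M \<omega>)" for \<omega>
      proof (rule form_bounded_mono[OF form_bounded_scale[OF wave_form_bounded[OF t]]])
        have "(1 + (\<zeta> + \<omega>)\<^sup>2) powr \<beta> \<le> 2 powr \<beta> * (1 + \<zeta>\<^sup>2) powr \<beta> * (1 + \<omega>\<^sup>2) powr \<beta>"
          by (rule one_plus_square_add_powr[OF \<beta>0])
        then have "norm (bump_hat m \<omega>) * (C\<^sub>H * (1 + (\<zeta> + \<omega>)\<^sup>2) powr \<beta> * (1 + t) powr \<kappa>) \<le>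
          norm (bump_hat m \<omega>) * (C\<^sub>H * (2 powr \<beta> * (1 + \<zeta>\<^sup>2) powr \<beta> * (1 + \<omega>\<^sup>2) powr \<beta>) * (1 + t) powr \<kappa>)"
          using C\<^sub>H_nonneg by (intro mult_left_mono mult_right_mono) auto
        also have "\<dots> = M \<omega>" by (simp add: M_def mult_ac)
        finally show "norm (bump_hat m \<omega>) * (C\<^sub>H * (1 + (\<zeta> + \<omega>)\<^sup>2) powr \<beta> * (1 + t) powr \<kappa>) \<le> M \<omega>" .
      qed
    qed
    moreover have "(LINT \<omega>|lborel. M \<omega>) = A * (1 + \<zeta>\<^sup>2) powr \<beta> * (1 + t) powr \<kappa>"
      unfolding M_def integral_mult_left_zero J_def[symmetric] A_def by (simp only: mult_ac)
    ultimately show ?thesis by simp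
  qed
  then show ?thesis using A0 by blast
qed

lemma spectral_multiplier_op_norm:
  assumes s: "s > 2 * \<sigma> + 2 * \<kappa> + 1"
  shows "\<exists>C>0. \<forall>F :: real \<Rightarrow> complex.
            F \<in> borel_measurable borel \<longrightarrow> bounded (range F) \<longrightarrow>
            closure {u. F u \<noteq> 0} \<subseteq> {-1..1} \<longrightarrow>
            F \<in> sobolev_space s \<longrightarrow> continuous_on UNIV F \<longrightarrow>
            (\<forall>p::ennreal. 1 \<le> p \<longrightarrow>
               op_norm \<mu> p p (fc F) < \<infinity> \<and>
               (\<forall>t>0. op_norm \<mu> p p (fc (\<lambda>u. F (t * u)))
                  \<le> ennreal (C * (1 + t) powr \<kappa> * sobolev_norm s F)))"
proof -
  have s\<beta>: "s > 2 * \<beta> + 1/2" using s by simp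
  have \<beta>0: "\<beta> \<ge> 0" using \<sigma> \<kappa> by simp
  obtain n :: nat where n: "real n > 2 * \<beta>" using reals_Archimedean2 by blast
  \<comment> \<open>A successor, because \<open>bump_eq_exp\<close> concerns positive
    indices.\<close>
  define m where "m = Suc n"
  have m: "real m > 2 * \<beta>" "m \<ge> 1" using n by (auto simp: m_def)
  obtain A where A: "A \<ge> 0" and Ab: "\<And>t \<zeta>. t > 0 \<Longrightarrow> form_bounded (half_line (\<lambda>u. exp (\<i> * of_real (\<zeta> * (t * u))) * (bump m (t * u) * exp (- of_real (t * u)))))
     (A * (1 + \<zeta>\<^sup>2) powr \<beta> * (1 + t) powr \<kappa>)"
    using bump_form_bounded[OF m] by blast
  define W where "W = sqrt (LINT \<xi>|lborel. (1 + \<xi>\<^sup>2) powr (2 * \<beta> - s))"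
  \<comment> \<open>The factor 1 / (2 pi) comes from Fourier inversion, \<surd>(2 pi) * W from
    Cauchy-Schwarz; the summand 1 makes the constant positive.\<close>
  define C where "C = A / (2 * pi) * (sqrt (2 * pi) * W) + 1"
  have W0: "W \<ge> 0" unfolding W_def by (auto intro!: integral_nonneg_AE)
  have C0: "C > 0" unfolding C_def using A W0 by (intro add_nonneg_pos) auto
  have main: "op_norm \<mu> p p (fc (\<lambda>u. F (t * u))) \<le> ennreal (C * (1 + t) powr \<kappa> * sobolev_norm s F)"
    if F: "F \<in> borel_measurable borel" "bounded (range F)" "closure {u. F u \<noteq> 0} \<subseteq> {-1..1}" "F \<in> sobolev_space s" "continuous_on UNIV F"
      and p: "1 \<le> p" and t: "t > 0" for F :: "real \<Rightarrow> complex" and p t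
  proof -
    note Fm[measurable] = F(1)
    obtain B where B: "\<And>x. norm (F x) \<le> B" using F(2) unfolding bounded_iff by blast
    have supp: "F x = 0" if "\<bar>x\<bar> > 1" for x
    proof (rule ccontr)
      assume "F x \<noteq> 0"
      then have "x \<in> {u. F u \<noteq> 0}" by simp
      then have "x \<in> closure {u. F u \<noteq> 0}" by (rule subsetD[OF closure_subset])
      then have "x \<in> {-1..1}" by (rule subsetD[OF F(3)])
      then show False using that by auto
    qed
    have Fi: "integrable lborel F" by (rule compact_support_integrable(1)[OF Fm B supp])
    note [measurable] = fourier_measurable[OF Fm]
    have SB1: "integrable lborel (\<lambda>\<xi>. (1 + \<xi>\<^sup>2) powr \<beta> * norm (fourier F \<xi>))"
      by (rule sobolev_fourier_bound(1)[OF Fm B supp F(4) s\<beta>])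
    have SB2: "(LINT \<xi>|lborel. (1 + \<xi>\<^sup>2) powr \<beta> * norm (fourier F \<xi>)) \<le> sqrt (2 * pi) * W * sobolev_norm s F"
      unfolding W_def by (rule sobolev_fourier_bound(2)[OF Fm B supp F(4) s\<beta>])
    have sn: "sobolev_norm s F \<ge> 0" unfolding sobolev_norm_def by (auto intro!: integral_nonneg_AE)
    have hatI: "integrable lborel (fourier F)"
    proof (rule Bochner_Integration.integrable_bound[OF SB1])
      show "AE \<xi> in lborel. norm (fourier F \<xi>) \<le> norm ((1 + \<xi>\<^sup>2) powr \<beta> * norm (fourier F \<xi>))"
      proof (rule AE_I2)
        fix \<xi> :: real
        have "1 * norm (fourier F \<xi>) \<le> (1 + \<xi>\<^sup>2) powr \<beta> * norm (fourier F \<xi>)"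
          using \<beta>0 by (intro mult_right_mono ge_one_powr_ge_zero) auto
        then show "norm (fourier F \<xi>) \<le> norm ((1 + \<xi>\<^sup>2) powr \<beta> * norm (fourier F \<xi>))" by simp
      qed
    qed measurable
    \<comment> \<open>Valid at every u by continuity of F. The spectral measure may charge single
      points, so an identity for almost every u would not do.\<close>
    have inv: "(LINT \<xi>|lborel. fourier F \<xi> * exp (\<i> * complex_of_real (u * \<xi>))) = 2 * pi * F u" for u
      by (rule fourier_inversion[OF Fi F(5) B hatI])
    \<comment> \<open>Multiplying the inversion integral at t u by bump m (t u) * exp (- t u)
      changes nothing: the factor is 1 for t u \<le> 1, and F (t u) = 0 beyond.\<close>
    define H where "H \<zeta> u = exp (\<i> * of_real (\<zeta> * (t * u))) * (bump m (t * u) * exp (- of_real (t * u)))" for \<zeta> u :: real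
    define N where "N = (LINT \<omega>|lborel. norm (bump_hat m \<omega>))"
    have bb: "norm (bump m u) \<le> N" for u
    proof -
      have "norm (bump m u) \<le> (LINT \<omega>|lborel. norm (bump_hat m \<omega> * exp (\<i> * complex_of_real (u * \<omega>))))"
        unfolding bump_def by (rule integral_norm_bound)
      then show ?thesis by (simp add: norm_mult N_def)
    qed
    have N0: "N \<ge> 0" by (simp add: N_def)
    have Hb: "norm (half_line (H \<zeta>) u) \<le> N" for \<zeta> u
    proof (cases "u \<ge> 0")
      case True
      have "norm (H \<zeta> u) = norm (bump m (t * u)) * exp (- (t * u))"
        by (simp add: H_def norm_mult flip: of_real_mult)
      also have "\<dots> \<le> N * 1" using bb[of "t * u"] t True N0 by (intro mult_mono) auto
      finally show ?thesis using True by (simp add: half_line_def)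
    qed (use N0 in \<open>simp add: half_line_def\<close>)
    define M where "M \<zeta> = (1 + \<zeta>\<^sup>2) powr \<beta> * norm (fourier F \<zeta>) * (A / (2 * pi) * (1 + t) powr \<kappa>)" for \<zeta>
    have Fb: "bounded_borel (half_line (\<lambda>u. F (t * u)))" using B by (intro bounded_borel_half_line[of _ B]) auto
    have bm[measurable]: "bump m \<in> borel_measurable borel" unfolding bump_def by measurable
    have "form_bounded (half_line (\<lambda>u. F (t * u))) (LINT \<zeta>|lborel. M \<zeta>)"
    proof (rule form_bounded_superposition[where G="\<lambda>\<zeta> u. fourier F \<zeta> / (2 * pi) * half_line (H \<zeta>) u" and w="\<lambda>\<zeta>. norm (fourier F \<zeta>) / (2 * pi) * N"])
      show "sigma_finite_measure (lborel :: real measure)" by (rule lborel.sigma_finite_measure_axioms)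
      have [measurable]: "(\<lambda>x. exp (\<i> * of_real (fst x * (t * snd x))) :: complex) \<in> borel_measurable (lborel \<Otimes>\<^sub>M borel)"
        "(\<lambda>x. exp (- of_real (t * snd x)) :: complex) \<in> borel_measurable (lborel \<Otimes>\<^sub>M borel)"
      proof -
        have "(\<lambda>x::real \<times> real. exp (\<i> * of_real (fst x * (t * snd x))) :: complex) \<in> borel_measurable borel"
          "(\<lambda>x::real \<times> real. exp (- of_real (t * snd x)) :: complex) \<in> borel_measurable borel"
          by (intro borel_measurable_continuous_onI continuous_intros)+
        moreover have "sets (lborel \<Otimes>\<^sub>M borel :: (real \<times> real) measure) = sets borel"
          unfolding borel_prod[symmetric] by (intro sets_pair_measure_cong) simp_all
        ultimately show "(\<lambda>x. exp (\<i> * of_real (fst x * (t * snd x))) :: complex) \<in> borel_measurable (lborel \<Otimes>\<^sub>M borel)"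
          "(\<lambda>x. exp (- of_real (t * snd x)) :: complex) \<in> borel_measurable (lborel \<Otimes>\<^sub>M borel)"
          by (simp_all cong: measurable_cong_sets)
      qed
      show "(\<lambda>(\<zeta>, u). fourier F \<zeta> / (2 * pi) * half_line (H \<zeta>) u) \<in> borel_measurable (lborel \<Otimes>\<^sub>M borel)"
        unfolding half_line_def H_def split_beta by measurable
      show "integrable lborel (\<lambda>\<zeta>. norm (fourier F \<zeta>) / (2 * pi) * N)" using hatI by simp
      show "norm (fourier F \<zeta> / (2 * pi) * half_line (H \<zeta>) u) \<le> norm (fourier F \<zeta>) / (2 * pi) * N" for \<zeta> u
        unfolding norm_mult norm_divide using Hb[of \<zeta> u] by (intro mult_mono) auto
      show "bounded_borel (half_line (\<lambda>u. F (t * u)))" by (rule Fb)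
      show "half_line (\<lambda>u. F (t * u)) u = (LINT \<zeta>|lborel. fourier F \<zeta> / (2 * pi) * half_line (H \<zeta>) u)" for u
      proof (cases "u \<ge> 0")
        case True
        have "(LINT \<zeta>|lborel. fourier F \<zeta> / (2 * pi) * half_line (H \<zeta>) u) =
          (LINT \<zeta>|lborel. (fourier F \<zeta> * exp (\<i> * complex_of_real ((t * u) * \<zeta>))) * (bump m (t * u) * exp (- of_real (t * u)) / (2 * pi)))"
          using True by (intro Bochner_Integration.integral_cong) (auto simp: half_line_def H_def mult_ac)
        also have "\<dots> = 2 * pi * F (t * u) * (bump m (t * u) * exp (- of_real (t * u)) / (2 * pi))"
          unfolding integral_mult_left_zero inv ..
        also have "\<dots> = F (t * u)"
        proof (cases "t * u \<le> 1")
          case True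
          then have "bump m (t * u) * exp (- of_real (t * u)) = complex_of_real (exp (t * u)) * exp (- of_real (t * u))"
            unfolding m_def by (simp add: bump_eq_exp)
          also have "\<dots> = 1" unfolding exp_of_real[symmetric] exp_add[symmetric] by simp
          finally show ?thesis by simp
        next
          case False
          then show ?thesis using supp[of "t * u"] by simp
        qed
        finally show ?thesis using True by (simp add: half_line_def)
      qed (simp add: half_line_def)
      show "integrable lborel M" unfolding M_def by (intro integrable_mult_left SB1)
      show "form_bounded (\<lambda>u. fourier F \<zeta> / (2 * pi) * half_line (H \<zeta>) u) (M \<zeta>)" for \<zeta>
      proof -
        have "form_bounded (\<lambda>u. fourier F \<zeta> / (2 * pi) * half_line (H \<zeta>) u) (norm (fourier F \<zeta> / (2 * pi)) * (A * (1 + \<zeta>\<^sup>2) powr \<beta> * (1 + t) powr \<kappa>))"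
          unfolding H_def by (rule form_bounded_scale[OF Ab[OF t]])
        moreover have "norm (fourier F \<zeta> / (2 * pi)) * (A * (1 + \<zeta>\<^sup>2) powr \<beta> * (1 + t) powr \<kappa>) = M \<zeta>"
          by (simp add: M_def norm_divide norm_mult mult_ac)
        ultimately show ?thesis by simp
      qed
    qed
    moreover have "(LINT \<zeta>|lborel. M \<zeta>) \<le> C * (1 + t) powr \<kappa> * sobolev_norm s F"
    proof -
      have "(LINT \<zeta>|lborel. M \<zeta>) = (LINT \<zeta>|lborel. (1 + \<zeta>\<^sup>2) powr \<beta> * norm (fourier F \<zeta>)) * (A / (2 * pi) * (1 + t) powr \<kappa>)"
        unfolding M_def by (rule integral_mult_left_zero)
      also have "\<dots> \<le> (sqrt (2 * pi) * W * sobolev_norm s F) * (A / (2 * pi) * (1 + t) powr \<kappa>)"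
        using SB2 A by (intro mult_right_mono) auto
      also have "\<dots> = (C - 1) * (1 + t) powr \<kappa> * sobolev_norm s F" by (simp add: C_def mult_ac)
      also have "\<dots> \<le> C * (1 + t) powr \<kappa> * sobolev_norm s F" using sn by (intro mult_right_mono) auto
      finally show ?thesis .
    qed
    ultimately have fb: "form_bounded (half_line (\<lambda>u. F (t * u))) (C * (1 + t) powr \<kappa> * sobolev_norm s F)"
      by (rule form_bounded_mono)
    show ?thesis
    \<comment> \<open>The Sobolev norm may be zero, while \<open>op_norm_of_form_bounded\<close>
      asks for a positive constant.\<close>
    proof (rule ennreal_le_epsilon)
      fix e :: real assume e: "e > 0"
      have R0: "0 \<le> C * (1 + t) powr \<kappa> * sobolev_norm s F" using C0 sn by simp
      have "op_norm \<mu> p p (fc (\<lambda>u. F (t * u))) \<le> ennreal (C * (1 + t) powr \<kappa> * sobolev_norm s F + e)"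
      proof (rule op_norm_of_form_bounded[where F="\<lambda>u. F (t * u)"])
        show "form_bounded (half_line (\<lambda>u. F (t * u))) (C * (1 + t) powr \<kappa> * sobolev_norm s F + e)"
          using e by (intro form_bounded_mono[OF fb]) simp
        show "0 < C * (1 + t) powr \<kappa> * sobolev_norm s F + e" using R0 e by simp
        show "represents (half_line (\<lambda>u. F (t * u))) f (fc (\<lambda>u. F (t * u)) f)" if "f \<in> Lp \<mu> 2" for f
          by (rule fc_represents[OF Fb that])
      qed (rule p)
      then show "op_norm \<mu> p p (fc (\<lambda>u. F (t * u))) \<le> ennreal (C * (1 + t) powr \<kappa> * sobolev_norm s F) + ennreal e"
        using R0 e by (simp add: ennreal_plus)
    qed
  qed
  have fin: "op_norm \<mu> p p (fc F) < \<infinity>"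
    if F: "F \<in> borel_measurable borel" "bounded (range F)" "closure {u. F u \<noteq> 0} \<subseteq> {-1..1}" "F \<in> sobolev_space s" "continuous_on UNIV F"
      and p: "1 \<le> p" for F :: "real \<Rightarrow> complex" and p
    using le_less_trans[OF main[OF F p zero_less_one] ennreal_less_top] by simp
  show ?thesis
  proof (rule exI[of _ C], intro conjI C0 allI impI)
    fix F :: "real \<Rightarrow> complex" and p :: ennreal and t :: real
    assume F: "F \<in> borel_measurable borel" "bounded (range F)" "closure {u. F u \<noteq> 0} \<subseteq> {-1..1}" "F \<in> sobolev_space s" "continuous_on UNIV F"
      and p: "1 \<le> p"
    show "op_norm \<mu> p p (fc F) < \<infinity>" by (rule fin[OF F p])
    assume "t > 0"
    then show "op_norm \<mu> p p (fc (\<lambda>u. F (t * u))) \<le> ennreal (C * (1 + t) powr \<kappa> * sobolev_norm s F)"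
      by (rule main[OF F p])
  qed
qed

end

theorem theorem1p1:
  fixes \<mu> :: "'a::metric_space measure"
    and D :: "('a \<Rightarrow> complex) set"
    and L :: "('a \<Rightarrow> complex) \<Rightarrow> ('a \<Rightarrow> complex)"
    and \<sigma> \<kappa> C\<^sub>0 :: real
  assumes "metric_measure_space \<mu>"
    and "self_adjoint_op \<mu> D L"
    and "nonneg_op \<mu> D L"
    and "finite_propagation_speed \<mu> D L"
    and "\<sigma> > 0" and "\<kappa> \<ge> 0"
    and "\<forall>t>0. op_norm \<mu> 2 \<infinity>
           (\<lambda>f x. complex_of_real (sqrt (vol \<mu> t x)) *
              func_calc \<mu> D L (\<lambda>u. complex_of_real ((1 + t\<^sup>2 * u) powr (- \<sigma>))) f x)
         \<le> ennreal (C\<^sub>0 * (1 + t\<^sup>2) powr \<kappa>)"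
  shows "(\<exists>C>0. \<forall>t>0. \<forall>\<xi>::real.
            op_norm \<mu> 1 1
              (func_calc \<mu> D L (\<lambda>u. exp (\<i> * of_real (\<xi> * t * u))) \<circ>
               func_calc \<mu> D L (\<lambda>u. exp (- of_real (t * u))))
            \<le> ennreal (C * (1 + \<xi>\<^sup>2) powr (\<sigma> + \<kappa> + 1/4) * (1 + t) powr \<kappa>)) \<and>
         (\<forall>s > 2 * \<sigma> + 2 * \<kappa> + 1. \<exists>C>0. \<forall>F :: real \<Rightarrow> complex.
            F \<in> borel_measurable borel \<longrightarrow> bounded (range F) \<longrightarrow>
            closure {u. F u \<noteq> 0} \<subseteq> {-1..1} \<longrightarrow>
            F \<in> sobolev_space s \<longrightarrow> continuous_on UNIV F \<longrightarrow>
            (\<forall>p::ennreal. 1 \<le> p \<longrightarrow>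
               op_norm \<mu> p p (func_calc \<mu> D L F) < \<infinity> \<and>
               (\<forall>t>0. op_norm \<mu> p p (func_calc \<mu> D L (\<lambda>u. F (t * u)))
                  \<le> ennreal (C * (1 + t) powr \<kappa> * sobolev_norm s F))))"
proof -
  interpret propagation \<mu> D L \<sigma> \<kappa> C\<^sub>0
    using assms by unfold_locales auto
  show ?thesis by (intro conjI allI impI wave_op_norm_L1 spectral_multiplier_op_norm)
qed

end
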